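(* Let $d\ge2$ and $\mathfrak p\ge\frac{2d}{d-1}$. Let $2\le p,q\le\infty$ and let $r$ satisfy $\frac1r=\frac1p+\frac1q$. Suppose that there is $N\in\mathbb N$ such that for every $s\ge\mathfrak p$ and every $\epsilon>0$ there is a constant $C$ such that $$\|\mathfrak S^\varphi_\delta f\|_{L^s(\mathbb R^d)}\le C\,\delta^{-\frac{d-2}{2}+\frac ds-\epsilon}\,\|f\|_{L^s(\mathbb R^d)}$$ holds for all $0<\delta\le 1/4$, all $\varphi\in\mathcal C^N([-1,1])$ and all $f$ (so $C$ is independent of $\varphi$ and $\delta$). Then for every $\alpha>\alpha^*_{\mathfrak p}(p,q)$ there is a constant $C'$ such that $$\|\mathcal B^\alpha_*(f,g)\|_{L^r(\mathbb R^d)}\le C'\,\|f\|_{L^p(\mathbb R^d)}\|g\|_{L^q(\mathbb R^d)}$$ for all $f,g$.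
   Context: The Fourier transform is $\widehat f(\xi)=\int_{\mathbb R^d}e^{-2\pi i x\cdot\xi}f(x)\,dx$. Operators are initially defined on Schwartz functions. Bilinear Bochner--Riesz operator of order $\alpha\ge0$: for $\lambda>0$, $$\mathcal B^\alpha_\lambda(f,g)(x)=\iint_{\mathbb R^d\times\mathbb R^d}e^{2\pi i x\cdot(\xi+\eta)}\bigl(1-|\lambda\xi|^2-|\lambda\eta|^2\bigr)_+^\alpha\,\widehat f(\xi)\widehat g(\eta)\,d\xi\,d\eta,$$ where $r_+=r$ for $r>0$ and $r_+=0$ for $r\le0$; the maximal operator is $\mathcal B^\alpha_*(f,g)=\sup_{\lambda>0}|\mathcal B^\alpha_\lambda(f,g)|$. $\mathcal C^N([-1,1])$ is the set of smooth functions $\varphi$ on $\mathbb R$ with $\operatorname{supp}\varphi\subset[-1,1]$ and $\max_{0\le n\le N}\|\varphi^{(n)}\|_{L^\infty(\mathbb R)}\le1$. Square function: $$\mathfrak S^\varphi_\delta f(x)=\Bigl(\int_{1/2}^2\Bigl|\varphi\Bigl(\frac{t-|D|^2}{\delta}\Bigr)f(x)\Bigr|^2dt\Bigr)^{1/2},$$ where $\varphi\bigl(\frac{t-|D|^2}{\delta}\bigr)$ is the Fourier multiplier operator with multiplier $\varphi\bigl(\frac{t-|\xi|^2}{\delta}\bigr)$. Let $\alpha(p)=\max\{d|\frac12-\frac1p|-\frac12,\,0\}$. For $\nu\in[0,\frac{d-1}{2d}]$ set $\mathcal D_1(\nu)=\{(u,v)\in[0,\frac12]^2:u,v\le\nu\}$,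 $\mathcal D_2(\nu)=\{(u,v)\in[0,\frac12]^2:u,v\ge\nu\}$, $\mathcal D_3(\nu)=\{(u,v)\in[0,\frac12]^2:u<\nu<v\text{ or }v<\nu<u\}$. The function $\alpha^*_{1/\nu}:[2,\infty]^2\to\mathbb R$ is $$\alpha^*_{1/\nu}(p,q)=\begin{cases}\alpha(p)+\alpha(q)+1=d(1-\frac1p-\frac1q),&(\frac1p,\frac1q)\in\mathcal D_1(\nu),\\[3pt] 1+\frac{2(1-1/p-1/q)}{1-2\nu}\,\alpha(1/\nu),&(\frac1p,\frac1q)\in\mathcal D_2(\nu),\\[3pt] 1+\max\{\alpha(p),\alpha(q)\}+\alpha(1/\nu)\min\Bigl\{\frac{p-2}{(1-2\nu)p},\frac{q-2}{(1-2\nu)q}\Bigr\},&(\frac1p,\frac1q)\in\mathcal D_3(\nu),\end{cases}$$ with $\frac{p-2}{p}$ read as $1-\frac2p$ when $p=\infty$. In the statement, $\alpha^*_{\mathfrak p}$ means $\nu=1/\mathfrak p$. *)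

theory Defs
  imports "HOL-Probability.Essential_Supremum"
begin

text \<open>Real powers on \<^typ>\<open>ennreal\<close>; only used with positive exponents.\<close>

definition epow :: "ennreal \<Rightarrow> real \<Rightarrow> ennreal" where
  "epow x a = (if x = \<infinity> then \<infinity> else ennreal (enn2real x powr a))"

text \<open>Exponents have type \<^typ>\<open>ennreal\<close>, where \<open>1 / \<infinity> = 0\<close>. Their reciprocals enter the numerology as
  real numbers.\<close>

definition recip :: "ennreal \<Rightarrow> real" where
  "recip p = enn2real (1 / p)"

text \<open>Functions valued in \<open>[0,\<infinity>]\<close> are needed because square functions and maximal functions are not
  finite by definition.\<close>

definition eLp_norm :: "ennreal \<Rightarrow> ('a::euclidean_space \<Rightarrow> ennreal) \<Rightarrow> ennreal" where
  "eLp_norm p F =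
     (if p = \<infinity> then esssup lborel F
      else epow (\<integral>\<^sup>+x. epow (F x) (enn2real p) \<partial>lborel) (recip p))"

definition Lp_norm :: "ennreal \<Rightarrow> ('a::euclidean_space \<Rightarrow> 'b::real_normed_vector) \<Rightarrow> ennreal" where
  "Lp_norm p f = eLp_norm p (\<lambda>x. ennreal (norm (f x)))"

definition partial_deriv ::
  "'a::euclidean_space \<Rightarrow> ('a \<Rightarrow> complex) \<Rightarrow> 'a \<Rightarrow> complex" where
  "partial_deriv b f x = frechet_derivative f (at x) b"

definition iter_partial_deriv ::
  "'a::euclidean_space list \<Rightarrow> ('a \<Rightarrow> complex) \<Rightarrow> 'a \<Rightarrow> complex" where
  "iter_partial_deriv bs f = foldr partial_deriv bs f"

text \<open>The lists \<open>bs\<close> of coordinate vectors play the role of multi-indices. Differentiability of all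
  iterated partial derivatives is smoothness, and it makes the use of the total function
  \<^const>\<open>frechet_derivative\<close> legitimate.\<close>

definition schwartz :: "('a::euclidean_space \<Rightarrow> complex) \<Rightarrow> bool" where
  "schwartz f \<longleftrightarrow>
     (\<forall>bs \<in> lists Basis.
        (\<forall>x. iter_partial_deriv bs f differentiable (at x)) \<and>
        (\<forall>k::nat. \<exists>C. \<forall>x. (1 + norm x) ^ k * norm (iter_partial_deriv bs f x) \<le> C))"

definition fourier :: "('a::euclidean_space \<Rightarrow> complex) \<Rightarrow> 'a \<Rightarrow> complex" where
  "fourier f \<xi> = (LINT x|lborel. cis (- 2 * pi * (x \<bullet> \<xi>)) * f x)"

definition multiplier_op ::
  "('a::euclidean_space \<Rightarrow> complex) \<Rightarrow> ('a \<Rightarrow> complex) \<Rightarrow> 'a \<Rightarrow> complex" where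
  "multiplier_op m f x = (LINT \<xi>|lborel. cis (2 * pi * (x \<bullet> \<xi>)) * m \<xi> * fourier f \<xi>)"

text \<open>Since \<open>0 powr \<alpha> = 0\<close> for every \<open>\<alpha>\<close>, including \<open>\<alpha> = 0\<close>, the weight vanishes wherever the
  expression under the positive part is nonpositive.\<close>

definition bochner_riesz ::
  "real \<Rightarrow> real \<Rightarrow> ('a::euclidean_space \<Rightarrow> complex) \<Rightarrow> ('a \<Rightarrow> complex) \<Rightarrow> 'a \<Rightarrow> complex" where
  "bochner_riesz \<alpha> l f g x =
     (LINT (\<xi>, \<eta>)|(lborel \<Otimes>\<^sub>M lborel).
        cis (2 * pi * (x \<bullet> (\<xi> + \<eta>))) *
        complex_of_real (max 0 (1 - (norm (l *\<^sub>R \<xi>))\<^sup>2 - (norm (l *\<^sub>R \<eta>))\<^sup>2) powr \<alpha>) *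
        fourier f \<xi> * fourier g \<eta>)"

definition bochner_riesz_max ::
  "real \<Rightarrow> ('a::euclidean_space \<Rightarrow> complex) \<Rightarrow> ('a \<Rightarrow> complex) \<Rightarrow> 'a \<Rightarrow> ennreal" where
  "bochner_riesz_max \<alpha> f g x = (SUP l\<in>{0<..}. ennreal (norm (bochner_riesz \<alpha> l f g x)))"

definition C_class :: "nat \<Rightarrow> (real \<Rightarrow> real) set" where
  "C_class N = {\<phi>.
     (\<forall>n x. (deriv ^^ n) \<phi> differentiable (at x)) \<and>
     closure {x. \<phi> x \<noteq> 0} \<subseteq> {-1..1} \<and>
     (\<forall>n\<le>N. Lp_norm \<infinity> ((deriv ^^ n) \<phi>) \<le> 1)}"

definition square_function ::
  "(real \<Rightarrow> real) \<Rightarrow> real \<Rightarrow> ('a::euclidean_space \<Rightarrow> complex) \<Rightarrow> 'a \<Rightarrow> ennreal" where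
  "square_function \<phi> \<delta> f x =
     epow (\<integral>\<^sup>+t\<in>{1/2..2}.
             ennreal ((norm (multiplier_op
               (\<lambda>\<xi>. complex_of_real (\<phi> ((t - (norm \<xi>)\<^sup>2) / \<delta>))) f x))\<^sup>2) \<partial>lborel) (1/2)"

definition alpha :: "nat \<Rightarrow> ennreal \<Rightarrow> real" where
  "alpha d p = max (real d * \<bar>1/2 - recip p\<bar> - 1/2) 0"

definition D1 :: "real \<Rightarrow> (real \<times> real) set" where
  "D1 \<nu> = {(u, v) \<in> {0..1/2} \<times> {0..1/2}. u \<le> \<nu> \<and> v \<le> \<nu>}"

definition D2 :: "real \<Rightarrow> (real \<times> real) set" where
  "D2 \<nu> = {(u, v) \<in> {0..1/2} \<times> {0..1/2}. u \<ge> \<nu> \<and> v \<ge> \<nu>}"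

text \<open>The parameter \<open>P\<close> is the subscript \<open>1/\<nu>\<close> of \<open>\<alpha>\<^sup>*\<close>. For \<open>0 \<le> \<nu> \<le> (d - 1)/(2 d)\<close> the formulas on
  \<open>D1\<close> and \<open>D2\<close> agree at their common point \<open>(\<nu>, \<nu>)\<close>. The last branch is the region
  \<open>u < \<nu> < v\<close> or \<open>v < \<nu> < u\<close>, which is what remains of the square \<open>[0,1/2]\<^sup>2\<close>.\<close>

definition alpha_star :: "nat \<Rightarrow> ennreal \<Rightarrow> ennreal \<Rightarrow> ennreal \<Rightarrow> real" where
  "alpha_star d P p q =
     (let \<nu> = recip P; u = recip p; v = recip q in
      if (u, v) \<in> D1 \<nu> then alpha d p + alpha d q + 1
      else if (u, v) \<in> D2 \<nu> then 1 + 2 * (1 - u - v) / (1 - 2 * \<nu>) * alpha d P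
      else 1 + max (alpha d p) (alpha d q)
             + alpha d P * min ((1 - 2 * u) / (1 - 2 * \<nu>)) ((1 - 2 * v) / (1 - 2 * \<nu>)))"

end

theory Submission
  imports Defs "HOL-Probability.Probability"
begin

text \<open>For \<open>\<alpha> = \<beta> + \<gamma> + 1\<close> the Beta integral writes \<open>(1 - |\<xi>|\<^sup>2 - |\<eta>|\<^sup>2)\<^sub>+\<^sup>\<alpha>\<close> as a constant times
  \<open>\<integral>(t - |\<xi>|\<^sup>2)\<^sub>+\<^sup>\<beta> (1 - t - |\<eta>|\<^sup>2)\<^sub>+\<^sup>\<gamma> dt\<close>. By the Cauchy--Schwarz inequality in \<open>t\<close> the bilinear maximal
  function is at most a product of two linear ones, each the supremum over all dilations of an \<open>L\<^sup>2\<close>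
  average in \<open>t\<close> of \<open>(t - |D|\<^sup>2)\<^sub>+\<^sup>\<beta> f\<close>, and Hoelder's inequality separates \<open>f\<close> from \<open>g\<close>. Since
  \<open>\<alpha>\<^sup>*\<close> is one plus a threshold at \<open>p\<close> plus a threshold at \<open>q\<close>, it remains to bound the linear maximal
  function on \<open>L\<^sup>p\<close> for \<open>\<beta>\<close> above the threshold at \<open>p\<close>.

  To this end \<open>(t - |\<xi>|\<^sup>2)\<^sub>+\<^sup>\<beta>\<close> is cut into a smooth part, dominated by the Hardy--Littlewood maximal
  function, and pieces at distance about \<open>2\<^sup>-\<^sup>n\<close> from the sphere, which are dominated by the square
  functions at scale \<open>2\<^sup>-\<^sup>n\<close> of a Littlewood--Paley piece of \<open>f\<close>. For \<open>p \<ge> 2\<close> the supremum over dyadic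
  dilations is at most an \<open>\<ell>\<^sup>p\<close> sum, which the Littlewood--Paley pieces control. The bound for the square
  function below \<open>P\<close> comes from interpolation between Plancherel's theorem at exponent \<open>2\<close> and the
  hypothesis.\<close>

section \<open>Smooth functions of one real variable\<close>

text \<open>The operators act on Schwartz functions only, so interpolation may not cut a function at
  a height by an indicator. A smooth rational cut, \<open>low_part\<close>, takes its place; it
  leaves a tail whose integral has to converge, hence the integer \<open>k\<close> in the
  interpolation theorems. The growth in the scale has to survive interpolation exactly, which is why
  these theorems carry explicit constants and a free parameter. The hypothesis sees t in [1/2, 2]
  only, while the maximal function runs over a continuum of dilations. Since t scales like the
  square of the frequency, an arbitrary dilation can be traded for a rescaling of t: the interval
  (0, 1] is cut into dyadic pieces adapted to the dilation, each of which is a dyadic dilate of a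
  piece of [1/2, 2], and the lengths of the pieces sum. Averaging in t thus replaces any control of
  derivatives in the dilation parameter. Every loss on the way is a factor
  \<open>2 powr (n * \<kappa>)\<close> with small \<kappa>; all of them are paid from the strict
  inequality between \<alpha> and \<open>alpha_star\<close>.\<close>

definition smooth_real :: "(real \<Rightarrow> real) \<Rightarrow> bool" where
  "smooth_real g \<longleftrightarrow> (\<forall>n x. (deriv ^^ n) g differentiable (at x))"

text \<open>A set of functions closed under differentiation contains only smooth functions. Choosing
  a suitable set replaces explicit formulas for higher derivatives in all closure properties
  below.\<close>

lemma smooth_realI:
  assumes "g \<in> S"
    and step: "\<And>h. h \<in> S \<Longrightarrow> \<exists>h'\<in>S. \<forall>x. (h has_real_derivative h' x) (at x)"
  shows "smooth_real g"
proof -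
  have *: "deriv h \<in> S \<and> (\<forall>x. h differentiable (at x))" if hS: "h \<in> S" for h
  proof -
    obtain h' where h': "h' \<in> S" "\<And>x. (h has_real_derivative h' x) (at x)"
      using step[OF hS] by blast
    then have "deriv h = h'" by (auto intro!: ext DERIV_imp_deriv)
    with h' show ?thesis by (auto intro: real_differentiable_def[THEN iffD2])
  qed
  have "(deriv ^^ n) g \<in> S" for n
    by (induction n) (use assms(1) * in auto)
  with * show ?thesis by (auto simp: smooth_real_def)
qed

lemma smooth_real_DERIV: "smooth_real g \<Longrightarrow> (g has_real_derivative deriv g x) (at x)"
  unfolding smooth_real_def
  by (metis DERIV_deriv_iff_real_differentiable funpow_0)

lemma smooth_real_deriv: "smooth_real g \<Longrightarrow> smooth_real (deriv g)"
  unfolding smooth_real_def by (metis funpow_swap1 funpow.simps(2) o_apply)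

lemma smooth_real_funpow_deriv: "smooth_real g \<Longrightarrow> smooth_real ((deriv ^^ n) g)"
  by (induction n) (auto intro: smooth_real_deriv)

lemma smooth_real_continuous: "smooth_real g \<Longrightarrow> continuous_on A g"
  by (meson DERIV_isCont continuous_at_imp_continuous_on smooth_real_DERIV)

lemma smooth_real_measurable: "smooth_real g \<Longrightarrow> g \<in> borel_measurable borel"
  using smooth_real_continuous borel_measurable_continuous_onI by blast

lemma smooth_real_const: "smooth_real (\<lambda>_. c)"
  by (rule smooth_realI[where S = "range (\<lambda>c _. c)"]) (auto intro!: derivative_eq_intros)

lemma smooth_real_id: "smooth_real (\<lambda>x. x)"
  by (rule smooth_realI[where S = "insert (\<lambda>x. x) (range (\<lambda>c _. c))"])
     (auto intro!: derivative_eq_intros exI[of _ "\<lambda>_. 1"])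

lemma smooth_real_add:
  assumes "smooth_real f" "smooth_real g" shows "smooth_real (\<lambda>x. f x + g x)"
proof (rule smooth_realI[where S = "{\<lambda>x. f x + g x |f g. smooth_real f \<and> smooth_real g}"])
  fix h assume "h \<in> {\<lambda>x. f x + g x |f g. smooth_real f \<and> smooth_real g}"
  then obtain f g where h: "h = (\<lambda>x. f x + g x)" and fg: "smooth_real f" "smooth_real g" by blast
  show "\<exists>h'\<in>{\<lambda>x. f x + g x |f g. smooth_real f \<and> smooth_real g}. \<forall>x. (h has_real_derivative h' x) (at x)"
    using fg unfolding h
    by (intro bexI[of _ "\<lambda>x. deriv f x + deriv g x"] allI DERIV_add)
       (auto intro: smooth_real_DERIV smooth_real_deriv)
qed (use assms in blast)

text \<open>The Leibniz rule turns a product into a sum of two products, so the products alone are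
  not closed under differentiation but their sums are. The codomain is left general because the same
  closure serves real smooth functions and complex Schwartz functions.\<close>

inductive_set prod_span :: "('a \<Rightarrow> 'b::comm_semiring_1) set \<Rightarrow> ('a \<Rightarrow> 'b) set" for A where
  prod_span_base: "f \<in> A \<Longrightarrow> g \<in> A \<Longrightarrow> (\<lambda>x. f x * g x) \<in> prod_span A"
| prod_span_add: "f \<in> prod_span A \<Longrightarrow> g \<in> prod_span A \<Longrightarrow> (\<lambda>x. f x + g x) \<in> prod_span A"

lemma smooth_real_mult:
  assumes "smooth_real f" "smooth_real g" shows "smooth_real (\<lambda>x. f x * g x)"
proof (rule smooth_realI[where S = "prod_span {f. smooth_real f}"])
  fix h assume "h \<in> prod_span {f. smooth_real f}"
  then show "\<exists>h'\<in>prod_span {f. smooth_real f}. \<forall>x. (h has_real_derivative h' x) (at x)"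
  proof induction
    case (prod_span_base f g)
    then have fg: "smooth_real f" "smooth_real g" by auto
    show ?case
    proof (intro bexI allI)
      show "((\<lambda>x. f x * g x) has_real_derivative (f x * deriv g x + deriv f x * g x)) (at x)" for x
        using DERIV_mult[OF smooth_real_DERIV[OF fg(1)] smooth_real_DERIV[OF fg(2)], of x]
        by (simp add: algebra_simps)
      show "(\<lambda>x. f x * deriv g x + deriv f x * g x) \<in> prod_span {f. smooth_real f}"
        using fg by (intro prod_span.intros) (auto intro: smooth_real_deriv)
    qed
  next
    case (prod_span_add f g)
    then obtain f' g' where
      "f' \<in> prod_span {f. smooth_real f}" "\<forall>x. (f has_real_derivative f' x) (at x)"
      "g' \<in> prod_span {f. smooth_real f}" "\<forall>x. (g has_real_derivative g' x) (at x)" by blast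
    then show ?case
      by (intro bexI[of _ "\<lambda>x. f' x + g' x"] allI DERIV_add prod_span.intros) auto
  qed
qed (use assms in \<open>auto intro: prod_span.intros\<close>)

lemma smooth_real_cmult: "smooth_real g \<Longrightarrow> smooth_real (\<lambda>x. c * g x)"
  by (intro smooth_real_mult smooth_real_const)

lemma smooth_real_diff:
  assumes "smooth_real f" "smooth_real g" shows "smooth_real (\<lambda>x. f x - g x)"
  using smooth_real_add[OF assms(1) smooth_real_cmult[OF assms(2), of "-1"]] by simp

lemma smooth_real_affine:
  assumes "smooth_real g" shows "smooth_real (\<lambda>x. g (a * x + b))"
proof (rule smooth_realI[where S = "{\<lambda>x. c * g (a * x + b) |c g. smooth_real g}"])
  fix h assume "h \<in> {\<lambda>x. c * g (a * x + b) |c g. smooth_real g}"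
  then obtain c g where h: "h = (\<lambda>x. c * g (a * x + b))" and g: "smooth_real g" by blast
  have "(h has_real_derivative (c * a) * deriv g (a * x + b)) (at x)" for x
    unfolding h
    by (rule DERIV_chain2[OF smooth_real_DERIV[OF g], THEN DERIV_cmult, THEN DERIV_cong] derivative_eq_intros refl | simp)+
  then show "\<exists>h'\<in>{\<lambda>x. c * g (a * x + b) |c g. smooth_real g}. \<forall>x. (h has_real_derivative h' x) (at x)"
    using smooth_real_deriv[OF g]
    by (intro bexI[of _ "\<lambda>x. (c * a) * deriv g (a * x + b)"]) blast+
next
  show "(\<lambda>x. g (a * x + b)) \<in> {\<lambda>x. c * g (a * x + b) |c g. smooth_real g}"
    using assms by (auto intro!: exI[of _ 1] exI[of _ g])
qed

lemma smooth_real_inverse: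
  assumes "smooth_real g" and pos: "\<And>x. g x > 0"
  shows "smooth_real (\<lambda>x. 1 / g x)"
\<comment> \<open>Differentiating h / g^(k+1) gives (h' g - (k+1) h g') / g^(k+2), again of this
  form.\<close>
proof (rule smooth_realI[where S = "{\<lambda>x. h x / g x ^ Suc k |h k. smooth_real h}"])
  fix F assume "F \<in> {\<lambda>x. h x / g x ^ Suc k |h k. smooth_real h}"
  then obtain h k where F: "F = (\<lambda>x. h x / g x ^ Suc k)" and h: "smooth_real h" by blast
  define h' where "h' = (\<lambda>x. deriv h x * g x - real (Suc k) * (h x * deriv g x))"
  have "(F has_real_derivative h' x / g x ^ Suc (Suc k)) (at x)" for x
  proof -
    have nz: "g x \<noteq> 0" using pos[of x] by simp
    have "(F has_real_derivative (deriv h x * g x ^ Suc k - h x * (real (Suc k) * g x ^ k * deriv g x)) / (g x ^ Suc k * g x ^ Suc k)) (at x)"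
      unfolding F
      by (intro DERIV_divide smooth_real_DERIV[OF h] DERIV_cong[OF DERIV_power[OF smooth_real_DERIV[OF assms(1)]]])
         (use nz in auto)
    moreover have "(deriv h x * g x ^ Suc k - h x * (real (Suc k) * g x ^ k * deriv g x)) / (g x ^ Suc k * g x ^ Suc k) = h' x / g x ^ Suc (Suc k)"
      using nz by (simp add: h'_def field_simps)
    ultimately show ?thesis by simp
  qed
  moreover have "smooth_real h'"
    unfolding h'_def using h assms(1)
    by (intro smooth_real_diff smooth_real_mult smooth_real_const smooth_real_deriv)
  ultimately show "\<exists>h'\<in>{\<lambda>x. h x / g x ^ Suc k |h k. smooth_real h}. \<forall>x. (F has_real_derivative h' x) (at x)"
    by (intro bexI[of _ "\<lambda>x. h' x / g x ^ Suc (Suc k)"]) blast+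
next
  show "(\<lambda>x. 1 / g x) \<in> {\<lambda>x. h x / g x ^ Suc k |h k. smooth_real h}"
    using smooth_real_const by (auto intro!: exI[of _ "\<lambda>_. 1"] exI[of _ 0])
qed

section \<open>A smooth step function\<close>

definition flat_exp :: "real \<Rightarrow> real" where
  "flat_exp x = (if x > 0 then exp (- (1 / x)) else 0)"

lemma poly_exp_tendsto_0: "((\<lambda>y::real. poly p y * exp (- y)) \<longlongrightarrow> 0) at_top"
proof -
  have "((\<lambda>y::real. \<Sum>i\<le>degree p. coeff p i * (y ^ i / exp y)) \<longlongrightarrow> (\<Sum>i\<le>degree p. coeff p i * 0)) at_top"
    by (intro tendsto_intros tendsto_power_div_exp_0)
  then show ?thesis
    by (simp add: poly_altdef sum_distrib_right exp_minus divide_inverse mult.assoc)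
qed

text \<open>Each derivative is a polynomial in 1/x times exp(-1/x), extended by zero. The polynomial
  \<open>q\<close> is y^2 (p - p') with y = 1/x, the factor y^2 coming from the inner derivative. At
  0 the exponential beats every polynomial.\<close>

lemma smooth_real_flat_exp: "smooth_real flat_exp"
proof (rule smooth_realI[where S = "{\<lambda>x. if x > 0 then poly p (1 / x) * exp (- (1 / x)) else 0 |p. True}"])
  fix h :: "real \<Rightarrow> real" assume "h \<in> {\<lambda>x. if x > 0 then poly p (1 / x) * exp (- (1 / x)) else 0 |p. True}"
  then obtain p where h: "h = (\<lambda>x. if x > 0 then poly p (1 / x) * exp (- (1 / x)) else 0)" by blast
  define q where "q = [:0, 0, 1:] * (p - pderiv p)"
  define h' where "h' = (\<lambda>x. if x > 0 then poly q (1 / x) * exp (- (1 / x)) else (0::real))"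
  have "(h has_real_derivative h' x) (at x)" for x
  proof -
    consider "x > 0" | "x < 0" | "x = 0" by linarith
    then show ?thesis
    proof cases
      case 1
      have "((\<lambda>x. poly p (1 / x) * exp (- (1 / x))) has_real_derivative poly q (1 / x) * exp (- (1 / x))) (at x)"
        using 1 by (auto intro!: derivative_eq_intros poly_DERIV[THEN DERIV_chain2] simp: q_def field_simps power2_eq_square)
      then have "(h has_real_derivative poly q (1 / x) * exp (- (1 / x))) (at x)"
        by (rule has_field_derivative_transform_within_open[of _ _ _ "{0<..}"]) (use 1 in \<open>auto simp: h\<close>)
      then show ?thesis using 1 by (simp add: h'_def)
    next
      case 2
      have "(h has_real_derivative 0) (at x)"
        by (rule has_field_derivative_transform_within_open[of "\<lambda>_. 0" _ _ "{..<0}"]) (use 2 in \<open>auto simp: h\<close>)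
      then show ?thesis using 2 by (simp add: h'_def)
    next
      case 3
      have R: "((\<lambda>y. h y / y) \<longlongrightarrow> 0) (at_right 0)"
      proof -
        \<comment> \<open>\<open>pCons 0 p\<close> is y p(y): the additional factor is the 1/y of
          the difference quotient at 0.\<close>
        have "((\<lambda>y::real. poly (pCons 0 p) (1 / y) * exp (- (1 / y))) \<longlongrightarrow> 0) (at_right 0)"
          by (rule filterlim_compose[OF poly_exp_tendsto_0])
             (simp add: filterlim_inverse_at_top_right[unfolded inverse_eq_divide])
        then show ?thesis
          by (rule Lim_transform_eventually) (auto simp: eventually_at_filter h)
      qed
      have L: "((\<lambda>y. h y / y) \<longlongrightarrow> 0) (at_left 0)"
        by (rule Lim_transform_eventually[OF tendsto_const]) (auto simp: eventually_at_filter h)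
      from L R have "((\<lambda>y. h y / y) \<longlongrightarrow> 0) (at 0)" by (simp add: filterlim_split_at)
      then have "(h has_real_derivative 0) (at 0)"
        by (simp add: has_field_derivative_iff h)
      then show ?thesis using 3 by (simp add: h'_def)
    qed
  qed
  then show "\<exists>h'\<in>{\<lambda>x. if x > 0 then poly p (1 / x) * exp (- (1 / x)) else 0 |p. True}. \<forall>x. (h has_real_derivative h' x) (at x)"
    by (intro bexI[of _ h']) (auto simp: h'_def)
qed (auto simp: flat_exp_def fun_eq_iff intro!: exI[of _ "[:1:]"])

definition smooth_step :: "real \<Rightarrow> real" where
  "smooth_step x = flat_exp x / (flat_exp x + flat_exp (1 - x))"

lemma flat_exp_pos: "x > 0 \<Longrightarrow> flat_exp x > 0" and flat_exp_nonneg: "flat_exp x \<ge> 0"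
  by (auto simp: flat_exp_def)

lemma smooth_step_denominator_pos: "flat_exp x + flat_exp (1 - x) > 0"
proof (cases "x > 0")
  case True then show ?thesis by (intro add_pos_nonneg flat_exp_pos flat_exp_nonneg)
next
  case False then show ?thesis by (intro add_nonneg_pos flat_exp_pos flat_exp_nonneg) simp
qed

lemma smooth_real_smooth_step: "smooth_real smooth_step"
proof -
  have "smooth_real (\<lambda>x. flat_exp x * (1 / (flat_exp x + flat_exp ((-1) * x + 1))))"
    by (intro smooth_real_mult smooth_real_inverse smooth_real_add smooth_real_affine smooth_real_flat_exp)
       (use smooth_step_denominator_pos in \<open>simp add: algebra_simps\<close>)
  then show ?thesis by (simp add: smooth_step_def[abs_def] algebra_simps)
qed

lemma smooth_step_eq_0: "x \<le> 0 \<Longrightarrow> smooth_step x = 0"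
  by (simp add: smooth_step_def flat_exp_def)

lemma smooth_step_eq_1: "x \<ge> 1 \<Longrightarrow> smooth_step x = 1"
  by (simp add: smooth_step_def flat_exp_def)

lemma smooth_step_nonneg: "0 \<le> smooth_step x" and smooth_step_le_1: "smooth_step x \<le> 1"
  using smooth_step_denominator_pos[of x] flat_exp_nonneg
  by (auto simp: smooth_step_def divide_simps)

text \<open>The power is singular at 0 only, where g vanishes identically. Differentiation lowers
  the exponent by one and replaces g by b g + x g', which vanishes on the same half-line, so the
  family with arbitrary exponents is closed.\<close>

lemma smooth_real_powr_mult:
  assumes "smooth_real g" and "\<And>x. x < c \<Longrightarrow> g x = 0" and "c > 0"
  shows "smooth_real (\<lambda>x. x powr b * g x)"
proof (rule smooth_realI[where S = "{\<lambda>x. x powr b * g x |b g. smooth_real g \<and> (\<forall>x<c. g x = 0)}"])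
  fix F assume "F \<in> {\<lambda>x. x powr b * g x |b g. smooth_real g \<and> (\<forall>x<c. g x = 0)}"
  then obtain b g where F: "F = (\<lambda>x. x powr b * g x)" and g: "smooth_real g" and g0: "\<forall>x<c. g x = 0" by blast
  define g' where "g' = (\<lambda>x. b * g x + x * deriv g x)"
  have "smooth_real g'"
    unfolding g'_def by (intro smooth_real_add smooth_real_mult smooth_real_const smooth_real_id smooth_real_deriv g)
  moreover have g'0: "g' x = 0" if "x < c" for x
  proof -
    have "(g has_real_derivative 0) (at x)"
      by (rule has_field_derivative_transform_within_open[of "\<lambda>_. 0" _ _ "{..<c}"]) (use that g0 in auto)
    then have "deriv g x = 0" by (rule DERIV_imp_deriv)
    then show ?thesis using that g0 by (simp add: g'_def)
  qed
  moreover have "(F has_real_derivative x powr (b - 1) * g' x) (at x)" for x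
  proof (cases "x < c")
    case True
    have "(F has_real_derivative 0) (at x)"
      by (rule has_field_derivative_transform_within_open[of "\<lambda>_. 0" _ _ "{..<c}"]) (use True g0 F in auto)
    then show ?thesis using g'0[OF True] by simp
  next
    case False
    then have x: "x > 0" using \<open>c > 0\<close> by simp
    have "(F has_real_derivative (b * x powr (b - 1)) * g x + deriv g x * x powr b) (at x)"
      unfolding F by (intro DERIV_mult has_real_derivative_powr[OF x] smooth_real_DERIV[OF g])
    moreover have "x powr b = x powr (b - 1) * x" using x by (simp add: powr_diff)
    ultimately show ?thesis by (simp add: g'_def algebra_simps)
  qed
  ultimately show "\<exists>h'\<in>{\<lambda>x. x powr b * g x |b g. smooth_real g \<and> (\<forall>x<c. g x = 0)}. \<forall>x. (F has_real_derivative h' x) (at x)"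
    by (intro bexI[of _ "\<lambda>x. x powr (b - 1) * g' x"]) blast+
qed (use assms in blast)

lemma smooth_real_deriv_vanish_less:
  assumes "\<And>x. x < c \<Longrightarrow> g x = 0" "x < c" shows "deriv g x = (0::real)"
proof -
  have "(g has_real_derivative 0) (at x)"
    by (rule has_field_derivative_transform_within_open[of "\<lambda>_. 0" _ _ "{..<c}"]) (use assms in auto)
  then show ?thesis by (rule DERIV_imp_deriv)
qed

text \<open>The hypothesis concerns normalised cutoffs, uniformly over the class. A fixed smooth
  cutoff belongs to the class after division by a constant, which linearity gives back later in
  \<open>square_function_cmult\<close>.\<close>

lemma C_class_scale:
  assumes g: "smooth_real g" and supp: "\<And>x. x \<notin> {-1..1} \<Longrightarrow> g x = 0"
  obtains K where "K > 0" "(\<lambda>x. g x / K) \<in> C_class N"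
proof -
  have zero: "(deriv ^^ n) g x = 0" if "x \<notin> {-1..1}" for n x
    using that
  proof (induction n arbitrary: x)
    case (Suc n)
    have "((deriv ^^ n) g has_real_derivative 0) (at x)"
      by (rule has_field_derivative_transform_within_open[of "\<lambda>_. 0" _ _ "- {-1..1}"]) (use Suc in auto)
    then show ?case by (simp add: DERIV_imp_deriv)
  qed (use supp in auto)
  have "\<exists>B. \<forall>x. \<bar>(deriv ^^ n) g x\<bar> \<le> B" for n
  proof -
    have "compact ((deriv ^^ n) g ` {-1..1})"
      by (intro compact_continuous_image smooth_real_continuous smooth_real_funpow_deriv g) auto
    then obtain B where "\<forall>x\<in>{-1..1}. \<bar>(deriv ^^ n) g x\<bar> \<le> B"
      by (meson bounded_real compact_imp_bounded image_eqI)
    then have "\<bar>(deriv ^^ n) g x\<bar> \<le> max B 0" for x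
      using zero[of x n] by (cases "x \<in> {-1..1}") force+
    then show ?thesis by blast
  qed
  then obtain B where B: "\<And>n x. \<bar>(deriv ^^ n) g x\<bar> \<le> B n" by metis
  define K where "K = 1 + (\<Sum>n\<le>N. B n)"
  have B0: "B n \<ge> 0" for n using B[of n 0] by linarith
  have K: "K > 0" unfolding K_def using B0 by (intro add_pos_nonneg sum_nonneg) auto
  have BK: "B n \<le> K" if "n \<le> N" for n
    using member_le_sum[of n "{..N}" B] that B0 by (auto simp: K_def)
  have D: "(deriv ^^ n) (\<lambda>x. g x / K) = (\<lambda>x. (deriv ^^ n) g x / K)" for n
  proof (induction n)
    case (Suc n)
    have "(((deriv ^^ n) (\<lambda>x. g x / K)) has_real_derivative (deriv ^^ Suc n) g x / K) (at x)" for x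
      using DERIV_cdivide[OF smooth_real_DERIV[OF smooth_real_funpow_deriv[OF g, of n], of x], of K]
      by (simp add: Suc)
    then show ?case by (auto intro!: ext DERIV_imp_deriv)
  qed simp
  have gK: "smooth_real (\<lambda>x. g x / K)"
    using smooth_real_cmult[OF g, of "1 / K"] by simp
  have "{x. g x / K \<noteq> 0} \<subseteq> {-1..1}" using supp K by force
  then have "closure {x. g x / K \<noteq> 0} \<subseteq> {-1..1}" by (rule closure_minimal) simp
  moreover have "Lp_norm \<infinity> ((deriv ^^ n) (\<lambda>x. g x / K)) \<le> 1" if "n \<le> N" for n
  proof -
    have m[measurable]: "(deriv ^^ n) g \<in> borel_measurable borel"
      by (intro smooth_real_measurable smooth_real_funpow_deriv g)
    have "ennreal (norm ((deriv ^^ n) g x / K)) \<le> 1" for x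
      using B[of n x] BK[OF that] K by (simp add: ennreal_le_1 divide_simps)
    then show ?thesis
      unfolding D Lp_norm_def eLp_norm_def by (auto intro!: esssup_I)
  qed
  ultimately have "(\<lambda>x. g x / K) \<in> C_class N"
    using gK by (auto simp: C_class_def smooth_real_def)
  with K that show ?thesis by blast
qed

section \<open>Schwartz functions\<close>

lemma partial_deriv_eq:
  "(\<And>x. (f has_derivative D x) (at x)) \<Longrightarrow> partial_deriv b f = (\<lambda>x. D x b)"
  by (intro ext) (metis frechet_derivative_at partial_deriv_def)

lemma schwartz_diff: "schwartz f \<Longrightarrow> f differentiable (at x)"
  unfolding schwartz_def by (drule bspec[of _ _ "[]"]) (auto simp: iter_partial_deriv_def)

lemma schwartz_partial_deriv:
  assumes "schwartz f" "b \<in> Basis" shows "schwartz (partial_deriv b f)"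
  unfolding schwartz_def
proof
  fix bs :: "'a list" assume "bs \<in> lists Basis"
  then have "bs @ [b] \<in> lists Basis" using assms by auto
  moreover have "iter_partial_deriv (bs @ [b]) f = iter_partial_deriv bs (partial_deriv b f)"
    by (simp add: iter_partial_deriv_def)
  ultimately show "(\<forall>x. iter_partial_deriv bs (partial_deriv b f) differentiable (at x)) \<and>
        (\<forall>k::nat. \<exists>C. \<forall>x. (1 + norm x) ^ k * norm (iter_partial_deriv bs (partial_deriv b f) x) \<le> C)"
    using assms(1) unfolding schwartz_def by metis
qed

lemma schwartz_decay:
  assumes "schwartz f"
  obtains C where "C > 0" "\<And>x. norm (f x) \<le> C / (1 + norm x) ^ k"
proof -
  from assms have "\<exists>C. \<forall>x. (1 + norm x) ^ k * norm (f x) \<le> C"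
    unfolding schwartz_def by (drule_tac bspec[of _ _ "[]"]) (auto simp: iter_partial_deriv_def)
  then obtain C where C: "\<And>x. (1 + norm x) ^ k * norm (f x) \<le> C" by blast
  have "norm (f x) \<le> (max C 0 + 1) / (1 + norm x) ^ k" for x
  proof -
    have "(1 + norm x) ^ k > 0" by (simp add: add_pos_nonneg)
    then show ?thesis using C[of x] by (simp add: divide_simps algebra_simps)
  qed
  then show ?thesis by (intro that[of "max C 0 + 1"]) auto
qed

text \<open>The analogue of \<open>smooth_realI\<close>: closure under partial derivatives reduces
  the bounds on all derivatives to decay of the members themselves.\<close>

lemma schwartzI:
  assumes fS: "f \<in> S"
    and deriv: "\<And>h. h \<in> S \<Longrightarrow> \<exists>D. (\<forall>x. (h has_derivative D x) (at x)) \<and> (\<forall>b\<in>Basis. (\<lambda>x. D x b) \<in> S)"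
    and decay: "\<And>h k. h \<in> S \<Longrightarrow> \<exists>C. \<forall>x. norm (h x) \<le> C / (1 + norm x) ^ k"
  shows "schwartz f"
proof -
  have step: "h differentiable (at x)" "b \<in> Basis \<Longrightarrow> partial_deriv b h \<in> S" if hS: "h \<in> S" for h x b
  proof -
    obtain D where D: "\<And>x. (h has_derivative D x) (at x)" "\<And>b. b \<in> Basis \<Longrightarrow> (\<lambda>x. D x b) \<in> S"
      using deriv[OF hS] by blast
    show "h differentiable (at x)" using D(1) by (auto simp: differentiable_def)
    show "partial_deriv b h \<in> S" if "b \<in> Basis" using D(2)[OF that] partial_deriv_eq[OF D(1)] by simp
  qed
  have "iter_partial_deriv bs f \<in> S" if "bs \<in> lists Basis" for bs
    using that by (induction bs) (auto simp: iter_partial_deriv_def fS step)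
  moreover have "\<exists>C. \<forall>x. (1 + norm x) ^ k * norm (h x) \<le> C" if hS: "h \<in> S" for h and k :: nat
  proof -
    obtain C where C: "\<And>x. norm (h x) \<le> C / (1 + norm x) ^ k" using decay[OF hS] by blast
    have "(1 + norm x) ^ k * norm (h x) \<le> C" for x
    proof -
      have "(1 + norm x) ^ k > 0" by (simp add: add_pos_nonneg)
      then show ?thesis using C[of x] by (simp add: divide_simps algebra_simps)
    qed
    then show ?thesis by blast
  qed
  ultimately show ?thesis using step(1) by (auto simp: schwartz_def)
qed

lemma schwartz_has_derivative:
  assumes "schwartz f"
  shows "(f has_derivative (\<lambda>h. \<Sum>b\<in>Basis. (h \<bullet> b) *\<^sub>R partial_deriv b f x)) (at x)"
proof -
  let ?D = "frechet_derivative f (at x)"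
  have D: "(f has_derivative ?D) (at x)" using schwartz_diff[OF assms] frechet_derivative_works by blast
  then interpret bounded_linear ?D by (rule has_derivative_bounded_linear)
  have "?D h = (\<Sum>b\<in>Basis. (h \<bullet> b) *\<^sub>R partial_deriv b f x)" for h
  proof -
    have "?D h = ?D (\<Sum>b\<in>Basis. (h \<bullet> b) *\<^sub>R b)" by (simp add: euclidean_representation)
    then show ?thesis by (simp add: sum scaleR partial_deriv_def)
  qed
  then have "?D = (\<lambda>h. \<Sum>b\<in>Basis. (h \<bullet> b) *\<^sub>R partial_deriv b f x)" by blast
  with D show ?thesis by simp
qed

lemma schwartz_continuous: "schwartz f \<Longrightarrow> continuous_on A f"
  by (meson differentiable_imp_continuous_on differentiable_on_def differentiable_at_withinI schwartz_diff)

lemma schwartz_measurable [measurable_dest]: "schwartz f \<Longrightarrow> f \<in> borel_measurable borel"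
  using borel_measurable_continuous_onI schwartz_continuous by blast

lemma basis_sum_component:
  fixes F :: "'a::euclidean_space \<Rightarrow> 'b::real_vector"
  shows "b \<in> Basis \<Longrightarrow> (\<Sum>c\<in>Basis. (b \<bullet> c) *\<^sub>R F c) = F b"
proof -
  assume b: "b \<in> Basis"
  have "(\<Sum>c\<in>Basis. (b \<bullet> c) *\<^sub>R F c) = (\<Sum>c\<in>Basis. if b = c then F c else 0)"
    by (rule sum.cong) (use b in \<open>auto simp: inner_Basis\<close>)
  then show ?thesis using b by simp
qed

lemma schwartz_deriv_ex:
  assumes "schwartz f"
  obtains D where "\<And>x. (f has_derivative D x) (at x)" "\<And>b. b \<in> Basis \<Longrightarrow> (\<lambda>x. D x b) = partial_deriv b f"
  using schwartz_has_derivative[OF assms] by (rule that) (auto simp: basis_sum_component)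

lemma decay_add:
  assumes "\<exists>C. \<forall>x. norm (f x) \<le> C / (1 + norm x) ^ k" "\<exists>C. \<forall>x. norm (g x) \<le> C / (1 + norm x) ^ k"
  shows "\<exists>C. \<forall>x. norm (f x + g x) \<le> C / (1 + norm x) ^ k"
proof -
  obtain C D where "\<And>x. norm (f x) \<le> C / (1 + norm x) ^ k" "\<And>x. norm (g x) \<le> D / (1 + norm x) ^ k"
    using assms by blast
  then have "norm (f x + g x) \<le> (C + D) / (1 + norm x) ^ k" for x
    by (metis add_divide_distrib add_mono norm_triangle_le)
  then show ?thesis by blast
qed

lemma schwartz_add:
  assumes "schwartz f" "schwartz g" shows "schwartz (\<lambda>x. f x + g x)"
proof (rule schwartzI[where S = "{\<lambda>x. f x + g x |f g. schwartz f \<and> schwartz g}"])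
  fix h :: "'a \<Rightarrow> complex"
  assume "h \<in> {\<lambda>x. f x + g x |f g. schwartz f \<and> schwartz g}"
  then obtain f g where h: "h = (\<lambda>x. f x + g x)" and fg: "schwartz f" "schwartz g" by blast
  obtain D E where D: "\<And>x. (f has_derivative D x) (at x)" "\<And>b. b \<in> Basis \<Longrightarrow> (\<lambda>x. D x b) = partial_deriv b f"
    and E: "\<And>x. (g has_derivative E x) (at x)" "\<And>b. b \<in> Basis \<Longrightarrow> (\<lambda>x. E x b) = partial_deriv b g"
    using schwartz_deriv_ex fg by metis
  have "(\<lambda>x. D x b + E x b) \<in> {\<lambda>x. f x + g x |f g. schwartz f \<and> schwartz g}" if b: "b \<in> Basis" for b
    using schwartz_partial_deriv[OF fg(1) b, folded D(2)[OF b]] schwartz_partial_deriv[OF fg(2) b, folded E(2)[OF b]]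
    by (intro CollectI exI[of _ "\<lambda>x. D x b"] exI[of _ "\<lambda>x. E x b"] conjI refl)
  then show "\<exists>D. (\<forall>x. (h has_derivative D x) (at x)) \<and> (\<forall>b\<in>Basis. (\<lambda>x. D x b) \<in> {\<lambda>x. f x + g x |f g. schwartz f \<and> schwartz g})"
    by (intro exI[of _ "\<lambda>x v. D x v + E x v"] conjI allI ballI) (simp_all add: h has_derivative_add D(1) E(1))
  show "\<exists>C. \<forall>x. norm (h x) \<le> C / (1 + norm x) ^ k" for k
    unfolding h using fg by (intro decay_add) (metis schwartz_decay)+
qed (use assms in blast)

lemma schwartz_prod_span:
  assumes "F \<in> prod_span {f. schwartz f}" shows "schwartz F"
proof (rule schwartzI[where S = "prod_span {f. schwartz f}"])
  fix h :: "'a \<Rightarrow> complex" assume hS: "h \<in> prod_span {f. schwartz f}"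
  then show "\<exists>D. (\<forall>x. (h has_derivative D x) (at x)) \<and> (\<forall>b\<in>Basis. (\<lambda>x. D x b) \<in> prod_span {f. schwartz f})"
  proof induction
    case (prod_span_base f g)
    then have fg: "schwartz f" "schwartz g" by auto
    obtain D E where D: "\<And>x. (f has_derivative D x) (at x)" "\<And>b. b \<in> Basis \<Longrightarrow> (\<lambda>x. D x b) = partial_deriv b f"
      and E: "\<And>x. (g has_derivative E x) (at x)" "\<And>b. b \<in> Basis \<Longrightarrow> (\<lambda>x. E x b) = partial_deriv b g"
      using schwartz_deriv_ex fg by metis
    have "(\<lambda>x. f x * E x b + D x b * g x) \<in> prod_span {f. schwartz f}" if b: "b \<in> Basis" for b
      using schwartz_partial_deriv[OF fg(1) b, folded D(2)[OF b]] schwartz_partial_deriv[OF fg(2) b, folded E(2)[OF b]] fg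
      by (intro prod_span.intros) auto
    then show ?case
      by (intro exI[of _ "\<lambda>x v. f x * E x v + D x v * g x"] conjI allI ballI has_derivative_mult D(1) E(1)) auto
  next
    case (prod_span_add f g)
    then obtain D E where "\<And>x. (f has_derivative D x) (at x)" "\<And>b. b \<in> Basis \<Longrightarrow> (\<lambda>x. D x b) \<in> prod_span {f. schwartz f}"
      "\<And>x. (g has_derivative E x) (at x)" "\<And>b. b \<in> Basis \<Longrightarrow> (\<lambda>x. E x b) \<in> prod_span {f. schwartz f}" by blast
    then show ?case
      by (intro exI[of _ "\<lambda>x v. D x v + E x v"] conjI allI ballI has_derivative_add prod_span.intros) auto
  qed
  show "\<exists>C. \<forall>x. norm (h x) \<le> C / (1 + norm x) ^ k" for k
    using hS
  proof induction
    case (prod_span_base f g)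
    then have fg: "schwartz f" "schwartz g" by auto
    obtain C where C: "C > 0" "\<And>x. norm (f x) \<le> C / (1 + norm x) ^ k" using schwartz_decay fg(1) by metis
    obtain C' where C': "C' > 0" "\<And>x. norm (g x) \<le> C' / (1 + norm x) ^ 0" using schwartz_decay fg(2) by metis
    have "norm (f x * g x) \<le> (C * C') / (1 + norm x) ^ k" for x
      using mult_mono[OF C(2)[of x] C'(2)[of x]] C C' by (simp add: norm_mult)
    then show ?case by blast
  qed (rule decay_add)
qed (use assms in blast)

lemma schwartz_mult: "schwartz f \<Longrightarrow> schwartz g \<Longrightarrow> schwartz (\<lambda>x. f x * g x)"
  by (rule schwartz_prod_span) (auto intro: prod_span.intros)

lemma schwartz_scale:
  fixes f :: "'a::euclidean_space \<Rightarrow> complex"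
  assumes "schwartz f" "\<sigma> \<noteq> 0" shows "schwartz (\<lambda>x. c * f (\<sigma> *\<^sub>R x))"
proof (rule schwartzI[where S = "{\<lambda>x. c * f (\<sigma> *\<^sub>R x) |c f. schwartz f}"])
  fix h :: "'a \<Rightarrow> complex"
  assume "h \<in> {\<lambda>x. c * f (\<sigma> *\<^sub>R x) |c f. schwartz f}"
  then obtain c f where h: "h = (\<lambda>x. c * f (\<sigma> *\<^sub>R x))" and f: "schwartz f" by blast
  obtain D where D: "\<And>x. (f has_derivative D x) (at x)" "\<And>b. b \<in> Basis \<Longrightarrow> (\<lambda>x. D x b) = partial_deriv b f"
    using schwartz_deriv_ex f by metis
  have "(h has_derivative (\<lambda>v. (c * of_real \<sigma>) * D (\<sigma> *\<^sub>R x) v)) (at x)" for x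
  proof -
    have lin: "D y (\<sigma> *\<^sub>R v) = of_real \<sigma> * D y v" for y v
      using has_derivative_bounded_linear[OF D(1)[of y]]
      by (simp add: bounded_linear.linear linear_scale scaleR_conv_of_real)
    have "((\<lambda>x. f (\<sigma> *\<^sub>R x)) has_derivative (\<lambda>v. D (\<sigma> *\<^sub>R x) (\<sigma> *\<^sub>R v))) (at x)"
      by (rule has_derivative_compose[OF _ D(1)]) (auto intro!: derivative_eq_intros)
    then show ?thesis
      unfolding h by (auto intro!: derivative_eq_intros simp: lin mult.assoc)
  qed
  moreover have "(\<lambda>x. (c * of_real \<sigma>) * D (\<sigma> *\<^sub>R x) b) \<in> {\<lambda>x. c * f (\<sigma> *\<^sub>R x) |c f. schwartz f}" if b: "b \<in> Basis" for b
  proof -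
    have "D y b = partial_deriv b f y" for y using D(2)[OF b] by (rule fun_cong)
    then show ?thesis using schwartz_partial_deriv[OF f b] by auto
  qed
  ultimately show "\<exists>D. (\<forall>x. (h has_derivative D x) (at x)) \<and> (\<forall>b\<in>Basis. (\<lambda>x. D x b) \<in> {\<lambda>x. c * f (\<sigma> *\<^sub>R x) |c f. schwartz f})"
    by (intro exI[of _ "\<lambda>x v. (c * of_real \<sigma>) * D (\<sigma> *\<^sub>R x) v"]) blast
  show "\<exists>C. \<forall>x. norm (h x) \<le> C / (1 + norm x) ^ k" for k
  proof -
    obtain C where C: "C > 0" "\<And>x. norm (f x) \<le> C / (1 + norm x) ^ k" using schwartz_decay f by metis
    \<comment> \<open>This m gives 1 + |x| \<le> m (1 + |\<sigma> x|), which moves the decay weight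
      from \<sigma> x to x.\<close>
    define m where "m = max 1 (1 / \<bar>\<sigma>\<bar>)"
    have "norm (h x) \<le> (norm c * C * m ^ k) / (1 + norm x) ^ k" for x
    proof -
      have "1 + norm x \<le> m * (1 + norm (\<sigma> *\<^sub>R x))"
      proof -
        have "norm x = 1 / \<bar>\<sigma>\<bar> * norm (\<sigma> *\<^sub>R x)" using assms(2) by simp
        also have "\<dots> \<le> m * norm (\<sigma> *\<^sub>R x)" by (rule mult_right_mono) (auto simp: m_def)
        finally show ?thesis by (simp add: m_def distrib_left)
      qed
      then have "(1 + norm x) ^ k \<le> m ^ k * (1 + norm (\<sigma> *\<^sub>R x)) ^ k"
        by (metis power_mono power_mult_distrib add_nonneg_nonneg norm_ge_zero zero_le_one)
      moreover have "(1 + norm (\<sigma> *\<^sub>R x)) ^ k > 0" "(1 + norm x) ^ k > 0" by (simp_all add: add_pos_nonneg)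
      ultimately have "C / (1 + norm (\<sigma> *\<^sub>R x)) ^ k \<le> C * m ^ k / (1 + norm x) ^ k"
        using C(1) by (simp add: divide_simps mult.commute mult.left_commute)
      with C(2)[of "\<sigma> *\<^sub>R x"] have "norm c * norm (f (\<sigma> *\<^sub>R x)) \<le> norm c * (C * m ^ k / (1 + norm x) ^ k)"
        by (intro mult_left_mono) auto
      then show ?thesis by (simp add: h norm_mult mult.assoc)
    qed
    then show ?thesis by blast
  qed
qed (use assms in blast)

lemma schwartz_cmult: "schwartz f \<Longrightarrow> schwartz (\<lambda>x. c * f x)"
  by (rule schwartz_scale[of f 1 c, unfolded scaleR_one]) simp_all

lemma schwartz_dilate: "schwartz f \<Longrightarrow> \<sigma> \<noteq> 0 \<Longrightarrow> schwartz (\<lambda>x. f (\<sigma> *\<^sub>R x))"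
  by (rule schwartz_scale[of f \<sigma> 1, unfolded mult_1])

lemma schwartz_minus: "schwartz f \<Longrightarrow> schwartz g \<Longrightarrow> schwartz (\<lambda>x. f x - g x)"
  using schwartz_add[OF _ schwartz_cmult, of f g "-1"] by (simp del: scaleR_one)

lemma schwartz_cnj:
  assumes "schwartz f" shows "schwartz (\<lambda>x. cnj (f x))"
proof (rule schwartzI[where S = "{\<lambda>x. cnj (f x) |f. schwartz f}"])
  fix h :: "'a \<Rightarrow> complex"
  assume "h \<in> {\<lambda>x. cnj (f x) |f. schwartz f}"
  then obtain f where h: "h = (\<lambda>x. cnj (f x))" and f: "schwartz f" by blast
  obtain D where D: "\<And>x. (f has_derivative D x) (at x)" "\<And>b. b \<in> Basis \<Longrightarrow> (\<lambda>x. D x b) = partial_deriv b f"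
    using schwartz_deriv_ex f by metis
  show "\<exists>D. (\<forall>x. (h has_derivative D x) (at x)) \<and> (\<forall>b\<in>Basis. (\<lambda>x. D x b) \<in> {\<lambda>x. cnj (f x) |f. schwartz f})"
  proof (intro exI[of _ "\<lambda>x v. cnj (D x v)"] conjI allI ballI)
    show "(h has_derivative (\<lambda>v. cnj (D x v))) (at x)" for x
      unfolding h by (rule has_derivative_cnj[OF D(1)])
    show "(\<lambda>x. cnj (D x b)) \<in> {\<lambda>x. cnj (f x) |f. schwartz f}" if b: "b \<in> Basis" for b
      using schwartz_partial_deriv[OF f b, folded D(2)[OF b]] by (intro CollectI exI[of _ "\<lambda>x. D x b"] conjI refl)
  qed
  show "\<exists>C. \<forall>x. norm (h x) \<le> C / (1 + norm x) ^ k" for k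
  proof -
    obtain C where "\<And>x. norm (f x) \<le> C / (1 + norm x) ^ k" using schwartz_decay[OF f] by blast
    then show ?thesis unfolding h complex_mod_cnj by blast
  qed
qed (use assms in blast)

section \<open>Truncation at a height within the Schwartz class\<close>

inductive_set resolvent_span :: "('a::euclidean_space \<Rightarrow> complex) \<Rightarrow> ('a \<Rightarrow> complex) set" for Q where
  resolvent_span_base: "schwartz h \<Longrightarrow> (\<lambda>x. h x * inverse (1 + Q x) ^ m) \<in> resolvent_span Q"
| resolvent_span_add: "f \<in> resolvent_span Q \<Longrightarrow> g \<in> resolvent_span Q \<Longrightarrow> (\<lambda>x. f x + g x) \<in> resolvent_span Q"

text \<open>Differentiating h / (1 + Q)^m gives h' / (1 + Q)^m - m h Q' / (1 + Q)^(m+1), a sum of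
  two members with Schwartz numerators. Since Q is real and nonnegative, the denominators are at
  least 1 in absolute value, so decay is inherited from the numerator.\<close>

lemma schwartz_resolvent_span:
  assumes Q: "schwartz Q" and Qpos: "\<And>x. \<exists>q\<ge>0. Q x = of_real q" and "F \<in> resolvent_span Q"
  shows "schwartz F"
proof (rule schwartzI[where S = "resolvent_span Q"])
  have nz: "1 + Q x \<noteq> 0" for x
    using Qpos[of x] by (metis add_nonneg_eq_0_iff of_real_1 of_real_add of_real_eq_0_iff zero_le_one zero_neq_one)
  have le1: "norm (inverse (1 + Q x)) \<le> 1" for x
  proof -
    obtain q where q: "q \<ge> 0" "Q x = of_real q" using Qpos by blast
    then have "norm (1 + Q x) = 1 + q" by (metis abs_of_nonneg add_nonneg_nonneg norm_of_real of_real_1 of_real_add zero_le_one)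
    then show ?thesis using q by (simp add: norm_inverse inverse_le_1_iff)
  qed
  obtain E where E: "\<And>x. (Q has_derivative E x) (at x)" "\<And>b. b \<in> Basis \<Longrightarrow> (\<lambda>x. E x b) = partial_deriv b Q"
    using schwartz_deriv_ex Q by metis
  fix h :: "'a \<Rightarrow> complex" assume hS: "h \<in> resolvent_span Q"
  then show "\<exists>D. (\<forall>x. (h has_derivative D x) (at x)) \<and> (\<forall>b\<in>Basis. (\<lambda>x. D x b) \<in> resolvent_span Q)"
  proof induction
    case (resolvent_span_base h m)
    obtain D where D: "\<And>x. (h has_derivative D x) (at x)" "\<And>b. b \<in> Basis \<Longrightarrow> (\<lambda>x. D x b) = partial_deriv b h"
      using schwartz_deriv_ex resolvent_span_base by metis
    define D' where "D' = (\<lambda>x v. D x v * inverse (1 + Q x) ^ m + (- of_nat m * (h x * E x v)) * inverse (1 + Q x) ^ Suc m)"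
    have G: "((\<lambda>x. inverse (1 + Q x) ^ m) has_derivative (\<lambda>v. - of_nat m * E x v * inverse (1 + Q x) ^ Suc m)) (at x)" for x
    proof -
      have "((\<lambda>x. inverse (1 + Q x) ^ m) has_derivative
          (\<lambda>v. of_nat m * (- (inverse (1 + Q x) * E x v * inverse (1 + Q x))) * inverse (1 + Q x) ^ (m - 1))) (at x)"
        by (intro has_derivative_power Deriv.has_derivative_inverse nz has_derivative_add[OF has_derivative_const E(1), of 1, unfolded add_0])
      then show ?thesis
        by (cases m) (auto simp: algebra_simps)
    qed
    have "((\<lambda>x. h x * inverse (1 + Q x) ^ m) has_derivative D' x) (at x)" for x
      using has_derivative_mult[OF D(1) G, of x] by (simp add: D'_def algebra_simps)
    moreover have "(\<lambda>x. D' x b) \<in> resolvent_span Q" if b: "b \<in> Basis" for b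
      unfolding D'_def
    proof (rule resolvent_span_add)
      show "(\<lambda>x. D x b * inverse (1 + Q x) ^ m) \<in> resolvent_span Q"
        using schwartz_partial_deriv[OF resolvent_span_base b, folded D(2)[OF b]] by (rule resolvent_span.intros)
      show "(\<lambda>x. - of_nat m * (h x * E x b) * inverse (1 + Q x) ^ Suc m) \<in> resolvent_span Q"
        by (intro resolvent_span.intros schwartz_cmult schwartz_mult resolvent_span_base)
           (use schwartz_partial_deriv[OF Q b, folded E(2)[OF b]] in simp)
    qed
    ultimately show ?case by blast
  next
    case (resolvent_span_add f g)
    then obtain D E where "\<And>x. (f has_derivative D x) (at x)" "\<And>b. b \<in> Basis \<Longrightarrow> (\<lambda>x. D x b) \<in> resolvent_span Q"
      "\<And>x. (g has_derivative E x) (at x)" "\<And>b. b \<in> Basis \<Longrightarrow> (\<lambda>x. E x b) \<in> resolvent_span Q" by blast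
    then show ?case
      by (intro exI[of _ "\<lambda>x v. D x v + E x v"] conjI allI ballI has_derivative_add resolvent_span.intros) auto
  qed
  show "\<exists>C. \<forall>x. norm (h x) \<le> C / (1 + norm x) ^ k" for k
    using hS
  proof induction
    case (resolvent_span_base h m)
    obtain C where C: "C > 0" "\<And>x. norm (h x) \<le> C / (1 + norm x) ^ k" using schwartz_decay resolvent_span_base by metis
    have "norm (h x * inverse (1 + Q x) ^ m) \<le> C / (1 + norm x) ^ k" for x
    proof -
      have "norm (inverse (1 + Q x) ^ m) \<le> 1" using le1[of x] by (simp add: norm_power power_le_one)
      then have "norm (h x * inverse (1 + Q x) ^ m) \<le> norm (h x)"
        by (simp add: norm_mult mult_left_le)
      with C(2)[of x] show ?thesis by linarith
    qed
    then show ?case by blast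
  qed (rule decay_add)
qed (use assms in blast)

text \<open>A smooth substitute for cutting f at height \<mu>: it stays comparable to f where |f|
  \<le> \<mu> and never exceeds \<mu> in size (for k > 0). The exponent is even because |f|^2 = f
  \<open>cnj\<close> f is smooth while |f| is not. A larger k makes the complementary high part
  smaller where |f| < \<mu>.\<close>

definition low_part :: "nat \<Rightarrow> real \<Rightarrow> ('a::euclidean_space \<Rightarrow> complex) \<Rightarrow> 'a \<Rightarrow> complex" where
  "low_part k \<mu> f x = f x / of_real (1 + (norm (f x) / \<mu>) ^ (2 * k))"

definition high_part :: "nat \<Rightarrow> real \<Rightarrow> ('a::euclidean_space \<Rightarrow> complex) \<Rightarrow> 'a \<Rightarrow> complex" where
  "high_part k \<mu> f x = f x - low_part k \<mu> f x"

lemma schwartz_power: "k > 0 \<Longrightarrow> schwartz f \<Longrightarrow> schwartz (\<lambda>x. f x ^ k)"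
proof (induction k rule: nat_induct_non_zero)
  case (Suc n) then show ?case using schwartz_mult[of f "\<lambda>x. f x ^ n"] by simp
qed simp

lemma schwartz_low_part:
  assumes f: "schwartz f" and "k > 0" shows "schwartz (low_part k \<mu> f)"
proof -
  define Q where "Q = (\<lambda>x. of_real (1 / \<mu> ^ (2 * k)) * (f x * cnj (f x)) ^ k)"
  have "schwartz Q"
    unfolding Q_def by (intro schwartz_cmult schwartz_power schwartz_mult schwartz_cnj f assms)
  have Qr: "Q x = of_real ((norm (f x) / \<mu>) ^ (2 * k))" for x
    unfolding Q_def complex_norm_square[symmetric] by (simp add: power_mult power_divide)
  have "(\<lambda>x. f x * inverse (1 + Q x) ^ 1) \<in> resolvent_span Q"
    by (rule resolvent_span_base[OF f])
  then have "schwartz (\<lambda>x. f x * inverse (1 + Q x) ^ 1)"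
    by (rule schwartz_resolvent_span[OF \<open>schwartz Q\<close>, rotated])
       (auto intro!: exI[of _ "(norm (f x) / \<mu>) ^ (2 * k)" for x] simp: Qr power_mult)
  moreover have "(\<lambda>x. f x * inverse (1 + Q x) ^ 1) = low_part k \<mu> f"
    by (simp add: low_part_def fun_eq_iff Qr divide_inverse)
  ultimately show ?thesis by metis
qed

lemma schwartz_high_part: "schwartz f \<Longrightarrow> k > 0 \<Longrightarrow> schwartz (high_part k \<mu> f)"
  unfolding high_part_def[abs_def] by (intro schwartz_minus schwartz_low_part)

lemma norm_low_part: "norm (low_part k \<mu> f x) = norm (f x) / (1 + (norm (f x) / \<mu>) ^ (2 * k))"
proof -
  have "1 + (norm (f x) / \<mu>) ^ (2 * k) > 0" by (simp add: power_mult add_pos_nonneg)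
  then show ?thesis by (simp add: low_part_def norm_divide del: of_real_add of_real_power)
qed

lemma norm_low_part_le: "norm (low_part k \<mu> f x) \<le> norm (f x)"
proof -
  have "1 + (norm (f x) / \<mu>) ^ (2 * k) \<ge> 1" by (simp add: power_mult)
  then show ?thesis unfolding norm_low_part by (simp add: divide_le_eq mult_left_le mult_le_cancel_left1)
qed

lemma norm_low_part_le_level:
  assumes "\<mu> > 0" "k > 0" shows "norm (low_part k \<mu> f x) \<le> \<mu>"
proof (cases "norm (f x) \<le> \<mu>")
  case True then show ?thesis using norm_low_part_le[of k \<mu> f x] by linarith
next
  case False
  define w where "w = norm (f x) / \<mu>"
  have w: "w \<ge> 1" "norm (f x) = \<mu> * w" using False assms by (auto simp: w_def)
  then have "w \<le> w ^ (2 * k)" using assms by (intro self_le_power) auto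
  then have "\<mu> * w \<le> \<mu> * (1 + w ^ (2 * k))" using assms by simp
  moreover have "1 + w ^ (2 * k) > 0" by (simp add: power_mult add_pos_nonneg)
  ultimately show ?thesis unfolding norm_low_part w_def[symmetric] by (simp add: divide_le_eq w)
qed

lemma high_part_eq: "high_part k \<mu> f x = f x * of_real ((norm (f x) / \<mu>) ^ (2 * k) / (1 + (norm (f x) / \<mu>) ^ (2 * k)))"
proof -
  have "1 + (norm (f x) / \<mu>) ^ (2 * k) > 0" by (simp add: power_mult add_pos_nonneg)
  then have nz: "complex_of_real (1 + (norm (f x) / \<mu>) ^ (2 * k)) \<noteq> 0"
    by (simp only: of_real_eq_0_iff)
  have "high_part k \<mu> f x = f x * (1 - 1 / complex_of_real (1 + (norm (f x) / \<mu>) ^ (2 * k)))"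
    by (simp only: high_part_def low_part_def right_diff_distrib times_divide_eq_right mult_1_right)
  moreover have "1 - 1 / complex_of_real (1 + (norm (f x) / \<mu>) ^ (2 * k)) = of_real ((norm (f x) / \<mu>) ^ (2 * k)) / complex_of_real (1 + (norm (f x) / \<mu>) ^ (2 * k))"
    (is "1 - 1 / ?D = ?w / ?D")
  proof -
    have "?D = 1 + ?w" by simp
    then show ?thesis using nz by (metis add_diff_cancel_left' diff_divide_distrib divide_self)
  qed
  ultimately show ?thesis by (simp only: of_real_divide)
qed

text \<open>A sharp cut would make the high part vanish below the height. Here it is only small
  there, of relative size (|f|/\<mu>)^(2k), and this is enough for interpolation once k is
  large.\<close>

lemma norm_high_part_le: "norm (high_part k \<mu> f x) \<le> norm (f x) * min 1 ((norm (f x) / \<mu>) ^ (2 * k))"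
proof -
  define w where "w = (norm (f x) / \<mu>) ^ (2 * k)"
  have w: "w \<ge> 0" by (simp add: w_def power_mult)
  have "norm (high_part k \<mu> f x) = norm (f x) * (w / (1 + w))"
    using w unfolding high_part_eq norm_mult norm_of_real w_def[symmetric] by simp
  also have "w / (1 + w) \<le> min 1 w" using w by (auto simp: divide_simps algebra_simps)
  finally show ?thesis unfolding w_def by (simp add: mult_left_mono)
qed

section \<open>Gaussians and the Fourier transform\<close>

lemma
  fixes f :: "'a::euclidean_space \<Rightarrow> real \<Rightarrow> complex"
  assumes "\<And>b. b \<in> Basis \<Longrightarrow> integrable lborel (f b)"
  shows integrable_lborel_prod: "integrable lborel (\<lambda>x. \<Prod>b\<in>Basis. f b (x \<bullet> b))"
    and integral_lborel_prod: "(LINT x|lborel. (\<Prod>b\<in>Basis. f b (x \<bullet> b))) = (\<Prod>b\<in>Basis. LINT t|lborel. f b t)"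
proof -
  interpret product_sigma_finite "\<lambda>_::'a. lborel :: real measure" by standard
  define T where "T = (\<lambda>g::'a \<Rightarrow> real. \<Sum>b\<in>Basis. g b *\<^sub>R b)"
  have T: "T \<in> measurable (\<Pi>\<^sub>M b\<in>Basis. lborel) borel" unfolding T_def by measurable
  have [measurable]: "\<And>b. b \<in> Basis \<Longrightarrow> f b \<in> borel_measurable borel"
    using assms borel_measurable_integrable by fastforce
  have m: "(\<lambda>x. \<Prod>b\<in>Basis. f b (x \<bullet> b)) \<in> borel_measurable borel" by measurable
  have e: "(\<Prod>b\<in>Basis. f b (T g \<bullet> b)) = (\<Prod>b\<in>Basis. f b (g b))" for g
    by (rule prod.cong) (auto simp: T_def)
  show "integrable lborel (\<lambda>x. \<Prod>b\<in>Basis. f b (x \<bullet> b))"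
    unfolding lborel_eq[where 'a='a] T_def[symmetric]
    by (subst integrable_distr_eq[OF T m]) (auto simp: e intro!: product_integrable_prod assms)
  show "(LINT x|lborel. (\<Prod>b\<in>Basis. f b (x \<bullet> b))) = (\<Prod>b\<in>Basis. LINT t|lborel. f b t)"
    unfolding lborel_eq[where 'a='a] T_def[symmetric]
    by (subst integral_distr[OF T m]) (auto simp: e intro!: product_integral_prod assms)
qed

lemma nn_integral_lborel_affine:
  fixes f :: "'a::euclidean_space \<Rightarrow> ennreal"
  assumes [measurable]: "f \<in> borel_measurable borel" and "c \<noteq> 0"
  shows "(\<integral>\<^sup>+x. f x \<partial>lborel) = ennreal (\<bar>c\<bar> ^ DIM('a)) * (\<integral>\<^sup>+x. f (t + c *\<^sub>R x) \<partial>lborel)"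
  by (subst lborel_affine[OF assms(2), of t])
     (simp add: nn_integral_density nn_integral_distr nn_integral_cmult)

lemma
  fixes f :: "'a::euclidean_space \<Rightarrow> 'b::{banach,second_countable_topology}"
  assumes "c \<noteq> 0"
  shows integrable_lborel_affine: "integrable lborel f \<Longrightarrow> integrable lborel (\<lambda>x. f (t + c *\<^sub>R x))"
    and integral_lborel_affine: "f \<in> borel_measurable borel \<Longrightarrow>
      (LINT x|lborel. f x) = \<bar>c\<bar> ^ DIM('a) *\<^sub>R (LINT x|lborel. f (t + c *\<^sub>R x))"
proof -
  have T: "(\<lambda>x. t + c *\<^sub>R x) \<in> measurable lborel borel" by measurable
  show "integrable lborel (\<lambda>x. f (t + c *\<^sub>R x))" if f: "integrable lborel f"
  proof -
    have [measurable]: "f \<in> borel_measurable borel" using borel_measurable_integrable[OF f] by simp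
    have "integrable (density (distr lborel borel (\<lambda>x. t + c *\<^sub>R x)) (\<lambda>_. \<bar>c\<bar> ^ DIM('a))) f"
      using f lborel_affine[OF assms, of t] by metis
    then have "integrable (distr lborel borel (\<lambda>x. t + c *\<^sub>R x)) (\<lambda>x. \<bar>c\<bar> ^ DIM('a) *\<^sub>R f x)"
      by (subst (asm) integrable_density) auto
    then have "integrable lborel (\<lambda>x. \<bar>c\<bar> ^ DIM('a) *\<^sub>R f (t + c *\<^sub>R x))"
      by (subst (asm) integrable_distr_eq[OF T]) auto
    then have "integrable lborel (\<lambda>x. inverse (\<bar>c\<bar> ^ DIM('a)) *\<^sub>R (\<bar>c\<bar> ^ DIM('a) *\<^sub>R f (t + c *\<^sub>R x)))"
      by (rule integrable_scaleR_right)
    then show ?thesis using assms by simp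
  qed
  assume [measurable]: "f \<in> borel_measurable borel"
  show "(LINT x|lborel. f x) = \<bar>c\<bar> ^ DIM('a) *\<^sub>R (LINT x|lborel. f (t + c *\<^sub>R x))"
    by (subst lborel_affine[OF assms, of t]) (simp add: integral_density integral_distr)
qed

lemma power2_norm_eq_sum: "(norm (x::'a::euclidean_space))\<^sup>2 = (\<Sum>b\<in>Basis. (x \<bullet> b)\<^sup>2)"
  unfolding power2_norm_eq_inner by (subst euclidean_inner) (simp add: power2_eq_square)

definition gaussian :: "'a::euclidean_space \<Rightarrow> real" where
  "gaussian x = exp (- (norm x)\<^sup>2 / 2)"

definition gauss_density :: "'a::euclidean_space \<Rightarrow> real" where
  "gauss_density x = gaussian x / sqrt (2 * pi) ^ DIM('a)"

lemma gaussian_measurable [measurable]: "gaussian \<in> borel_measurable borel"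
  unfolding gaussian_def[abs_def] by measurable

lemma gauss_density_measurable [measurable]: "gauss_density \<in> borel_measurable borel"
  unfolding gauss_density_def[abs_def] by measurable

lemma gauss_density_nonneg: "gauss_density x \<ge> 0"
  by (simp add: gauss_density_def gaussian_def)

lemma gauss_density_prod: "gauss_density x = (\<Prod>b\<in>Basis. std_normal_density (x \<bullet> b))"
proof -
  have "gaussian x = (\<Prod>b\<in>Basis. exp (- (x \<bullet> b)\<^sup>2 / 2))"
    by (simp add: gaussian_def power2_norm_eq_sum exp_sum[symmetric] sum_negf sum_divide_distrib)
  then show ?thesis
    by (simp add: gauss_density_def std_normal_density_def prod_dividef prod_constant)
qed

lemma cis_sum: "finite A \<Longrightarrow> cis (\<Sum>b\<in>A. f b) = (\<Prod>b\<in>A. cis (f b))"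
  by (induction A rule: finite_induct) (auto simp: cis_mult[symmetric])

text \<open>Both the density and the character factor over the coordinates, so the claim reduces to
  the characteristic function of the standard normal distribution on the line.\<close>

lemma
  shows integrable_gauss_density: "integrable lborel (gauss_density :: 'a::euclidean_space \<Rightarrow> real)"
    and gauss_density_cis: "(LINT u|lborel. cis (y \<bullet> u) * complex_of_real (gauss_density u)) = complex_of_real (gaussian (y::'a))"
proof -
  have 1: "integrable lborel (\<lambda>t. cis (c * t) * complex_of_real (std_normal_density t))" for c
  proof (rule Bochner_Integration.integrable_bound[OF integrable_normal_density[of 1 0]])
    show "AE t in lborel. norm (cis (c * t) * complex_of_real (std_normal_density t)) \<le> norm (std_normal_density t)"
      by (simp add: norm_mult)
    show "(\<lambda>t. cis (c * t) * complex_of_real (std_normal_density t)) \<in> borel_measurable lborel"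
      unfolding cis_conv_exp by measurable
  qed simp
  have 2: "(LINT t|lborel. cis (c * t) * complex_of_real (std_normal_density t)) = of_real (exp (- c\<^sup>2 / 2))" for c
  proof -
    have "(LINT t|lborel. cis (c * t) * complex_of_real (std_normal_density t)) = char std_normal_distribution c"
      unfolding char_def
      by (subst integral_density) (auto simp: cis_conv_exp scaleR_conv_of_real mult.commute intro!: Bochner_Integration.integral_cong)
    then show ?thesis by (simp add: char_std_normal_distribution)
  qed
  have 3: "cis (y \<bullet> u) * complex_of_real (gauss_density u) = (\<Prod>b\<in>Basis. cis ((y \<bullet> b) * (u \<bullet> b)) * complex_of_real (std_normal_density (u \<bullet> b)))" for y u :: 'a
    by (simp add: prod.distrib gauss_density_prod cis_sum[symmetric] euclidean_inner[symmetric])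
  have "integrable lborel (\<lambda>u::'a. cis (0 \<bullet> u) * complex_of_real (gauss_density u))"
    unfolding 3 by (rule integrable_lborel_prod) (rule 1)
  from integrable_norm[OF this] show "integrable lborel (gauss_density :: 'a \<Rightarrow> real)"
    by (simp add: norm_mult gauss_density_nonneg)
  show "(LINT u|lborel. cis (y \<bullet> u) * complex_of_real (gauss_density u)) = complex_of_real (gaussian y)"
    unfolding 3 by (subst integral_lborel_prod[OF 1])
      (simp add: 2 gaussian_def power2_norm_eq_sum exp_sum[symmetric] sum_negf sum_divide_distrib flip: of_real_prod)
qed

lemma integral_gauss_density: "(LINT u|lborel. gauss_density (u::'a::euclidean_space)) = 1"
proof -
  have "(LINT u|lborel. complex_of_real (gauss_density (u::'a))) = 1"
    using gauss_density_cis[of "0::'a"] by (simp add: gaussian_def)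
  then show ?thesis by (metis integral_complex_of_real of_real_eq_1_iff)
qed

text \<open>The inverse Fourier transform of the weight
  \<open>gaussian (\<epsilon> *\<^sub>R \<xi>)\<close>: a probability density at length scale
  \<epsilon> / (2 pi), hence an approximate identity as \<epsilon> tends to 0.\<close>

definition gauss_kernel :: "real \<Rightarrow> 'a::euclidean_space \<Rightarrow> real" where
  "gauss_kernel \<epsilon> z = (2 * pi / \<epsilon>) ^ DIM('a) * gauss_density ((2 * pi / \<epsilon>) *\<^sub>R z)"

lemma gauss_kernel_measurable [measurable]: "gauss_kernel \<epsilon> \<in> borel_measurable borel"
  unfolding gauss_kernel_def[abs_def] by measurable

lemma gauss_kernel_nonneg: "\<epsilon> > 0 \<Longrightarrow> gauss_kernel \<epsilon> z \<ge> 0"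
  by (simp add: gauss_kernel_def gauss_density_nonneg)

lemma gauss_kernel_minus: "gauss_kernel \<epsilon> (- z) = gauss_kernel \<epsilon> z"
  by (simp add: gauss_kernel_def gauss_density_def gaussian_def)

lemma nn_integral_gauss_kernel:
  assumes "\<epsilon> > 0" shows "(\<integral>\<^sup>+y. ennreal (gauss_kernel \<epsilon> (x - y)) \<partial>lborel) = 1"
proof -
  have "1 = (\<integral>\<^sup>+y. ennreal (gauss_density (y::'a)) \<partial>lborel)"
    by (subst nn_integral_eq_integral) (auto simp: integrable_gauss_density gauss_density_nonneg integral_gauss_density)
  also have "\<dots> = ennreal (\<bar>- (2 * pi / \<epsilon>)\<bar> ^ DIM('a)) * (\<integral>\<^sup>+y. ennreal (gauss_density ((2 * pi / \<epsilon>) *\<^sub>R x + (- (2 * pi / \<epsilon>)) *\<^sub>R y)) \<partial>lborel)"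
    by (rule nn_integral_lborel_affine) (use assms in auto)
  also have "\<dots> = (\<integral>\<^sup>+y. ennreal (gauss_kernel \<epsilon> (x - y)) \<partial>lborel)"
    using assms by (subst nn_integral_cmult[symmetric])
      (auto simp: gauss_kernel_def scaleR_diff_right ennreal_mult'[symmetric] gauss_density_nonneg)
  finally show ?thesis by simp
qed

lemma cis_measurable [measurable (raw)]:
  "f \<in> borel_measurable M \<Longrightarrow> (\<lambda>x. cis (f x)) \<in> borel_measurable M"
  unfolding cis_conv_exp by measurable

lemma integrable_cis_mult:
  assumes "integrable M f" "g \<in> borel_measurable M"
  shows "integrable M (\<lambda>x. cis (g x) * f x)"
proof (rule Bochner_Integration.integrable_bound[OF assms(1)])
  have [measurable]: "f \<in> borel_measurable M" using assms(1) by auto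
  show "(\<lambda>x. cis (g x) * f x) \<in> borel_measurable M" using assms(2) by measurable
qed (simp add: norm_mult)

lemma gaussian_fourier:
  fixes z :: "'a::euclidean_space"
  assumes e: "\<epsilon> > 0"
  shows "(LINT \<xi>|lborel. cis (2 * pi * (z \<bullet> \<xi>)) * complex_of_real (gaussian (\<epsilon> *\<^sub>R \<xi>))) = complex_of_real (gauss_kernel \<epsilon> z)"
proof -
  define c where "c = sqrt (2 * pi) ^ DIM('a)"
  have c: "c > 0" "c * c = (2 * pi) ^ DIM('a)"
    unfolding c_def by (simp, subst power_mult_distrib[symmetric], simp)
  define E where "E = \<epsilon> ^ DIM('a)"
  have E: "E > 0" using e by (simp add: E_def)
  have cE: "of_real (c / E) * of_real (E / c) = (1::complex)"
    using c(1) E unfolding of_real_mult[symmetric] by simp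
  define y where "y = (2 * pi / \<epsilon>) *\<^sub>R z"
  have gd: "gaussian u = c * gauss_density u" for u :: 'a using c by (simp add: gauss_density_def c_def)
  have "(LINT u|lborel. cis (y \<bullet> u) * complex_of_real (gauss_density u)) =
      \<bar>\<epsilon>\<bar> ^ DIM('a) *\<^sub>R (LINT \<xi>|lborel. cis (y \<bullet> (0 + \<epsilon> *\<^sub>R \<xi>)) * complex_of_real (gauss_density (0 + \<epsilon> *\<^sub>R \<xi>)))"
    by (rule integral_lborel_affine) (use e in auto)
  also have "(\<lambda>\<xi>::'a. cis (y \<bullet> (0 + \<epsilon> *\<^sub>R \<xi>)) * complex_of_real (gauss_density (0 + \<epsilon> *\<^sub>R \<xi>))) =
      (\<lambda>\<xi>. of_real (1 / c) * (cis (2 * pi * (z \<bullet> \<xi>)) * complex_of_real (gaussian (\<epsilon> *\<^sub>R \<xi>))))"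
    using e c by (auto simp: fun_eq_iff y_def gd)
  also have "\<bar>\<epsilon>\<bar> ^ DIM('a) *\<^sub>R (LINT \<xi>|lborel. of_real (1 / c) * (cis (2 * pi * (z \<bullet> \<xi>)) * complex_of_real (gaussian (\<epsilon> *\<^sub>R \<xi>)))) =
      of_real (E / c) * (LINT \<xi>|lborel. cis (2 * pi * (z \<bullet> \<xi>)) * complex_of_real (gaussian (\<epsilon> *\<^sub>R \<xi>)))"
    (is "_ = _ * ?I")
    using e by (simp add: E_def scaleR_conv_of_real)
  finally have "complex_of_real (gaussian y) = of_real (E / c) * ?I"
    by (simp add: gauss_density_cis)
  then have "of_real (c / E) * complex_of_real (gaussian y) = ?I"
    by (simp only: mult.assoc[symmetric] cE mult_1)
  moreover have "c / E * gaussian y = gauss_kernel \<epsilon> z"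
  proof -
    have "gauss_kernel \<epsilon> z = (2 * pi) ^ DIM('a) / E * gauss_density y"
      by (simp add: gauss_kernel_def y_def power_divide E_def)
    then show ?thesis by (simp only: c(2)[symmetric] gd times_divide_eq_left mult.assoc)
  qed
  ultimately show ?thesis by (metis of_real_mult)
qed

lemma integrable_gaussian:
  fixes \<epsilon> :: real assumes "\<epsilon> > 0"
  shows "integrable lborel (\<lambda>\<xi>::'a::euclidean_space. gaussian (\<epsilon> *\<^sub>R \<xi>))"
proof -
  have "integrable lborel (\<lambda>\<xi>::'a. gauss_density (0 + \<epsilon> *\<^sub>R \<xi>))"
    by (rule integrable_lborel_affine) (use assms integrable_gauss_density in auto)
  then have "integrable lborel (\<lambda>\<xi>::'a. sqrt (2 * pi) ^ DIM('a) * gauss_density (0 + \<epsilon> *\<^sub>R \<xi>))"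
    by (rule integrable_mult_right)
  then show ?thesis by (simp add: gauss_density_def)
qed

text \<open>The multiplication formula for the Fourier transform; c is 2 pi or -2 pi in the
  applications. Absolute integrability of both factors justifies the exchange, and the later
  passages between space and frequency go through it.\<close>

lemma fubini_cis:
  fixes f :: "'a::euclidean_space \<Rightarrow> complex" and g :: "'a \<Rightarrow> complex"
  assumes f: "integrable lborel f" and g: "integrable lborel g"
  shows "(LINT x|lborel. f x * (LINT y|lborel. cis (c * (x \<bullet> y)) * g y)) = (LINT y|lborel. g y * (LINT x|lborel. cis (c * (x \<bullet> y)) * f x))"
proof -
  have [measurable]: "f \<in> borel_measurable borel" "g \<in> borel_measurable borel"
    using assms borel_measurable_integrable by fastforce+
  have "integrable (lborel \<Otimes>\<^sub>M lborel) (\<lambda>(x, y). f x * cis (c * (x \<bullet> y)) * g y)"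
  proof (rule lborel_pair.Fubini_integrable)
    show "integrable lborel (\<lambda>x. LINT y|lborel. norm (case (x, y) of (x, y) \<Rightarrow> f x * cis (c * (x \<bullet> y)) * g y))"
      using f by (simp add: norm_mult)
    show "AE x in lborel. integrable lborel (\<lambda>y. case (x, y) of (x, y) \<Rightarrow> f x * cis (c * (x \<bullet> y)) * g y)"
      using g by (auto simp: mult.assoc intro!: integrable_mult_right integrable_cis_mult)
  qed measurable
  from lborel_pair.Fubini_integral[OF this]
  have "(LINT y|lborel. (LINT x|lborel. f x * cis (c * (x \<bullet> y)) * g y)) = (LINT x|lborel. (LINT y|lborel. f x * cis (c * (x \<bullet> y)) * g y))"
    (is ?F) .
  have A: "(LINT y|lborel. f x * cis (c * (x \<bullet> y)) * g y) = f x * (LINT y|lborel. cis (c * (x \<bullet> y)) * g y)" for x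
    by (simp add: mult.assoc)
  have B: "(LINT x|lborel. f x * cis (c * (x \<bullet> y)) * g y) = g y * (LINT x|lborel. cis (c * (x \<bullet> y)) * f x)" for y
    by (subst integral_mult_right_zero[symmetric]) (auto simp: mult_ac intro!: Bochner_Integration.integral_cong)
  show ?thesis using \<open>?F\<close> unfolding A B by (rule sym)
qed

section \<open>Decay of Fourier transforms\<close>

lemma fourier_measurable [measurable]:
  fixes f :: "'a::euclidean_space \<Rightarrow> complex"
  assumes [measurable]: "f \<in> borel_measurable borel" shows "fourier f \<in> borel_measurable borel"
  unfolding fourier_def[abs_def] by measurable

lemma norm_LINT_le:
  fixes f :: "_ \<Rightarrow> 'b::{banach,second_countable_topology}"
  shows "ennreal (norm (LINT x|M. f x)) \<le> (\<integral>\<^sup>+x. ennreal (norm (f x)) \<partial>M)"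
  by (cases "integrable M f") (auto simp: integral_norm_bound_ennreal not_integrable_integral_eq)

lemma norm_fourier_le:
  "ennreal (norm (fourier f \<xi>)) \<le> (\<integral>\<^sup>+x. norm (f x) \<partial>lborel)"
  unfolding fourier_def
  by (rule order_trans[OF norm_LINT_le]) (simp_all add: norm_mult)

text \<open>The exponent 2d is chosen so that (1 + |x|)^(2d) dominates the product of 1 + x_b^2 over
  the d coordinates, whose reciprocal factors into integrable functions on the line.\<close>

lemma integrable_decay:
  fixes f :: "'a::euclidean_space \<Rightarrow> 'b::{banach,second_countable_topology}"
  assumes "f \<in> borel_measurable borel" and le: "\<And>x. norm (f x) \<le> C / (1 + norm x) ^ (2 * DIM('a))"
  shows "integrable lborel f"
proof -
  let ?w = "\<lambda>x::'a. \<Prod>b\<in>Basis. complex_of_real (inverse (1 + (x \<bullet> b)\<^sup>2))"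
  have "integrable lborel (\<lambda>t::real. inverse (1 + t\<^sup>2))"
    using integrable_inverse_1_plus_square by (simp add: set_integrable_def einterval_def)
  then have "integrable lborel ?w"
    by (intro integrable_lborel_prod integrable_of_real)
  then have "integrable lborel (\<lambda>x. C *\<^sub>R norm (?w x))"
    by (intro integrable_scaleR_right integrable_norm)
  then show ?thesis
  proof (rule Bochner_Integration.integrable_bound)
    show "AE x in lborel. norm (f x) \<le> norm (C *\<^sub>R norm (?w x))"
    proof (rule AE_I2)
      fix x :: 'a
      have C: "0 \<le> C" using order_trans[OF norm_ge_zero le[of 0]] by simp
      have "(\<Prod>b\<in>(Basis::'a set). 1 + (x \<bullet> b)\<^sup>2) \<le> (\<Prod>b\<in>(Basis::'a set). (1 + norm x)\<^sup>2)"
      proof (rule prod_mono)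
        fix b :: 'a assume "b \<in> Basis"
        then have "(x \<bullet> b)\<^sup>2 \<le> (norm x)\<^sup>2" by (metis Basis_le_norm power2_abs power_mono abs_ge_zero)
        then show "0 \<le> 1 + (x \<bullet> b)\<^sup>2 \<and> 1 + (x \<bullet> b)\<^sup>2 \<le> (1 + norm x)\<^sup>2"
          by (simp add: power2_sum add_increasing2)
      qed
      also have "\<dots> = (1 + norm x) ^ (2 * DIM('a))" by (simp add: power_mult)
      finally have "(\<Prod>b\<in>(Basis::'a set). 1 + (x \<bullet> b)\<^sup>2) \<le> (1 + norm x) ^ (2 * DIM('a))" .
      moreover have "(\<Prod>b\<in>(Basis::'a set). 1 + (x \<bullet> b)\<^sup>2) > 0" by (intro prod_pos) (auto intro: add_pos_nonneg)
      ultimately have "C / (1 + norm x) ^ (2 * DIM('a)) \<le> C / (\<Prod>b\<in>(Basis::'a set). 1 + (x \<bullet> b)\<^sup>2)"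
        using C by (intro divide_left_mono) (auto intro!: mult_pos_pos zero_less_power add_pos_nonneg)
      also have "\<dots> = C * norm (?w x)"
      proof -
        have "norm (?w x) = (\<Prod>b\<in>Basis. inverse (1 + (x \<bullet> b)\<^sup>2))"
          unfolding prod_norm[symmetric] norm_of_real by (intro prod.cong) (auto intro!: abs_of_nonneg)
        also have "\<dots> = inverse (\<Prod>b\<in>Basis. (1 + (x \<bullet> b)\<^sup>2))"
          using prod_inversef[of "\<lambda>b. 1 + (x \<bullet> b)\<^sup>2" Basis] by (simp only: o_def)
        finally show ?thesis by (simp only: divide_inverse)
      qed
      finally show "norm (f x) \<le> norm (C *\<^sub>R norm (?w x))"
        using le[of x] C by (simp only: real_norm_def real_scaleR_def)
    qed
  qed (use assms in simp)
qed

lemma schwartz_integrable: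
  fixes f :: "'a::euclidean_space \<Rightarrow> complex"
  assumes "schwartz f" shows "integrable lborel f"
proof -
  obtain C where "\<And>x. norm (f x) \<le> C / (1 + norm x) ^ (2 * DIM('a))" using schwartz_decay[OF assms] by metis
  then show ?thesis by (rule integrable_decay[OF schwartz_measurable[OF assms]])
qed

lemma schwartz_bounded:
  assumes "schwartz f" obtains C where "C > 0" "\<And>x. norm (f x) \<le> C"
  using schwartz_decay[OF assms, of 0] by auto

text \<open>The mean value inequality on a segment of length at most one. On such a segment 1 + |y|
  is at least half of 1 + |x|, so the decay of the gradient may be evaluated at the base point at
  the cost of 2^k.\<close>

lemma schwartz_increment:
  fixes f :: "'a::euclidean_space \<Rightarrow> complex"
  assumes f: "schwartz f"
  obtains C where "C \<ge> 0" "\<And>x h. norm h \<le> 1 \<Longrightarrow> norm (f (x + h) - f x) \<le> C * norm h / (1 + norm x) ^ k"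
proof -
  have "\<exists>C>0. \<forall>x. norm (partial_deriv b f x) \<le> C / (1 + norm x) ^ k" if b: "b \<in> Basis" for b
    using schwartz_decay[OF schwartz_partial_deriv[OF f b]] by metis
  then obtain C where C: "\<And>b. b \<in> Basis \<Longrightarrow> C b > 0" "\<And>b x. b \<in> Basis \<Longrightarrow> norm (partial_deriv b f x) \<le> C b / (1 + norm x) ^ k"
    by metis
  define B where "B = (\<Sum>b\<in>Basis. C b)"
  have B: "B \<ge> 0" unfolding B_def by (rule sum_nonneg) (use C(1) less_imp_le in blast)
  have "norm (f (x + h) - f x) \<le> (B * 2 ^ k) * norm h / (1 + norm x) ^ k" if h: "norm h \<le> 1" for x h
  proof -
    let ?S = "closed_segment x (x + h)"
    have "norm (f (x + h) - f x) \<le> (B * 2 ^ k / (1 + norm x) ^ k) * norm (x + h - x)"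
    proof (rule differentiable_bound[OF convex_closed_segment])
      show "(f has_derivative (\<lambda>h. \<Sum>b\<in>Basis. (h \<bullet> b) *\<^sub>R partial_deriv b f y)) (at y within ?S)" for y
        by (rule has_derivative_at_withinI[OF schwartz_has_derivative[OF f]])
      fix y assume y: "y \<in> ?S"
      have "norm (y - x) \<le> norm (x + h - x)" using segment_bound(1)[OF y] by (simp add: norm_minus_commute)
      then have "norm x \<le> norm y + 1" using h norm_triangle_ineq2[of x y] by (simp add: norm_minus_commute)
      then have xy: "1 + norm x \<le> 2 * (1 + norm y)" by (smt (verit) norm_ge_zero)
      have "(1 + norm x) ^ k \<le> 2 ^ k * (1 + norm y) ^ k"
        unfolding power_mult_distrib[symmetric] by (rule power_mono[OF xy]) simp
      moreover have "(1 + norm x) ^ k > 0" "(1 + norm y) ^ k > 0" by (simp_all add: add_pos_nonneg)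
      ultimately have *: "B / (1 + norm y) ^ k \<le> B * 2 ^ k / (1 + norm x) ^ k"
        using B by (simp add: divide_simps mult_left_mono mult.assoc)
      show "onorm (\<lambda>h. \<Sum>b\<in>Basis. (h \<bullet> b) *\<^sub>R partial_deriv b f y) \<le> B * 2 ^ k / (1 + norm x) ^ k"
      proof (rule onorm_le)
        fix v :: 'a
        have "norm (\<Sum>b\<in>Basis. (v \<bullet> b) *\<^sub>R partial_deriv b f y) \<le> (\<Sum>b\<in>Basis. norm v * (C b / (1 + norm y) ^ k))"
        proof (rule sum_norm_le)
          fix b :: 'a assume b: "b \<in> Basis"
          show "norm ((v \<bullet> b) *\<^sub>R partial_deriv b f y) \<le> norm v * (C b / (1 + norm y) ^ k)"
            unfolding norm_scaleR real_norm_def using b by (intro mult_mono Basis_le_norm C(2)) auto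
        qed
        also have "\<dots> = B / (1 + norm y) ^ k * norm v"
          by (simp add: B_def sum_distrib_left[symmetric] sum_divide_distrib[symmetric])
        also have "\<dots> \<le> B * 2 ^ k / (1 + norm x) ^ k * norm v" by (intro mult_right_mono *) simp
        finally show "norm (\<Sum>b\<in>Basis. (v \<bullet> b) *\<^sub>R partial_deriv b f y) \<le> B * 2 ^ k / (1 + norm x) ^ k * norm v" .
      qed
    qed auto
    then show ?thesis by simp
  qed
  then show ?thesis using B by (intro that[of "B * 2 ^ k"]) auto
qed

lemma fourier_translate:
  fixes f :: "'a::euclidean_space \<Rightarrow> complex"
  assumes [measurable]: "f \<in> borel_measurable borel"
  shows "fourier (\<lambda>x. f (x + h)) \<xi> = cis (2 * pi * (h \<bullet> \<xi>)) * fourier f \<xi>"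
proof -
  have "fourier (\<lambda>x. f (x + h)) \<xi> = (LINT x|lborel. cis (- 2 * pi * ((- h + x) \<bullet> \<xi>)) * f x)"
    using integral_lborel_affine[of 1 "\<lambda>x. cis (- 2 * pi * (x \<bullet> \<xi>)) * f (x + h)" "- h"]
    unfolding fourier_def by simp
  also have "\<dots> = (LINT x|lborel. cis (2 * pi * (h \<bullet> \<xi>)) * (cis (- 2 * pi * (x \<bullet> \<xi>)) * f x))"
  proof (intro Bochner_Integration.integral_cong refl)
    fix x
    have "- 2 * pi * ((- h + x) \<bullet> \<xi>) = 2 * pi * (h \<bullet> \<xi>) + - 2 * pi * (x \<bullet> \<xi>)"
      by (simp only: inner_add_left inner_minus_left distrib_left)
    then show "cis (- 2 * pi * ((- h + x) \<bullet> \<xi>)) * f x = cis (2 * pi * (h \<bullet> \<xi>)) * (cis (- 2 * pi * (x \<bullet> \<xi>)) * f x)"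
      by (simp only: cis_mult[symmetric] mult.assoc)
  qed
  finally show ?thesis by (simp add: fourier_def)
qed

text \<open>Difference quotients replace integration by parts: a translation of f is a phase on the
  Fourier side, and the quotient of the phase converges. \<open>schwartz_increment\<close> provides
  the integrable majorant.\<close>

lemma fourier_partial_deriv:
  fixes f :: "'a::euclidean_space \<Rightarrow> complex"
  assumes f: "schwartz f" and b: "b \<in> Basis"
  shows "fourier (partial_deriv b f) \<xi> = \<i> * of_real (2 * pi * (b \<bullet> \<xi>)) * fourier f \<xi>"
proof -
  define h where "h = (\<lambda>n::nat. 1 / real (Suc n))"
  have h: "h n > 0" "h n \<le> 1" "h \<longlonglongrightarrow> 0" for n
    using LIMSEQ_inverse_real_of_nat by (auto simp: h_def inverse_eq_divide)
  define s where "s = (\<lambda>n x. cis (- 2 * pi * (x \<bullet> \<xi>)) * ((f (x + h n *\<^sub>R b) - f x) / of_real (h n)))"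
  note [measurable] = schwartz_measurable[OF f] schwartz_measurable[OF schwartz_partial_deriv[OF f b]]
  obtain C where C: "\<And>x h. norm h \<le> 1 \<Longrightarrow> norm (f (x + h) - f x) \<le> C * norm h / (1 + norm x) ^ (2 * DIM('a))"
    using schwartz_increment[OF f] by metis
  have L: "(\<lambda>n. LINT x|lborel. s n x) \<longlonglongrightarrow> (LINT x|lborel. cis (- 2 * pi * (x \<bullet> \<xi>)) * partial_deriv b f x)"
  proof (rule integral_dominated_convergence[where w = "\<lambda>x. C / (1 + norm x) ^ (2 * DIM('a))"])
    show "integrable lborel (\<lambda>x::'a. C / (1 + norm x) ^ (2 * DIM('a)))"
    proof (rule integrable_decay)
      show "norm (C / (1 + norm x) ^ (2 * DIM('a))) \<le> \<bar>C\<bar> / (1 + norm x) ^ (2 * DIM('a))" for x :: 'a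
        by (simp add: norm_divide)
    qed measurable
    show "AE x in lborel. (\<lambda>n. s n x) \<longlonglongrightarrow> cis (- 2 * pi * (x \<bullet> \<xi>)) * partial_deriv b f x"
    proof (rule AE_I2)
      fix x
      let ?D = "\<lambda>v. \<Sum>c\<in>Basis. (v \<bullet> c) *\<^sub>R partial_deriv c f x"
      have "((\<lambda>y. norm (f y - f x - ?D (y - x)) / norm (y - x)) \<longlongrightarrow> 0) (at x)"
        using schwartz_has_derivative[OF f, of x] by (simp add: has_derivative_iff_norm)
      moreover have "filterlim (\<lambda>n. x + h n *\<^sub>R b) (at x) sequentially"
        unfolding filterlim_at
      proof
        show "((\<lambda>n. x + h n *\<^sub>R b) \<longlongrightarrow> x) sequentially"
          using tendsto_add[OF tendsto_const tendsto_scaleR[OF h(3) tendsto_const], of x b] by simp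
        show "\<forall>\<^sub>F n in sequentially. x + h n *\<^sub>R b \<in> UNIV \<and> x + h n *\<^sub>R b \<noteq> x"
          using h(1) b by (auto simp: less_le)
      qed
      ultimately have "(\<lambda>n. norm (f (x + h n *\<^sub>R b) - f x - ?D (h n *\<^sub>R b)) / norm (h n *\<^sub>R b)) \<longlonglongrightarrow> 0"
        by (auto dest: filterlim_compose)
      moreover have "norm (f (x + h n *\<^sub>R b) - f x - ?D (h n *\<^sub>R b)) / norm (h n *\<^sub>R b) =
          norm ((f (x + h n *\<^sub>R b) - f x) / of_real (h n) - partial_deriv b f x)" for n
      proof -
        have "?D (h n *\<^sub>R b) = h n *\<^sub>R (\<Sum>c\<in>Basis. (b \<bullet> c) *\<^sub>R partial_deriv c f x)"
          by (simp only: scaleR_sum_right inner_scaleR_left scaleR_scaleR)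
        then have "?D (h n *\<^sub>R b) = of_real (h n) * partial_deriv b f x"
          unfolding basis_sum_component[OF b] by (simp only: scaleR_conv_of_real)
        then have "f (x + h n *\<^sub>R b) - f x - ?D (h n *\<^sub>R b) = of_real (h n) * ((f (x + h n *\<^sub>R b) - f x) / of_real (h n) - partial_deriv b f x)"
        proof -
          have "D - of_real (h n) * p = of_real (h n) * (D / of_real (h n) - p)" for D p :: complex
            using h(1)[of n] by (simp add: right_diff_distrib)
          then show ?thesis unfolding \<open>?D (h n *\<^sub>R b) = of_real (h n) * partial_deriv b f x\<close> .
        qed
        then show ?thesis using h(1)[of n] b by (simp add: norm_mult)
      qed
      ultimately have "(\<lambda>n. (f (x + h n *\<^sub>R b) - f x) / of_real (h n) - partial_deriv b f x) \<longlonglongrightarrow> 0"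
        by (simp add: tendsto_norm_zero_iff)
      then have "(\<lambda>n. (f (x + h n *\<^sub>R b) - f x) / of_real (h n)) \<longlonglongrightarrow> partial_deriv b f x"
        using LIM_zero_iff by blast
      then show "(\<lambda>n. s n x) \<longlonglongrightarrow> cis (- 2 * pi * (x \<bullet> \<xi>)) * partial_deriv b f x"
        unfolding s_def by (rule tendsto_mult_left)
    qed
    show "AE x in lborel. norm (s n x) \<le> C / (1 + norm x) ^ (2 * DIM('a))" for n
    proof (rule AE_I2)
      fix x
      have "norm (f (x + h n *\<^sub>R b) - f x) \<le> C * h n / (1 + norm x) ^ (2 * DIM('a))"
        using C[of "h n *\<^sub>R b" x] h(1,2)[of n] b by simp
      then show "norm (s n x) \<le> C / (1 + norm x) ^ (2 * DIM('a))"
        using h(1)[of n] by (simp add: s_def norm_mult norm_divide divide_le_eq)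
    qed
  qed (auto simp: s_def)
  have V: "(LINT x|lborel. s n x) = (cis (2 * pi * (b \<bullet> \<xi>) * h n) - 1) / of_real (h n) * fourier f \<xi>" for n
  proof -
    have i: "integrable lborel (\<lambda>x. cis (- 2 * pi * (x \<bullet> \<xi>)) * f (x + h n *\<^sub>R b))"
      using integrable_lborel_affine[of 1 f "h n *\<^sub>R b"] schwartz_integrable[OF f]
      by (intro integrable_cis_mult) (auto simp: add.commute)
    have i2: "integrable lborel (\<lambda>x. cis (- 2 * pi * (x \<bullet> \<xi>)) * f x)"
      by (intro integrable_cis_mult schwartz_integrable f) auto
    have "s n x = 1 / of_real (h n) * (cis (- 2 * pi * (x \<bullet> \<xi>)) * f (x + h n *\<^sub>R b) - cis (- 2 * pi * (x \<bullet> \<xi>)) * f x)" for x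
      by (simp add: s_def algebra_simps diff_divide_distrib)
    then have "(LINT x|lborel. s n x) = 1 / of_real (h n) * (LINT x|lborel. cis (- 2 * pi * (x \<bullet> \<xi>)) * f (x + h n *\<^sub>R b) - cis (- 2 * pi * (x \<bullet> \<xi>)) * f x)"
      by (simp only: integral_mult_right_zero)
    also have "\<dots> = 1 / of_real (h n) * (fourier (\<lambda>x. f (x + h n *\<^sub>R b)) \<xi> - fourier f \<xi>)"
      by (subst Bochner_Integration.integral_diff[OF i i2]) (simp add: fourier_def)
    also have "\<dots> = (cis (2 * pi * (b \<bullet> \<xi>) * h n) - 1) / of_real (h n) * fourier f \<xi>"
      by (subst fourier_translate) (auto simp: algebra_simps diff_divide_distrib)
    finally show ?thesis .
  qed
  have "(\<lambda>n. (cis (a * h n) - 1) / of_real (h n)) \<longlonglongrightarrow> \<i> * of_real a" for a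
  proof -
    have "norm ((cis (a * h n) - 1) / of_real (h n) - \<i> * of_real a) \<le> a\<^sup>2 * h n" for n
    proof -
      have "norm (cis (a * h n) - (1 + \<i> * of_real (a * h n))) * 2 \<le> (a * h n)\<^sup>2"
        using iexp_approx1[of "a * h n" 1] by (simp add: cis_conv_exp numeral_2_eq_2)
      then have "norm (cis (a * h n) - (1 + \<i> * of_real (a * h n))) \<le> (a * h n)\<^sup>2"
        using norm_ge_zero[of "cis (a * h n) - (1 + \<i> * of_real (a * h n))"] by linarith
      moreover have "cis (a * h n) - (1 + \<i> * of_real (a * h n)) = of_real (h n) * ((cis (a * h n) - 1) / of_real (h n) - \<i> * of_real a)"
      proof -
        have "of_real (h n) * (X / of_real (h n) - \<i> * of_real a) = X - \<i> * of_real (a * h n)" for X :: complex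
          using h(1)[of n] by (simp add: right_diff_distrib mult.left_commute)
        then show ?thesis by simp
      qed
      ultimately have "h n * norm ((cis (a * h n) - 1) / of_real (h n) - \<i> * of_real a) \<le> h n * (a\<^sup>2 * h n)"
        using h(1)[of n] by (simp add: norm_mult power2_eq_square mult_ac)
      then show ?thesis using h(1)[of n] by simp
    qed
    then have "\<forall>\<^sub>F n in sequentially. norm ((cis (a * h n) - 1) / of_real (h n) - \<i> * of_real a) \<le> a\<^sup>2 * h n"
      by (rule always_eventually[OF allI])
    moreover have "(\<lambda>n. a\<^sup>2 * h n) \<longlonglongrightarrow> 0" using tendsto_mult_left[OF h(3), of "a\<^sup>2"] by simp
    ultimately have "(\<lambda>n. (cis (a * h n) - 1) / of_real (h n) - \<i> * of_real a) \<longlonglongrightarrow> 0"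
      by (rule Lim_null_comparison)
    then show ?thesis using LIM_zero_iff by blast
  qed
  then have "(\<lambda>n. (cis (2 * pi * (b \<bullet> \<xi>) * h n) - 1) / of_real (h n) * fourier f \<xi>) \<longlonglongrightarrow> \<i> * of_real (2 * pi * (b \<bullet> \<xi>)) * fourier f \<xi>"
    by (intro tendsto_mult_right)
  with L show ?thesis unfolding fourier_def[of "partial_deriv b f"] V by (rule LIMSEQ_unique)
qed

lemma schwartz_partial_deriv_funpow:
  "schwartz f \<Longrightarrow> b \<in> Basis \<Longrightarrow> schwartz ((partial_deriv b ^^ n) f)"
  by (induction n) (auto intro: schwartz_partial_deriv)

text \<open>Derivatives become powers of the coordinates of \<xi>, and the largest coordinate
  controls |\<xi>|. The bound depends on f through A alone; this gives uniformity in the parameter t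
  in \<open>radial_fourier_decay\<close>.\<close>

lemma fourier_decay_bound:
  fixes f :: "'a::euclidean_space \<Rightarrow> complex"
  assumes f: "schwartz f" and A: "A \<ge> 0"
    and A0: "(\<integral>\<^sup>+x. norm (f x) \<partial>lborel) \<le> ennreal A"
    and An: "\<And>b. b \<in> Basis \<Longrightarrow> (\<integral>\<^sup>+x. norm ((partial_deriv b ^^ n) f x) \<partial>lborel) \<le> ennreal A"
  shows "norm (fourier f \<xi>) \<le> real (Suc DIM('a)) ^ Suc n * A / (1 + norm \<xi>) ^ n"
proof -
  have pw: "fourier ((partial_deriv b ^^ k) f) \<xi> = (\<i> * of_real (2 * pi * (b \<bullet> \<xi>))) ^ k * fourier f \<xi>" if "b \<in> Basis" for k b
  proof (induction k)
    case (Suc k)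
    show ?case
      using fourier_partial_deriv[OF schwartz_partial_deriv_funpow[OF f that, of k] that, of \<xi>] Suc
      by (simp add: mult_ac)
  qed simp
  define F where "F = norm (fourier f \<xi>)"
  have F0: "F \<ge> 0" "F \<le> A"
    using order_trans[OF norm_fourier_le A0, of \<xi>] A by (auto simp: F_def)
  have b1: "\<bar>\<xi> \<bullet> b\<bar> ^ n * F \<le> A" if b: "b \<in> Basis" for b
  proof -
    have "ennreal (norm (fourier ((partial_deriv b ^^ n) f) \<xi>)) \<le> ennreal A"
      by (rule order_trans[OF norm_fourier_le An[OF b]])
    then have "(2 * pi * \<bar>\<xi> \<bullet> b\<bar>) ^ n * F \<le> A"
      using A unfolding pw[OF b] by (simp add: norm_mult norm_power abs_mult F_def inner_commute)
    moreover have "\<bar>\<xi> \<bullet> b\<bar> ^ n \<le> (2 * pi * \<bar>\<xi> \<bullet> b\<bar>) ^ n"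
      using pi_gt3 by (intro power_mono mult_le_cancel_right1[THEN iffD2]) (auto simp: mult_ge1_I)
    ultimately show ?thesis using F0 by (meson mult_right_mono order_trans)
  qed
  \<comment> \<open>Including 1 in the maximum treats bounded \<xi>, where the bound on f itself is
    used, together with large \<xi>; in all cases 1 + |\<xi>| \<le> (d + 1) M.\<close>
  define M where "M = Max (insert 1 ((\<lambda>b. \<bar>\<xi> \<bullet> b\<bar>) ` Basis))"
  have M: "M \<in> insert 1 ((\<lambda>b. \<bar>\<xi> \<bullet> b\<bar>) ` Basis)" unfolding M_def by (rule Max_in) auto
  have M1: "1 \<le> M" and Mb: "\<And>b. b \<in> Basis \<Longrightarrow> \<bar>\<xi> \<bullet> b\<bar> \<le> M" unfolding M_def by (auto intro!: Max_ge simp del: Max_insert)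
  have "M ^ n * F \<le> A" using M F0 b1 by auto
  have "1 + norm \<xi> \<le> real (Suc DIM('a)) * M"
    using norm_le_l1[of \<xi>] sum_bounded_above[of Basis "\<lambda>b. \<bar>\<xi> \<bullet> b\<bar>" M, OF Mb] M1 by (simp add: algebra_simps)
  then have "(1 + norm \<xi>) ^ n \<le> (real (Suc DIM('a)) * M) ^ n" by (intro power_mono) auto
  then have "(1 + norm \<xi>) ^ n * F \<le> real (Suc DIM('a)) ^ n * (M ^ n * F)"
    using F0 by (simp add: power_mult_distrib mult_right_mono flip: mult.assoc)
  also have "\<dots> \<le> real (Suc DIM('a)) ^ n * A" by (intro mult_left_mono \<open>M ^ n * F \<le> A\<close>) auto
  also have "\<dots> \<le> real (Suc DIM('a)) ^ Suc n * A" using A by (intro mult_right_mono power_increasing) auto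
  finally show ?thesis
    unfolding F_def[symmetric] by (simp add: le_divide_eq add_pos_nonneg mult.commute)
qed

lemma schwartz_nn_integral_finite:
  assumes "schwartz f" shows "(\<integral>\<^sup>+x. ennreal (norm (f x)) \<partial>lborel) < \<infinity>"
  using schwartz_integrable[OF assms] by (simp add: integrable_iff_bounded)

lemma schwartz_fourier_decay:
  fixes f :: "'a::euclidean_space \<Rightarrow> complex"
  assumes f: "schwartz f"
  obtains C where "C > 0" "\<And>\<xi>. norm (fourier f \<xi>) \<le> C / (1 + norm \<xi>) ^ n"
proof -
  define A where "A = enn2real ((\<integral>\<^sup>+x. norm (f x) \<partial>lborel) + (\<Sum>b\<in>Basis. \<integral>\<^sup>+x. norm ((partial_deriv b ^^ n) f x) \<partial>lborel))"
  have fin: "(\<integral>\<^sup>+x. norm (f x) \<partial>lborel) + (\<Sum>b\<in>Basis. \<integral>\<^sup>+x. norm ((partial_deriv b ^^ n) f x) \<partial>lborel) < \<infinity>"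
    using schwartz_nn_integral_finite[OF f] schwartz_nn_integral_finite[OF schwartz_partial_deriv_funpow[OF f]]
    by (auto simp: ennreal_add_less_top)
  then have A: "ennreal A = (\<integral>\<^sup>+x. norm (f x) \<partial>lborel) + (\<Sum>b\<in>Basis. \<integral>\<^sup>+x. norm ((partial_deriv b ^^ n) f x) \<partial>lborel)"
    by (auto simp: A_def)
  have "norm (fourier f \<xi>) \<le> (real (Suc DIM('a)) ^ Suc n * A + 1) / (1 + norm \<xi>) ^ n" for \<xi>
  proof -
    have "norm (fourier f \<xi>) \<le> real (Suc DIM('a)) ^ Suc n * A / (1 + norm \<xi>) ^ n"
    proof (rule fourier_decay_bound[OF f])
      show "A \<ge> 0" by (simp add: A_def)
      show "(\<integral>\<^sup>+x. norm (f x) \<partial>lborel) \<le> ennreal A" unfolding A by simp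
      show "(\<integral>\<^sup>+x. norm ((partial_deriv b ^^ n) f x) \<partial>lborel) \<le> ennreal A" if "b \<in> Basis" for b
        unfolding A by (rule order_trans[OF member_le_sum[of b Basis]]) (use that in auto)
    qed
    also have "\<dots> \<le> (real (Suc DIM('a)) ^ Suc n * A + 1) / (1 + norm \<xi>) ^ n"
      by (intro divide_right_mono) auto
    finally show ?thesis .
  qed
  moreover have "real (Suc DIM('a)) ^ Suc n * A + 1 > 0" by (simp add: A_def add_nonneg_pos)
  ultimately show ?thesis using that by blast
qed

text \<open>Dominated convergence with majorant |h|. The measure and the frequency map are general
  so that the statement covers both the Fourier transform and the bilinear integral, whose frequency
  is the sum of two variables.\<close>

lemma continuous_on_LINT_cis:
  fixes h :: "'b \<Rightarrow> complex" and \<theta> :: "'b \<Rightarrow> 'a::euclidean_space"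
  assumes h: "integrable M h" and [measurable]: "\<theta> \<in> borel_measurable M"
  shows "continuous_on UNIV (\<lambda>x. LINT w|M. cis (c * (x \<bullet> \<theta> w)) * h w)"
  unfolding continuous_on_sequentially
proof (intro allI ballI impI, elim conjE, unfold o_def)
  fix X and a :: 'a assume X: "X \<longlonglongrightarrow> a"
  have [measurable]: "h \<in> borel_measurable M" using h by auto
  show "(\<lambda>n. LINT w|M. cis (c * (X n \<bullet> \<theta> w)) * h w) \<longlonglongrightarrow> (LINT w|M. cis (c * (a \<bullet> \<theta> w)) * h w)"
  proof (rule integral_dominated_convergence[where w = "\<lambda>w. norm (h w)"])
    show "AE w in M. (\<lambda>n. cis (c * (X n \<bullet> \<theta> w)) * h w) \<longlonglongrightarrow> cis (c * (a \<bullet> \<theta> w)) * h w"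
      by (intro AE_I2 tendsto_intros X)
  qed (use h in \<open>auto simp: norm_mult\<close>)
qed

lemma continuous_fourier:
  fixes f :: "'a::euclidean_space \<Rightarrow> complex"
  assumes "integrable lborel f" shows "continuous_on UNIV (fourier f)"
  using continuous_on_LINT_cis[OF assms, of "\<lambda>x. x" "- 2 * pi"]
  by (simp add: fourier_def[abs_def] inner_commute)

section \<open>Bessel's inequality and Fourier inversion\<close>

lemma cnj_measurable [measurable (raw)]:
  "f \<in> borel_measurable M \<Longrightarrow> (\<lambda>x. cnj (f x)) \<in> borel_measurable M"
  by (rule measurable_compose[OF _ borel_measurable_continuous_onI]) (auto intro: continuous_intros)

lemma cnj_fourier: "cnj (fourier f \<xi>) = (LINT x|lborel. cis (2 * pi * (x \<bullet> \<xi>)) * cnj (f x))"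
  unfolding fourier_def by (subst Bochner_Integration.integral_cnj[symmetric]) (simp add: cis_cnj)

lemma ennreal_half_add: "X / 2 + X / 2 = (X::ennreal)"
proof (cases X)
  case (real r)
  then have "X / 2 = ennreal (r / 2)" using divide_ennreal[of r 2] by simp
  then show ?thesis using real by (simp flip: ennreal_plus)
qed (simp add: ennreal_top_divide)

text \<open>The Gaussian weight makes the integral over \<open>\<xi>\<close> absolutely convergent; Schur's test for the
  resulting nonnegative kernel of mass one gives the bound uniformly in \<open>\<epsilon>\<close>.\<close>

lemma bessel_gaussian:
  fixes f :: "'a::euclidean_space \<Rightarrow> complex"
  assumes f: "integrable lborel f" and e: "\<epsilon> > 0"
  shows "(\<integral>\<^sup>+\<xi>. ennreal ((norm (fourier f \<xi>))\<^sup>2 * gaussian (\<epsilon> *\<^sub>R \<xi>)) \<partial>lborel) \<le> (\<integral>\<^sup>+x. ennreal ((norm (f x))\<^sup>2) \<partial>lborel)"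
proof -
  have fm[measurable]: "f \<in> borel_measurable borel" using borel_measurable_integrable[OF f] by simp
  have g0: "gaussian (\<epsilon> *\<^sub>R \<xi>) \<ge> 0" for \<xi> :: 'a by (simp add: gaussian_def)
  have gi: "integrable lborel (\<lambda>\<xi>::'a. complex_of_real (gaussian (\<epsilon> *\<^sub>R \<xi>)))"
    using integrable_gaussian[OF e] by (rule integrable_of_real)
  define B where "B = enn2real (\<integral>\<^sup>+x. norm (f x) \<partial>lborel)"
  have B: "norm (fourier f \<xi>) \<le> B" for \<xi>
  proof -
    have "(\<integral>\<^sup>+x. norm (f x) \<partial>lborel) = ennreal B"
      using f by (simp add: B_def integrable_iff_bounded)
    then have "ennreal (norm (fourier f \<xi>)) \<le> ennreal B" using norm_fourier_le[of f \<xi>] by simp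
    moreover have "B \<ge> 0" by (simp add: B_def)
    ultimately show ?thesis by simp
  qed
  define h where "h = (\<lambda>(x::'a) \<xi>. cis (- 2 * pi * (x \<bullet> \<xi>)) * complex_of_real (gaussian (\<epsilon> *\<^sub>R \<xi>)))"
  have hi: "integrable lborel (h x)" for x
    unfolding h_def by (intro integrable_cis_mult gi) auto
  define F where "F = (\<lambda>\<xi>. cnj (fourier f \<xi>) * complex_of_real (gaussian (\<epsilon> *\<^sub>R \<xi>)))"
  have Fi: "integrable lborel F"
  proof (rule Bochner_Integration.integrable_bound)
    show "integrable lborel (\<lambda>\<xi>::'a. B * norm (complex_of_real (gaussian (\<epsilon> *\<^sub>R \<xi>))))"
      by (intro integrable_mult_right integrable_norm gi)
    show "AE \<xi> in lborel. norm (F \<xi>) \<le> norm (B * norm (complex_of_real (gaussian (\<epsilon> *\<^sub>R \<xi>))))"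
      using B order_trans[OF norm_ge_zero B[of 0]] by (auto simp: F_def norm_mult abs_mult intro!: mult_right_mono)
    show "F \<in> borel_measurable lborel" unfolding F_def by measurable
  qed
  \<comment> \<open>Expanding the conjugate transform and integrating in \<xi> first leaves the
    Gaussian kernel in x - y.\<close>
  have inner: "(LINT \<xi>|lborel. cis (- 2 * pi * (x \<bullet> \<xi>)) * F \<xi>) = (LINT y|lborel. cnj (f y) * complex_of_real (gauss_kernel \<epsilon> (x - y)))" for x
  proof -
    have "(LINT \<xi>|lborel. cis (- 2 * pi * (x \<bullet> \<xi>)) * F \<xi>) = (LINT \<xi>|lborel. h x \<xi> * (LINT y|lborel. cis (2 * pi * (\<xi> \<bullet> y)) * cnj (f y)))"
      unfolding F_def h_def cnj_fourier by (simp add: mult_ac inner_commute)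
    also have "\<dots> = (LINT y|lborel. cnj (f y) * (LINT \<xi>|lborel. cis (2 * pi * (\<xi> \<bullet> y)) * h x \<xi>))"
      by (rule fubini_cis[OF hi]) (use f in simp)
    also have "(\<lambda>y. LINT \<xi>|lborel. cis (2 * pi * (\<xi> \<bullet> y)) * h x \<xi>) = (\<lambda>y. complex_of_real (gauss_kernel \<epsilon> (x - y)))"
    proof
      fix y
      have "cis (2 * pi * (\<xi> \<bullet> y)) * h x \<xi> = cis (2 * pi * ((y - x) \<bullet> \<xi>)) * complex_of_real (gaussian (\<epsilon> *\<^sub>R \<xi>))" for \<xi>
      proof -
        have "2 * pi * ((y - x) \<bullet> \<xi>) = 2 * pi * (\<xi> \<bullet> y) + - 2 * pi * (x \<bullet> \<xi>)"
          by (simp add: inner_diff_left inner_commute[of \<xi>] right_diff_distrib)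
        then show ?thesis by (simp only: h_def cis_mult[symmetric] mult.assoc)
      qed
      then show "(LINT \<xi>|lborel. cis (2 * pi * (\<xi> \<bullet> y)) * h x \<xi>) = complex_of_real (gauss_kernel \<epsilon> (x - y))"
        using gaussian_fourier[OF e, of "y - x"] gauss_kernel_minus[of \<epsilon> "x - y"]
        by (simp only: minus_diff_eq)
    qed
    finally show ?thesis .
  qed
  have "(LINT \<xi>|lborel. F \<xi> * (LINT x|lborel. cis (- 2 * pi * (\<xi> \<bullet> x)) * f x)) = (LINT x|lborel. f x * (LINT \<xi>|lborel. cis (- 2 * pi * (\<xi> \<bullet> x)) * F \<xi>))"
    by (rule fubini_cis[OF Fi f])
  also have "\<dots> = (LINT x|lborel. f x * (LINT y|lborel. cnj (f y) * complex_of_real (gauss_kernel \<epsilon> (x - y))))"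
    using inner by (simp add: inner_commute)
  also have "(\<lambda>\<xi>. F \<xi> * (LINT x|lborel. cis (- 2 * pi * (\<xi> \<bullet> x)) * f x)) = (\<lambda>\<xi>. complex_of_real ((norm (fourier f \<xi>))\<^sup>2 * gaussian (\<epsilon> *\<^sub>R \<xi>)))"
  proof
    fix \<xi>
    have "(LINT x|lborel. cis (- 2 * pi * (\<xi> \<bullet> x)) * f x) = fourier f \<xi>" by (simp add: fourier_def inner_commute)
    then show "F \<xi> * (LINT x|lborel. cis (- 2 * pi * (\<xi> \<bullet> x)) * f x) = complex_of_real ((norm (fourier f \<xi>))\<^sup>2 * gaussian (\<epsilon> *\<^sub>R \<xi>))"
      unfolding F_def by (simp only: of_real_mult complex_norm_square mult_ac)
  qed
  finally have eq: "complex_of_real (LINT \<xi>|lborel. (norm (fourier f \<xi>))\<^sup>2 * gaussian (\<epsilon> *\<^sub>R \<xi>)) =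
      (LINT x|lborel. f x * (LINT y|lborel. cnj (f y) * complex_of_real (gauss_kernel \<epsilon> (x - y))))"
    unfolding integral_complex_of_real .
  have li: "integrable lborel (\<lambda>\<xi>. (norm (fourier f \<xi>))\<^sup>2 * gaussian (\<epsilon> *\<^sub>R \<xi>))"
  proof (rule Bochner_Integration.integrable_bound)
    show "integrable lborel (\<lambda>\<xi>::'a. B\<^sup>2 * norm (complex_of_real (gaussian (\<epsilon> *\<^sub>R \<xi>))))"
      by (intro integrable_mult_right integrable_norm gi)
    show "AE \<xi> in lborel. norm ((norm (fourier f \<xi>))\<^sup>2 * gaussian (\<epsilon> *\<^sub>R \<xi>)) \<le> norm (B\<^sup>2 * norm (complex_of_real (gaussian (\<epsilon> *\<^sub>R \<xi>))))"
      using B by (auto simp: abs_mult intro!: mult_right_mono power_mono)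
    show "(\<lambda>\<xi>. (norm (fourier f \<xi>))\<^sup>2 * gaussian (\<epsilon> *\<^sub>R \<xi>)) \<in> borel_measurable lborel" by measurable
  qed
  let ?K = "\<lambda>x y. ennreal (gauss_kernel \<epsilon> (x - y))"
  let ?n = "\<lambda>x. ennreal ((norm (f x))\<^sup>2)"
  have K0: "gauss_kernel \<epsilon> z \<ge> 0" for z :: 'a by (rule gauss_kernel_nonneg[OF e])
  have "(\<integral>\<^sup>+\<xi>. ennreal ((norm (fourier f \<xi>))\<^sup>2 * gaussian (\<epsilon> *\<^sub>R \<xi>)) \<partial>lborel) = ennreal (LINT \<xi>|lborel. (norm (fourier f \<xi>))\<^sup>2 * gaussian (\<epsilon> *\<^sub>R \<xi>))"
    by (rule nn_integral_eq_integral[OF li]) (use g0 in auto)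
  also have "\<dots> \<le> ennreal (norm (complex_of_real (LINT \<xi>|lborel. (norm (fourier f \<xi>))\<^sup>2 * gaussian (\<epsilon> *\<^sub>R \<xi>))))"
    unfolding norm_of_real by (rule ennreal_leI) simp
  also have "\<dots> \<le> (\<integral>\<^sup>+x. ennreal (norm (f x * (LINT y|lborel. cnj (f y) * complex_of_real (gauss_kernel \<epsilon> (x - y))))) \<partial>lborel)"
    unfolding eq by (rule norm_LINT_le)
  \<comment> \<open>The product |f(x)| |f(y)| is at most half the sum of the squares; each half is
    then integrated against a kernel of mass one in the other variable.\<close>
  also have "\<dots> \<le> (\<integral>\<^sup>+x. (\<integral>\<^sup>+y. ?n x * (?K x y / 2) + ?n y * (?K x y / 2) \<partial>lborel) \<partial>lborel)"
  proof (rule nn_integral_mono)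
    fix x
    have "ennreal (norm (f x * (LINT y|lborel. cnj (f y) * complex_of_real (gauss_kernel \<epsilon> (x - y)))))
       \<le> ennreal (norm (f x)) * (\<integral>\<^sup>+y. ennreal (norm (cnj (f y) * complex_of_real (gauss_kernel \<epsilon> (x - y)))) \<partial>lborel)"
      unfolding norm_mult[of "f x"] by (subst ennreal_mult) (auto intro!: mult_left_mono norm_LINT_le simp del: norm_mult)
    also have "\<dots> = (\<integral>\<^sup>+y. ennreal (norm (f x)) * ennreal (norm (cnj (f y) * complex_of_real (gauss_kernel \<epsilon> (x - y)))) \<partial>lborel)"
      by (rule nn_integral_cmult[symmetric]) measurable
    also have "\<dots> \<le> (\<integral>\<^sup>+y. ?n x * (?K x y / 2) + ?n y * (?K x y / 2) \<partial>lborel)"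
    proof (rule nn_integral_mono)
      fix y
      have "norm (f x) * (norm (f y) * gauss_kernel \<epsilon> (x - y)) \<le> ((norm (f x))\<^sup>2 + (norm (f y))\<^sup>2) * (gauss_kernel \<epsilon> (x - y) / 2)"
        using mult_right_mono[OF sum_squares_bound[of "norm (f x)" "norm (f y)"], of "gauss_kernel \<epsilon> (x - y) / 2"] K0[of "x - y"]
        by (simp add: mult_ac)
      then have "ennreal (norm (f x) * (norm (f y) * gauss_kernel \<epsilon> (x - y))) \<le> ennreal (((norm (f x))\<^sup>2 + (norm (f y))\<^sup>2) * (gauss_kernel \<epsilon> (x - y) / 2))"
        by (rule ennreal_leI)
      then show "ennreal (norm (f x)) * ennreal (norm (cnj (f y) * complex_of_real (gauss_kernel \<epsilon> (x - y)))) \<le> ?n x * (?K x y / 2) + ?n y * (?K x y / 2)"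
        using K0[of "x - y"] divide_ennreal[of "gauss_kernel \<epsilon> (x - y)" 2]
        by (simp add: norm_mult ennreal_mult[symmetric] ennreal_plus[symmetric] distrib_right del: ennreal_plus)
    qed
    finally show "ennreal (norm (f x * (LINT y|lborel. cnj (f y) * complex_of_real (gauss_kernel \<epsilon> (x - y)))))
        \<le> (\<integral>\<^sup>+y. ?n x * (?K x y / 2) + ?n y * (?K x y / 2) \<partial>lborel)" .
  qed
  also have "\<dots> = (\<integral>\<^sup>+x. (\<integral>\<^sup>+y. ?n x * (?K x y / 2) \<partial>lborel) + (\<integral>\<^sup>+y. ?n y * (?K x y / 2) \<partial>lborel) \<partial>lborel)"
    by (intro nn_integral_cong nn_integral_add) measurable
  also have "\<dots> = (\<integral>\<^sup>+x. (\<integral>\<^sup>+y. ?n x * (?K x y / 2) \<partial>lborel) \<partial>lborel) + (\<integral>\<^sup>+x. (\<integral>\<^sup>+y. ?n y * (?K x y / 2) \<partial>lborel) \<partial>lborel)"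
    by (rule nn_integral_add) measurable
  also have "(\<integral>\<^sup>+x. (\<integral>\<^sup>+y. ?n y * (?K x y / 2) \<partial>lborel) \<partial>lborel) = (\<integral>\<^sup>+y. (\<integral>\<^sup>+x. ?n y * (?K x y / 2) \<partial>lborel) \<partial>lborel)"
    by (rule lborel_pair.Fubini') measurable
  also have "(\<lambda>y. \<integral>\<^sup>+x. ?n y * (?K x y / 2) \<partial>lborel) = (\<lambda>y. ?n y / 2)"
  proof
    fix y :: 'a
    have "(\<integral>\<^sup>+x. ?K x y \<partial>lborel) = (\<integral>\<^sup>+x. ?K y x \<partial>lborel)"
      by (intro nn_integral_cong) (metis gauss_kernel_minus minus_diff_eq)
    then show "(\<integral>\<^sup>+x. ?n y * (?K x y / 2) \<partial>lborel) = ?n y / 2" using nn_integral_gauss_kernel[OF e, of y]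
      by (simp add: nn_integral_cmult nn_integral_divide ennreal_times_divide)
  qed
  also have "(\<lambda>x. \<integral>\<^sup>+y. ?n x * (?K x y / 2) \<partial>lborel) = (\<lambda>x. ?n x / 2)"
  proof
    fix x :: 'a
    show "(\<integral>\<^sup>+y. ?n x * (?K x y / 2) \<partial>lborel) = ?n x / 2"
      using nn_integral_gauss_kernel[OF e, of x]
      by (simp add: nn_integral_cmult nn_integral_divide ennreal_times_divide)
  qed
  also have "(\<integral>\<^sup>+x. ?n x / 2 \<partial>lborel) + (\<integral>\<^sup>+x. ?n x / 2 \<partial>lborel) = (\<integral>\<^sup>+x. ?n x \<partial>lborel)"
    by (simp add: nn_integral_divide ennreal_half_add)
  finally show ?thesis .
qed

text \<open>Fatou's lemma removes the Gaussian weight of \<open>bessel_gaussian\<close> along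
  \<epsilon> = 1/(n+1).\<close>

lemma bessel_inequality:
  fixes f :: "'a::euclidean_space \<Rightarrow> complex"
  assumes f: "integrable lborel f"
  shows "(\<integral>\<^sup>+\<xi>. ennreal ((norm (fourier f \<xi>))\<^sup>2) \<partial>lborel) \<le> (\<integral>\<^sup>+x. ennreal ((norm (f x))\<^sup>2) \<partial>lborel)"
proof -
  have [measurable]: "f \<in> borel_measurable borel" using borel_measurable_integrable[OF f] by simp
  define e where "e = (\<lambda>n::nat. 1 / real (Suc n))"
  have e: "e n > 0" "e \<longlonglongrightarrow> 0" for n
    using LIMSEQ_inverse_real_of_nat by (auto simp: e_def inverse_eq_divide)
  have "(\<lambda>n. ennreal ((norm (fourier f \<xi>))\<^sup>2 * gaussian (e n *\<^sub>R \<xi>))) \<longlonglongrightarrow> ennreal ((norm (fourier f \<xi>))\<^sup>2)" for \<xi>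
  proof -
    have "(\<lambda>n. (norm (fourier f \<xi>))\<^sup>2 * gaussian (e n *\<^sub>R \<xi>)) \<longlonglongrightarrow> (norm (fourier f \<xi>))\<^sup>2 * exp (- (norm (0 *\<^sub>R \<xi>))\<^sup>2 / 2)"
      unfolding gaussian_def by (intro tendsto_intros e) simp
    then show ?thesis by (intro tendsto_ennrealI) simp
  qed
  then have "(\<integral>\<^sup>+\<xi>. ennreal ((norm (fourier f \<xi>))\<^sup>2) \<partial>lborel) = (\<integral>\<^sup>+\<xi>. liminf (\<lambda>n. ennreal ((norm (fourier f \<xi>))\<^sup>2 * gaussian (e n *\<^sub>R \<xi>))) \<partial>lborel)"
    by (intro nn_integral_cong lim_imp_Liminf[symmetric]) auto
  also have "\<dots> \<le> liminf (\<lambda>n. \<integral>\<^sup>+\<xi>. ennreal ((norm (fourier f \<xi>))\<^sup>2 * gaussian (e n *\<^sub>R \<xi>)) \<partial>lborel)"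
    by (rule nn_integral_liminf) measurable
  also have "\<dots> \<le> limsup (\<lambda>n. \<integral>\<^sup>+\<xi>. ennreal ((norm (fourier f \<xi>))\<^sup>2 * gaussian (e n *\<^sub>R \<xi>)) \<partial>lborel)"
    by (rule Liminf_le_Limsup) simp
  also have "\<dots> \<le> (\<integral>\<^sup>+x. ennreal ((norm (f x))\<^sup>2) \<partial>lborel)"
    by (rule Limsup_bounded) (use bessel_gaussian[OF f e(1)] in auto)
  finally show ?thesis .
qed

text \<open>The integral with a Gaussian weight is evaluated in two ways. As the weight tends to 1,
  dominated convergence gives the inversion integral; by the multiplication formula the same
  quantity is an average of f over points x - (\<epsilon> / 2 pi) v with v distributed by
  \<open>gauss_density\<close>, which tends to f(x) since f is continuous and bounded.\<close>

lemma fourier_inversion: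
  fixes f :: "'a::euclidean_space \<Rightarrow> complex"
  assumes f: "integrable lborel f" and cf: "continuous_on UNIV f" and bf: "\<And>x. norm (f x) \<le> B"
    and ff: "integrable lborel (fourier f)"
  shows "(LINT \<xi>|lborel. cis (2 * pi * (x \<bullet> \<xi>)) * fourier f \<xi>) = f x"
proof -
  have fm[measurable]: "f \<in> borel_measurable borel" using borel_measurable_integrable[OF f] by simp
  define e where "e = (\<lambda>n::nat. 1 / real (Suc n))"
  have e: "e n > 0" "e \<longlonglongrightarrow> 0" for n
    using LIMSEQ_inverse_real_of_nat by (auto simp: e_def inverse_eq_divide)
  let ?s = "\<lambda>n \<xi>. cis (2 * pi * (x \<bullet> \<xi>)) * complex_of_real (gaussian (e n *\<^sub>R \<xi>)) * fourier f \<xi>"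
  have lim1: "(\<lambda>n. LINT \<xi>|lborel. ?s n \<xi>) \<longlonglongrightarrow> (LINT \<xi>|lborel. cis (2 * pi * (x \<bullet> \<xi>)) * fourier f \<xi>)"
  proof (rule integral_dominated_convergence[where w = "\<lambda>\<xi>. norm (fourier f \<xi>)"])
    show "AE \<xi> in lborel. (\<lambda>n. ?s n \<xi>) \<longlonglongrightarrow> cis (2 * pi * (x \<bullet> \<xi>)) * fourier f \<xi>"
    proof (rule AE_I2)
      fix \<xi> :: 'a
      have "(\<lambda>n. cis (2 * pi * (x \<bullet> \<xi>)) * complex_of_real (gaussian (e n *\<^sub>R \<xi>)) * fourier f \<xi>) \<longlonglongrightarrow>
        cis (2 * pi * (x \<bullet> \<xi>)) * complex_of_real (exp (- (norm (0 *\<^sub>R \<xi>))\<^sup>2 / 2)) * fourier f \<xi>"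
        unfolding gaussian_def by (intro tendsto_intros e) simp
      then show "(\<lambda>n. ?s n \<xi>) \<longlonglongrightarrow> cis (2 * pi * (x \<bullet> \<xi>)) * fourier f \<xi>" by simp
    qed
    show "AE \<xi> in lborel. norm (?s n \<xi>) \<le> norm (fourier f \<xi>)" for n
      by (rule AE_I2) (simp add: norm_mult gaussian_def mult_left_le_one_le)
  qed (use ff in auto)
  have val: "(LINT \<xi>|lborel. ?s n \<xi>) = (LINT v|lborel. complex_of_real (gauss_density v) * f (x + (- (e n / (2 * pi))) *\<^sub>R v))" for n
  proof -
    let ?h = "\<lambda>\<xi>. cis (2 * pi * (x \<bullet> \<xi>)) * complex_of_real (gaussian (e n *\<^sub>R \<xi>))"
    have hi: "integrable lborel ?h"
      by (intro integrable_cis_mult integrable_of_real integrable_gaussian e) auto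
    have "(LINT \<xi>|lborel. ?s n \<xi>) = (LINT \<xi>|lborel. ?h \<xi> * (LINT y|lborel. cis (- 2 * pi * (\<xi> \<bullet> y)) * f y))"
      by (simp add: fourier_def inner_commute)
    also have "\<dots> = (LINT y|lborel. f y * (LINT \<xi>|lborel. cis (- 2 * pi * (\<xi> \<bullet> y)) * ?h \<xi>))"
      by (rule fubini_cis[OF hi f])
    also have "(\<lambda>y. LINT \<xi>|lborel. cis (- 2 * pi * (\<xi> \<bullet> y)) * ?h \<xi>) = (\<lambda>y. complex_of_real (gauss_kernel (e n) (x - y)))"
    proof
      fix y
      have "cis (- 2 * pi * (\<xi> \<bullet> y)) * ?h \<xi> = cis (2 * pi * ((x - y) \<bullet> \<xi>)) * complex_of_real (gaussian (e n *\<^sub>R \<xi>))" for \<xi>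
      proof -
        have "2 * pi * ((x - y) \<bullet> \<xi>) = - 2 * pi * (\<xi> \<bullet> y) + 2 * pi * (x \<bullet> \<xi>)"
          by (simp add: inner_diff_left inner_commute[of \<xi>] right_diff_distrib)
        then show ?thesis by (simp only: cis_mult[symmetric] mult.assoc)
      qed
      then show "(LINT \<xi>|lborel. cis (- 2 * pi * (\<xi> \<bullet> y)) * ?h \<xi>) = complex_of_real (gauss_kernel (e n) (x - y))"
        using gaussian_fourier[OF e(1)[of n], of "x - y"] by (simp only:)
    qed
    also have "(LINT y|lborel. f y * complex_of_real (gauss_kernel (e n) (x - y))) =
      \<bar>- (e n / (2 * pi))\<bar> ^ DIM('a) *\<^sub>R (LINT v|lborel. f (x + (- (e n / (2 * pi))) *\<^sub>R v) * complex_of_real (gauss_kernel (e n) (x - (x + (- (e n / (2 * pi))) *\<^sub>R v))))"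
      by (rule integral_lborel_affine) (use e(1)[of n] in auto)
    also have "\<dots> = (LINT v|lborel. complex_of_real (gauss_density v) * f (x + (- (e n / (2 * pi))) *\<^sub>R v))"
    proof (subst integral_scaleR_right[symmetric], intro disjI2 Bochner_Integration.integral_cong refl)
      fix v :: 'a
      have "gauss_kernel (e n) (x - (x + (- (e n / (2 * pi))) *\<^sub>R v)) = (2 * pi / e n) ^ DIM('a) * gauss_density v"
        using e(1)[of n] by (simp add: gauss_kernel_def)
      moreover have "\<bar>- (e n / (2 * pi))\<bar> ^ DIM('a) * (2 * pi / e n) ^ DIM('a) = 1"
        using e(1)[of n] by (simp flip: power_mult_distrib)
      then have "complex_of_real (\<bar>- (e n / (2 * pi))\<bar> ^ DIM('a)) * complex_of_real ((2 * pi / e n) ^ DIM('a)) = 1"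
        by (metis of_real_1 of_real_mult)
      ultimately show "\<bar>- (e n / (2 * pi))\<bar> ^ DIM('a) *\<^sub>R (f (x + (- (e n / (2 * pi))) *\<^sub>R v) * complex_of_real (gauss_kernel (e n) (x - (x + (- (e n / (2 * pi))) *\<^sub>R v))))
          = complex_of_real (gauss_density v) * f (x + (- (e n / (2 * pi))) *\<^sub>R v)"
        unfolding scaleR_conv_of_real by (simp only: of_real_mult mult_ac) (simp only: mult.assoc[symmetric] mult_1)
    qed
    finally show ?thesis .
  qed
  have lim2: "(\<lambda>n. LINT v|lborel. complex_of_real (gauss_density v) * f (x + (- (e n / (2 * pi))) *\<^sub>R v)) \<longlonglongrightarrow>
      (LINT v|lborel. complex_of_real (gauss_density (v::'a)) * f x)"
  proof (rule integral_dominated_convergence[where w = "\<lambda>v. B * gauss_density v"])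
    show "AE v in lborel. (\<lambda>n. complex_of_real (gauss_density v) * f (x + (- (e n / (2 * pi))) *\<^sub>R v)) \<longlonglongrightarrow> complex_of_real (gauss_density v) * f x"
    proof (rule AE_I2)
      fix v :: 'a
      have "(\<lambda>n. x + (- (e n / (2 * pi))) *\<^sub>R v) \<longlonglongrightarrow> x + (- (0 / (2 * pi))) *\<^sub>R v"
        by (intro tendsto_intros e) auto
      then have "(\<lambda>n. x + (- (e n / (2 * pi))) *\<^sub>R v) \<longlonglongrightarrow> x" by simp
      then have "(\<lambda>n. f (x + (- (e n / (2 * pi))) *\<^sub>R v)) \<longlonglongrightarrow> f x"
        using cf by (auto simp: continuous_on_eq_continuous_at intro: isCont_tendsto_compose)
      then show "(\<lambda>n. complex_of_real (gauss_density v) * f (x + (- (e n / (2 * pi))) *\<^sub>R v)) \<longlonglongrightarrow> complex_of_real (gauss_density v) * f x"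
        by (rule tendsto_mult_left)
    qed
    show "AE v in lborel. norm (complex_of_real (gauss_density v) * f (x + (- (e n / (2 * pi))) *\<^sub>R v)) \<le> B * gauss_density v" for n
      by (rule AE_I2) (use bf in \<open>auto simp: norm_mult gauss_density_nonneg mult.commute[of B] intro!: mult_left_mono\<close>)
  qed (auto intro: integrable_gauss_density)
  have one: "(LINT v|lborel. complex_of_real (gauss_density (v::'a)) * f x) = f x"
    using integral_gauss_density[where 'a='a] by simp
  have "(\<lambda>n. LINT \<xi>|lborel. ?s n \<xi>) \<longlonglongrightarrow> f x" using lim2 unfolding val one .
  with lim1 show ?thesis by (rule LIMSEQ_unique)
qed

section \<open>Fourier multipliers\<close>

lemma multiplier_op_eq_fourier: "multiplier_op m f x = fourier (\<lambda>\<xi>. m \<xi> * fourier f \<xi>) (- x)"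
  by (simp add: multiplier_op_def fourier_def inner_commute mult.assoc)

lemma multiplier_op_conv:
  fixes f :: "'a::euclidean_space \<Rightarrow> complex"
  assumes m: "integrable lborel m" and f: "integrable lborel f"
  shows "multiplier_op m f x = (LINT u|lborel. fourier m (- u) * f (x - u))"
proof -
  have [measurable]: "f \<in> borel_measurable borel" "m \<in> borel_measurable borel"
    using borel_measurable_integrable[OF f] borel_measurable_integrable[OF m] by simp_all
  let ?h = "\<lambda>\<xi>. cis (2 * pi * (x \<bullet> \<xi>)) * m \<xi>"
  have hi: "integrable lborel ?h" by (intro integrable_cis_mult m) auto
  have "multiplier_op m f x = (LINT \<xi>|lborel. ?h \<xi> * (LINT y|lborel. cis (- 2 * pi * (\<xi> \<bullet> y)) * f y))"
    unfolding multiplier_op_def fourier_def[of f] by (simp add: inner_commute)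
  also have "\<dots> = (LINT y|lborel. f y * (LINT \<xi>|lborel. cis (- 2 * pi * (\<xi> \<bullet> y)) * ?h \<xi>))"
    by (rule fubini_cis[OF hi f])
  also have "(\<lambda>y. LINT \<xi>|lborel. cis (- 2 * pi * (\<xi> \<bullet> y)) * ?h \<xi>) = (\<lambda>y. fourier m (y - x))"
    unfolding fourier_def
  proof (intro ext Bochner_Integration.integral_cong refl)
    fix y \<xi>
    have "- 2 * pi * (\<xi> \<bullet> (y - x)) = - 2 * pi * (\<xi> \<bullet> y) + 2 * pi * (x \<bullet> \<xi>)"
      by (simp add: inner_diff_right inner_commute[of x] right_diff_distrib)
    then show "cis (- 2 * pi * (\<xi> \<bullet> y)) * ?h \<xi> = cis (- 2 * pi * (\<xi> \<bullet> (y - x))) * m \<xi>"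
      by (simp only: cis_mult[symmetric] mult.assoc)
  qed
  also have "(LINT y|lborel. f y * fourier m (y - x)) = \<bar>-1\<bar> ^ DIM('a) *\<^sub>R (LINT u|lborel. f (x + (-1) *\<^sub>R u) * fourier m (x + (-1) *\<^sub>R u - x))"
    by (rule integral_lborel_affine) auto
  finally show ?thesis by (simp add: mult.commute)
qed

lemma multiplier_op_bessel:
  fixes f :: "'a::euclidean_space \<Rightarrow> complex"
  assumes mf: "integrable lborel (\<lambda>\<xi>. m \<xi> * fourier f \<xi>)"
  shows "(\<integral>\<^sup>+x. ennreal ((norm (multiplier_op m f x))\<^sup>2) \<partial>lborel) \<le> (\<integral>\<^sup>+\<xi>. ennreal ((norm (m \<xi> * fourier f \<xi>))\<^sup>2) \<partial>lborel)"
proof -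
  have [measurable]: "(\<lambda>\<xi>. m \<xi> * fourier f \<xi>) \<in> borel_measurable borel"
    using borel_measurable_integrable[OF mf] by simp
  have "(\<integral>\<^sup>+x. ennreal ((norm (multiplier_op m f x))\<^sup>2) \<partial>lborel) = (\<integral>\<^sup>+x. ennreal ((norm (fourier (\<lambda>\<xi>. m \<xi> * fourier f \<xi>) x))\<^sup>2) \<partial>lborel)"
    unfolding multiplier_op_eq_fourier
    by (subst nn_integral_lborel_affine[of _ "-1" 0]) auto
  also have "\<dots> \<le> (\<integral>\<^sup>+\<xi>. ennreal ((norm (m \<xi> * fourier f \<xi>))\<^sup>2) \<partial>lborel)"
    by (rule bessel_inequality[OF mf])
  finally show ?thesis .
qed

text \<open>A multiplier operator is a Fourier transform evaluated at -x, so Bessel's inequality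
  applies twice: to the outer transform, and to the transform of f.\<close>

lemma multiplier_op_L2:
  fixes f :: "'a::euclidean_space \<Rightarrow> complex"
  assumes mf: "integrable lborel (\<lambda>\<xi>. m \<xi> * fourier f \<xi>)" and f: "integrable lborel f"
    and B: "\<And>\<xi>. norm (m \<xi>) \<le> B"
  shows "(\<integral>\<^sup>+x. ennreal ((norm (multiplier_op m f x))\<^sup>2) \<partial>lborel) \<le> ennreal (B\<^sup>2) * (\<integral>\<^sup>+x. ennreal ((norm (f x))\<^sup>2) \<partial>lborel)"
proof -
  have [measurable]: "f \<in> borel_measurable borel"
    using borel_measurable_integrable[OF f] by simp
  have "(\<integral>\<^sup>+x. ennreal ((norm (multiplier_op m f x))\<^sup>2) \<partial>lborel) \<le> (\<integral>\<^sup>+\<xi>. ennreal ((norm (m \<xi> * fourier f \<xi>))\<^sup>2) \<partial>lborel)"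
    by (rule multiplier_op_bessel[OF mf])
  also have "\<dots> \<le> (\<integral>\<^sup>+\<xi>. ennreal (B\<^sup>2) * ennreal ((norm (fourier f \<xi>))\<^sup>2) \<partial>lborel)"
    by (intro nn_integral_mono)
       (auto simp: norm_mult power_mult_distrib ennreal_mult[symmetric] intro!: ennreal_leI mult_right_mono power_mono B)
  also have "\<dots> = ennreal (B\<^sup>2) * (\<integral>\<^sup>+\<xi>. ennreal ((norm (fourier f \<xi>))\<^sup>2) \<partial>lborel)"
    by (rule nn_integral_cmult) measurable
  also have "\<dots> \<le> ennreal (B\<^sup>2) * (\<integral>\<^sup>+x. ennreal ((norm (f x))\<^sup>2) \<partial>lborel)"
    by (intro mult_left_mono bessel_inequality f) auto
  finally show ?thesis .
qed

lemma fourier_dilate: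
  fixes f :: "'a::euclidean_space \<Rightarrow> complex"
  assumes [measurable]: "f \<in> borel_measurable borel" and s: "\<sigma> > 0"
  shows "fourier f \<xi> = of_real (\<sigma> ^ DIM('a)) * fourier (\<lambda>x. f (\<sigma> *\<^sub>R x)) (\<sigma> *\<^sub>R \<xi>)"
proof -
  have "fourier f \<xi> = \<bar>\<sigma>\<bar> ^ DIM('a) *\<^sub>R (LINT x|lborel. cis (- 2 * pi * ((0 + \<sigma> *\<^sub>R x) \<bullet> \<xi>)) * f (0 + \<sigma> *\<^sub>R x))"
    unfolding fourier_def by (rule integral_lborel_affine) (use s in auto)
  then show ?thesis using s by (simp add: fourier_def scaleR_conv_of_real)
qed

lemma multiplier_op_dilate:
  fixes f :: "'a::euclidean_space \<Rightarrow> complex"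
  assumes [measurable]: "f \<in> borel_measurable borel" "m \<in> borel_measurable borel" and s: "\<sigma> > 0"
  shows "multiplier_op (\<lambda>\<xi>. m (\<sigma> *\<^sub>R \<xi>)) f x = multiplier_op m (\<lambda>x. f (\<sigma> *\<^sub>R x)) ((1 / \<sigma>) *\<^sub>R x)"
proof -
  have "multiplier_op m (\<lambda>x. f (\<sigma> *\<^sub>R x)) ((1 / \<sigma>) *\<^sub>R x) =
      \<bar>\<sigma>\<bar> ^ DIM('a) *\<^sub>R (LINT \<xi>|lborel. cis (2 * pi * ((1 / \<sigma>) *\<^sub>R x \<bullet> (0 + \<sigma> *\<^sub>R \<xi>))) * m (0 + \<sigma> *\<^sub>R \<xi>) * fourier (\<lambda>x. f (\<sigma> *\<^sub>R x)) (0 + \<sigma> *\<^sub>R \<xi>))"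
    unfolding multiplier_op_def by (rule integral_lborel_affine) (use s in auto)
  also have "\<dots> = (LINT \<xi>|lborel. cis (2 * pi * (x \<bullet> \<xi>)) * m (\<sigma> *\<^sub>R \<xi>) * fourier f \<xi>)"
    unfolding fourier_dilate[OF assms(1) s]
    by (subst integral_scaleR_right[symmetric])
       (use s in \<open>auto simp: scaleR_conv_of_real mult_ac intro!: Bochner_Integration.integral_cong\<close>)
  finally show ?thesis by (simp add: multiplier_op_def)
qed

text \<open>The constant does not depend on x, so the remainder can be integrated against a kernel
  when a convolution is differentiated.\<close>

lemma schwartz_taylor:
  fixes f :: "'a::euclidean_space \<Rightarrow> complex"
  assumes f: "schwartz f"
  obtains C where "C \<ge> 0" "\<And>x v. norm v \<le> 1 \<Longrightarrow> norm (f (x + v) - f x - (\<Sum>b\<in>Basis. (v \<bullet> b) *\<^sub>R partial_deriv b f x)) \<le> C * (norm v)\<^sup>2"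
proof -
  let ?D = "\<lambda>y v. \<Sum>b\<in>Basis. (v \<bullet> b) *\<^sub>R partial_deriv b f y"
  have "\<exists>C\<ge>0. \<forall>x h. norm h \<le> 1 \<longrightarrow> norm (partial_deriv b f (x + h) - partial_deriv b f x) \<le> C * norm h" if b: "b \<in> Basis" for b
    using schwartz_increment[OF schwartz_partial_deriv[OF f b], of 0] by (metis div_by_1 power_0)
  then obtain C where C: "\<And>b. b \<in> Basis \<Longrightarrow> C b \<ge> 0"
    "\<And>b x h. b \<in> Basis \<Longrightarrow> norm h \<le> 1 \<Longrightarrow> norm (partial_deriv b f (x + h) - partial_deriv b f x) \<le> C b * norm h"
    by metis
  define B where "B = (\<Sum>b\<in>Basis. C b)"
  have B: "B \<ge> 0" unfolding B_def by (rule sum_nonneg) (rule C(1))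
  have "norm (f (x + v) - f x - ?D x (x + v - x)) \<le> norm (x + v - x) * (B * norm v)" if v: "norm v \<le> 1" for x v
  proof (rule differentiable_bound_linearization)
    show "x + t *\<^sub>R (x + v - x) \<in> closed_segment x (x + v)" if "t \<in> {0..1}" for t
      using that by (auto simp: closed_segment_def algebra_simps intro!: exI[of _ t])
    show "(f has_derivative ?D y) (at y within closed_segment x (x + v))" for y
      by (rule has_derivative_at_withinI[OF schwartz_has_derivative[OF f]])
    fix y assume y: "y \<in> closed_segment x (x + v)"
    have yx: "norm (y - x) \<le> norm v" using segment_bound(1)[OF y] by (simp add: norm_minus_commute)
    show "onorm (?D y - ?D x) \<le> B * norm v"
    proof (rule onorm_le)
      fix w :: 'a
      have "norm ((?D y - ?D x) w) = norm (\<Sum>b\<in>Basis. (w \<bullet> b) *\<^sub>R (partial_deriv b f (x + (y - x)) - partial_deriv b f x))"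
        by (simp add: sum_subtractf scaleR_diff_right)
      also have "\<dots> \<le> (\<Sum>b\<in>Basis. norm w * (C b * norm v))"
      proof (rule sum_norm_le)
        fix b :: 'a assume b: "b \<in> Basis"
        have "norm (partial_deriv b f (x + (y - x)) - partial_deriv b f x) \<le> C b * norm v"
          using C(2)[OF b, of "y - x" x] yx v C(1)[OF b] by (meson mult_left_mono order_trans)
        then show "norm ((w \<bullet> b) *\<^sub>R (partial_deriv b f (x + (y - x)) - partial_deriv b f x)) \<le> norm w * (C b * norm v)"
          unfolding norm_scaleR real_norm_def using b by (intro mult_mono Basis_le_norm) auto
      qed
      also have "\<dots> = B * norm v * norm w" by (simp add: B_def sum_distrib_left sum_distrib_right mult_ac)
      finally show "norm ((?D y - ?D x) w) \<le> B * norm v * norm w" .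
    qed
  qed auto
  then show ?thesis using B by (intro that[of B]) (auto simp: power2_eq_square mult_ac)
qed

text \<open>All derivatives fall on f, so K needs rapid decay but no smoothness; this is exactly
  what is known of the Fourier transform of a Schwartz function. The decay of the convolution comes
  from 1 + |x| \<le> (1 + |u|) (1 + |x - u|).\<close>

lemma schwartz_convolution:
  fixes f K :: "'a::euclidean_space \<Rightarrow> complex"
  assumes Km[measurable]: "K \<in> borel_measurable borel"
    and K: "\<And>n. \<exists>C. \<forall>u. norm (K u) \<le> C / (1 + norm u) ^ n" and f: "schwartz f"
  shows "schwartz (\<lambda>x. LINT u|lborel. K u * f (x - u))"
proof -
  have Ki: "integrable lborel K" using K[of "2 * DIM('a)"] integrable_decay[OF Km] by blast
  have KFi: "integrable lborel (\<lambda>u. K u * f (x - u))" if f: "schwartz f" for f x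
  proof -
    obtain C where C: "C > 0" "\<And>x. norm (f x) \<le> C" using schwartz_bounded[OF f] by metis
    have [measurable]: "f \<in> borel_measurable borel" by (rule schwartz_measurable[OF f])
    show ?thesis
    proof (rule Bochner_Integration.integrable_bound)
      show "integrable lborel (\<lambda>u. C * norm (K u))" by (intro integrable_mult_right integrable_norm Ki)
      show "AE u in lborel. norm (K u * f (x - u)) \<le> norm (C * norm (K u))"
        using C by (auto simp: norm_mult mult.commute[of C] intro!: mult_left_mono)
    qed measurable
  qed
  let ?conv = "\<lambda>f x. LINT u|lborel. K u * f (x - u)"
  show ?thesis
  proof (rule schwartzI[where S = "?conv ` {f. schwartz f}"])
    fix h assume "h \<in> ?conv ` {f. schwartz f}"
    then obtain f where h: "h = ?conv f" and f: "schwartz f" by blast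
    note [measurable] = schwartz_measurable[OF f]
    obtain C where C: "C \<ge> 0" "\<And>x v. norm v \<le> 1 \<Longrightarrow> norm (f (x + v) - f x - (\<Sum>b\<in>Basis. (v \<bullet> b) *\<^sub>R partial_deriv b f x)) \<le> C * (norm v)\<^sup>2"
      using schwartz_taylor[OF f] by metis
    define I where "I = (LINT u|lborel. norm (K u))"
    define D where "D = (\<lambda>x v. \<Sum>b\<in>Basis. (v \<bullet> b) *\<^sub>R ?conv (partial_deriv b f) x)"
    have bl: "bounded_linear (D x)" for x
      unfolding D_def by (intro bounded_linear_sum bounded_linear_scaleR_const bounded_linear_inner_left)
    have "(h has_derivative D x) (at x)" for x
    proof (rule has_derivativeI_sandwich[where e = 1 and H = "\<lambda>y. (C * I) * norm (y - x)"])
      fix y assume y: "y \<noteq> x" "dist y x < 1"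
      define v where "v = y - x"
      have v: "norm v \<le> 1" "v \<noteq> 0" "y = x + v" using y by (auto simp: v_def dist_norm)
      have pd: "integrable lborel (\<lambda>u. (v \<bullet> b) *\<^sub>R (K u * partial_deriv b f (x - u)))" if "b \<in> Basis" for b
        by (intro integrable_scaleR_right KFi schwartz_partial_deriv f that)
      have "D x v = (LINT u|lborel. (\<Sum>b\<in>Basis. (v \<bullet> b) *\<^sub>R (K u * partial_deriv b f (x - u))))"
        unfolding D_def by (subst Bochner_Integration.integral_sum[OF pd]) simp_all
      then have "h y - h x - D x v = (LINT u|lborel. K u * f (y - u) - K u * f (x - u) - (\<Sum>b\<in>Basis. (v \<bullet> b) *\<^sub>R (K u * partial_deriv b f (x - u))))"
        unfolding h using KFi[OF f] pd by (simp add: Bochner_Integration.integral_diff Bochner_Integration.integrable_sum)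
      also have "norm \<dots> \<le> (LINT u|lborel. (C * (norm v)\<^sup>2) * norm (K u))"
      proof (rule Bochner_Integration.integral_norm_bound_integral)
        show "integrable lborel (\<lambda>u. K u * f (y - u) - K u * f (x - u) - (\<Sum>b\<in>Basis. (v \<bullet> b) *\<^sub>R (K u * partial_deriv b f (x - u))))"
          using KFi[OF f] pd by (intro Bochner_Integration.integrable_diff Bochner_Integration.integrable_sum)
        show "integrable lborel (\<lambda>u. (C * (norm v)\<^sup>2) * norm (K u))" by (intro integrable_mult_right integrable_norm Ki)
        fix u
        have "K u * f (y - u) - K u * f (x - u) - (\<Sum>b\<in>Basis. (v \<bullet> b) *\<^sub>R (K u * partial_deriv b f (x - u)))
          = K u * (f ((x - u) + v) - f (x - u) - (\<Sum>b\<in>Basis. (v \<bullet> b) *\<^sub>R partial_deriv b f (x - u)))"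
          using v(3) by (simp add: right_diff_distrib sum_distrib_left scaleR_conv_of_real mult_ac add_diff_eq diff_add_eq)
        then show "norm (K u * f (y - u) - K u * f (x - u) - (\<Sum>b\<in>Basis. (v \<bullet> b) *\<^sub>R (K u * partial_deriv b f (x - u)))) \<le> (C * (norm v)\<^sup>2) * norm (K u)"
          using mult_left_mono[OF C(2)[OF v(1), of "x - u"], of "norm (K u)"] by (simp add: norm_mult mult.commute)
      qed
      also have "\<dots> = (C * I) * norm v * norm v" by (simp add: I_def power2_eq_square)
      finally show "norm (h y - h x - D x (y - x)) / norm (y - x) \<le> (C * I) * norm (y - x)"
        using v(2) unfolding v_def[symmetric] by (simp add: divide_le_eq)
    next
      have "((\<lambda>y. (C * I) * norm (y - x)) \<longlongrightarrow> (C * I) * norm (x - x)) (at x)" by (intro tendsto_intros)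
      then show "((\<lambda>y. (C * I) * norm (y - x)) \<longlongrightarrow> 0) (at x)" by simp
    qed (use bl in auto)
    moreover have "(\<lambda>x. D x b) \<in> ?conv ` {f. schwartz f}" if b: "b \<in> Basis" for b
      unfolding D_def basis_sum_component[OF b] using schwartz_partial_deriv[OF f b] by blast
    ultimately show "\<exists>D. (\<forall>x. (h has_derivative D x) (at x)) \<and> (\<forall>b\<in>Basis. (\<lambda>x. D x b) \<in> ?conv ` {f. schwartz f})"
      by blast
    show "\<exists>C. \<forall>x. norm (h x) \<le> C / (1 + norm x) ^ k" for k
    proof -
      obtain A where A: "A > 0" "\<And>x. norm (f x) \<le> A / (1 + norm x) ^ k" using schwartz_decay[OF f] by metis
      obtain B where B: "\<And>u. norm (K u) \<le> B / (1 + norm u) ^ (2 * DIM('a) + k)" using K by metis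
      define W where "W = (\<lambda>u. norm (K u) * (1 + norm u) ^ k)"
      have "norm (W u) \<le> B / (1 + norm u) ^ (2 * DIM('a))" for u
      proof -
        have p: "(1 + norm u) ^ k > 0" by (simp add: add_pos_nonneg)
        then have "W u \<le> B / (1 + norm u) ^ (2 * DIM('a) + k) * (1 + norm u) ^ k"
          unfolding W_def by (intro mult_right_mono B) auto
        moreover have "1 + norm u \<noteq> 0" using norm_ge_zero[of u] by linarith
        ultimately show ?thesis by (simp add: power_add W_def abs_mult)
      qed
      then have Wi: "integrable lborel W" by (rule integrable_decay[rotated]) (simp add: W_def)
      have "norm (h x) \<le> (A * (LINT u|lborel. W u)) / (1 + norm x) ^ k" for x
      proof -
        have "norm (h x) \<le> (LINT u|lborel. (A / (1 + norm x) ^ k) * W u)"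
          unfolding h
        proof (rule Bochner_Integration.integral_norm_bound_integral[OF KFi[OF f]])
          show "integrable lborel (\<lambda>u. (A / (1 + norm x) ^ k) * W u)" by (intro integrable_mult_right Wi)
          fix u
          have "norm x \<le> norm (x - u) + norm u" using norm_triangle_ineq[of "x - u" u] by simp
          have "1 + norm x \<le> (1 + norm u) * (1 + norm (x - u))"
          proof -
            have "(1 + norm u) * (1 + norm (x - u)) = 1 + norm u + norm (x - u) + norm u * norm (x - u)"
              by (simp add: algebra_simps)
            moreover have "0 \<le> norm u * norm (x - u)" by simp
            ultimately show ?thesis using \<open>norm x \<le> norm (x - u) + norm u\<close> by linarith
          qed
          then have "(1 + norm x) ^ k \<le> (1 + norm u) ^ k * (1 + norm (x - u)) ^ k"
            unfolding power_mult_distrib[symmetric] by (intro power_mono) auto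
          moreover have "(1 + norm x) ^ k > 0" "(1 + norm (x - u)) ^ k > 0" by (simp_all add: add_pos_nonneg)
          ultimately have "A / (1 + norm (x - u)) ^ k \<le> A * (1 + norm u) ^ k / (1 + norm x) ^ k"
            using A(1) by (simp add: divide_simps mult_ac)
          with A(2)[of "x - u"] have "norm (f (x - u)) \<le> A * (1 + norm u) ^ k / (1 + norm x) ^ k" by linarith
          then have "norm (K u) * norm (f (x - u)) \<le> norm (K u) * (A * (1 + norm u) ^ k / (1 + norm x) ^ k)"
            by (rule mult_left_mono) simp
          then show "norm (K u * f (x - u)) \<le> (A / (1 + norm x) ^ k) * W u"
            by (simp add: norm_mult W_def mult_ac)
        qed
        then show ?thesis by simp
      qed
      then show ?thesis by blast
    qed
  qed (use f in blast)
qed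

lemma integrable_fourier_schwartz:
  assumes "schwartz f" shows "integrable lborel (fourier (f :: 'a::euclidean_space \<Rightarrow> complex))"
proof -
  obtain C where "\<And>\<xi>. norm (fourier f \<xi>) \<le> C / (1 + norm \<xi>) ^ (2 * DIM('a))"
    using schwartz_fourier_decay[OF assms] by metis
  then show ?thesis
    by (rule integrable_decay[OF fourier_measurable[OF schwartz_measurable[OF assms]]])
qed

lemma integrable_mult_bounded:
  fixes m h :: "'a \<Rightarrow> complex"
  assumes h: "integrable M h" and [measurable]: "m \<in> borel_measurable M" and B: "\<And>x. norm (m x) \<le> B"
  shows "integrable M (\<lambda>x. m x * h x)"
proof (rule Bochner_Integration.integrable_bound)
  have [measurable]: "h \<in> borel_measurable M" using h by auto
  show "integrable M (\<lambda>x. B * norm (h x))" by (intro integrable_mult_right integrable_norm h)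
  show "(\<lambda>x. m x * h x) \<in> borel_measurable M" by measurable
  have "0 \<le> B" using order_trans[OF norm_ge_zero B] .
  then show "AE x in M. norm (m x * h x) \<le> norm (B * norm (h x))"
    using B by (auto simp: norm_mult abs_mult intro!: mult_right_mono)
qed

text \<open>The operator is convolution with a rapidly decaying kernel, hence it preserves the
  class. For its transform, let h be the product of \<rho> with the transform of f: the transform of
  h is the reflected operator, which is integrable by the first part, so inversion applies to h.
  This is what allows the Littlewood--Paley cutoff to be inserted into other multipliers.\<close>

lemma
  fixes f \<rho> :: "'a::euclidean_space \<Rightarrow> complex"
  assumes r: "schwartz \<rho>" and f: "schwartz f"
  shows schwartz_multiplier_op: "schwartz (multiplier_op \<rho> f)"
    and fourier_multiplier_op: "fourier (multiplier_op \<rho> f) \<xi> = \<rho> \<xi> * fourier f \<xi>"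
proof -
  have [measurable]: "f \<in> borel_measurable borel" "\<rho> \<in> borel_measurable borel"
    by (rule schwartz_measurable[OF f], rule schwartz_measurable[OF r])
  show s: "schwartz (multiplier_op \<rho> f)"
    unfolding multiplier_op_conv[OF schwartz_integrable[OF r] schwartz_integrable[OF f], abs_def]
  proof (rule schwartz_convolution[OF _ _ f])
    show "\<exists>C. \<forall>u. norm (fourier \<rho> (- u)) \<le> C / (1 + norm u) ^ n" for n
    proof -
      obtain C where "\<And>\<xi>. norm (fourier \<rho> \<xi>) \<le> C / (1 + norm \<xi>) ^ n" using schwartz_fourier_decay[OF r] by metis
      then show ?thesis by (metis norm_minus_cancel)
    qed
  qed measurable
  obtain B where B: "\<And>x. norm (\<rho> x) \<le> B" using schwartz_bounded[OF r] by metis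
  obtain B' where B': "B' > 0" "\<And>\<xi>. norm (fourier f \<xi>) \<le> B' / (1 + norm \<xi>) ^ 0" using schwartz_fourier_decay[OF f] by metis
  let ?h = "\<lambda>\<xi>. \<rho> \<xi> * fourier f \<xi>"
  have hi: "integrable lborel ?h"
    by (rule integrable_mult_bounded[OF integrable_fourier_schwartz[OF f] _ B]) simp
  have hc: "continuous_on UNIV ?h"
    by (intro continuous_on_mult schwartz_continuous[OF r] continuous_fourier schwartz_integrable[OF f])
  have hb: "norm (?h \<xi>) \<le> B * B'" for \<xi>
    unfolding norm_mult using B B' by (intro mult_mono) (auto intro: order_trans[OF norm_ge_zero B])
  have e: "fourier ?h x = multiplier_op \<rho> f (- x)" for x
    by (simp add: multiplier_op_eq_fourier)
  have "integrable lborel (\<lambda>x. multiplier_op \<rho> f (0 + (-1) *\<^sub>R x))"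
    by (rule integrable_lborel_affine[OF _ schwartz_integrable[OF s]]) simp
  then have fi: "integrable lborel (fourier ?h)" by (simp add: e[abs_def])
  have "fourier (multiplier_op \<rho> f) \<xi> = \<bar>-1\<bar> ^ DIM('a) *\<^sub>R (LINT x|lborel. cis (- 2 * pi * ((0 + (-1) *\<^sub>R x) \<bullet> \<xi>)) * multiplier_op \<rho> f (0 + (-1) *\<^sub>R x))"
    unfolding fourier_def by (rule integral_lborel_affine) (use schwartz_measurable[OF s] in auto)
  also have "\<dots> = (LINT x|lborel. cis (2 * pi * (\<xi> \<bullet> x)) * fourier ?h x)"
    by (simp add: e inner_commute)
  also have "\<dots> = ?h \<xi>" by (rule fourier_inversion[OF hi hc hb fi])
  finally show "fourier (multiplier_op \<rho> f) \<xi> = ?h \<xi>" .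
qed

section \<open>Radial multipliers with bounds uniform in a parameter\<close>

inductive_set radial_family :: "(real \<Rightarrow> 'a::euclidean_space \<Rightarrow> complex) set" where
  radial_base: "smooth_real h \<Longrightarrow> (\<And>x. x < 0 \<Longrightarrow> h x = 0) \<Longrightarrow> (\<lambda>t \<xi>. of_real (h (t - (norm \<xi>)\<^sup>2))) \<in> radial_family"
| radial_affine: "F \<in> radial_family \<Longrightarrow> (\<lambda>t \<xi>. of_real (c + \<xi> \<bullet> a) * F t \<xi>) \<in> radial_family"
| radial_add: "F \<in> radial_family \<Longrightarrow> G \<in> radial_family \<Longrightarrow> (\<lambda>t \<xi>. F t \<xi> + G t \<xi>) \<in> radial_family"

text \<open>The derivative of h(t - |\<xi>|^2) in direction v is -2 (\<xi> \<bullet> v) h'(t -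
  |\<xi>|^2); this is why the family admits affine factors. Keeping t as an argument of the members
  makes the later bounds uniform in t.\<close>

lemma radial_family_deriv:
  fixes F :: "real \<Rightarrow> 'a::euclidean_space \<Rightarrow> complex"
  assumes "F \<in> radial_family"
  shows "\<exists>D. (\<forall>t \<xi>. (F t has_derivative D t \<xi>) (at \<xi>)) \<and> (\<forall>b. (\<lambda>t \<xi>. D t \<xi> b) \<in> radial_family)"
  using assms
proof induction
  case (radial_base h)
  define D where "D = (\<lambda>t (\<xi>::'a) v. complex_of_real (0 + \<xi> \<bullet> ((-2) *\<^sub>R v)) * complex_of_real (deriv h (t - (norm \<xi>)\<^sup>2)))"
  have "((\<lambda>\<xi>. complex_of_real (h (t - (norm \<xi>)\<^sup>2))) has_derivative D t \<xi>) (at \<xi>)" for t and \<xi> :: 'a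
  proof -
    have 1: "((\<lambda>\<xi>::'a. t - (norm \<xi>)\<^sup>2) has_derivative (\<lambda>v. \<xi> \<bullet> ((-2) *\<^sub>R v))) (at \<xi>)"
      unfolding power2_norm_eq_inner by (auto intro!: derivative_eq_intros simp: inner_commute)
    have 2: "(h has_derivative (\<lambda>s. s * deriv h (t - (norm \<xi>)\<^sup>2))) (at (t - (norm \<xi>)\<^sup>2))"
      using smooth_real_DERIV[OF radial_base(1)] by (simp add: has_field_derivative_def mult_commute_abs)
    from has_derivative_of_real[OF has_derivative_compose[OF 1 2]]
    show ?thesis by (simp add: D_def)
  qed
  moreover have "(\<lambda>t \<xi>. D t \<xi> b) \<in> radial_family" for b
    unfolding D_def using radial_base
    by (intro radial_family.intros smooth_real_deriv) (auto intro: smooth_real_deriv_vanish_less[where c = 0])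
  ultimately show ?case by blast
next
  case (radial_affine F c a)
  then obtain D where D: "\<And>t \<xi>. (F t has_derivative D t \<xi>) (at \<xi>)" "\<And>b. (\<lambda>t \<xi>. D t \<xi> b) \<in> radial_family" by blast
  have "((\<lambda>\<xi>. of_real (c + \<xi> \<bullet> a) * F t \<xi>) has_derivative (\<lambda>v. of_real (c + \<xi> \<bullet> a) * D t \<xi> v + of_real (v \<bullet> a + \<xi> \<bullet> 0) * F t \<xi>)) (at \<xi>)" for t \<xi>
    by (rule has_derivative_mult[OF has_derivative_of_real D(1)]) (auto intro!: derivative_eq_intros)
  moreover have "(\<lambda>t \<xi>. of_real (c + \<xi> \<bullet> a) * D t \<xi> b + of_real (b \<bullet> a + \<xi> \<bullet> 0) * F t \<xi>) \<in> radial_family" for b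
    by (intro radial_family.intros D radial_affine)
  ultimately show ?case
    by (intro exI[of _ "\<lambda>t \<xi> v. of_real (c + \<xi> \<bullet> a) * D t \<xi> v + of_real (v \<bullet> a + \<xi> \<bullet> 0) * F t \<xi>"]) blast
next
  case (radial_add F G)
  then obtain D E where D: "\<And>t \<xi>. (F t has_derivative D t \<xi>) (at \<xi>)" "\<And>b. (\<lambda>t \<xi>. D t \<xi> b) \<in> radial_family"
    and E: "\<And>t \<xi>. (G t has_derivative E t \<xi>) (at \<xi>)" "\<And>b. (\<lambda>t \<xi>. E t \<xi> b) \<in> radial_family" by blast
  then show ?case
    by (intro exI[of _ "\<lambda>t \<xi> v. D t \<xi> v + E t \<xi> v"] conjI allI has_derivative_add radial_family.intros)
qed

text \<open>For t \<le> 5 a nonzero value forces |\<xi>|^2 \<le> 5 < 9, and the argument t -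
  |\<xi>|^2 ranges over the compact interval [0, 5]. The value 5 leaves room for
  \<open>lp_mult\<close>, which is realised as the member with t = 5.\<close>

lemma radial_family_bound:
  fixes F :: "real \<Rightarrow> 'a::euclidean_space \<Rightarrow> complex"
  assumes "F \<in> radial_family"
  shows "\<exists>B\<ge>0. \<forall>t\<le>5. \<forall>\<xi>. norm (F t \<xi>) \<le> B \<and> (norm \<xi> > 3 \<longrightarrow> F t \<xi> = 0)"
  using assms
proof induction
  case (radial_base h)
  have "compact (h ` {0..5})"
    by (intro compact_continuous_image smooth_real_continuous radial_base) auto
  then obtain B where B: "\<forall>x\<in>{0..5}. \<bar>h x\<bar> \<le> B"
    by (meson bounded_real compact_imp_bounded image_eqI)
  have "\<bar>h (t - (norm \<xi>)\<^sup>2)\<bar> \<le> max B 0" if "t \<le> 5" for t and \<xi> :: 'a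
  proof (cases "t - (norm \<xi>)\<^sup>2 < 0")
    case False
    have "0 \<le> (norm \<xi>)\<^sup>2" by simp
    then have "t - (norm \<xi>)\<^sup>2 \<le> 5" using that by (smt (verit))
    with False have "t - (norm \<xi>)\<^sup>2 \<in> {0..5}" by simp
    from bspec[OF B this] show ?thesis by (simp add: le_max_iff_disj)
  qed (simp add: radial_base)
  moreover have "h (t - (norm \<xi>)\<^sup>2) = 0" if "t \<le> 5" "norm \<xi> > 3" for t and \<xi> :: 'a
  proof -
    have "3\<^sup>2 < (norm \<xi>)\<^sup>2" using that by (intro power_strict_mono) auto
    then show ?thesis using that by (intro radial_base) simp
  qed
  ultimately show ?case by (intro exI[of _ "max B 0"]) auto
next
  case (radial_affine F c a)
  then obtain B where B: "B \<ge> 0" "\<And>t \<xi>. t \<le> 5 \<Longrightarrow> norm (F t \<xi>) \<le> B" "\<And>t \<xi>. t \<le> 5 \<Longrightarrow> norm \<xi> > 3 \<Longrightarrow> F t \<xi> = 0" by blast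
  have "norm (of_real (c + \<xi> \<bullet> a) * F t \<xi>) \<le> (\<bar>c\<bar> + 3 * norm a) * B" if t: "t \<le> 5" for t \<xi>
  proof (cases "norm \<xi> > 3")
    case False
    have "\<bar>\<xi> \<bullet> a\<bar> \<le> norm \<xi> * norm a" by (rule Cauchy_Schwarz_ineq2)
    also have "\<dots> \<le> 3 * norm a" using False by (intro mult_right_mono) auto
    finally have "\<bar>c + \<xi> \<bullet> a\<bar> \<le> \<bar>c\<bar> + 3 * norm a" by linarith
    then show ?thesis unfolding norm_mult norm_of_real by (intro mult_mono B(2)[OF t]) auto
  qed (use B t in auto)
  then show ?case using B by (intro exI[of _ "(\<bar>c\<bar> + 3 * norm a) * B"]) auto
next
  case (radial_add F G)
  then obtain B C where "B \<ge> 0" "\<And>t \<xi>. t \<le> 5 \<Longrightarrow> norm (F t \<xi>) \<le> B" "\<And>t \<xi>. t \<le> 5 \<Longrightarrow> norm \<xi> > 3 \<Longrightarrow> F t \<xi> = 0"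
    "C \<ge> 0" "\<And>t \<xi>. t \<le> 5 \<Longrightarrow> norm (G t \<xi>) \<le> C" "\<And>t \<xi>. t \<le> 5 \<Longrightarrow> norm \<xi> > 3 \<Longrightarrow> G t \<xi> = 0" by blast
  then show ?case by (intro exI[of _ "B + C"]) (auto intro: order_trans[OF norm_triangle_ineq add_mono])
qed

lemma radial_family_schwartz:
  fixes F :: "real \<Rightarrow> 'a::euclidean_space \<Rightarrow> complex"
  assumes F: "F \<in> radial_family" and t: "t \<le> 5" shows "schwartz (F t)"
proof (rule schwartzI[where S = "(\<lambda>F. F t) ` radial_family"])
  fix h :: "'a \<Rightarrow> complex" assume "h \<in> (\<lambda>F. F t) ` radial_family"
  then obtain F where h: "h = F t" and F: "F \<in> radial_family" by blast
  obtain D where "\<And>t \<xi>. (F t has_derivative D t \<xi>) (at \<xi>)" "\<And>b. (\<lambda>t \<xi>. D t \<xi> b) \<in> radial_family"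
    using radial_family_deriv[OF F] by blast
  then show "\<exists>D. (\<forall>x. (h has_derivative D x) (at x)) \<and> (\<forall>b\<in>Basis. (\<lambda>x. D x b) \<in> (\<lambda>F. F t) ` radial_family)"
    unfolding h by (intro exI[of _ "D t"] conjI allI ballI) (auto intro!: image_eqI[of _ _ "\<lambda>t \<xi>. D t \<xi> b" for b])
  obtain B where B: "B \<ge> 0" "\<And>\<xi>. norm (F t \<xi>) \<le> B" "\<And>\<xi>. norm \<xi> > 3 \<Longrightarrow> F t \<xi> = 0"
    using radial_family_bound[OF F] t by blast
  show "\<exists>C. \<forall>x. norm (h x) \<le> C / (1 + norm x) ^ k" for k
  proof (intro exI[of _ "B * 4 ^ k"] allI)
    fix x :: 'a
    have p: "(1 + norm x) ^ k > 0" by (simp add: add_pos_nonneg)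
    show "norm (h x) \<le> B * 4 ^ k / (1 + norm x) ^ k"
    proof (cases "norm x > 3")
      case False
      then have "(1 + norm x) ^ k \<le> 4 ^ k" by (intro power_mono) auto
      then have "norm (F t x) * (1 + norm x) ^ k \<le> B * 4 ^ k" using B p by (intro mult_mono) auto
      then show ?thesis using p by (simp add: h le_divide_eq)
    qed (use B p h in simp)
  qed
qed (use F in blast)

text \<open>Iterated partial derivatives stay in \<open>radial_family\<close>, whose members are
  uniformly bounded and supported in one fixed ball; so their L^1 norms are bounded uniformly in t
  and \<open>fourier_decay_bound\<close> applies with a single A.\<close>

lemma radial_fourier_decay:
  assumes g: "smooth_real g" and g0: "\<And>x. x < 0 \<Longrightarrow> g x = 0"
  obtains C where "C > 0" "\<And>t \<xi>. t \<le> 5 \<Longrightarrow> norm (fourier (\<lambda>\<xi>::'a::euclidean_space. complex_of_real (g (t - (norm \<xi>)\<^sup>2))) \<xi>) \<le> C / (1 + norm \<xi>) ^ n"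
proof -
  let ?F = "\<lambda>t (\<xi>::'a). complex_of_real (g (t - (norm \<xi>)\<^sup>2))"
  have F: "?F \<in> radial_family" by (intro radial_family.intros g g0)
  have L1: "\<exists>A\<ge>0. \<forall>t\<le>5. (\<integral>\<^sup>+x. ennreal (norm (G t x)) \<partial>lborel) \<le> ennreal A" if "G \<in> radial_family" for G :: "real \<Rightarrow> 'a \<Rightarrow> complex"
  proof -
    obtain B where B: "B \<ge> 0" "\<And>t \<xi>. t \<le> 5 \<Longrightarrow> norm (G t \<xi>) \<le> B" "\<And>t \<xi>. t \<le> 5 \<Longrightarrow> norm \<xi> > 3 \<Longrightarrow> G t \<xi> = 0"
      using radial_family_bound[OF \<open>G \<in> radial_family\<close>] by blast
    have fin: "emeasure lborel (cball (0::'a) 3) < \<infinity>" by (rule emeasure_lborel_cball_finite)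
    have "(\<integral>\<^sup>+x. ennreal (norm (G t x)) \<partial>lborel) \<le> ennreal (B * measure lborel (cball (0::'a) 3))" if "t \<le> 5" for t
    proof -
      have "(\<integral>\<^sup>+x. ennreal (norm (G t x)) \<partial>lborel) \<le> (\<integral>\<^sup>+x. ennreal B * indicator (cball (0::'a) 3) x \<partial>lborel)"
      proof (rule nn_integral_mono)
        fix x :: 'a show "ennreal (norm (G t x)) \<le> ennreal B * indicator (cball 0 3) x"
          using B(2,3)[OF that, of x] by (cases "norm x > 3") (auto simp: ennreal_leI)
      qed
      also have "\<dots> = ennreal (B * measure lborel (cball (0::'a) 3))"
        using B(1) fin by (simp add: nn_integral_cmult_indicator emeasure_eq_ennreal_measure ennreal_mult)
      finally show ?thesis .
    qed
    then show ?thesis using B(1) by (intro exI[of _ "B * measure lborel (cball (0::'a) 3)"]) auto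
  qed
  have pd: "\<exists>G\<in>radial_family. \<forall>t. (partial_deriv b ^^ n) (?F t) = G t" for b n
  proof (induction n)
    case (Suc n)
    then obtain G where G: "G \<in> radial_family" "\<And>t. (partial_deriv b ^^ n) (?F t) = G t" by blast
    obtain D where D: "\<And>t \<xi>. (G t has_derivative D t \<xi>) (at \<xi>)" "(\<lambda>t \<xi>. D t \<xi> b) \<in> radial_family"
      using radial_family_deriv[OF G(1)] by blast
    have "partial_deriv b (G t) = (\<lambda>\<xi>. D t \<xi> b)" for t by (rule partial_deriv_eq[OF D(1)])
    then show ?case using D(2) by (intro bexI[of _ "\<lambda>t \<xi>. D t \<xi> b"]) (auto simp: G(2))
  qed (use F in \<open>auto intro!: bexI[of _ ?F]\<close>)
  have "\<exists>A\<ge>0. \<forall>t\<le>5. (\<integral>\<^sup>+x. ennreal (norm ((partial_deriv b ^^ n) (?F t) x)) \<partial>lborel) \<le> ennreal A" for b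
    using bexE[OF pd[where b = b and n = n]] L1 by metis
  then obtain A where A: "\<And>b. A b \<ge> 0" "\<And>b t. t \<le> 5 \<Longrightarrow> (\<integral>\<^sup>+x. ennreal (norm ((partial_deriv b ^^ n) (?F t) x)) \<partial>lborel) \<le> ennreal (A b)"
    by metis
  obtain A0 where A0: "A0 \<ge> 0" "\<And>t. t \<le> 5 \<Longrightarrow> (\<integral>\<^sup>+x. ennreal (norm (?F t x)) \<partial>lborel) \<le> ennreal A0"
    using L1[OF F] by blast
  define M where "M = A0 + (\<Sum>b\<in>Basis. A b)"
  have M: "M \<ge> 0" "A0 \<le> M" "\<And>b. b \<in> Basis \<Longrightarrow> A b \<le> M"
    using A(1) A0(1) member_le_sum[of _ Basis A] unfolding M_def
    by (auto intro!: add_nonneg_nonneg sum_nonneg intro: add_increasing)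
  have "norm (fourier (?F t) \<xi>) \<le> (real (Suc DIM('a)) ^ Suc n * M + 1) / (1 + norm \<xi>) ^ n" if t: "t \<le> 5" for t \<xi>
  proof -
    have "norm (fourier (?F t) \<xi>) \<le> real (Suc DIM('a)) ^ Suc n * M / (1 + norm \<xi>) ^ n"
    proof (rule fourier_decay_bound[OF radial_family_schwartz[OF F t] M(1)])
      show "(\<integral>\<^sup>+x. ennreal (norm (?F t x)) \<partial>lborel) \<le> ennreal M"
        by (rule order_trans[OF A0(2)[OF t] ennreal_leI[OF M(2)]])
      show "(\<integral>\<^sup>+x. ennreal (norm ((partial_deriv b ^^ n) (?F t) x)) \<partial>lborel) \<le> ennreal M" if "b \<in> Basis" for b
        by (rule order_trans[OF A(2)[OF t] ennreal_leI[OF M(3)[OF that]]])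
    qed
    also have "\<dots> \<le> (real (Suc DIM('a)) ^ Suc n * M + 1) / (1 + norm \<xi>) ^ n" by (intro divide_right_mono) auto
    finally show ?thesis .
  qed
  moreover have "real (Suc DIM('a)) ^ Suc n * M + 1 > 0" using M by (simp add: add_nonneg_pos)
  ultimately show ?thesis using that by blast
qed

section \<open>Real interpolation\<close>

lemma epow_ennreal: "r \<ge> 0 \<Longrightarrow> epow (ennreal r) a = ennreal (r powr a)"
  by (simp add: epow_def)

lemma epow_top [simp]: "epow \<infinity> a = \<infinity>" "epow top a = top"
  by (simp_all add: epow_def)

lemma epow_0 [simp]: "epow 0 a = 0"
  by (simp add: epow_def)

lemma epow_mono:
  assumes "x \<le> y" "a > 0" shows "epow x a \<le> epow y a"
proof (cases y)
  case (real s)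
  moreover obtain r where "x = ennreal r" "0 \<le> r" using assms(1) real by (cases x) (auto simp: top_unique)
  ultimately show ?thesis using assms by (auto simp: epow_ennreal intro!: ennreal_leI powr_mono2)
qed simp

lemma epow_measurable [measurable (raw)]:
  "f \<in> borel_measurable M \<Longrightarrow> (\<lambda>x. epow (f x) a) \<in> borel_measurable M"
proof -
  have "(\<lambda>x. epow x a) \<in> borel_measurable borel"
    unfolding epow_def by (intro measurable_If) auto
  then show "f \<in> borel_measurable M \<Longrightarrow> (\<lambda>x. epow (f x) a) \<in> borel_measurable M"
    by (rule measurable_compose[rotated])
qed

lemma epow_numeral [simp]: "epow (numeral n) a = ennreal (numeral n powr a)"
  using epow_ennreal[of "numeral n" a] by simp

lemma epow_mult: "a > 0 \<Longrightarrow> epow (x * y) a = epow x a * epow y a"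
proof (cases x; cases y)
  fix r s assume "x = ennreal r" "0 \<le> r" "y = ennreal s" "0 \<le> s"
  then show ?thesis by (simp add: ennreal_mult[symmetric] epow_ennreal powr_mult)
next
  fix r assume *: "x = ennreal r" "0 \<le> r" "y = top"
  then show ?thesis by (cases "r = 0") (auto simp: epow_ennreal ennreal_mult_top)
next
  fix r assume *: "y = ennreal r" "0 \<le> r" "x = top"
  then show ?thesis by (cases "r = 0") (auto simp: epow_ennreal ennreal_top_mult)
next
  assume "x = top" "y = top"
  then show ?thesis by (simp add: ennreal_top_mult)
qed

lemma epow_epow: "epow (epow x a) b = epow x (a * b)"
  by (cases x) (auto simp: epow_ennreal powr_powr)

lemma epow_one [simp]: "epow x 1 = x"
  by (cases x) (auto simp: epow_ennreal)

lemma epow_inverse: "a \<noteq> 0 \<Longrightarrow> epow (epow x a) (1 / a) = x" "a \<noteq> 0 \<Longrightarrow> epow (epow x (1 / a)) a = x"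
  by (simp_all add: epow_epow)

lemma epow_add_le:
  assumes "a > 0" shows "epow (x + y) a \<le> ennreal (2 powr a) * (epow x a + epow y a)"
proof -
  have "x + y \<le> ennreal 2 * max x y" by (simp add: mult_2 add_mono)
  then have "epow (x + y) a \<le> epow (ennreal 2 * max x y) a" using assms by (rule epow_mono)
  also have "\<dots> = ennreal (2 powr a) * epow (max x y) a" using assms by (subst epow_mult) (auto simp: epow_ennreal)
  also have "epow (max x y) a \<le> epow x a + epow y a" by (auto simp: max_def add_increasing add_increasing2)
  finally show ?thesis by (simp add: mult_left_mono)
qed

text \<open>A geometric weight replaces Minkowski's inequality for infinite sums, at the price of an
  arbitrarily small exponential loss.\<close>

lemma epow_suminf_le:
  assumes a: "a > 0" and k: "\<kappa> > 0"
  obtains C where "C > 0" "\<And>b :: nat \<Rightarrow> ennreal. epow (\<Sum>n. b n) a \<le> ennreal C * (\<Sum>n. ennreal (2 powr (real n * \<kappa> * a)) * epow (b n) a)"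
proof -
  define c where "c = (\<Sum>n. (2 powr (- \<kappa>)) ^ n)"
  have q: "0 < (2::real) powr (- \<kappa>)" "(2::real) powr (- \<kappa>) < 1" using k by (auto simp: powr_less_one)
  have sm: "summable (\<lambda>n. ((2::real) powr (- \<kappa>)) ^ n)" using q by (intro summable_geometric) auto
  have c: "c > 0" unfolding c_def using q by (intro suminf_pos sm) auto
  have "epow (\<Sum>n. b n) a \<le> ennreal (c powr a) * (\<Sum>n. ennreal (2 powr (real n * \<kappa> * a)) * epow (b n) a)" for b :: "nat \<Rightarrow> ennreal"
  proof -
    define S where "S = (\<Sum>n. ennreal (2 powr (real n * \<kappa> * a)) * epow (b n) a)"
    \<comment> \<open>Each single weighted term is at most the whole sum S; solving for b n leaves a
      geometric factor, which can be summed.\<close>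
    have bn: "b n \<le> ennreal ((2 powr (- \<kappa>)) ^ n) * epow S (1 / a)" for n
    proof -
      have "ennreal (2 powr (real n * \<kappa> * a)) * epow (b n) a \<le> S"
        unfolding S_def using sum_le_suminf[of "\<lambda>n. ennreal (2 powr (real n * \<kappa> * a)) * epow (b n) a" "{n}"] by simp
      then have "epow (ennreal (2 powr (real n * \<kappa> * a)) * epow (b n) a) (1 / a) \<le> epow S (1 / a)"
        using a by (intro epow_mono) auto
      then have *: "ennreal (2 powr (real n * \<kappa>)) * b n \<le> epow S (1 / a)"
        using a by (simp add: epow_mult epow_inverse epow_ennreal powr_powr)
      have "ennreal ((2 powr (- \<kappa>)) ^ n) * ennreal (2 powr (real n * \<kappa>)) = 1"
        by (simp add: ennreal_mult[symmetric] powr_realpow[symmetric] powr_powr powr_add[symmetric] mult.commute)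
      then have "b n = ennreal ((2 powr (- \<kappa>)) ^ n) * (ennreal (2 powr (real n * \<kappa>)) * b n)"
        by (simp add: mult.assoc[symmetric])
      also have "\<dots> \<le> ennreal ((2 powr (- \<kappa>)) ^ n) * epow S (1 / a)" by (intro mult_left_mono *) simp
      finally show ?thesis .
    qed
    have "(\<Sum>n. b n) \<le> (\<Sum>n. ennreal ((2 powr (- \<kappa>)) ^ n) * epow S (1 / a))"
      by (intro suminf_le bn) auto
    also have "\<dots> = ennreal c * epow S (1 / a)"
      unfolding c_def by (simp add: ennreal_suminf_multc suminf_ennreal2[OF _ sm])
    finally have "epow (\<Sum>n. b n) a \<le> epow (ennreal c * epow S (1 / a)) a" using a by (intro epow_mono) auto
    also have "\<dots> = ennreal (c powr a) * S" using a c by (simp add: epow_mult epow_inverse epow_ennreal)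
    finally show ?thesis unfolding S_def .
  qed
  moreover have "c powr a > 0" using c by simp
  ultimately show ?thesis using that by blast
qed

section \<open>The layer cake formula and Marcinkiewicz interpolation\<close>

lemma nn_integral_powr_0:
  assumes "a > -1" "c \<ge> 0"
  shows "(\<integral>\<^sup>+l. ennreal (l powr a) * indicator {0..c} l \<partial>lborel) = ennreal (c powr (a + 1) / (a + 1))"
  by (rule nn_integral_has_integral_lebesgue'[OF _ has_integral_powr_from_0[OF assms]]) simp

lemma nn_integral_powr_inf:
  assumes "e < -1" "c > 0"
  shows "(\<integral>\<^sup>+l. ennreal (l powr e) * indicator {c..} l \<partial>lborel) = ennreal (c powr (e + 1) / (- (e + 1)))"
proof -
  have "c powr (e + 1) / (- (e + 1)) = - (c powr (e + 1)) / (e + 1)"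
    by (simp only: divide_minus_right minus_divide_left)
  then show ?thesis
    using nn_integral_has_integral_lebesgue'[OF _ has_integral_powr_to_inf[OF assms]] by simp
qed

text \<open>The common form of the two integrals over levels in Marcinkiewicz interpolation: an
  integrable power below a break point and another one above it.\<close>

lemma nn_integral_power_split:
  assumes "a > -1" "e < -1" "s > 0" "A \<ge> 0" "B \<ge> 0"
    and le1: "\<And>l. 0 < l \<Longrightarrow> l \<le> s \<Longrightarrow> h l \<le> A * l powr a" and le2: "\<And>l. s \<le> l \<Longrightarrow> h l \<le> B * l powr e"
  shows "(\<integral>\<^sup>+l. ennreal (h l) * indicator {0<..} l \<partial>lborel) \<le> ennreal (A * (s powr (a + 1) / (a + 1)) + B * (s powr (e + 1) / (- (e + 1))))"
proof -
  have "(\<integral>\<^sup>+l. ennreal (h l) * indicator {0<..} l \<partial>lborel) \<le>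
      (\<integral>\<^sup>+l. ennreal A * (ennreal (l powr a) * indicator {0..s} l) + ennreal B * (ennreal (l powr e) * indicator {s..} l) \<partial>lborel)"
  proof (rule nn_integral_mono)
    fix l :: real
    show "ennreal (h l) * indicator {0<..} l \<le> ennreal A * (ennreal (l powr a) * indicator {0..s} l) + ennreal B * (ennreal (l powr e) * indicator {s..} l)"
    proof (cases "l \<le> 0")
      case False
      show ?thesis
      proof (cases "l \<le> s")
        case True
        have "ennreal (h l) \<le> ennreal A * ennreal (l powr a)"
          using le1[of l] True False \<open>A \<ge> 0\<close> by (subst ennreal_mult[symmetric]) (auto intro: ennreal_leI)
        with True False show ?thesis by (auto intro: add_increasing2)
      next
        case F: False
        have "ennreal (h l) \<le> ennreal B * ennreal (l powr e)"
          using le2[of l] F \<open>B \<ge> 0\<close> by (subst ennreal_mult[symmetric]) (auto intro: ennreal_leI)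
        with F False show ?thesis by auto
      qed
    qed simp
  qed
  also have "\<dots> = ennreal A * ennreal (s powr (a + 1) / (a + 1)) + ennreal B * ennreal (s powr (e + 1) / (- (e + 1)))"
    using nn_integral_powr_0[of a s] nn_integral_powr_inf[of e s] assms
    by (subst nn_integral_add) (auto simp: nn_integral_cmult simp del: minus_add_distrib)
  also have "\<dots> = ennreal (A * (s powr (a + 1) / (a + 1)) + B * (s powr (e + 1) / (- (e + 1))))"
  proof -
    have "0 < a + 1" "0 < - (e + 1)" using assms by auto
    then have "0 \<le> s powr (a + 1) / (a + 1)" "0 \<le> s powr (e + 1) / (- (e + 1))"
      by (auto intro!: divide_nonneg_pos simp only: powr_ge_zero)
    with assms show ?thesis by (simp only: ennreal_mult ennreal_plus mult_nonneg_nonneg)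
  qed
  finally show ?thesis .
qed

lemma layer_cake_pointwise:
  assumes "p > 0"
  shows "epow x p = (\<integral>\<^sup>+l. ennreal (p * l powr (p - 1)) * indicator {0<..} l * indicator {l. ennreal l < x} l \<partial>lborel)"
proof -
  have fin: "(\<integral>\<^sup>+l. ennreal (p * l powr (p - 1)) * indicator {0..r} l \<partial>lborel) = ennreal (r powr p)" if "r \<ge> 0" for r
  proof -
    have "(\<integral>\<^sup>+l. ennreal (p * l powr (p - 1)) * indicator {0..r} l \<partial>lborel) = (\<integral>\<^sup>+l. ennreal p * (ennreal (l powr (p - 1)) * indicator {0..r} l) \<partial>lborel)"
      using assms by (intro nn_integral_cong) (simp add: ennreal_mult mult.assoc)
    also have "\<dots> = ennreal p * ennreal (r powr p / p)"
      using nn_integral_powr_0[of "p - 1" r] assms that by (subst nn_integral_cmult) auto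
    finally show ?thesis using assms by (simp add: ennreal_mult[symmetric])
  qed
  let ?I = "\<integral>\<^sup>+l. ennreal (p * l powr (p - 1)) * indicator {0<..} l * indicator {l. ennreal l < x} l \<partial>lborel"
  show ?thesis
  proof (cases x)
    case (real r)
    have "?I = (\<integral>\<^sup>+l. ennreal (p * l powr (p - 1)) * indicator {0..r} l \<partial>lborel)"
    proof (rule nn_integral_cong_AE)
      have "AE l in lborel. l \<noteq> 0 \<and> l \<noteq> r" using AE_lborel_singleton[of 0] AE_lborel_singleton[of r] by eventually_elim auto
      then show "AE l in lborel. ennreal (p * l powr (p - 1)) * indicator {0<..} l * indicator {l. ennreal l < x} l = ennreal (p * l powr (p - 1)) * indicator {0..r} l"
        by eventually_elim (use real in \<open>auto simp: indicator_def ennreal_less_iff\<close>)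
    qed
    then show ?thesis using fin[of r] real by (simp add: epow_ennreal)
  next
    case top
    have "ennreal (real n powr p) \<le> ?I" for n
    proof -
      have "ennreal (real n powr p) = (\<integral>\<^sup>+l. ennreal (p * l powr (p - 1)) * indicator {0..real n} l \<partial>lborel)" using fin[of "real n"] by simp
      also have "\<dots> \<le> ?I"
      proof (rule nn_integral_mono_AE)
        show "AE l in lborel. ennreal (p * l powr (p - 1)) * indicator {0..real n} l \<le> ennreal (p * l powr (p - 1)) * indicator {0<..} l * indicator {l. ennreal l < x} l"
          using AE_lborel_singleton[of 0] by eventually_elim (use top in \<open>auto simp: indicator_def\<close>)
      qed
      finally show ?thesis .
    qed
    note le = this
    have "?I = top"
    proof -
      have "ennreal B \<le> ?I" for B
      proof -
        obtain n :: nat where "max B 1 powr (1 / p) \<le> real n" using real_arch_simple by blast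
        then have "(max B 1 powr (1 / p)) powr p \<le> real n powr p" using assms by (intro powr_mono2) auto
        then have "B \<le> real n powr p" using assms by (simp add: powr_powr)
        then show ?thesis using le[of n] by (meson ennreal_leI order_trans)
      qed
      then show ?thesis
        by (cases ?I) (metis ennreal_le_iff gt_ex not_le)+
    qed
    then show ?thesis using top by simp
  qed
qed

lemma layer_cake:
  fixes F :: "'b \<Rightarrow> ennreal"
  assumes "sigma_finite_measure N" and [measurable]: "F \<in> borel_measurable N" and p: "p > 0"
  shows "(\<integral>\<^sup>+y. epow (F y) p \<partial>N) =
    (\<integral>\<^sup>+l. ennreal (p * l powr (p - 1)) * indicator {0<..} l * emeasure N {y \<in> space N. ennreal l < F y} \<partial>lborel)"
proof -
  interpret N: sigma_finite_measure N by fact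
  interpret pair_sigma_finite N "lborel :: real measure" ..
  have m: "(\<lambda>(y, l). ennreal (p * l powr (p - 1)) * indicator {0<..} l * indicator {l. ennreal l < F y} l) \<in> borel_measurable (N \<Otimes>\<^sub>M lborel)"
    unfolding indicator_def by measurable
  have "(\<integral>\<^sup>+y. epow (F y) p \<partial>N) = (\<integral>\<^sup>+y. (\<integral>\<^sup>+l. ennreal (p * l powr (p - 1)) * indicator {0<..} l * indicator {l. ennreal l < F y} l \<partial>lborel) \<partial>N)"
    by (simp only: layer_cake_pointwise[OF p])
  also have "\<dots> = (\<integral>\<^sup>+l. (\<integral>\<^sup>+y. ennreal (p * l powr (p - 1)) * indicator {0<..} l * indicator {l. ennreal l < F y} l \<partial>N) \<partial>lborel)"
    using Fubini'[OF m] by simp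
  also have "\<dots> = (\<integral>\<^sup>+l. ennreal (p * l powr (p - 1)) * indicator {0<..} l * emeasure N {y \<in> space N. ennreal l < F y} \<partial>lborel)"
  proof (rule nn_integral_cong)
    fix l :: real
    have "(\<integral>\<^sup>+y. ennreal (p * l powr (p - 1)) * indicator {0<..} l * indicator {l. ennreal l < F y} l \<partial>N) =
      (\<integral>\<^sup>+y. ennreal (p * l powr (p - 1)) * indicator {0<..} l * indicator {y \<in> space N. ennreal l < F y} y \<partial>N)"
      by (rule nn_integral_cong) (simp add: indicator_def)
    then show "(\<integral>\<^sup>+y. ennreal (p * l powr (p - 1)) * indicator {0<..} l * indicator {l. ennreal l < F y} l \<partial>N) =
      ennreal (p * l powr (p - 1)) * indicator {0<..} l * emeasure N {y \<in> space N. ennreal l < F y}"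
      by (simp add: nn_integral_cmult_indicator)
  qed
  finally show ?thesis .
qed

text \<open>The first term is the integral of \<open>l powr (p - 1 - p0)\<close> over (0, 1]; the
  second is the integral over [1, \<infinity>) after the tail of the smooth cut has contributed
  \<open>l powr (- 2 * k * p0)\<close>. Both are finite and positive for p0 < p < p0 + 2 k
  p0.\<close>

definition marc_const :: "nat \<Rightarrow> real \<Rightarrow> real \<Rightarrow> real" where
  "marc_const k p0 p = 1 / (p - p0) + 1 / (2 * real k * p0 + p0 - p)"

text \<open>For fixed height u the break point is l = u/c, where the truncation height c l reaches
  u. A sharp cut would end the integral there; the smooth cut continues with (s/l)^(2k), and p < p0
  + 2 k p0 makes this tail converge.\<close>

lemma marcinkiewicz_high:
  assumes "0 < p0" "p0 < p" "p < p0 + 2 * real k * p0" "c > 0" "u \<ge> 0"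
  shows "(\<integral>\<^sup>+l. ennreal (l powr (p - 1 - p0) * (u * min 1 ((u / (c * l)) ^ (2 * k))) powr p0) * indicator {0<..} l \<partial>lborel)
    \<le> ennreal (marc_const k p0 p * c powr (p0 - p) * u powr p)"
proof (cases "u = 0")
  case True then show ?thesis by simp
next
  case False
  then have u: "u > 0" using assms by simp
  define s where "s = u / c"
  have s: "s > 0" using u assms by (simp add: s_def)
  define e where "e = p - 1 - p0 - 2 * real k * p0"
  have pw: "(u / (c * l)) ^ (2 * k) = (s / l) powr (2 * real k)" if "l > 0" for l
  proof -
    have "(s / l) powr real (2 * k) = (s / l) ^ (2 * k)" by (rule powr_realpow) (use s that in simp)
    then show ?thesis by (simp add: s_def)
  qed
  have "(\<integral>\<^sup>+l. ennreal (l powr (p - 1 - p0) * (u * min 1 ((u / (c * l)) ^ (2 * k))) powr p0) * indicator {0<..} l \<partial>lborel)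
    \<le> ennreal (u powr p0 * (s powr (p - 1 - p0 + 1) / (p - 1 - p0 + 1)) + (u powr p0 * s powr (2 * real k * p0)) * (s powr (e + 1) / (- (e + 1))))"
  proof (rule nn_integral_power_split)
    fix l :: real assume l: "0 < l" "l \<le> s"
    have "(u * min 1 ((u / (c * l)) ^ (2 * k))) powr p0 \<le> u powr p0"
      using u l s assms(1) by (intro powr_mono2) (auto simp: mult_left_le pw)
    from mult_left_mono[OF this, of "l powr (p - 1 - p0)"]
    show "l powr (p - 1 - p0) * (u * min 1 ((u / (c * l)) ^ (2 * k))) powr p0 \<le> u powr p0 * l powr (p - 1 - p0)"
      by (simp only: mult.commute[of "u powr p0"] powr_ge_zero)
  next
    fix l assume l: "s \<le> l"
    with s have l0: "l > 0" by simp
    have "(u * min 1 ((u / (c * l)) ^ (2 * k))) powr p0 \<le> (u * (s / l) powr (2 * real k)) powr p0"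
      using u l l0 s assms(1) by (intro powr_mono2) (auto simp: pw)
    also have "\<dots> = u powr p0 * s powr (2 * real k * p0) / l powr (2 * real k * p0)"
      using u l0 s by (simp add: powr_mult powr_powr powr_divide)
    finally have "l powr (p - 1 - p0) * (u * min 1 ((u / (c * l)) ^ (2 * k))) powr p0 \<le> l powr (p - 1 - p0) * (u powr p0 * s powr (2 * real k * p0) / l powr (2 * real k * p0))"
      by (intro mult_left_mono) auto
    also have "\<dots> = u powr p0 * s powr (2 * real k * p0) * l powr e"
      using l0 by (simp add: e_def powr_diff)
    finally show "l powr (p - 1 - p0) * (u * min 1 ((u / (c * l)) ^ (2 * k))) powr p0 \<le> u powr p0 * s powr (2 * real k * p0) * l powr e" .
  qed (use assms s in \<open>auto simp: e_def\<close>)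
  also have "u powr p0 * (s powr (p - 1 - p0 + 1) / (p - 1 - p0 + 1)) + (u powr p0 * s powr (2 * real k * p0)) * (s powr (e + 1) / (- (e + 1)))
    = marc_const k p0 p * c powr (p0 - p) * u powr p"
  proof -
    have 1: "u powr p0 * s powr (p - p0) = c powr (p0 - p) * u powr p"
    proof -
      have "s powr (p - p0) = u powr (p - p0) * c powr (p0 - p)"
        using u assms by (simp add: s_def powr_divide powr_diff)
      moreover have "u powr p0 * u powr (p - p0) = u powr p" using u by (simp flip: powr_add)
      ultimately show ?thesis by (simp add: mult_ac)
    qed
    have 2: "s powr (2 * real k * p0) * s powr (e + 1) = s powr (p - p0)"
      by (simp add: powr_add[symmetric] e_def)
    have 3: "p - 1 - p0 + 1 = p - p0" "- (e + 1) = 2 * real k * p0 + p0 - p" by (simp_all add: e_def)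
    have "(u powr p0 * s powr (2 * real k * p0)) * (s powr (e + 1) / (- (e + 1))) = u powr p0 * s powr (p - p0) / (- (e + 1))"
      using 2 by (simp add: mult.assoc)
    then show ?thesis unfolding 3 1 marc_const_def by (simp add: 1 distrib_right)
  qed
  finally show ?thesis .
qed

lemma marcinkiewicz_low:
  assumes "0 < p" "p < p1" "c > 0" "u \<ge> 0"
  shows "(\<integral>\<^sup>+l. ennreal (l powr (p - 1 - p1) * (min u (c * l)) powr p1) * indicator {0<..} l \<partial>lborel)
    \<le> ennreal ((1 / p + 1 / (p1 - p)) * c powr (p1 - p) * u powr p)"
proof (cases "u = 0")
  case True
  have "(\<integral>\<^sup>+l. ennreal (l powr (p - 1 - p1) * (min u (c * l)) powr p1) * indicator {0<..} l \<partial>lborel) = (\<integral>\<^sup>+l. 0 \<partial>(lborel :: real measure))"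
    using True assms by (intro nn_integral_cong) (auto simp: indicator_def min_def)
  then show ?thesis using True by simp
next
  case False
  then have u: "u > 0" using assms by simp
  define s where "s = u / c"
  have s: "s > 0" using u assms by (simp add: s_def)
  have "(\<integral>\<^sup>+l. ennreal (l powr (p - 1 - p1) * (min u (c * l)) powr p1) * indicator {0<..} l \<partial>lborel)
    \<le> ennreal (c powr p1 * (s powr (p - 1 + 1) / (p - 1 + 1)) + u powr p1 * (s powr (p - 1 - p1 + 1) / (- (p - 1 - p1 + 1))))"
  proof (rule nn_integral_power_split)
    fix l :: real assume l: "0 < l" "l \<le> s"
    have "(min u (c * l)) powr p1 \<le> (c * l) powr p1"
      using u l assms by (intro powr_mono2) auto
    then have "l powr (p - 1 - p1) * (min u (c * l)) powr p1 \<le> l powr (p - 1 - p1) * (c powr p1 * l powr p1)"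
      using assms l by (intro mult_left_mono) (auto simp: powr_mult)
    also have "\<dots> = c powr p1 * l powr (p - 1)" using l by (simp add: powr_diff)
    finally show "l powr (p - 1 - p1) * (min u (c * l)) powr p1 \<le> c powr p1 * l powr (p - 1)" .
  next
    fix l assume l: "s \<le> l"
    have "(min u (c * l)) powr p1 \<le> u powr p1" using u l s assms by (intro powr_mono2) auto
    from mult_left_mono[OF this, of "l powr (p - 1 - p1)"]
    show "l powr (p - 1 - p1) * (min u (c * l)) powr p1 \<le> u powr p1 * l powr (p - 1 - p1)"
      by (simp only: mult.commute[of "u powr p1"] powr_ge_zero)
  qed (use assms s in auto)
  also have "c powr p1 * (s powr (p - 1 + 1) / (p - 1 + 1)) + u powr p1 * (s powr (p - 1 - p1 + 1) / (- (p - 1 - p1 + 1)))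
    = (1 / p + 1 / (p1 - p)) * c powr (p1 - p) * u powr p"
  proof -
    have 1: "c powr p1 * s powr p = c powr (p1 - p) * u powr p"
      using u assms by (simp add: s_def powr_divide powr_diff)
    have 2: "u powr p1 * s powr (p - p1) = c powr (p1 - p) * u powr p"
      using u assms by (simp add: s_def powr_divide powr_diff)
    have 3: "p - 1 + 1 = p" "p - 1 - p1 + 1 = p - p1" "- (p - p1) = p1 - p" by simp_all
    show ?thesis unfolding 3 times_divide_eq_right 1 2 by (simp add: distrib_right)
  qed
  finally show ?thesis .
qed

text \<open>The layer cake formula, Tonelli's theorem, and the one-dimensional integrals for each
  fixed x. The statement speaks of a distribution function rather than of an operator, so the case
  of an infinite endpoint can reuse it with A1 = 0.\<close>

lemma marcinkiewicz_distribution: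
  fixes u :: "'a::euclidean_space \<Rightarrow> real" and G :: "'b \<Rightarrow> ennreal"
  assumes N: "sigma_finite_measure N" and G: "G \<in> borel_measurable N"
    and um[measurable]: "u \<in> borel_measurable borel" and u0: "\<And>x. u x \<ge> 0"
    and p: "0 < p0" "p0 < p" "p < p0 + 2 * real k * p0" "p < p1" and c: "c > 0" and A: "A0 \<ge> 0" "A1 \<ge> 0"
    and D: "\<And>l. l > 0 \<Longrightarrow> emeasure N {y \<in> space N. ennreal l < G y} \<le>
      ennreal (A0 / l powr p0) * (\<integral>\<^sup>+x. ennreal ((u x * min 1 ((u x / (c * l)) ^ (2 * k))) powr p0) \<partial>lborel)
      + ennreal (A1 / l powr p1) * (\<integral>\<^sup>+x. ennreal ((min (u x) (c * l)) powr p1) \<partial>lborel)"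
  shows "(\<integral>\<^sup>+y. epow (G y) p \<partial>N) \<le>
    ennreal (p * (A0 * marc_const k p0 p * c powr (p0 - p) + A1 * (1 / p + 1 / (p1 - p)) * c powr (p1 - p))) * (\<integral>\<^sup>+x. ennreal (u x powr p) \<partial>lborel)"
proof -
  have p': "p > 0" using p by simp
  let ?h = "\<lambda>l x. ennreal (l powr (p - 1 - p0) * (u x * min 1 ((u x / (c * l)) ^ (2 * k))) powr p0) * indicator {0<..} l"
  let ?g = "\<lambda>l x. ennreal (l powr (p - 1 - p1) * (min (u x) (c * l)) powr p1) * indicator {0<..} l"
  have hm: "(\<lambda>(l, x). ?h l x) \<in> borel_measurable (lborel \<Otimes>\<^sub>M lborel)" unfolding indicator_def by measurable
  have gm: "(\<lambda>(l, x). ?g l x) \<in> borel_measurable (lborel \<Otimes>\<^sub>M lborel)" unfolding indicator_def by measurable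
  note [measurable] = hm gm
  have "(\<integral>\<^sup>+y. epow (G y) p \<partial>N) = (\<integral>\<^sup>+l. ennreal (p * l powr (p - 1)) * indicator {0<..} l * emeasure N {y \<in> space N. ennreal l < G y} \<partial>lborel)"
    by (rule layer_cake[OF N G p'])
  also have "\<dots> \<le> (\<integral>\<^sup>+l. ennreal (p * A0) * (\<integral>\<^sup>+x. ?h l x \<partial>lborel) + ennreal (p * A1) * (\<integral>\<^sup>+x. ?g l x \<partial>lborel) \<partial>lborel)"
  proof (rule nn_integral_mono)
    fix l :: real
    show "ennreal (p * l powr (p - 1)) * indicator {0<..} l * emeasure N {y \<in> space N. ennreal l < G y} \<le>
       ennreal (p * A0) * (\<integral>\<^sup>+x. ?h l x \<partial>lborel) + ennreal (p * A1) * (\<integral>\<^sup>+x. ?g l x \<partial>lborel)"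
    proof (cases "l > 0")
      case True
      have e0: "ennreal (p * l powr (p - 1)) * ennreal (A0 / l powr p0) = ennreal (p * A0) * ennreal (l powr (p - 1 - p0))"
        using True p' A by (simp add: ennreal_mult[symmetric] powr_diff mult_ac)
      have e1: "ennreal (p * l powr (p - 1)) * ennreal (A1 / l powr p1) = ennreal (p * A1) * ennreal (l powr (p - 1 - p1))"
        using True p' A by (simp add: ennreal_mult[symmetric] powr_diff mult_ac)
      have "ennreal (p * l powr (p - 1)) * indicator {0<..} l * emeasure N {y \<in> space N. ennreal l < G y} \<le>
        ennreal (p * l powr (p - 1)) * (ennreal (A0 / l powr p0) * (\<integral>\<^sup>+x. ennreal ((u x * min 1 ((u x / (c * l)) ^ (2 * k))) powr p0) \<partial>lborel)
        + ennreal (A1 / l powr p1) * (\<integral>\<^sup>+x. ennreal ((min (u x) (c * l)) powr p1) \<partial>lborel))"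
        using D[OF True] True by (auto intro!: mult_left_mono)
      also have "\<dots> = ennreal (p * A0) * (ennreal (l powr (p - 1 - p0)) * (\<integral>\<^sup>+x. ennreal ((u x * min 1 ((u x / (c * l)) ^ (2 * k))) powr p0) \<partial>lborel))
        + ennreal (p * A1) * (ennreal (l powr (p - 1 - p1)) * (\<integral>\<^sup>+x. ennreal ((min (u x) (c * l)) powr p1) \<partial>lborel))"
        by (simp only: distrib_left mult.assoc[symmetric] e0 e1)
      also have "ennreal (l powr (p - 1 - p0)) * (\<integral>\<^sup>+x. ennreal ((u x * min 1 ((u x / (c * l)) ^ (2 * k))) powr p0) \<partial>lborel) = (\<integral>\<^sup>+x. ?h l x \<partial>lborel)"
        using True by (subst nn_integral_cmult[symmetric]) (auto simp: ennreal_mult)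
      also have "ennreal (l powr (p - 1 - p1)) * (\<integral>\<^sup>+x. ennreal ((min (u x) (c * l)) powr p1) \<partial>lborel) = (\<integral>\<^sup>+x. ?g l x \<partial>lborel)"
        using True by (subst nn_integral_cmult[symmetric]) (auto simp: ennreal_mult)
      finally show ?thesis .
    qed simp
  qed
  also have "\<dots> = ennreal (p * A0) * (\<integral>\<^sup>+l. (\<integral>\<^sup>+x. ?h l x \<partial>lborel) \<partial>lborel) + ennreal (p * A1) * (\<integral>\<^sup>+l. (\<integral>\<^sup>+x. ?g l x \<partial>lborel) \<partial>lborel)"
    by (subst nn_integral_add) (auto simp: nn_integral_cmult)
  also have "(\<integral>\<^sup>+l. (\<integral>\<^sup>+x. ?h l x \<partial>lborel) \<partial>lborel) = (\<integral>\<^sup>+x. (\<integral>\<^sup>+l. ?h l x \<partial>lborel) \<partial>lborel)"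
    using lborel_pair.Fubini'[OF hm] by simp
  also have "(\<integral>\<^sup>+l. (\<integral>\<^sup>+x. ?g l x \<partial>lborel) \<partial>lborel) = (\<integral>\<^sup>+x. (\<integral>\<^sup>+l. ?g l x \<partial>lborel) \<partial>lborel)"
    using lborel_pair.Fubini'[OF gm] by simp
  also have "(\<integral>\<^sup>+x. (\<integral>\<^sup>+l. ?h l x \<partial>lborel) \<partial>lborel) \<le> (\<integral>\<^sup>+x. ennreal (marc_const k p0 p * c powr (p0 - p)) * ennreal (u x powr p) \<partial>lborel)"
    using marcinkiewicz_high[OF p(1,2,3) c u0] p
    by (intro nn_integral_mono) (simp add: ennreal_mult[symmetric] marc_const_def)
  also have "\<dots> = ennreal (marc_const k p0 p * c powr (p0 - p)) * (\<integral>\<^sup>+x. ennreal (u x powr p) \<partial>lborel)"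
    by (rule nn_integral_cmult) measurable
  also have "(\<integral>\<^sup>+x. (\<integral>\<^sup>+l. ?g l x \<partial>lborel) \<partial>lborel) \<le> (\<integral>\<^sup>+x. ennreal ((1 / p + 1 / (p1 - p)) * c powr (p1 - p)) * ennreal (u x powr p) \<partial>lborel)"
    using marcinkiewicz_low[OF p' p(4) c u0] p p'
    by (intro nn_integral_mono) (simp add: ennreal_mult[symmetric])
  also have "\<dots> = ennreal ((1 / p + 1 / (p1 - p)) * c powr (p1 - p)) * (\<integral>\<^sup>+x. ennreal (u x powr p) \<partial>lborel)"
    by (rule nn_integral_cmult) measurable
  finally have "(\<integral>\<^sup>+y. epow (G y) p \<partial>N) \<le> ennreal (p * A0) * (ennreal (marc_const k p0 p * c powr (p0 - p)) * (\<integral>\<^sup>+x. ennreal (u x powr p) \<partial>lborel))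
      + ennreal (p * A1) * (ennreal ((1 / p + 1 / (p1 - p)) * c powr (p1 - p)) * (\<integral>\<^sup>+x. ennreal (u x powr p) \<partial>lborel))"
    by (simp add: add_mono mult_left_mono)
  also have "\<dots> = (ennreal (p * A0) * ennreal (marc_const k p0 p * c powr (p0 - p)) + ennreal (p * A1) * ennreal ((1 / p + 1 / (p1 - p)) * c powr (p1 - p)))
      * (\<integral>\<^sup>+x. ennreal (u x powr p) \<partial>lborel)"
    by (simp only: distrib_right mult.assoc)
  also have "ennreal (p * A0) * ennreal (marc_const k p0 p * c powr (p0 - p)) + ennreal (p * A1) * ennreal ((1 / p + 1 / (p1 - p)) * c powr (p1 - p))
    = ennreal (p * (A0 * marc_const k p0 p * c powr (p0 - p) + A1 * (1 / p + 1 / (p1 - p)) * c powr (p1 - p)))"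
  proof -
    have n: "0 \<le> marc_const k p0 p" "0 \<le> 1 / p + 1 / (p1 - p)" using p p' by (simp_all add: marc_const_def)
    show ?thesis using n p' A
      by (simp only: ennreal_mult[symmetric] ennreal_plus[symmetric] mult_nonneg_nonneg powr_ge_zero order.strict_implies_order)
         (simp add: distrib_left mult_ac)
  qed
  finally show ?thesis .
qed

text \<open>A is the p-th power of the weak-type constant, so no roots appear in the
  interpolation.\<close>

definition weak_type :: "'b measure \<Rightarrow> (('a::euclidean_space \<Rightarrow> complex) \<Rightarrow> 'b \<Rightarrow> ennreal) \<Rightarrow> real \<Rightarrow> real \<Rightarrow> bool" where
  "weak_type N T p A \<longleftrightarrow> (\<forall>h l. schwartz h \<longrightarrow> 0 < l \<longrightarrow>
     emeasure N {y \<in> space N. ennreal l < T h y} \<le> ennreal (A / l powr p) * (\<integral>\<^sup>+x. ennreal (norm (h x) powr p) \<partial>lborel))"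

lemma strong_imp_weak_type:
  fixes T :: "('a::euclidean_space \<Rightarrow> complex) \<Rightarrow> 'b \<Rightarrow> ennreal"
  assumes [measurable]: "\<And>h. schwartz h \<Longrightarrow> T h \<in> borel_measurable N" and p: "p > 0" and A: "A \<ge> 0"
    and strong: "\<And>h. schwartz h \<Longrightarrow> (\<integral>\<^sup>+y. epow (T h y) p \<partial>N) \<le> ennreal A * (\<integral>\<^sup>+x. ennreal (norm (h x) powr p) \<partial>lborel)"
  shows "weak_type N T p A"
  unfolding weak_type_def
proof (intro allI impI)
  fix h :: "'a \<Rightarrow> complex" and l :: real assume h: "schwartz h" and l: "0 < l"
  note [measurable] = assms(1)[OF h]
  have lp: "l powr p > 0" using l by simp
  let ?E = "{y \<in> space N. ennreal l < T h y}"
  have "emeasure N ?E = (\<integral>\<^sup>+y. indicator ?E y \<partial>N)" by simp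
  also have "\<dots> \<le> (\<integral>\<^sup>+y. ennreal (1 / l powr p) * epow (T h y) p \<partial>N)"
  proof (rule nn_integral_mono)
    fix y assume "y \<in> space N"
    show "indicator ?E y \<le> ennreal (1 / l powr p) * epow (T h y) p"
    proof (cases "ennreal l < T h y")
      case True
      then have "epow (ennreal l) p \<le> epow (T h y) p" using p by (intro epow_mono) auto
      then have "ennreal (1 / l powr p) * epow (ennreal l) p \<le> ennreal (1 / l powr p) * epow (T h y) p" by (rule mult_left_mono) simp
      moreover have "ennreal (1 / l powr p) * epow (ennreal l) p = 1"
        using l lp by (simp add: epow_ennreal ennreal_mult[symmetric])
      ultimately show ?thesis using True by (auto simp: indicator_def)
    qed (auto simp: indicator_def)
  qed
  also have "\<dots> = ennreal (1 / l powr p) * (\<integral>\<^sup>+y. epow (T h y) p \<partial>N)" by (rule nn_integral_cmult) measurable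
  also have "\<dots> \<le> ennreal (1 / l powr p) * (ennreal A * (\<integral>\<^sup>+x. ennreal (norm (h x) powr p) \<partial>lborel))"
    by (intro mult_left_mono strong h) simp
  also have "\<dots> = ennreal (A / l powr p) * (\<integral>\<^sup>+x. ennreal (norm (h x) powr p) \<partial>lborel)"
    using A by (simp add: mult.assoc[symmetric] ennreal_mult[symmetric])
  finally show "emeasure N ?E \<le> ennreal (A / l powr p) * (\<integral>\<^sup>+x. ennreal (norm (h x) powr p) \<partial>lborel)" .
qed

text \<open>The constant 2 accommodates square functions, for which the triangle inequality is
  obtained by way of |a + b|^2 \<le> 2 |a|^2 + 2 |b|^2.\<close>

definition quasi_sublinear :: "'b measure \<Rightarrow> (('a::euclidean_space \<Rightarrow> complex) \<Rightarrow> 'b \<Rightarrow> ennreal) \<Rightarrow> bool" where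
  "quasi_sublinear N T \<longleftrightarrow> (\<forall>h. schwartz h \<longrightarrow> T h \<in> borel_measurable N) \<and>
     (\<forall>g h. schwartz g \<longrightarrow> schwartz h \<longrightarrow> (\<forall>y. T (\<lambda>x. g x + h x) y \<le> 2 * (T g y + T h y)))"

text \<open>If both parts are at most l, the quasi-triangle inequality gives T f \<le> 2 (l + l) = 4
  l; this is the source of the factor 1/4.\<close>

lemma quasi_sublinear_split:
  assumes q: "quasi_sublinear N T" and f: "schwartz f" and k: "k > 0" and l: "l > 0"
  shows "emeasure N {y \<in> space N. ennreal l < ennreal (1/4) * T f y} \<le>
    emeasure N {y \<in> space N. ennreal l < T (high_part k \<mu> f) y} + emeasure N {y \<in> space N. ennreal l < T (low_part k \<mu> f) y}"
proof -
  have s: "schwartz (high_part k \<mu> f)" "schwartz (low_part k \<mu> f)"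
    using schwartz_high_part[OF f k] schwartz_low_part[OF f k] by auto
  have [measurable]: "T (high_part k \<mu> f) \<in> borel_measurable N" "T (low_part k \<mu> f) \<in> borel_measurable N"
    using q s by (auto simp: quasi_sublinear_def)
  have fe: "f = (\<lambda>x. high_part k \<mu> f x + low_part k \<mu> f x)" by (simp add: high_part_def)
  have T: "T f y \<le> 2 * (T (high_part k \<mu> f) y + T (low_part k \<mu> f) y)" for y
    using q s fe unfolding quasi_sublinear_def by metis
  have "{y \<in> space N. ennreal l < ennreal (1/4) * T f y} \<subseteq> {y \<in> space N. ennreal l < T (high_part k \<mu> f) y} \<union> {y \<in> space N. ennreal l < T (low_part k \<mu> f) y}"
  proof (rule subsetI, rule ccontr)
    fix y assume y: "y \<in> {y \<in> space N. ennreal l < ennreal (1/4) * T f y}"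
      "y \<notin> {y \<in> space N. ennreal l < T (high_part k \<mu> f) y} \<union> {y \<in> space N. ennreal l < T (low_part k \<mu> f) y}"
    then have "T (high_part k \<mu> f) y \<le> ennreal l" "T (low_part k \<mu> f) y \<le> ennreal l" by auto
    then have "T f y \<le> 2 * (ennreal l + ennreal l)" by (meson T add_mono mult_left_mono order_trans zero_le)
    then have "ennreal (1/4) * T f y \<le> ennreal (1/4) * (2 * (ennreal l + ennreal l))" by (rule mult_left_mono) simp
    also have "2 * (ennreal l + ennreal l) = ennreal (4 * l)"
      using l ennreal_mult[of 2 "l + l"] by (simp flip: ennreal_plus)
    also have "ennreal (1/4) * ennreal (4 * l) = ennreal l" using l by (simp flip: ennreal_mult)
    finally show False using y by auto
  qed
  then have "emeasure N {y \<in> space N. ennreal l < ennreal (1/4) * T f y} \<le> emeasure N ({y \<in> space N. ennreal l < T (high_part k \<mu> f) y} \<union> {y \<in> space N. ennreal l < T (low_part k \<mu> f) y})"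
    by (rule emeasure_mono) measurable
  also have "\<dots> \<le> emeasure N {y \<in> space N. ennreal l < T (high_part k \<mu> f) y} + emeasure N {y \<in> space N. ennreal l < T (low_part k \<mu> f) y}"
    by (rule emeasure_subadditive) measurable
  finally show ?thesis .
qed

lemma weak_type_high:
  assumes w: "weak_type N T p0 A0" and f: "schwartz f" and k: "k > 0" and p0: "p0 > 0" and l: "l > 0"
  shows "emeasure N {y \<in> space N. ennreal l < T (high_part k \<mu> f) y} \<le>
    ennreal (A0 / l powr p0) * (\<integral>\<^sup>+x. ennreal ((norm (f x) * min 1 ((norm (f x) / \<mu>) ^ (2 * k))) powr p0) \<partial>lborel)"
proof -
  have "emeasure N {y \<in> space N. ennreal l < T (high_part k \<mu> f) y} \<le> ennreal (A0 / l powr p0) * (\<integral>\<^sup>+x. ennreal (norm (high_part k \<mu> f x) powr p0) \<partial>lborel)"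
    using w schwartz_high_part[OF f k] l by (simp add: weak_type_def)
  also have "\<dots> \<le> ennreal (A0 / l powr p0) * (\<integral>\<^sup>+x. ennreal ((norm (f x) * min 1 ((norm (f x) / \<mu>) ^ (2 * k))) powr p0) \<partial>lborel)"
    using p0 by (intro mult_left_mono nn_integral_mono ennreal_leI powr_mono2 norm_high_part_le) auto
  finally show ?thesis .
qed

lemma weak_type_low:
  assumes w: "weak_type N T p1 A1" and f: "schwartz f" and k: "k > 0" and p1: "p1 > 0" and l: "l > 0" and mu: "\<mu> > 0"
  shows "emeasure N {y \<in> space N. ennreal l < T (low_part k \<mu> f) y} \<le>
    ennreal (A1 / l powr p1) * (\<integral>\<^sup>+x. ennreal ((min (norm (f x)) \<mu>) powr p1) \<partial>lborel)"
proof -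
  have "emeasure N {y \<in> space N. ennreal l < T (low_part k \<mu> f) y} \<le> ennreal (A1 / l powr p1) * (\<integral>\<^sup>+x. ennreal (norm (low_part k \<mu> f x) powr p1) \<partial>lborel)"
    using w schwartz_low_part[OF f k] l by (simp add: weak_type_def)
  also have "\<dots> \<le> ennreal (A1 / l powr p1) * (\<integral>\<^sup>+x. ennreal ((min (norm (f x)) \<mu>) powr p1) \<partial>lborel)"
    using p1 norm_low_part_le norm_low_part_le_level[OF mu k]
    by (intro mult_left_mono nn_integral_mono ennreal_leI powr_mono2) auto
  finally show ?thesis .
qed

lemma epow_quarter:
  assumes "p > 0" "F \<in> borel_measurable N"
  shows "(\<integral>\<^sup>+y. epow (F y) p \<partial>N) = ennreal (4 powr p) * (\<integral>\<^sup>+y. epow (ennreal (1/4) * F y) p \<partial>N)"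
proof -
  have e: "ennreal (4 powr p) * ennreal ((1/4) powr p) = 1"
    by (simp add: ennreal_mult[symmetric] powr_mult[symmetric])
  have "ennreal (4 powr p) * (\<integral>\<^sup>+y. epow (ennreal (1/4) * F y) p \<partial>N) = (\<integral>\<^sup>+y. ennreal (4 powr p) * epow (ennreal (1/4) * F y) p \<partial>N)"
    using assms by (intro nn_integral_cmult[symmetric]) measurable
  also have "\<dots> = (\<integral>\<^sup>+y. epow (F y) p \<partial>N)"
    using assms by (intro nn_integral_cong) (simp add: epow_mult epow_ennreal mult.assoc[symmetric] e)
  finally show ?thesis by simp
qed

text \<open>The free parameter \<open>c\<close> couples the truncation height to the level; optimising over it
  reproduces the interpolated operator norm.\<close>

theorem marcinkiewicz:
  assumes N: "sigma_finite_measure N" and q: "quasi_sublinear N T" and p: "0 < p0" "p0 < p" "p < p1"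
    and A: "A0 \<ge> 0" "A1 \<ge> 0" and w: "weak_type N T p0 A0" "weak_type N T p1 A1"
    and k: "p < p0 + 2 * real k * p0" and f: "schwartz f" and c: "c > 0"
  shows "(\<integral>\<^sup>+y. epow (T f y) p \<partial>N) \<le>
    ennreal (4 powr p * (p * (A0 * marc_const k p0 p * c powr (p0 - p) + A1 * (1 / p + 1 / (p1 - p)) * c powr (p1 - p)))) * (\<integral>\<^sup>+x. ennreal (norm (f x) powr p) \<partial>lborel)"
proof -
  have k0: "k > 0" using k p by (cases k) auto
  have m[measurable]: "T f \<in> borel_measurable N" using q f by (simp add: quasi_sublinear_def)
  have "(\<integral>\<^sup>+y. epow (ennreal (1/4) * T f y) p \<partial>N) \<le>
    ennreal (p * (A0 * marc_const k p0 p * c powr (p0 - p) + A1 * (1 / p + 1 / (p1 - p)) * c powr (p1 - p))) * (\<integral>\<^sup>+x. ennreal (norm (f x) powr p) \<partial>lborel)"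
  proof (rule marcinkiewicz_distribution[OF N])
    fix l :: real assume l: "l > 0"
    show "emeasure N {y \<in> space N. ennreal l < ennreal (1/4) * T f y} \<le>
      ennreal (A0 / l powr p0) * (\<integral>\<^sup>+x. ennreal ((norm (f x) * min 1 ((norm (f x) / (c * l)) ^ (2 * k))) powr p0) \<partial>lborel)
      + ennreal (A1 / l powr p1) * (\<integral>\<^sup>+x. ennreal ((min (norm (f x)) (c * l)) powr p1) \<partial>lborel)"
      by (rule order_trans[OF quasi_sublinear_split[OF q f k0 l]], rule add_mono, rule weak_type_high[OF w(1) f k0 p(1) l], rule weak_type_low[OF w(2) f k0 _ l])
         (use p c l in auto)
  qed (use p A k c schwartz_measurable[OF f] in auto)
  then show ?thesis
    using p unfolding epow_quarter[OF order.strict_trans[OF p(1,2)] m]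
    by (subst ennreal_mult') (auto simp: mult.assoc intro!: mult_left_mono)
qed

text \<open>Truncating at height l / B makes T of the low part at most l almost everywhere, so only
  the high part contributes to the level set. This fixes c = 1/B and turns the factor
  \<open>c powr (p0 - p)\<close> into \<open>B powr (p - p0)\<close>.\<close>

theorem marcinkiewicz_infinity:
  assumes N: "sigma_finite_measure N" and q: "quasi_sublinear N T" and p: "0 < p0" "p0 < p"
    and A: "A0 \<ge> 0" and w: "weak_type N T p0 A0" and B: "B > 0"
    and bd: "\<And>h \<mu>. schwartz h \<Longrightarrow> \<mu> > 0 \<Longrightarrow> (\<And>x. norm (h x) \<le> \<mu>) \<Longrightarrow> AE y in N. T h y \<le> ennreal (B * \<mu>)"
    and k: "p < p0 + 2 * real k * p0" and f: "schwartz f"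
  shows "(\<integral>\<^sup>+y. epow (T f y) p \<partial>N) \<le>
    ennreal (4 powr p * (p * (A0 * marc_const k p0 p * B powr (p - p0)))) * (\<integral>\<^sup>+x. ennreal (norm (f x) powr p) \<partial>lborel)"
proof -
  have k0: "k > 0" using k p by (cases k) auto
  have m[measurable]: "T f \<in> borel_measurable N" using q f by (simp add: quasi_sublinear_def)
  define c where "c = 1 / B"
  have c: "c > 0" using B by (simp add: c_def)
  \<comment> \<open>The upper endpoint is a placeholder: exponent p + 1 with constant A1 =
    0.\<close>
  have "(\<integral>\<^sup>+y. epow (ennreal (1/4) * T f y) p \<partial>N) \<le>
    ennreal (p * (A0 * marc_const k p0 p * c powr (p0 - p) + 0 * (1 / p + 1 / ((p + 1) - p)) * c powr ((p + 1) - p))) * (\<integral>\<^sup>+x. ennreal (norm (f x) powr p) \<partial>lborel)"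
  proof (rule marcinkiewicz_distribution[OF N])
    fix l :: real assume l: "l > 0"
    have "emeasure N {y \<in> space N. ennreal l < T (low_part k (c * l) f) y} = 0"
    proof -
      have s: "schwartz (low_part k (c * l) f)" by (rule schwartz_low_part[OF f k0])
      have [measurable]: "T (low_part k (c * l) f) \<in> borel_measurable N" using q s by (simp add: quasi_sublinear_def)
      have "AE y in N. T (low_part k (c * l) f) y \<le> ennreal (B * (c * l))"
        using c l k0 by (intro bd s norm_low_part_le_level) auto
      then have "AE y in N. \<not> ennreal l < T (low_part k (c * l) f) y"
        using B by (simp add: c_def not_less)
      then show ?thesis by (subst (asm) AE_iff_measurable[OF _ refl]) auto
    qed
    then have "emeasure N {y \<in> space N. ennreal l < ennreal (1/4) * T f y} \<le> emeasure N {y \<in> space N. ennreal l < T (high_part k (c * l) f) y}"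
      using quasi_sublinear_split[OF q f k0 l, of "c * l"] by simp
    also have "\<dots> \<le> ennreal (A0 / l powr p0) * (\<integral>\<^sup>+x. ennreal ((norm (f x) * min 1 ((norm (f x) / (c * l)) ^ (2 * k))) powr p0) \<partial>lborel)"
      by (rule weak_type_high[OF w f k0 p(1) l])
    finally show "emeasure N {y \<in> space N. ennreal l < ennreal (1/4) * T f y} \<le>
      ennreal (A0 / l powr p0) * (\<integral>\<^sup>+x. ennreal ((norm (f x) * min 1 ((norm (f x) / (c * l)) ^ (2 * k))) powr p0) \<partial>lborel)
      + ennreal (0 / l powr (p + 1)) * (\<integral>\<^sup>+x. ennreal ((min (norm (f x)) (c * l)) powr (p + 1)) \<partial>lborel)" by simp
  qed (use p A k c schwartz_measurable[OF f] in auto)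
  moreover have "c powr (p0 - p) = B powr (p - p0)" using B by (simp add: c_def powr_divide powr_diff)
  ultimately show ?thesis
    using p unfolding epow_quarter[OF order.strict_trans[OF p(1,2)] m]
    by (subst ennreal_mult') (auto simp: mult.assoc intro!: mult_left_mono)
qed

section \<open>The Hardy--Littlewood maximal function\<close>

definition ball_mean :: "('a::euclidean_space \<Rightarrow> complex) \<Rightarrow> 'a \<Rightarrow> real \<Rightarrow> ennreal" where
  "ball_mean f z r = ennreal (1 / (unit_ball_vol DIM('a) * r ^ DIM('a))) * (\<integral>\<^sup>+y. ennreal (norm (f y)) * indicator (ball z r) y \<partial>lborel)"

text \<open>The uncentred version: its superlevel sets are unions of open balls, hence open, which
  settles measurability.\<close>

definition hl_max :: "('a::euclidean_space \<Rightarrow> complex) \<Rightarrow> 'a \<Rightarrow> ennreal" where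
  "hl_max f x = (SUP (z, r)\<in>{(z, r). 0 < r \<and> x \<in> ball z r}. ball_mean f z r)"

lemma ball_pred_measurable [measurable]: "Measurable.pred borel (\<lambda>x::'a::euclidean_space. x \<in> ball z r)"
  by (simp add: pred_def)

lemma ennreal_cancel_left:
  assumes "V > 0" shows "ennreal V * (ennreal (1 / V) * X) = X" "ennreal (1 / V) * (ennreal V * X) = X"
  using assms by (simp_all add: mult.assoc[symmetric] ennreal_mult[symmetric])

lemma ball_mean_le_hl_max: "0 < r \<Longrightarrow> x \<in> ball z r \<Longrightarrow> ball_mean f z r \<le> hl_max f x"
  unfolding hl_max_def by (rule SUP_upper2[of "(z, r)"]) auto

lemma integral_ball_le_hl_max:
  fixes f :: "'a::euclidean_space \<Rightarrow> complex"
  assumes "0 < r" "x \<in> ball z r"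
  shows "(\<integral>\<^sup>+y. ennreal (norm (f y)) * indicator (ball z r) y \<partial>lborel) \<le> ennreal (unit_ball_vol DIM('a) * r ^ DIM('a)) * hl_max f x"
proof -
  let ?V = "unit_ball_vol (real DIM('a)) * r ^ DIM('a)"
  have V: "?V > 0" using assms by simp
  have "ennreal ?V * ball_mean f z r = (\<integral>\<^sup>+y. ennreal (norm (f y)) * indicator (ball z r) y \<partial>lborel)"
    unfolding ball_mean_def by (rule ennreal_cancel_left[OF V])
  then show ?thesis using mult_left_mono[OF ball_mean_le_hl_max[OF assms, of f], of "ennreal ?V"] by simp
qed

lemma hl_max_measurable [measurable]: "hl_max f \<in> borel_measurable borel"
proof (rule borel_measurableI_greater)
  fix a
  have "{x \<in> space borel. a < hl_max f x} = (\<Union>(z, r)\<in>{(z, r). 0 < r \<and> a < ball_mean f z r}. ball z r)"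
    by (auto simp: hl_max_def less_SUP_iff) blast
  also have "open \<dots>" by (intro open_UN) auto
  finally show "{x \<in> space borel. a < hl_max f x} \<in> sets borel" by simp
qed

lemma hl_max_add:
  fixes f g :: "'a::euclidean_space \<Rightarrow> complex"
  assumes [measurable]: "f \<in> borel_measurable borel" "g \<in> borel_measurable borel"
  shows "hl_max (\<lambda>x. f x + g x) x \<le> hl_max f x + hl_max g x"
proof -
  have "ball_mean (\<lambda>x. f x + g x) z r \<le> hl_max f x + hl_max g x" if zr: "0 < r" "x \<in> ball z r" for z r
  proof -
    have "(\<integral>\<^sup>+y. ennreal (norm (f y + g y)) * indicator (ball z r) y \<partial>lborel) \<le>
      (\<integral>\<^sup>+y. ennreal (norm (f y)) * indicator (ball z r) y + ennreal (norm (g y)) * indicator (ball z r) y \<partial>lborel)"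
      by (intro nn_integral_mono)
         (auto simp: distrib_right[symmetric] ennreal_plus[symmetric] norm_triangle_ineq intro!: mult_right_mono ennreal_leI simp del: ennreal_plus)
    also have "\<dots> = (\<integral>\<^sup>+y. ennreal (norm (f y)) * indicator (ball z r) y \<partial>lborel) + (\<integral>\<^sup>+y. ennreal (norm (g y)) * indicator (ball z r) y \<partial>lborel)"
      by (rule nn_integral_add) measurable
    finally have "ball_mean (\<lambda>x. f x + g x) z r \<le> ball_mean f z r + ball_mean g z r"
      unfolding ball_mean_def distrib_left[symmetric] by (rule mult_left_mono) simp
    also have "\<dots> \<le> hl_max f x + hl_max g x" by (intro add_mono ball_mean_le_hl_max zr)
    finally show ?thesis .
  qed
  then show ?thesis unfolding hl_max_def[of "\<lambda>x. f x + g x"] by (intro SUP_least) auto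
qed

lemma hl_max_bounded:
  fixes f :: "'a::euclidean_space \<Rightarrow> complex"
  assumes "\<And>x. norm (f x) \<le> \<mu>" shows "hl_max f x \<le> ennreal \<mu>"
proof -
  have mu: "\<mu> \<ge> 0" using order_trans[OF norm_ge_zero assms] .
  have "ball_mean f z r \<le> ennreal \<mu>" if r: "0 < r" for z r
  proof -
    let ?V = "unit_ball_vol (real DIM('a)) * r ^ DIM('a)"
    have V: "?V > 0" using r by simp
    have "(\<integral>\<^sup>+y. ennreal (norm (f y)) * indicator (ball z r) y \<partial>lborel) \<le> (\<integral>\<^sup>+y. ennreal \<mu> * indicator (ball z r) y \<partial>lborel)"
      by (intro nn_integral_mono mult_right_mono ennreal_leI assms) auto
    also have "\<dots> = ennreal \<mu> * ennreal ?V" using r by (simp add: nn_integral_cmult_indicator emeasure_ball)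
    finally have "ball_mean f z r \<le> ennreal (1 / ?V) * (ennreal \<mu> * ennreal ?V)"
      unfolding ball_mean_def by (rule mult_left_mono) simp
    also have "\<dots> = ennreal \<mu>"
      unfolding mult.commute[of "ennreal \<mu>"] by (rule ennreal_cancel_left[OF V])
    finally show ?thesis .
  qed
  then show ?thesis unfolding hl_max_def by (intro SUP_least) auto
qed

lemma nn_integral_disjoint_indicator_le:
  assumes "countable C" "pairwise (\<lambda>i j. disjnt (X i) (X j)) C"
  shows "(\<integral>\<^sup>+i. indicator (X i) x \<partial>count_space C) \<le> (1::ennreal)"
proof (cases "\<exists>j\<in>C. x \<in> X j")
  case True
  then obtain j where j: "j \<in> C" "x \<in> X j" by blast
  have "(\<integral>\<^sup>+i. indicator (X i) x \<partial>count_space C) = (\<integral>\<^sup>+i. indicator {j} i \<partial>count_space C)"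
    using j assms(2) by (intro nn_integral_cong) (auto simp: indicator_def pairwise_def disjnt_iff)
  also have "\<dots> = 1" using j by simp
  finally show ?thesis by simp
next
  case False
  then have "(\<integral>\<^sup>+i. indicator (X i) x \<partial>count_space C) = (\<integral>\<^sup>+i. 0 \<partial>count_space C)"
    by (intro nn_integral_cong) (auto simp: indicator_def)
  then show ?thesis by simp
qed

text \<open>Vitali's covering lemma selects disjoint balls whose fivefold enlargements cover the
  superlevel set; enlargement costs 5^d in volume, and disjointness lets the integrals over the
  balls add up to at most the L^1 norm.\<close>

lemma hl_max_weak:
  fixes f :: "'a::euclidean_space \<Rightarrow> complex"
  assumes [measurable]: "f \<in> borel_measurable borel" and l: "l > 0"
    and fin: "(\<integral>\<^sup>+x. ennreal (norm (f x)) \<partial>lborel) < \<infinity>"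
  shows "emeasure lborel {x. ennreal l < hl_max f x} \<le> ennreal (5 ^ DIM('a) / l) * (\<integral>\<^sup>+x. ennreal (norm (f x)) \<partial>lborel)"
proof -
  let ?d = "DIM('a)"
  define v where "v = unit_ball_vol (real ?d)"
  have v: "v > 0" by (simp add: v_def)
  define I where "I = enn2real (\<integral>\<^sup>+x. ennreal (norm (f x)) \<partial>lborel)"
  have I: "(\<integral>\<^sup>+x. ennreal (norm (f x)) \<partial>lborel) = ennreal I" "I \<ge> 0" using fin by (auto simp: I_def)
  define K where "K = {zr. 0 < snd zr \<and> ennreal l < ball_mean f (fst zr) (snd zr)}"
  have Kint: "ennreal (l * (v * snd i ^ ?d)) \<le> (\<integral>\<^sup>+y. ennreal (norm (f y)) * indicator (ball (fst i) (snd i)) y \<partial>lborel)" if "i \<in> K" for i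
  proof -
    have V: "v * snd i ^ ?d > 0" using that v by (simp add: K_def)
    have "ennreal (v * snd i ^ ?d) * ennreal l \<le> ennreal (v * snd i ^ ?d) * ball_mean f (fst i) (snd i)"
      using that by (intro mult_left_mono) (auto simp: K_def)
    also have "\<dots> = (\<integral>\<^sup>+y. ennreal (norm (f y)) * indicator (ball (fst i) (snd i)) y \<partial>lborel)"
      using V unfolding ball_mean_def v_def by (rule ennreal_cancel_left)
    finally show ?thesis using V l by (simp add: ennreal_mult[symmetric] mult.commute)
  qed
  have cover: "{x. ennreal l < hl_max f x} \<subseteq> (\<Union>i\<in>K. ball (fst i) (snd i))"
    by (auto simp: hl_max_def less_SUP_iff K_def) blast
  \<comment> \<open>The covering lemma needs bounded radii. A ball with mean above l has volume at
    most I / l, which bounds the d-th power of the radius; comparison with 1 removes the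
    power.\<close>
  have rB: "0 < snd i \<and> snd i \<le> max 1 (I / (l * v))" if i: "i \<in> K" for i
  proof -
    have pos: "0 < snd i" using i by (simp add: K_def)
    have "ennreal (l * (v * snd i ^ ?d)) \<le> (\<integral>\<^sup>+y. ennreal (norm (f y)) \<partial>lborel)"
      by (rule order_trans[OF Kint[OF i]]) (auto intro!: nn_integral_mono simp: indicator_def)
    then have "l * (v * snd i ^ ?d) \<le> I" using I by simp
    then have *: "snd i ^ ?d \<le> I / (l * v)" using l v by (simp add: field_simps)
    have "snd i \<le> max 1 (I / (l * v))"
    proof (cases "snd i \<le> 1")
      case False
      then have "snd i \<le> snd i ^ ?d" by (intro self_le_power) auto
      with * show ?thesis by simp
    qed simp
    with pos show ?thesis by simp
  qed
  obtain C where C: "countable C" "C \<subseteq> K" "pairwise (\<lambda>i j. disjnt (ball (fst i) (snd i)) (ball (fst j) (snd j))) C"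
    "{x. ennreal l < hl_max f x} \<subseteq> (\<Union>i\<in>C. ball (fst i) (5 * snd i))"
    by (rule Vitali_covering_lemma_balls[OF cover rB]) blast
  have [measurable]: "{x. ennreal l < hl_max f x} \<in> sets borel" by measurable
  have "ennreal l * emeasure lborel {x. ennreal l < hl_max f x} = (\<integral>\<^sup>+x. ennreal l * indicator {x. ennreal l < hl_max f x} x \<partial>lborel)"
    by (simp add: nn_integral_cmult_indicator)
  \<comment> \<open>The countable sum over the selected balls is written as an integral over
    counting measure, so that it can be exchanged with the integral in x.\<close>
  also have "\<dots> \<le> (\<integral>\<^sup>+x. (\<integral>\<^sup>+i. ennreal l * indicator (ball (fst i) (5 * snd i)) x \<partial>count_space C) \<partial>lborel)"
  proof (rule nn_integral_mono)
    fix x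
    show "ennreal l * indicator {x. ennreal l < hl_max f x} x \<le> (\<integral>\<^sup>+i. ennreal l * indicator (ball (fst i) (5 * snd i)) x \<partial>count_space C)"
    proof (cases "ennreal l < hl_max f x")
      case True
      then obtain j where j: "j \<in> C" "x \<in> ball (fst j) (5 * snd j)" using C(4) by blast
      have "ennreal l = (\<integral>\<^sup>+i. ennreal l * indicator {j} i \<partial>count_space C)" using j by (simp add: nn_integral_cmult)
      also have "\<dots> \<le> (\<integral>\<^sup>+i. ennreal l * indicator (ball (fst i) (5 * snd i)) x \<partial>count_space C)"
        using j by (intro nn_integral_mono) (auto simp: indicator_def)
      finally show ?thesis using True by simp
    qed simp
  qed
  also have "\<dots> = (\<integral>\<^sup>+i. (\<integral>\<^sup>+x. ennreal l * indicator (ball (fst i) (5 * snd i)) x \<partial>lborel) \<partial>count_space C)"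
    by (rule nn_integral_count_space_nn_integral[OF C(1)]) simp
  also have "\<dots> \<le> (\<integral>\<^sup>+i. ennreal (5 ^ ?d) * (\<integral>\<^sup>+y. ennreal (norm (f y)) * indicator (ball (fst i) (snd i)) y \<partial>lborel) \<partial>count_space C)"
  proof (rule nn_integral_mono)
    fix i assume "i \<in> space (count_space C)"
    then have i: "i \<in> K" using C(2) by auto
    then have s: "snd i > 0" by (simp add: K_def)
    have "(\<integral>\<^sup>+x. ennreal l * indicator (ball (fst i) (5 * snd i)) x \<partial>lborel) = ennreal l * ennreal (v * (5 * snd i) ^ ?d)"
      using s by (simp add: nn_integral_cmult_indicator emeasure_ball v_def)
    also have "\<dots> = ennreal (5 ^ ?d) * ennreal (l * (v * snd i ^ ?d))"
      using s l v by (simp add: ennreal_mult[symmetric] power_mult_distrib mult_ac)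
    also have "\<dots> \<le> ennreal (5 ^ ?d) * (\<integral>\<^sup>+y. ennreal (norm (f y)) * indicator (ball (fst i) (snd i)) y \<partial>lborel)"
      by (intro mult_left_mono Kint i) simp
    finally show "(\<integral>\<^sup>+x. ennreal l * indicator (ball (fst i) (5 * snd i)) x \<partial>lborel) \<le> ennreal (5 ^ ?d) * (\<integral>\<^sup>+y. ennreal (norm (f y)) * indicator (ball (fst i) (snd i)) y \<partial>lborel)" .
  qed
  also have "\<dots> = ennreal (5 ^ ?d) * (\<integral>\<^sup>+i. (\<integral>\<^sup>+y. ennreal (norm (f y)) * indicator (ball (fst i) (snd i)) y \<partial>lborel) \<partial>count_space C)"
    by (rule nn_integral_cmult) simp
  also have "(\<integral>\<^sup>+i. (\<integral>\<^sup>+y. ennreal (norm (f y)) * indicator (ball (fst i) (snd i)) y \<partial>lborel) \<partial>count_space C)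
      = (\<integral>\<^sup>+y. (\<integral>\<^sup>+i. ennreal (norm (f y)) * indicator (ball (fst i) (snd i)) y \<partial>count_space C) \<partial>lborel)"
    by (rule nn_integral_count_space_nn_integral[OF C(1), symmetric]) measurable
  also have "\<dots> \<le> (\<integral>\<^sup>+y. ennreal (norm (f y)) \<partial>lborel)"
  proof (rule nn_integral_mono)
    fix y
    have "(\<integral>\<^sup>+i. ennreal (norm (f y)) * indicator (ball (fst i) (snd i)) y \<partial>count_space C) = ennreal (norm (f y)) * (\<integral>\<^sup>+i. indicator (ball (fst i) (snd i)) y \<partial>count_space C)"
      by (rule nn_integral_cmult) simp
    also have "\<dots> \<le> ennreal (norm (f y)) * 1"
      by (intro mult_left_mono nn_integral_disjoint_indicator_le C) simp
    finally show "(\<integral>\<^sup>+i. ennreal (norm (f y)) * indicator (ball (fst i) (snd i)) y \<partial>count_space C) \<le> ennreal (norm (f y))" by simp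
  qed
  finally have "ennreal l * emeasure lborel {x. ennreal l < hl_max f x} \<le> ennreal (5 ^ ?d) * (\<integral>\<^sup>+y. ennreal (norm (f y)) \<partial>lborel)"
    by (simp add: mult_left_mono)
  then have "ennreal (1 / l) * (ennreal l * emeasure lborel {x. ennreal l < hl_max f x}) \<le> ennreal (1 / l) * (ennreal (5 ^ ?d) * (\<integral>\<^sup>+y. ennreal (norm (f y)) \<partial>lborel))"
    by (rule mult_left_mono) simp
  then show ?thesis using l by (simp add: mult.assoc[symmetric] ennreal_mult[symmetric])
qed

theorem hl_max_Lp:
  assumes p: "p > 1"
  obtains C where "C > 0" "\<And>f :: 'a::euclidean_space \<Rightarrow> complex. schwartz f \<Longrightarrow>
    (\<integral>\<^sup>+x. epow (hl_max f x) p \<partial>lborel) \<le> ennreal C * (\<integral>\<^sup>+x. ennreal (norm (f x) powr p) \<partial>lborel)"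
proof -
  obtain k :: nat where k: "p < real k" using reals_Archimedean2 by blast
  let ?C = "4 powr p * (p * (5 ^ DIM('a) * marc_const k 1 p * 1 powr (p - 1)))"
  have mc: "marc_const k 1 p > 0" using p k unfolding marc_const_def by (intro add_pos_pos) auto
  have "(\<integral>\<^sup>+x. epow (hl_max f x) p \<partial>lborel) \<le> ennreal ?C * (\<integral>\<^sup>+x. ennreal (norm (f x) powr p) \<partial>lborel)"
    if f: "schwartz f" for f :: "'a \<Rightarrow> complex"
  proof -
    have q: "quasi_sublinear lborel (hl_max :: ('a \<Rightarrow> complex) \<Rightarrow> 'a \<Rightarrow> ennreal)"
      unfolding quasi_sublinear_def
    proof (intro conjI allI impI)
      fix g h :: "'a \<Rightarrow> complex" and y :: 'a assume "schwartz g" "schwartz h"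
      then have "hl_max (\<lambda>x. g x + h x) y \<le> hl_max g y + hl_max h y" by (intro hl_max_add schwartz_measurable)
      also have "\<dots> \<le> 2 * (hl_max g y + hl_max h y)" by (simp add: mult_2)
      finally show "hl_max (\<lambda>x. g x + h x) y \<le> 2 * (hl_max g y + hl_max h y)" .
    qed simp
    have w: "weak_type lborel (hl_max :: ('a \<Rightarrow> complex) \<Rightarrow> 'a \<Rightarrow> ennreal) 1 (5 ^ DIM('a))"
      unfolding weak_type_def
      using hl_max_weak[OF schwartz_measurable _ schwartz_nn_integral_finite] by auto
    have bd: "AE y in lborel. hl_max h y \<le> ennreal (1 * \<mu>)" if "\<And>x. norm (h x) \<le> \<mu>" for h :: "'a \<Rightarrow> complex" and \<mu>
      using hl_max_bounded[of h \<mu>, OF that] by simp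
    show ?thesis
      by (rule marcinkiewicz_infinity[OF sigma_finite_lborel q _ p _ w _ bd _ f]) (use p k in auto)
  qed
  moreover have "?C > 0" using mc p by simp
  ultimately show ?thesis using that by blast
qed

text \<open>Balls dilate to balls and means are unchanged. Hence all dyadic dilates of the coarse
  part are dominated by one and the same maximal function, at no cost for the supremum over
  dilations.\<close>

lemma hl_max_dilate:
  fixes f :: "'a::euclidean_space \<Rightarrow> complex"
  assumes [measurable]: "f \<in> borel_measurable borel" and s: "\<sigma> > 0"
  shows "hl_max (\<lambda>x. f (\<sigma> *\<^sub>R x)) ((1 / \<sigma>) *\<^sub>R x) \<le> hl_max f x"
proof -
  have "ball_mean (\<lambda>x. f (\<sigma> *\<^sub>R x)) z r \<le> hl_max f x" if r: "0 < r" "(1 / \<sigma>) *\<^sub>R x \<in> ball z r" for z r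
  proof -
    have in_ball: "\<sigma> *\<^sub>R y \<in> ball (\<sigma> *\<^sub>R z) (\<sigma> * r) \<longleftrightarrow> y \<in> ball z r" for y
    proof -
      have "dist (\<sigma> *\<^sub>R z) (\<sigma> *\<^sub>R y) = \<sigma> * dist z y"
        using s by (simp add: dist_norm scaleR_diff_right[symmetric])
      then show ?thesis using s by simp
    qed
    have "(\<integral>\<^sup>+y. ennreal (norm (f y)) * indicator (ball (\<sigma> *\<^sub>R z) (\<sigma> * r)) y \<partial>lborel)
      = ennreal (\<bar>\<sigma>\<bar> ^ DIM('a)) * (\<integral>\<^sup>+y. ennreal (norm (f (0 + \<sigma> *\<^sub>R y))) * indicator (ball (\<sigma> *\<^sub>R z) (\<sigma> * r)) (0 + \<sigma> *\<^sub>R y) \<partial>lborel)"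
      by (rule nn_integral_lborel_affine) (use s in auto)
    also have "(\<integral>\<^sup>+y. ennreal (norm (f (0 + \<sigma> *\<^sub>R y))) * indicator (ball (\<sigma> *\<^sub>R z) (\<sigma> * r)) (0 + \<sigma> *\<^sub>R y) \<partial>lborel)
      = (\<integral>\<^sup>+y. ennreal (norm (f (\<sigma> *\<^sub>R y))) * indicator (ball z r) y \<partial>lborel)"
      using in_ball by (intro nn_integral_cong) (simp add: indicator_def)
    finally have e: "(\<integral>\<^sup>+y. ennreal (norm (f y)) * indicator (ball (\<sigma> *\<^sub>R z) (\<sigma> * r)) y \<partial>lborel)
      = ennreal (\<sigma> ^ DIM('a)) * (\<integral>\<^sup>+y. ennreal (norm (f (\<sigma> *\<^sub>R y))) * indicator (ball z r) y \<partial>lborel)" using s by simp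
    have "ball_mean (\<lambda>x. f (\<sigma> *\<^sub>R x)) z r = ball_mean f (\<sigma> *\<^sub>R z) (\<sigma> * r)"
    proof -
      have "ennreal (1 / (unit_ball_vol DIM('a) * (\<sigma> * r) ^ DIM('a))) * ennreal (\<sigma> ^ DIM('a)) = ennreal (1 / (unit_ball_vol DIM('a) * r ^ DIM('a)))"
        using s r by (simp add: ennreal_mult[symmetric] power_mult_distrib)
      then show ?thesis unfolding ball_mean_def e by (simp add: mult.assoc[symmetric])
    qed
    also have "\<dots> \<le> hl_max f x"
      using in_ball[of "(1 / \<sigma>) *\<^sub>R x"] r s by (intro ball_mean_le_hl_max) auto
    finally show ?thesis by simp
  qed
  then show ?thesis unfolding hl_max_def[of "\<lambda>x. f (\<sigma> *\<^sub>R x)"] by (intro SUP_least) auto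
qed

lemma inverse_power_le_dyadic:
  fixes s :: real assumes "s \<ge> 0"
  shows "\<exists>k. s < 2 ^ k \<and> 1 / (1 + s) ^ n \<le> 2 ^ n * (1 / 2 ^ k) ^ n"
proof -
  define k where "k = (LEAST k. s < (2::real) ^ k)"
  have ex: "\<exists>k. s < (2::real) ^ k" by (rule real_arch_pow) simp
  have k: "s < 2 ^ k" unfolding k_def by (rule LeastI_ex[OF ex])
  have "2 ^ k \<le> 2 * (1 + s)"
  proof (cases k)
    case (Suc j)
    then have "\<not> s < 2 ^ j" unfolding k_def by (metis lessI not_less_Least)
    then show ?thesis using Suc by simp
  qed (use assms in simp)
  then have "(2 ^ k) ^ n \<le> 2 ^ n * (1 + s) ^ n"
    unfolding power_mult_distrib[symmetric] by (intro power_mono) auto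
  moreover have "(1 + s) ^ n > 0" "((2::real) ^ k) ^ n > 0" using assms by simp_all
  moreover have "1 / X \<le> c / Y" if "Y \<le> c * X" "X > 0" "Y > 0" for X Y c :: real
    using that by (simp add: field_simps)
  ultimately have "1 / (1 + s) ^ n \<le> 2 ^ n / (2 ^ k) ^ n" by blast
  then have "1 / (1 + s) ^ n \<le> 2 ^ n * (1 / 2 ^ k) ^ n"
    by (simp add: power_divide)
  with k show ?thesis by blast
qed

text \<open>Majorise the kernel by a sum of indicators of dyadic balls.\<close>

lemma kernel_le_hl_max:
  fixes f K :: "'a::euclidean_space \<Rightarrow> complex"
  assumes fm[measurable]: "f \<in> borel_measurable borel" and C: "C \<ge> 0"
    and K: "\<And>u. norm (K u) \<le> C / (1 + norm u) ^ Suc DIM('a)"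
  shows "ennreal (norm (LINT u|lborel. K u * f (x - u))) \<le> ennreal (C * (2 ^ (DIM('a) + 2) * unit_ball_vol DIM('a))) * hl_max f x"
proof -
  let ?d = "DIM('a)"
  define v where "v = unit_ball_vol (real ?d)"
  have v: "v > 0" by (simp add: v_def)
  \<comment> \<open>The weight is the kernel bound at distance about 2^k. Its factor 2^(-k(d+1))
    against the volume 2^(kd) of the ball leaves the summable 2^(-k).\<close>
  define w where "w = (\<lambda>k::nat. C * (2 ^ Suc ?d * (1 / 2 ^ k) ^ Suc ?d))"
  have w: "w k \<ge> 0" for k using C by (simp add: w_def)
  have "ennreal (norm (LINT u|lborel. K u * f (x - u))) \<le> (\<integral>\<^sup>+u. ennreal (norm (K u * f (x - u))) \<partial>lborel)"
    by (rule norm_LINT_le)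
  also have "\<dots> \<le> (\<integral>\<^sup>+u. (\<Sum>k. ennreal (w k) * (ennreal (norm (f (x - u))) * indicator (ball 0 (2 ^ k)) u)) \<partial>lborel)"
  proof (rule nn_integral_mono)
    fix u :: 'a
    obtain k where k: "norm u < 2 ^ k" "1 / (1 + norm u) ^ Suc ?d \<le> 2 ^ Suc ?d * (1 / 2 ^ k) ^ Suc ?d"
      using inverse_power_le_dyadic[of "norm u" "Suc ?d"] by auto
    have "norm (K u) \<le> w k"
      using K[of u] mult_left_mono[OF k(2) C] unfolding w_def by simp
    then have "ennreal (norm (K u * f (x - u))) \<le> ennreal (w k * norm (f (x - u)))"
      unfolding norm_mult by (intro ennreal_leI mult_right_mono) auto
    also have "\<dots> = ennreal (w k) * (ennreal (norm (f (x - u))) * indicator (ball 0 (2 ^ k)) u)"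
      using w k by (simp add: ennreal_mult)
    also have "\<dots> \<le> (\<Sum>k. ennreal (w k) * (ennreal (norm (f (x - u))) * indicator (ball 0 (2 ^ k)) u))"
      using sum_le_suminf[of "\<lambda>k. ennreal (w k) * (ennreal (norm (f (x - u))) * indicator (ball 0 (2 ^ k)) u)" "{k}"] by simp
    finally show "ennreal (norm (K u * f (x - u))) \<le> (\<Sum>k. ennreal (w k) * (ennreal (norm (f (x - u))) * indicator (ball 0 (2 ^ k)) u))" .
  qed
  also have "\<dots> = (\<Sum>k. ennreal (w k) * (\<integral>\<^sup>+u. ennreal (norm (f (x - u))) * indicator (ball 0 (2 ^ k)) u \<partial>lborel))"
    by (subst nn_integral_suminf) (auto simp: nn_integral_cmult)
  also have "\<dots> \<le> (\<Sum>k. ennreal (C * (2 ^ Suc ?d * v)) * hl_max f x * ennreal ((1 / 2) ^ k))"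
  proof (intro suminf_le)
    fix k
    have "(\<integral>\<^sup>+u. ennreal (norm (f (x - u))) * indicator (ball 0 (2 ^ k)) u \<partial>lborel) = (\<integral>\<^sup>+y. ennreal (norm (f y)) * indicator (ball x (2 ^ k)) y \<partial>lborel)"
      by (subst (2) nn_integral_lborel_affine[of _ "-1" x]) (auto simp: indicator_def dist_norm)
    also have "\<dots> \<le> ennreal (v * (2 ^ k) ^ ?d) * hl_max f x"
      unfolding v_def by (rule integral_ball_le_hl_max) auto
    finally have "ennreal (w k) * (\<integral>\<^sup>+u. ennreal (norm (f (x - u))) * indicator (ball 0 (2 ^ k)) u \<partial>lborel) \<le> ennreal (w k) * (ennreal (v * (2 ^ k) ^ ?d) * hl_max f x)"
      by (rule mult_left_mono) simp
    also have "\<dots> = ennreal (C * (2 ^ Suc ?d * v)) * hl_max f x * ennreal ((1 / 2) ^ k)"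
    proof -
      have "w k * (v * (2 ^ k) ^ ?d) = C * (2 ^ Suc ?d * v) * (1 / 2) ^ k"
        by (simp add: w_def power_divide field_simps)
      then have "ennreal (w k) * ennreal (v * (2 ^ k) ^ ?d) = ennreal (C * (2 ^ Suc ?d * v)) * ennreal ((1 / 2) ^ k)"
        using w v C by (simp add: ennreal_mult[symmetric])
      then show ?thesis by (metis mult.assoc mult.commute)
    qed
    finally show "ennreal (w k) * (\<integral>\<^sup>+u. ennreal (norm (f (x - u))) * indicator (ball 0 (2 ^ k)) u \<partial>lborel) \<le> ennreal (C * (2 ^ Suc ?d * v)) * hl_max f x * ennreal ((1 / 2) ^ k)" .
  qed auto
  also have "\<dots> = ennreal (C * (2 ^ Suc ?d * v)) * hl_max f x * (\<Sum>k. ennreal ((1 / 2) ^ k))"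
    by (rule ennreal_suminf_cmult)
  also have "(\<Sum>k. ennreal ((1 / 2) ^ k)) = ennreal 2"
    using suminf_geometric[of "1 / 2 :: real"] by (subst suminf_ennreal2) (auto intro: summable_geometric)
  also have "ennreal (C * (2 ^ Suc ?d * v)) * hl_max f x * ennreal 2 = ennreal (C * (2 ^ (?d + 2) * v)) * hl_max f x"
  proof -
    have "ennreal (C * (2 ^ Suc ?d * v)) * ennreal 2 = ennreal (C * (2 ^ (?d + 2) * v))"
      using C v by (simp only: ennreal_mult[symmetric] mult_nonneg_nonneg zero_le_power zero_le_numeral order.strict_implies_order) (simp add: mult_ac)
    then show ?thesis by (metis mult.assoc mult.commute)
  qed
  finally show ?thesis unfolding v_def .
qed

section \<open>Littlewood--Paley pieces\<close>

text \<open>A cutoff in |\<xi>|^2 that equals 1 on [1/4, 3] and vanishes outside [1/8, 4]. The inner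
  range contains every value of |\<xi>|^2 within 1/4 of some t in [1/2, 2].\<close>

definition lp_mult :: "'a::euclidean_space \<Rightarrow> complex" where
  "lp_mult \<xi> = of_real (smooth_step (8 * (norm \<xi>)\<^sup>2 - 1) * smooth_step (4 - (norm \<xi>)\<^sup>2))"

lemma schwartz_lp_mult: "schwartz lp_mult"
proof -
  \<comment> \<open>The profile is rewritten in the variable x = 5 - |\<xi>|^2, which turns 8
    |\<xi>|^2 - 1 into 39 - 8 x and 4 - |\<xi>|^2 into x - 1, so that g vanishes for negative x as
    \<open>radial_family\<close> requires.\<close>
  define g where "g = (\<lambda>x. smooth_step ((-8) * x + 39) * smooth_step (1 * x + (-1)))"
  have "(\<lambda>t (\<xi>::'a). complex_of_real (g (t - (norm \<xi>)\<^sup>2))) \<in> radial_family"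
  proof (rule radial_base)
    show "smooth_real g" unfolding g_def by (intro smooth_real_mult smooth_real_affine smooth_real_smooth_step)
    show "g x = 0" if "x < 0" for x using that by (simp add: g_def smooth_step_eq_0)
  qed
  then have "schwartz (\<lambda>\<xi>::'a. complex_of_real (g (5 - (norm \<xi>)\<^sup>2)))"
    by (rule radial_family_schwartz[where F = "\<lambda>t \<xi>. complex_of_real (g (t - (norm \<xi>)\<^sup>2))"]) simp
  moreover have "(\<lambda>\<xi>::'a. complex_of_real (g (5 - (norm \<xi>)\<^sup>2))) = lp_mult"
    by (simp add: fun_eq_iff g_def lp_mult_def algebra_simps)
  ultimately show ?thesis by metis
qed

lemma lp_mult_eq_1: "1/4 \<le> (norm \<xi>)\<^sup>2 \<Longrightarrow> (norm \<xi>)\<^sup>2 \<le> 3 \<Longrightarrow> lp_mult \<xi> = 1"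
  by (simp add: lp_mult_def smooth_step_eq_1)

lemma lp_mult_eq_0: "(norm \<xi>)\<^sup>2 \<le> 1/8 \<or> (norm \<xi>)\<^sup>2 \<ge> 4 \<Longrightarrow> lp_mult \<xi> = 0"
  by (auto simp: lp_mult_def smooth_step_eq_0)

lemma norm_lp_mult_le: "norm (lp_mult \<xi>) \<le> 1"
  unfolding lp_mult_def norm_of_real abs_mult
  by (intro mult_le_one) (auto simp: smooth_step_nonneg smooth_step_le_1)

lemma lp_mult_measurable [measurable]: "lp_mult \<in> borel_measurable borel"
  by (rule schwartz_measurable[OF schwartz_lp_mult])

lemma lp_bounded:
  obtains C where "C > 0" "\<And>(f :: 'a::euclidean_space \<Rightarrow> complex) \<mu> x. schwartz f \<Longrightarrow> (\<And>x. norm (f x) \<le> \<mu>) \<Longrightarrow> norm (multiplier_op lp_mult f x) \<le> C * \<mu>"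
proof -
  define I where "I = (LINT u|lborel. norm (fourier lp_mult (- u :: 'a)))"
  have "integrable lborel (\<lambda>u::'a. fourier lp_mult (0 + (-1) *\<^sub>R u))"
    by (rule integrable_lborel_affine[OF _ integrable_fourier_schwartz[OF schwartz_lp_mult]]) simp
  then have Ki: "integrable lborel (\<lambda>u::'a. fourier lp_mult (- u))" by simp
  have I0: "I \<ge> 0" unfolding I_def by simp
  have "norm (multiplier_op lp_mult f x) \<le> (I + 1) * \<mu>" if f: "schwartz f" and mu: "\<And>x. norm (f x) \<le> \<mu>" for f :: "'a \<Rightarrow> complex" and \<mu> x
  proof -
    note [measurable] = schwartz_measurable[OF f]
    have mu0: "0 \<le> \<mu>" by (rule order_trans[OF norm_ge_zero mu])
    have "norm (multiplier_op lp_mult f x) = norm (LINT u|lborel. fourier lp_mult (- u) * f (x - u))"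
      by (subst multiplier_op_conv[OF schwartz_integrable[OF schwartz_lp_mult] schwartz_integrable[OF f]]) simp
    also have "\<dots> \<le> (LINT u|lborel. norm (fourier lp_mult (- u :: 'a)) * \<mu>)"
    proof (rule Bochner_Integration.integral_norm_bound_integral)
      show i: "integrable lborel (\<lambda>u::'a. norm (fourier lp_mult (- u)) * \<mu>)"
        by (intro integrable_mult_left integrable_norm Ki)
      show le: "norm (fourier lp_mult (- u) * f (x - u)) \<le> norm (fourier lp_mult (- u)) * \<mu>" for u
        unfolding norm_mult by (intro mult_left_mono mu) simp
      show "integrable lborel (\<lambda>u. fourier lp_mult (- u) * f (x - u))"
        by (rule Bochner_Integration.integrable_bound[OF i]) (use le mu0 in \<open>auto simp: abs_mult\<close>)
    qed
    also have "\<dots> = I * \<mu>" by (simp add: I_def)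
    also have "\<dots> \<le> (I + 1) * \<mu>" using mu0 by (simp add: mult_right_mono)
    finally show ?thesis .
  qed
  with I0 show ?thesis by (intro that[of "I + 1"]) auto
qed

text \<open>Consecutive scales differ by the square root of 2, so that |\<xi>|^2, and with it the
  parameter t, changes by a factor 2.\<close>

definition dyad :: "int \<Rightarrow> real" where
  "dyad l = 2 powr (- (real_of_int l) / 2)"

lemma dyad_pos [simp]: "dyad l > 0"
  by (simp add: dyad_def)

lemma dyad_power2: "(dyad l)\<^sup>2 = 2 powr (- real_of_int l)"
proof -
  have "(dyad l)\<^sup>2 = dyad l * dyad l" by (rule power2_eq_square)
  also have "\<dots> = 2 powr (- real_of_int l)" unfolding dyad_def powr_add[symmetric] by simp
  finally show ?thesis .
qed

definition lp_piece :: "int \<Rightarrow> ('a::euclidean_space \<Rightarrow> complex) \<Rightarrow> 'a \<Rightarrow> complex" where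
  "lp_piece l f x = multiplier_op lp_mult (\<lambda>x. f (dyad l *\<^sub>R x)) ((1 / dyad l) *\<^sub>R x)"

lemma lp_piece_eq:
  "schwartz f \<Longrightarrow> lp_piece l f x = multiplier_op (\<lambda>\<xi>. lp_mult (dyad l *\<^sub>R \<xi>)) f x"
  unfolding lp_piece_def by (rule multiplier_op_dilate[symmetric]) (auto intro: schwartz_measurable)

text \<open>A nonzero value forces 2^(-3) < 2^(-l) |\<xi>|^2 < 2^2, which confines l to an open
  interval of length five around the logarithm of |\<xi>|^2; rounding leaves a window of six
  integers.\<close>

lemma dyadic_overlap:
  fixes \<xi> :: "'a::euclidean_space"
  shows "(\<integral>\<^sup>+l. ennreal ((norm (lp_mult (dyad l *\<^sub>R \<xi>)))\<^sup>2) \<partial>count_space UNIV) \<le> 6"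
proof -
  define a where "a = (norm \<xi>)\<^sup>2"
  have na: "(norm (dyad l *\<^sub>R \<xi>))\<^sup>2 = 2 powr (- real_of_int l) * a" for l
    by (simp add: power_mult_distrib dyad_power2 a_def)
  define S where "S = {\<lfloor>log 2 a\<rfloor> - 2..\<lfloor>log 2 a\<rfloor> + 3}"
  have sub: "l \<in> S" if "lp_mult (dyad l *\<^sub>R \<xi>) \<noteq> 0" for l
  proof -
    have b: "1/8 < 2 powr (- real_of_int l) * a" "2 powr (- real_of_int l) * a < 4"
      using that lp_mult_eq_0[of "dyad l *\<^sub>R \<xi>"] unfolding na by force+
    then have a: "a > 0" using zero_le_power2[of "norm \<xi>"] unfolding a_def by (cases "norm \<xi> = 0") auto
    have e: "2 powr (- real_of_int l) * a = 2 powr (log 2 a - real_of_int l)"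
      using a by (simp add: powr_diff powr_minus divide_inverse mult.commute)
    have "(2::real) powr (-3) < 2 powr (log 2 a - real_of_int l)" using b(1) unfolding e by (simp add: powr_minus)
    then have "-3 < log 2 a - real_of_int l" by (rule powr_less_cancel) simp
    moreover have "2 powr (log 2 a - real_of_int l) < (2::real) powr 2" using b(2) unfolding e by simp
    then have "log 2 a - real_of_int l < 2" by (rule powr_less_cancel) simp
    ultimately have "-3 < log 2 a - real_of_int l" "log 2 a - real_of_int l < 2" by simp_all
    then show ?thesis unfolding S_def atLeastAtMost_iff by linarith
  qed
  have "(\<integral>\<^sup>+l. ennreal ((norm (lp_mult (dyad l *\<^sub>R \<xi>)))\<^sup>2) \<partial>count_space UNIV) \<le> (\<integral>\<^sup>+l. indicator S l \<partial>count_space UNIV)"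
  proof (rule nn_integral_mono)
    fix l
    have "(norm (lp_mult (dyad l *\<^sub>R \<xi>)))\<^sup>2 \<le> 1" by (rule power_le_one[OF norm_ge_zero norm_lp_mult_le])
    then show "ennreal ((norm (lp_mult (dyad l *\<^sub>R \<xi>)))\<^sup>2) \<le> indicator S l"
      using sub[of l] by (cases "l \<in> S") (auto simp: ennreal_le_1)
  qed
  also have "\<dots> = emeasure (count_space UNIV) S" by simp
  also have "\<dots> = 6" by (subst emeasure_count_space) (auto simp: S_def)
  finally show ?thesis .
qed

lemma integrable_lp_piece:
  fixes f :: "'a::euclidean_space \<Rightarrow> complex"
  assumes f: "schwartz f" shows "integrable lborel (\<lambda>\<xi>. lp_mult (dyad l *\<^sub>R \<xi>) * fourier f \<xi>)"
  by (rule integrable_mult_bounded[OF integrable_fourier_schwartz[OF f] _ norm_lp_mult_le]) simp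

lemma lp_piece_measurable [measurable]:
  fixes f :: "'a::euclidean_space \<Rightarrow> complex"
  assumes "schwartz f" shows "lp_piece l f \<in> borel_measurable borel"
proof -
  note [measurable] = schwartz_measurable[OF schwartz_multiplier_op[OF schwartz_lp_mult schwartz_dilate[OF assms]]]
  show ?thesis unfolding lp_piece_def[abs_def] by (rule measurable_compose[OF _ schwartz_measurable[OF schwartz_multiplier_op[OF schwartz_lp_mult schwartz_dilate[OF assms]]]]) (auto simp: less_imp_neq[symmetric])
qed

lemma lp_piece_L2:
  fixes f :: "'a::euclidean_space \<Rightarrow> complex"
  assumes f: "schwartz f"
  shows "(\<integral>\<^sup>+l. (\<integral>\<^sup>+x. ennreal (norm (lp_piece l f x) powr 2) \<partial>lborel) \<partial>count_space UNIV) \<le> ennreal 6 * (\<integral>\<^sup>+x. ennreal (norm (f x) powr 2) \<partial>lborel)"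
proof -
  note [measurable] = schwartz_measurable[OF f]
  have "(\<integral>\<^sup>+l. (\<integral>\<^sup>+x. ennreal (norm (lp_piece l f x) powr 2) \<partial>lborel) \<partial>count_space UNIV) \<le>
    (\<integral>\<^sup>+l. (\<integral>\<^sup>+\<xi>. ennreal ((norm (lp_mult (dyad l *\<^sub>R \<xi>)))\<^sup>2) * ennreal ((norm (fourier f \<xi>))\<^sup>2) \<partial>lborel) \<partial>count_space UNIV)"
  proof (rule nn_integral_mono)
    fix l
    show "(\<integral>\<^sup>+x. ennreal (norm (lp_piece l f x) powr 2) \<partial>lborel) \<le> (\<integral>\<^sup>+\<xi>. ennreal ((norm (lp_mult (dyad l *\<^sub>R \<xi>)))\<^sup>2) * ennreal ((norm (fourier f \<xi>))\<^sup>2) \<partial>lborel)"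
      using multiplier_op_bessel[OF integrable_lp_piece[OF f, of l]]
      by (simp add: lp_piece_eq[OF f] norm_mult power_mult_distrib ennreal_mult)
  qed
  also have "\<dots> = (\<integral>\<^sup>+\<xi>. (\<integral>\<^sup>+l. ennreal ((norm (lp_mult (dyad l *\<^sub>R \<xi>)))\<^sup>2) * ennreal ((norm (fourier f \<xi>))\<^sup>2) \<partial>count_space UNIV) \<partial>lborel)"
    by (rule nn_integral_count_space_nn_integral[symmetric]) auto
  also have "\<dots> \<le> (\<integral>\<^sup>+\<xi>. ennreal 6 * ennreal ((norm (fourier f \<xi>))\<^sup>2) \<partial>lborel)"
    using dyadic_overlap by (intro nn_integral_mono) (auto simp: nn_integral_multc intro!: mult_right_mono)
  also have "\<dots> = ennreal 6 * (\<integral>\<^sup>+\<xi>. ennreal ((norm (fourier f \<xi>))\<^sup>2) \<partial>lborel)"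
    by (rule nn_integral_cmult) measurable
  also have "\<dots> \<le> ennreal 6 * (\<integral>\<^sup>+x. ennreal ((norm (f x))\<^sup>2) \<partial>lborel)"
    by (intro mult_left_mono bessel_inequality schwartz_integrable f) simp
  finally show ?thesis by simp
qed

lemma multiplier_op_add:
  fixes g h :: "'a::euclidean_space \<Rightarrow> complex"
  assumes g: "schwartz g" and h: "schwartz h" and [measurable]: "m \<in> borel_measurable borel" and m: "\<And>\<xi>. norm (m \<xi>) \<le> B"
  shows "multiplier_op m (\<lambda>x. g x + h x) x = multiplier_op m g x + multiplier_op m h x"
proof -
  have F: "fourier (\<lambda>x. g x + h x) \<xi> = fourier g \<xi> + fourier h \<xi>" for \<xi>
  proof -
    have "integrable lborel (\<lambda>x. cis (- 2 * pi * (x \<bullet> \<xi>)) * g x)" "integrable lborel (\<lambda>x. cis (- 2 * pi * (x \<bullet> \<xi>)) * h x)"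
      by (intro integrable_cis_mult schwartz_integrable g h; simp)+
    then show ?thesis unfolding fourier_def distrib_left by (rule Bochner_Integration.integral_add)
  qed
  have i: "integrable lborel (\<lambda>\<xi>. cis (2 * pi * (x \<bullet> \<xi>)) * m \<xi> * fourier f \<xi>)" if "schwartz f" for f
  proof -
    have "integrable lborel (\<lambda>\<xi>. cis (2 * pi * (x \<bullet> \<xi>)) * (m \<xi> * fourier f \<xi>))"
      by (intro integrable_cis_mult integrable_mult_bounded[OF integrable_fourier_schwartz[OF that] _ m]) auto
    then show ?thesis by (simp add: mult.assoc)
  qed
  show ?thesis unfolding multiplier_op_def F distrib_left by (rule Bochner_Integration.integral_add[OF i[OF g] i[OF h]])
qed

text \<open>All pieces together form one operator into functions on the product of the integers with
  the space. For this single operator bounded overlap gives the L^2 bound and the integrable kernel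
  the L^\<infinity> bound, and interpolation yields the l^p sum of L^p norms. This is the reason for
  a general target measure in the interpolation theorems.\<close>

theorem lp_piece_Lp:
  assumes p: "p \<ge> 2"
  obtains C where "C > 0" "\<And>f :: 'a::euclidean_space \<Rightarrow> complex. schwartz f \<Longrightarrow>
    (\<integral>\<^sup>+l. (\<integral>\<^sup>+x. ennreal (norm (lp_piece l f x) powr p) \<partial>lborel) \<partial>count_space UNIV) \<le> ennreal C * (\<integral>\<^sup>+x. ennreal (norm (f x) powr p) \<partial>lborel)"
proof (cases "p = 2")
  case True
  then show ?thesis using lp_piece_L2 by (intro that[of 6]) auto
next
  case False
  then have p2: "p > 2" using p by simp
  define N where "N = count_space (UNIV :: int set) \<Otimes>\<^sub>M (lborel :: 'a measure)"
  interpret pair_sigma_finite "count_space (UNIV :: int set)" "lborel :: 'a measure"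
    by (intro pair_sigma_finite.intro sigma_finite_measure_count_space sigma_finite_lborel)
  have sf: "sigma_finite_measure N" unfolding N_def by unfold_locales
  define T where "T = (\<lambda>(f :: 'a \<Rightarrow> complex) (y :: int \<times> 'a). ennreal (norm (lp_piece (fst y) f (snd y))))"
  have Tm: "T f \<in> borel_measurable N" if "schwartz f" for f
    unfolding N_def T_def using lp_piece_measurable[OF that] by (intro measurable_pair_measure_countable1) auto
  have Tint: "(\<integral>\<^sup>+y. epow (T f y) q \<partial>N) = (\<integral>\<^sup>+l. (\<integral>\<^sup>+x. ennreal (norm (lp_piece l f x) powr q) \<partial>lborel) \<partial>count_space UNIV)" if "schwartz f" for f q
  proof -
    have [measurable]: "T f \<in> borel_measurable (count_space (UNIV :: int set) \<Otimes>\<^sub>M (lborel :: 'a measure))" using Tm[OF that] by (simp add: N_def)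
    have "(\<integral>\<^sup>+l. (\<integral>\<^sup>+x. epow (T f (l, x)) q \<partial>lborel) \<partial>count_space UNIV) = (\<integral>\<^sup>+y. epow (T f y) q \<partial>N)"
      unfolding N_def by (rule lborel.nn_integral_fst) measurable
    then show ?thesis by (simp add: T_def epow_ennreal)
  qed
  have q: "quasi_sublinear N T"
    unfolding quasi_sublinear_def
  proof (intro conjI allI impI Tm)
    fix g h :: "'a \<Rightarrow> complex" and y :: "int \<times> 'a" assume gh: "schwartz g" "schwartz h"
    have "lp_piece (fst y) (\<lambda>x. g x + h x) (snd y) = lp_piece (fst y) g (snd y) + lp_piece (fst y) h (snd y)"
      unfolding lp_piece_def
      by (rule multiplier_op_add[OF _ _ lp_mult_measurable norm_lp_mult_le]) (intro schwartz_dilate gh less_imp_neq[symmetric] dyad_pos)+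
    then have "T (\<lambda>x. g x + h x) y \<le> T g y + T h y"
      unfolding T_def by (simp add: ennreal_plus[symmetric] norm_triangle_ineq ennreal_leI del: ennreal_plus)
    also have "\<dots> \<le> 2 * (T g y + T h y)" by (simp add: mult_2)
    finally show "T (\<lambda>x. g x + h x) y \<le> 2 * (T g y + T h y)" .
  qed
  have w: "weak_type N T 2 6"
    by (rule strong_imp_weak_type[OF Tm]) (use lp_piece_L2 Tint in auto)
  obtain B where B: "B > 0" "\<And>(f :: 'a \<Rightarrow> complex) \<mu> x. schwartz f \<Longrightarrow> (\<And>x. norm (f x) \<le> \<mu>) \<Longrightarrow> norm (multiplier_op lp_mult f x) \<le> B * \<mu>"
    using lp_bounded by metis
  have bd: "AE y in N. T h y \<le> ennreal (B * \<mu>)" if h: "schwartz h" and mu: "\<And>x. norm (h x) \<le> \<mu>" for h \<mu>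
  proof -
    have "norm (lp_piece l h x) \<le> B * \<mu>" for l x
      unfolding lp_piece_def by (rule B(2)[OF schwartz_dilate[OF h]]) (auto simp: mu less_imp_neq[symmetric])
    then show ?thesis by (auto simp: T_def intro!: ennreal_leI)
  qed
  obtain k :: nat where k: "p < real k" using reals_Archimedean2 by blast
  have mc: "marc_const k 2 p > 0" using p2 k unfolding marc_const_def by (intro add_pos_pos) auto
  let ?C = "4 powr p * (p * (6 * marc_const k 2 p * B powr (p - 2)))"
  have "(\<integral>\<^sup>+y. epow (T f y) p \<partial>N) \<le> ennreal ?C * (\<integral>\<^sup>+x. ennreal (norm (f x) powr p) \<partial>lborel)" if f: "schwartz f" for f
    by (rule marcinkiewicz_infinity[OF sf q _ p2 _ w B(1) bd _ f]) (use p2 k in auto)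
  moreover have "?C > 0" using mc p2 B by simp
  ultimately show ?thesis using Tint by (intro that[of ?C]) auto
qed

section \<open>Square functions for a fixed cutoff\<close>

definition sphere_mult :: "(real \<Rightarrow> real) \<Rightarrow> real \<Rightarrow> real \<Rightarrow> 'a::euclidean_space \<Rightarrow> complex" where
  "sphere_mult \<phi> \<delta> t \<xi> = complex_of_real (\<phi> ((t - (norm \<xi>)\<^sup>2) / \<delta>))"

lemma square_function_eq:
  "square_function \<phi> \<delta> f x = epow (\<integral>\<^sup>+t\<in>{1/2..2}. ennreal ((norm (multiplier_op (sphere_mult \<phi> \<delta> t) f x))\<^sup>2) \<partial>lborel) (1/2)"
  by (simp add: square_function_def sphere_mult_def[abs_def])

lemma multiplier_op_measurable2:
  fixes f :: "'a::euclidean_space \<Rightarrow> complex"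
  assumes [measurable]: "f \<in> borel_measurable borel" "(\<lambda>(t, \<xi>). m t \<xi>) \<in> borel_measurable (borel \<Otimes>\<^sub>M borel)"
  shows "(\<lambda>(x, t::real). multiplier_op (m t) f x) \<in> borel_measurable (borel \<Otimes>\<^sub>M borel)"
proof -
  have "(\<lambda>(xt, \<xi>). cis (2 * pi * (fst xt \<bullet> \<xi>)) * m (snd xt) \<xi> * fourier f \<xi>) \<in> borel_measurable ((borel \<Otimes>\<^sub>M borel) \<Otimes>\<^sub>M lborel)"
    by measurable
  from lborel.borel_measurable_lebesgue_integral[OF this]
  show ?thesis by (simp add: multiplier_op_def case_prod_beta')
qed

lemma sphere_mult_measurable2 [measurable]:
  assumes [measurable]: "\<phi> \<in> borel_measurable borel"
  shows "(\<lambda>(t, \<xi>). sphere_mult \<phi> \<delta> t \<xi>) \<in> borel_measurable (borel \<Otimes>\<^sub>M borel)"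
  unfolding sphere_mult_def by measurable

lemma sphere_mult_op_measurable:
  fixes f :: "'a::euclidean_space \<Rightarrow> complex"
  assumes [measurable]: "f \<in> borel_measurable borel" "\<phi> \<in> borel_measurable borel"
  shows "(\<lambda>(x, t). multiplier_op (sphere_mult \<phi> \<delta> t) f x) \<in> borel_measurable (borel \<Otimes>\<^sub>M borel)"
  by (rule multiplier_op_measurable2) measurable

lemma square_function_measurable:
  fixes f :: "'a::euclidean_space \<Rightarrow> complex"
  assumes [measurable]: "f \<in> borel_measurable borel" "\<phi> \<in> borel_measurable borel"
  shows "square_function \<phi> \<delta> f \<in> borel_measurable borel"
proof -
  note [measurable] = sphere_mult_op_measurable[OF assms]
  have "(\<lambda>x. \<integral>\<^sup>+t. ennreal ((norm (multiplier_op (sphere_mult \<phi> \<delta> t) f x))\<^sup>2) * indicator {1/2..2} t \<partial>lborel) \<in> borel_measurable borel"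
    by measurable
  then show ?thesis unfolding square_function_eq[abs_def] by measurable
qed

lemma sphere_mult_op_L2:
  fixes f :: "'a::euclidean_space \<Rightarrow> complex"
  assumes f: "schwartz f" and [measurable]: "\<phi> \<in> borel_measurable borel" and M: "\<And>x. \<bar>\<phi> x\<bar> \<le> M"
  shows "(\<integral>\<^sup>+x. ennreal ((norm (multiplier_op (sphere_mult \<phi> \<delta> t) f x))\<^sup>2) \<partial>lborel) \<le> ennreal (M\<^sup>2) * (\<integral>\<^sup>+x. ennreal ((norm (f x))\<^sup>2) \<partial>lborel)"
proof (rule multiplier_op_L2)
  have m: "norm (sphere_mult \<phi> \<delta> t \<xi>) \<le> M" for \<xi> :: 'a by (simp add: sphere_mult_def M)
  then show "\<And>\<xi>::'a. norm (sphere_mult \<phi> \<delta> t \<xi>) \<le> M" .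
  have "sphere_mult \<phi> \<delta> t \<in> borel_measurable (lborel :: 'a measure)" unfolding sphere_mult_def by measurable
  then show "integrable lborel (\<lambda>\<xi>. sphere_mult \<phi> \<delta> t \<xi> * fourier f \<xi>)"
    by (rule integrable_mult_bounded[OF integrable_fourier_schwartz[OF f] _ m])
qed (rule schwartz_integrable[OF f])

text \<open>The multiplier bound holds for each t separately; 3/2 is the length of [1/2, 2]. The
  bound is independent of \<delta>, so the endpoint 2 contributes no growth in the scale.\<close>

lemma square_function_L2:
  fixes f :: "'a::euclidean_space \<Rightarrow> complex"
  assumes f: "schwartz f" and [measurable]: "\<phi> \<in> borel_measurable borel" and M: "\<And>x. \<bar>\<phi> x\<bar> \<le> M"
  shows "(\<integral>\<^sup>+x. epow (square_function \<phi> \<delta> f x) 2 \<partial>lborel) \<le> ennreal (3/2 * M\<^sup>2) * (\<integral>\<^sup>+x. ennreal (norm (f x) powr 2) \<partial>lborel)"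
proof -
  note [measurable] = schwartz_measurable[OF f]
  note [measurable] = sphere_mult_op_measurable[OF schwartz_measurable[OF f] assms(2), of \<delta>]
  have m: "(\<lambda>(x, t). ennreal ((norm (multiplier_op (sphere_mult \<phi> \<delta> t) f x))\<^sup>2) * indicator {1/2..2} t) \<in> borel_measurable (lborel \<Otimes>\<^sub>M lborel)"
    by measurable
  have "(\<integral>\<^sup>+x. epow (square_function \<phi> \<delta> f x) 2 \<partial>lborel) = (\<integral>\<^sup>+x. (\<integral>\<^sup>+t\<in>{1/2..2}. ennreal ((norm (multiplier_op (sphere_mult \<phi> \<delta> t) f x))\<^sup>2) \<partial>lborel) \<partial>lborel)"
    by (simp add: square_function_eq epow_epow)
  also have "\<dots> = (\<integral>\<^sup>+t. (\<integral>\<^sup>+x. ennreal ((norm (multiplier_op (sphere_mult \<phi> \<delta> t) f x))\<^sup>2) * indicator {1/2..2} t \<partial>lborel) \<partial>lborel)"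
    using lborel_pair.Fubini'[OF m] by simp
  also have "\<dots> \<le> (\<integral>\<^sup>+t. (ennreal (M\<^sup>2) * (\<integral>\<^sup>+x. ennreal ((norm (f x))\<^sup>2) \<partial>lborel)) * indicator {1/2..2} (t::real) \<partial>lborel)"
    using sphere_mult_op_L2[OF f assms(2) M] by (intro nn_integral_mono) (auto simp: indicator_def)
  also have "\<dots> = (ennreal (M\<^sup>2) * (\<integral>\<^sup>+x. ennreal ((norm (f x))\<^sup>2) \<partial>lborel)) * ennreal (3/2)"
    by (subst nn_integral_cmult_indicator) auto
  also have "\<dots> = ennreal (3/2 * M\<^sup>2) * (\<integral>\<^sup>+x. ennreal (norm (f x) powr 2) \<partial>lborel)"
    by (subst ennreal_mult) (auto simp: mult_ac)
  finally show ?thesis .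
qed

lemma square_function_quasi_sublinear:
  assumes [measurable]: "\<phi> \<in> borel_measurable borel" and M: "\<And>x. \<bar>\<phi> x\<bar> \<le> M"
  shows "quasi_sublinear lborel (square_function \<phi> \<delta> :: ('a::euclidean_space \<Rightarrow> complex) \<Rightarrow> 'a \<Rightarrow> ennreal)"
  unfolding quasi_sublinear_def
proof (intro conjI allI impI)
  fix g h :: "'a \<Rightarrow> complex" and y :: 'a assume gh: "schwartz g" "schwartz h"
  note [measurable] = sphere_mult_op_measurable[OF schwartz_measurable[OF gh(1)] assms(1), of \<delta>]
    sphere_mult_op_measurable[OF schwartz_measurable[OF gh(2)] assms(1), of \<delta>]
  let ?S = "\<lambda>f t. ennreal ((norm (multiplier_op (sphere_mult \<phi> \<delta> t) f y))\<^sup>2) * indicator {1/2..2} t"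
  have "?S (\<lambda>x. g x + h x) t \<le> 2 * ?S g t + 2 * ?S h t" for t :: real
  proof -
    have "multiplier_op (sphere_mult \<phi> \<delta> t) (\<lambda>x. g x + h x) y = multiplier_op (sphere_mult \<phi> \<delta> t) g y + multiplier_op (sphere_mult \<phi> \<delta> t) h y"
      by (rule multiplier_op_add[OF gh, where B = M]) (auto simp: sphere_mult_def[abs_def] M)
    moreover have "(norm (a + b))\<^sup>2 \<le> 2 * (norm a)\<^sup>2 + 2 * (norm b)\<^sup>2" for a b :: complex
    proof -
      have "(norm (a + b))\<^sup>2 \<le> (norm a + norm b)\<^sup>2" by (intro power_mono norm_triangle_ineq) simp
      also have "\<dots> \<le> 2 * (norm a)\<^sup>2 + 2 * (norm b)\<^sup>2" using sum_squares_bound[of "norm a" "norm b"] by (simp add: power2_sum)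
      finally show ?thesis .
    qed
    ultimately have "ennreal ((norm (multiplier_op (sphere_mult \<phi> \<delta> t) (\<lambda>x. g x + h x) y))\<^sup>2) \<le>
        ennreal (2 * (norm (multiplier_op (sphere_mult \<phi> \<delta> t) g y))\<^sup>2 + 2 * (norm (multiplier_op (sphere_mult \<phi> \<delta> t) h y))\<^sup>2)"
      by (intro ennreal_leI) simp
    also have "\<dots> = 2 * ennreal ((norm (multiplier_op (sphere_mult \<phi> \<delta> t) g y))\<^sup>2) + 2 * ennreal ((norm (multiplier_op (sphere_mult \<phi> \<delta> t) h y))\<^sup>2)"
      by (simp add: ennreal_mult)
    finally show ?thesis by (simp add: indicator_def)
  qed
  then have "(\<integral>\<^sup>+t. ?S (\<lambda>x. g x + h x) t \<partial>lborel) \<le> (\<integral>\<^sup>+t. 2 * ?S g t + 2 * ?S h t \<partial>lborel)" by (rule nn_integral_mono)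
  also have "\<dots> = 2 * (\<integral>\<^sup>+t. ?S g t \<partial>lborel) + 2 * (\<integral>\<^sup>+t. ?S h t \<partial>lborel)"
    by (subst nn_integral_add) (auto simp: nn_integral_cmult)
  finally have "square_function \<phi> \<delta> (\<lambda>x. g x + h x) y \<le> epow (2 * (\<integral>\<^sup>+t. ?S g t \<partial>lborel) + 2 * (\<integral>\<^sup>+t. ?S h t \<partial>lborel)) (1/2)"
    unfolding square_function_eq by (rule epow_mono) simp
  \<comment> \<open>One factor sqrt 2 comes from the root of the sum, another from the factor 2 in
    the squares; together they give the constant 2 of \<open>quasi_sublinear\<close>.\<close>
  also have "\<dots> \<le> ennreal (2 powr (1/2)) * (epow (2 * (\<integral>\<^sup>+t. ?S g t \<partial>lborel)) (1/2) + epow (2 * (\<integral>\<^sup>+t. ?S h t \<partial>lborel)) (1/2))"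
    by (rule epow_add_le) simp
  also have "\<dots> = (ennreal (2 powr (1/2)) * ennreal (2 powr (1/2))) * (square_function \<phi> \<delta> g y + square_function \<phi> \<delta> h y)"
    unfolding square_function_eq by (simp add: epow_mult distrib_left mult.assoc)
  also have "ennreal (2 powr (1/2)) * ennreal (2 powr (1/2)) = 2"
    by (simp add: ennreal_mult[symmetric] powr_add[symmetric])
  finally show "square_function \<phi> \<delta> (\<lambda>x. g x + h x) y \<le> 2 * (square_function \<phi> \<delta> g y + square_function \<phi> \<delta> h y)" .
next
  fix h :: "'a \<Rightarrow> complex" assume "schwartz h"
  then show "square_function \<phi> \<delta> h \<in> borel_measurable lborel"
    using square_function_measurable[OF schwartz_measurable assms(1)] by simp
qed

lemma square_function_cmult:
  fixes f :: "'a::euclidean_space \<Rightarrow> complex"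
  assumes K: "K \<ge> 0" and fm: "f \<in> borel_measurable borel" and pm: "\<phi> \<in> borel_measurable borel"
  shows "square_function (\<lambda>x. K * \<phi> x) \<delta> f x = ennreal K * square_function \<phi> \<delta> f x"
proof -
  have "multiplier_op (sphere_mult (\<lambda>x. K * \<phi> x) \<delta> t) f x = of_real K * multiplier_op (sphere_mult \<phi> \<delta> t) f x" for t
  proof -
    have "multiplier_op (sphere_mult (\<lambda>x. K * \<phi> x) \<delta> t) f x = (LINT \<xi>|lborel. of_real K * (cis (2 * pi * (x \<bullet> \<xi>)) * sphere_mult \<phi> \<delta> t \<xi> * fourier f \<xi>))"
      unfolding multiplier_op_def by (simp add: sphere_mult_def mult_ac)
    then show ?thesis unfolding multiplier_op_def by (simp only: integral_mult_right_zero)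
  qed
  then have e: "ennreal ((norm (multiplier_op (sphere_mult (\<lambda>x. K * \<phi> x) \<delta> t) f x))\<^sup>2) * indicator {1/2..2} t =
    ennreal (K\<^sup>2) * (ennreal ((norm (multiplier_op (sphere_mult \<phi> \<delta> t) f x))\<^sup>2) * indicator {1/2..2} t)" for t :: real
    by (simp add: norm_mult power_mult_distrib ennreal_mult mult.assoc)
  show ?thesis
  proof (cases "K = 0")
    case True
    then show ?thesis unfolding square_function_eq e by simp
  next
    case False
    note [measurable] = sphere_mult_op_measurable[OF fm pm, of \<delta>]
    show ?thesis
      unfolding square_function_eq e using K False
      by (simp add: nn_integral_cmult epow_mult epow_ennreal powr_half_sqrt)
  qed
qed

section \<open>Square functions at a fixed scale\<close>

lemma recip_infinity [simp]: "recip \<infinity> = 0" "recip top = 0"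
  by (simp_all add: recip_def)

lemma recip_ennreal: "q > 0 \<Longrightarrow> recip (ennreal q) = 1 / q"
  by (simp add: recip_def divide_ennreal flip: ennreal_1)

lemma recip_nonneg [simp]: "recip p \<ge> 0"
  by (simp add: recip_def)

lemma recip_antimono:
  assumes "ennreal c \<le> s" "c > 0" shows "recip s \<le> 1 / c"
proof (cases s)
  case (real r)
  then have "c \<le> r" using assms by simp
  then show ?thesis using real assms by (simp add: recip_ennreal frac_le)
qed (use assms in simp)

lemma exponent_cases:
  assumes "p \<ge> (2::ennreal)"
  obtains "p = \<infinity>" | q where "p = ennreal q" "q \<ge> 2"
proof (cases p)
  case (real r)
  then have "ennreal 2 \<le> ennreal r" using assms by simp
  then have "2 \<le> r" using real by (subst (asm) ennreal_le_iff) auto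
  then show ?thesis using real that by blast
qed (use that in simp)

lemma eLp_norm_ennreal: "q > 0 \<Longrightarrow> eLp_norm (ennreal q) F = epow (\<integral>\<^sup>+x. epow (F x) q \<partial>lborel) (1 / q)"
  by (simp add: eLp_norm_def recip_ennreal)

lemma Lp_norm_ennreal: "q > 0 \<Longrightarrow> Lp_norm (ennreal q) f = epow (\<integral>\<^sup>+x. ennreal (norm (f x) powr q) \<partial>lborel) (1 / q)"
  by (simp add: Lp_norm_def eLp_norm_ennreal epow_ennreal)

lemma eLp_norm_le_iff:
  assumes q: "q > 0" and c: "c \<ge> 0"
  shows "eLp_norm (ennreal q) F \<le> ennreal c * Lp_norm (ennreal q) f \<longleftrightarrow>
    (\<integral>\<^sup>+x. epow (F x) q \<partial>lborel) \<le> ennreal (c powr q) * (\<integral>\<^sup>+x. ennreal (norm (f x) powr q) \<partial>lborel)"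
    (is "?L \<longleftrightarrow> ?I \<le> _ * ?J")
proof
  assume ?L
  then have "epow ?I (1 / q) \<le> ennreal c * epow ?J (1 / q)" using q by (simp add: eLp_norm_ennreal Lp_norm_ennreal)
  then have "epow (epow ?I (1 / q)) q \<le> epow (ennreal c * epow ?J (1 / q)) q" using q by (rule epow_mono)
  then show "?I \<le> ennreal (c powr q) * ?J" using q c by (simp add: epow_mult epow_inverse epow_ennreal)
next
  assume "?I \<le> ennreal (c powr q) * ?J"
  then have "epow ?I (1 / q) \<le> epow (ennreal (c powr q) * ?J) (1 / q)" using q by (intro epow_mono) auto
  also have "\<dots> = ennreal c * epow ?J (1 / q)" using q c by (simp add: epow_mult epow_ennreal powr_powr)
  finally show ?L using q by (simp add: eLp_norm_ennreal Lp_norm_ennreal)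
qed

lemma Lp_norm_infinity_le:
  fixes f :: "'a::euclidean_space \<Rightarrow> complex"
  assumes [measurable]: "f \<in> borel_measurable borel" and "\<And>x. norm (f x) \<le> \<mu>"
  shows "Lp_norm \<infinity> f \<le> ennreal \<mu>"
  unfolding Lp_norm_def eLp_norm_def by (auto intro!: esssup_I ennreal_leI assms)

lemma eLp_norm_cmult_le:
  fixes F :: "'a::euclidean_space \<Rightarrow> ennreal"
  assumes [measurable]: "F \<in> borel_measurable borel" and K: "K \<ge> 0" and s: "s \<ge> 2"
  shows "eLp_norm s (\<lambda>x. ennreal K * F x) \<le> ennreal K * eLp_norm s F"
  using s
proof (cases rule: exponent_cases)
  case 1
  have "AE x in lborel. F x \<le> esssup lborel F" by (rule esssup_AE)
  then have "AE x in lborel. ennreal K * F x \<le> ennreal K * esssup lborel F" by eventually_elim (rule mult_left_mono, auto)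
  then show ?thesis unfolding 1 eLp_norm_def by (auto intro!: esssup_I)
next
  case (2 q)
  then show ?thesis using K
    by (simp add: eLp_norm_ennreal epow_mult epow_ennreal nn_integral_cmult powr_powr)
qed

text \<open>From 2d/(d-1) on, 1/s is at most 1/2 and the first entry of the maximum in
  \<open>alpha\<close> is nonnegative, so the exponent is affine in 1/s.\<close>

lemma alpha_eq:
  assumes d: "d \<ge> 2" and s: "s \<ge> ennreal (2 * real d / (real d - 1))"
  shows "alpha d s = (real d - 1) / 2 - real d * recip s" "alpha d s \<ge> 0"
proof -
  have "recip s \<le> 1 / (2 * real d / (real d - 1))" by (rule recip_antimono[OF s]) (use d in auto)
  then have r: "recip s \<le> (real d - 1) / (2 * real d)" by simp
  have h: "(real d - 1) / (2 * real d) \<le> 1/2" using d by (simp add: field_simps)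
  then have "\<bar>1/2 - recip s\<bar> = 1/2 - recip s" using r by linarith
  moreover have "real d * recip s \<le> (real d - 1) / 2"
  proof -
    have "real d * ((real d - 1) / (2 * real d)) = (real d - 1) / 2" using d by simp
    with mult_left_mono[OF r, of "real d"] show ?thesis by simp
  qed
  ultimately show "alpha d s = (real d - 1) / 2 - real d * recip s"
    unfolding alpha_def by (simp add: right_diff_distrib diff_divide_distrib max_def)
  show "alpha d s \<ge> 0" by (simp add: alpha_def)
qed

text \<open>The threshold for a single function: on each of the regions \<open>D1\<close>, \<open>D2\<close>, \<open>D3\<close>, the exponent
  \<^const>\<open>alpha_star\<close> is one plus the sum of the thresholds at \<open>p\<close> and at \<open>q\<close>.\<close>

definition crit :: "nat \<Rightarrow> ennreal \<Rightarrow> ennreal \<Rightarrow> real" where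
  "crit d P p = (if P \<le> p then alpha d p else (1 - 2 * recip p) / (1 - 2 * recip P) * alpha d P)"

text \<open>The hypothesis of the theorem with N fixed. The type argument is a token for the
  underlying space, which the remaining arguments do not determine.\<close>

definition square_function_hyp :: "'a::euclidean_space itself \<Rightarrow> nat \<Rightarrow> ennreal \<Rightarrow> bool" where
  "square_function_hyp _ N P \<longleftrightarrow> (\<forall>s\<ge>P. \<forall>\<epsilon>>0. \<exists>C\<ge>0. \<forall>\<delta> \<phi>. \<forall>f :: 'a \<Rightarrow> complex.
     0 < \<delta> \<and> \<delta> \<le> 1/4 \<and> \<phi> \<in> C_class N \<and> schwartz f \<longrightarrow>
     eLp_norm s (square_function \<phi> \<delta> f)
       \<le> ennreal (C * \<delta> powr (- (real DIM('a) - 2) / 2 + real DIM('a) * recip s - \<epsilon>)) * Lp_norm s f)"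

text \<open>The hypothesis rewritten for one fixed cutoff at dyadic scales, with the growth
  expressed through \<open>alpha\<close>. Starting at 2^(-2) keeps the scale within the range
  \<delta> \<le> 1/4.\<close>

lemma square_function_endpoint:
  fixes \<psi> :: "real \<Rightarrow> real"
  assumes d: "DIM('a::euclidean_space) \<ge> 2" and P: "P \<ge> ennreal (2 * real DIM('a) / (real DIM('a) - 1))"
    and H: "square_function_hyp TYPE('a) N P"
    and psi: "smooth_real \<psi>" "\<And>x. x \<notin> {-1..1} \<Longrightarrow> \<psi> x = 0" and s: "s \<ge> P" "s \<ge> 2" and e: "\<epsilon> > 0"
  obtains C where "C > 0" "\<And>n (f :: 'a \<Rightarrow> complex). schwartz f \<Longrightarrow>
    eLp_norm s (square_function \<psi> (2 powr (- real (n + 2))) f) \<le> ennreal (C * 2 powr (real n * (alpha DIM('a) s + \<epsilon>))) * Lp_norm s f"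
proof -
  obtain K where K: "K > 0" "(\<lambda>x. \<psi> x / K) \<in> C_class N" using C_class_scale[OF psi] by metis
  obtain C0 where C0: "C0 \<ge> 0" "\<And>\<delta> \<phi> (f :: 'a \<Rightarrow> complex). 0 < \<delta> \<Longrightarrow> \<delta> \<le> 1/4 \<Longrightarrow> \<phi> \<in> C_class N \<Longrightarrow> schwartz f \<Longrightarrow>
      eLp_norm s (square_function \<phi> \<delta> f) \<le> ennreal (C0 * \<delta> powr (- (real DIM('a) - 2) / 2 + real DIM('a) * recip s - \<epsilon>)) * Lp_norm s f"
    using H s e unfolding square_function_hyp_def by metis
  define a where "a = alpha DIM('a) s + \<epsilon>"
  have sP: "s \<ge> ennreal (2 * real DIM('a) / (real DIM('a) - 1))" using s P by simp
  have a: "a > 0" using alpha_eq(2)[OF d sP] e by (simp add: a_def)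
  \<comment> \<open>Since alpha(s) = (d-1)/2 - d/s, the assumed exponent is 1/2 - alpha(s) -
    \<epsilon>.\<close>
  have ex: "- (real DIM('a) - 2) / 2 + real DIM('a) * recip s - \<epsilon> = 1/2 - a"
    unfolding a_def alpha_eq(1)[OF d sP] by (simp add: field_simps)
  \<comment> \<open>\<open>2 powr (2 * a)\<close> absorbs the offset in n + 2; adding 1 makes C
    positive even if C0 is 0.\<close>
  define C where "C = K * C0 * 2 powr (2 * a) + 1"
  have C: "C > 0" using K C0 by (simp add: C_def add_nonneg_pos)
  have "eLp_norm s (square_function \<psi> (2 powr (- real (n + 2))) f) \<le> ennreal (C * 2 powr (real n * a)) * Lp_norm s f"
    if f: "schwartz f" for n and f :: "'a \<Rightarrow> complex"
  proof -
    define \<delta> where "\<delta> = (2::real) powr (- real (n + 2))"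
    have de: "\<delta> > 0" "\<delta> \<le> 1/4"
    proof -
      have "\<delta> \<le> 2 powr (- 2)" unfolding \<delta>_def by (intro powr_mono) auto
      then show "\<delta> \<le> 1/4" by (simp add: powr_minus)
    qed (simp add: \<delta>_def)
    have m: "(\<lambda>x. \<psi> x / K) \<in> borel_measurable borel" using smooth_real_measurable[OF psi(1)] by measurable
    have sq: "square_function \<psi> \<delta> f = (\<lambda>x. ennreal K * square_function (\<lambda>x. \<psi> x / K) \<delta> f x)"
      using square_function_cmult[OF less_imp_le[OF K(1)] schwartz_measurable[OF f] m, of \<delta>] K(1) by (simp add: fun_eq_iff)
    have "eLp_norm s (square_function \<psi> \<delta> f) \<le> ennreal K * eLp_norm s (square_function (\<lambda>x. \<psi> x / K) \<delta> f)"
      unfolding sq using K(1) s by (intro eLp_norm_cmult_le square_function_measurable schwartz_measurable f m) auto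
    also have "\<dots> \<le> ennreal K * (ennreal (C0 * \<delta> powr (1/2 - a)) * Lp_norm s f)"
      using C0(2)[OF de K(2) f] unfolding ex by (rule mult_left_mono) simp
    also have "\<dots> = ennreal (K * (C0 * \<delta> powr (1/2 - a))) * Lp_norm s f"
      using K C0 by (simp add: mult.assoc ennreal_mult)
    also have "\<dots> \<le> ennreal (C * 2 powr (real n * a)) * Lp_norm s f"
    proof (intro mult_right_mono ennreal_leI)
      have "\<delta> powr (1/2 - a) = 2 powr (real (n + 2) * (a - 1/2))"
        unfolding \<delta>_def powr_powr by (simp add: algebra_simps)
      \<comment> \<open>The factor \<delta>^(1/2) is at most 1 and is given away here.\<close>
      also have "\<dots> \<le> 2 powr (real (n + 2) * a)" by (intro powr_mono mult_left_mono) auto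
      also have "\<dots> = 2 powr (2 * a) * 2 powr (real n * a)" by (simp add: powr_add[symmetric] algebra_simps)
      finally have "K * C0 * \<delta> powr (1/2 - a) \<le> K * C0 * (2 powr (2 * a) * 2 powr (real n * a))"
        using K C0 by (intro mult_left_mono) auto
      also have "\<dots> \<le> C * 2 powr (real n * a)" by (simp add: C_def distrib_right mult.assoc)
      finally show "K * (C0 * \<delta> powr (1/2 - a)) \<le> C * 2 powr (real n * a)" by (simp add: mult.assoc)
    qed simp
    finally show ?thesis unfolding \<delta>_def .
  qed
  with C show ?thesis unfolding a_def by (rule that)
qed

lemma smooth_compact_bounded:
  assumes "smooth_real \<psi>" "\<And>x. x \<notin> {-1..1} \<Longrightarrow> \<psi> x = 0"
  obtains M where "M > 0" "\<And>x. \<bar>\<psi> x\<bar> \<le> M"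
proof -
  have "compact (\<psi> ` {-1..1})" by (intro compact_continuous_image smooth_real_continuous assms) auto
  then obtain B where B: "\<forall>x\<in>{-1..1}. \<bar>\<psi> x\<bar> \<le> B" by (meson bounded_real compact_imp_bounded image_eqI)
  have "\<bar>\<psi> x\<bar> \<le> max B 0 + 1" for x
  proof (cases "x \<in> {-1..1}")
    case True
    then have "\<bar>\<psi> x\<bar> \<le> B" using B by blast
    then show ?thesis by linarith
  qed (use assms in simp)
  then show ?thesis by (intro that[of "max B 0 + 1"]) auto
qed

text \<open>The interpolated bound carries \<theta> (a + \<epsilon>) in the exponent; since \<theta>
  \<le> 1, the loss \<theta> \<epsilon> is at most \<epsilon>.\<close>

lemma interpolated_norm_bound:
  assumes q: "q > 0" and C1: "C1 > 0" and K0: "K0 > 0" and th: "\<theta> \<ge> 0" "\<theta> \<le> 1" and e: "\<epsilon> > 0"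
    and b: "(\<integral>\<^sup>+x. epow (F x) q \<partial>lborel) \<le> ennreal (K0 * (C1 * 2 powr (real n * (a + \<epsilon>))) powr (q * \<theta>)) * (\<integral>\<^sup>+x. ennreal (norm (f x) powr q) \<partial>lborel)"
  shows "eLp_norm (ennreal q) F \<le> ennreal (K0 powr (1 / q) * C1 powr \<theta> * 2 powr (real n * (\<theta> * a + \<epsilon>))) * Lp_norm (ennreal q) f"
proof -
  have "(C1 * 2 powr (real n * (a + \<epsilon>))) powr (q * \<theta>) = (C1 powr \<theta> * 2 powr (real n * (\<theta> * a + \<theta> * \<epsilon>))) powr q"
    using C1 by (simp add: powr_mult powr_powr algebra_simps)
  also have "\<dots> \<le> (C1 powr \<theta> * 2 powr (real n * (\<theta> * a + \<epsilon>))) powr q"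
    using q th e by (intro powr_mono2 mult_left_mono powr_mono add_left_mono) (auto simp: mult_left_le_one_le)
  finally have "K0 * (C1 * 2 powr (real n * (a + \<epsilon>))) powr (q * \<theta>) \<le> K0 * (C1 powr \<theta> * 2 powr (real n * (\<theta> * a + \<epsilon>))) powr q"
    using K0 by simp
  also have "\<dots> = (K0 powr (1 / q) * C1 powr \<theta> * 2 powr (real n * (\<theta> * a + \<epsilon>))) powr q"
    using K0 q by (simp add: powr_mult powr_powr mult.assoc)
  finally have "ennreal (K0 * (C1 * 2 powr (real n * (a + \<epsilon>))) powr (q * \<theta>)) * (\<integral>\<^sup>+x. ennreal (norm (f x) powr q) \<partial>lborel) \<le>
     ennreal ((K0 powr (1 / q) * C1 powr \<theta> * 2 powr (real n * (\<theta> * a + \<epsilon>))) powr q) * (\<integral>\<^sup>+x. ennreal (norm (f x) powr q) \<partial>lborel)"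
    by (intro mult_right_mono ennreal_leI) simp_all
  with b show ?thesis using q by (subst eLp_norm_le_iff) auto
qed

text \<open>For p below P, the relation 1/p = (1 - \<theta>)/2 + \<theta>/P determines \<theta> = (1
  - 2/p) / (1 - 2/P), the factor in \<open>crit\<close>. The L^2 bound does not grow with n, so only
  the share \<theta> of the growth at P remains.\<close>

theorem square_function_scale:
  fixes \<psi> :: "real \<Rightarrow> real"
  assumes d: "DIM('a::euclidean_space) \<ge> 2" and P: "P \<ge> ennreal (2 * real DIM('a) / (real DIM('a) - 1))"
    and H: "square_function_hyp TYPE('a) N P"
    and psi: "smooth_real \<psi>" "\<And>x. x \<notin> {-1..1} \<Longrightarrow> \<psi> x = 0" and p: "p \<ge> 2" and e: "\<epsilon> > 0"
  obtains C where "C > 0" "\<And>n (f :: 'a \<Rightarrow> complex). schwartz f \<Longrightarrow>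
    eLp_norm p (square_function \<psi> (2 powr (- real (n + 2))) f) \<le> ennreal (C * 2 powr (real n * (crit DIM('a) P p + \<epsilon>))) * Lp_norm p f"
proof (cases "P \<le> p")
  case True
  from square_function_endpoint[OF d P H psi True p e] that show ?thesis
    using True by (auto simp: crit_def)
next
  case False
  have d1: "2 < 2 * real DIM('a) / (real DIM('a) - 1)" using d by (simp add: field_simps)
  have P2: "P \<ge> 2"
  proof -
    have "ennreal 2 \<le> ennreal (2 * real DIM('a) / (real DIM('a) - 1))" using d1 by (intro ennreal_leI) simp
    from order_trans[OF this P] show ?thesis by simp
  qed
  obtain q where q: "p = ennreal q" "q \<ge> 2" using False p by (auto elim: exponent_cases)
  obtain M where M: "M > 0" "\<And>x. \<bar>\<psi> x\<bar> \<le> M" using smooth_compact_bounded[OF psi] by metis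
  have pm[measurable]: "\<psi> \<in> borel_measurable borel" by (rule smooth_real_measurable[OF psi(1)])
  define \<delta> where "\<delta> = (\<lambda>n::nat. (2::real) powr (- real (n + 2)))"
  note qs = square_function_quasi_sublinear[OF pm M(2), where 'a='a]
  have L2: "(\<integral>\<^sup>+x. epow (square_function \<psi> \<delta>' f x) 2 \<partial>lborel) \<le> ennreal (3/2 * M\<^sup>2) * (\<integral>\<^sup>+x. ennreal (norm (f x) powr 2) \<partial>lborel)"
    if "schwartz f" for f :: "'a \<Rightarrow> complex" and \<delta>'
    by (rule square_function_L2[OF that pm M(2)])
  have w2: "weak_type lborel (square_function \<psi> \<delta>' :: ('a \<Rightarrow> complex) \<Rightarrow> _) 2 (3/2 * M\<^sup>2)" for \<delta>'
    by (rule strong_imp_weak_type[OF _ _ _ L2]) (use qs in \<open>auto simp: quasi_sublinear_def\<close>)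
  obtain C1 where C1: "C1 > 0" "\<And>n (f :: 'a \<Rightarrow> complex). schwartz f \<Longrightarrow>
    eLp_norm P (square_function \<psi> (\<delta> n) f) \<le> ennreal (C1 * 2 powr (real n * (alpha DIM('a) P + \<epsilon>))) * Lp_norm P f"
    using square_function_endpoint[OF d P H psi order_refl P2 e] unfolding \<delta>_def by metis
  define B where "B = (\<lambda>n. C1 * 2 powr (real n * (alpha DIM('a) P + \<epsilon>)))"
  have B: "B n > 0" for n using C1 by (simp add: B_def)
  have crit: "crit DIM('a) P p = (1 - 2 * recip p) / (1 - 2 * recip P) * alpha DIM('a) P" using False by (simp add: crit_def)
  have "\<exists>K0>0. \<exists>\<theta>\<ge>0. \<theta> \<le> 1 \<and> \<theta> = (1 - 2 * recip p) / (1 - 2 * recip P) \<and> (\<forall>n (f :: 'a \<Rightarrow> complex). schwartz f \<longrightarrow>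
     (\<integral>\<^sup>+x. epow (square_function \<psi> (\<delta> n) f x) q \<partial>lborel) \<le> ennreal (K0 * B n powr (q * \<theta>)) * (\<integral>\<^sup>+x. ennreal (norm (f x) powr q) \<partial>lborel))"
  proof (cases "q = 2")
    case True
    have "(1 - 2 * recip p) / (1 - 2 * recip P) = 0" using True recip_ennreal[of 2] unfolding q(1) by simp
    moreover have "B n powr 0 = 1" for n using B[of n] by simp
    ultimately show ?thesis
      using L2 M(1) unfolding True by (intro exI[of _ "3/2 * M\<^sup>2"], intro conjI, simp, intro exI[of _ 0]) simp
  next
    case q2: False
    then have q2: "q > 2" using q by simp
    obtain k :: nat where k: "q < real k" using reals_Archimedean2 by blast
    have mc: "marc_const k 2 q > 0" using q2 k unfolding marc_const_def by (intro add_pos_pos) auto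
    from P2 show ?thesis
    proof (cases rule: exponent_cases)
      case 1
      define K0 where "K0 = 4 powr q * (q * (3/2 * M\<^sup>2 * marc_const k 2 q))"
      have bd: "AE y in lborel. square_function \<psi> (\<delta> n) h y \<le> ennreal (B n * \<mu>)" if h: "schwartz h" and mu: "\<And>x. norm (h x) \<le> \<mu>" for h :: "'a \<Rightarrow> complex" and \<mu> n
      proof -
        have "eLp_norm \<infinity> (square_function \<psi> (\<delta> n) h) \<le> ennreal (B n) * ennreal \<mu>"
          using C1(2)[OF h, of n] Lp_norm_infinity_le[OF schwartz_measurable[OF h] mu] unfolding 1 B_def
          by (meson mult_left_mono order_trans zero_le)
        then have "esssup lborel (square_function \<psi> (\<delta> n) h) \<le> ennreal (B n * \<mu>)"
          using B[of n] by (simp add: eLp_norm_def ennreal_mult')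
        with esssup_AE[of "square_function \<psi> (\<delta> n) h" lborel] show ?thesis
          by (auto elim!: eventually_mono)
      qed
      have "(\<integral>\<^sup>+x. epow (square_function \<psi> (\<delta> n) f x) q \<partial>lborel) \<le> ennreal (K0 * B n powr (q * ((1 - 2 * recip p) / (1 - 2 * recip P)))) * (\<integral>\<^sup>+x. ennreal (norm (f x) powr q) \<partial>lborel)"
        if f: "schwartz f" for n and f :: "'a \<Rightarrow> complex"
      proof -
        have "(\<integral>\<^sup>+x. epow (square_function \<psi> (\<delta> n) f x) q \<partial>lborel) \<le> ennreal (4 powr q * (q * (3/2 * M\<^sup>2 * marc_const k 2 q * B n powr (q - 2)))) * (\<integral>\<^sup>+x. ennreal (norm (f x) powr q) \<partial>lborel)"
          by (rule marcinkiewicz_infinity[OF sigma_finite_lborel qs _ q2 _ w2 B bd _ f]) (use q2 k in auto)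
        \<comment> \<open>With P infinite, \<theta> = 1 - 2/q, so the power
          \<open>B n powr (q - 2)\<close> from the infinite endpoint is already the interpolated
          one.\<close>
        moreover have "q * ((1 - 2 * recip p) / (1 - 2 * recip P)) = q - 2"
          using q q2 by (simp add: 1 recip_ennreal field_simps)
        ultimately show ?thesis by (simp add: K0_def mult.assoc)
      qed
      moreover have "K0 > 0" using mc M q2 by (simp add: K0_def)
      moreover have "0 \<le> (1 - 2 * recip p) / (1 - 2 * recip P)" "(1 - 2 * recip p) / (1 - 2 * recip P) \<le> 1"
        using q q2 by (simp_all add: 1 recip_ennreal)
      ultimately show ?thesis by blast
    next
      case (2 Q)
      have qQ: "q < Q" using False q 2 by (simp add: ennreal_le_iff)
      define K0 where "K0 = 4 powr q * (q * (3/2 * M\<^sup>2 * marc_const k 2 q + (1 / q + 1 / (Q - q))))"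
      define \<theta> where "\<theta> = (1 - 2 * recip p) / (1 - 2 * recip P)"
      have th: "\<theta> = Q * (q - 2) / (q * (Q - 2))"
        using q q2 qQ unfolding \<theta>_def 2(1) q(1) by (simp add: recip_ennreal field_simps)
      have wQ: "weak_type lborel (square_function \<psi> (\<delta> n) :: ('a \<Rightarrow> complex) \<Rightarrow> _) Q (B n powr Q)" for n
      proof (rule strong_imp_weak_type)
        show "(\<integral>\<^sup>+y. epow (square_function \<psi> (\<delta> n) h y) Q \<partial>lborel) \<le> ennreal (B n powr Q) * (\<integral>\<^sup>+x. ennreal (norm (h x) powr Q) \<partial>lborel)"
          if "schwartz h" for h :: "'a \<Rightarrow> complex"
        proof -
          have "eLp_norm (ennreal Q) (square_function \<psi> (\<delta> n) h) \<le> ennreal (B n) * Lp_norm (ennreal Q) h"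
            using C1(2)[OF that, of n] unfolding B_def 2(1) .
          then show ?thesis using B[of n] 2 by (subst (asm) eLp_norm_le_iff) auto
        qed
      qed (use qs 2 in \<open>auto simp: quasi_sublinear_def\<close>)
      have "(\<integral>\<^sup>+x. epow (square_function \<psi> (\<delta> n) f x) q \<partial>lborel) \<le> ennreal (K0 * B n powr (q * \<theta>)) * (\<integral>\<^sup>+x. ennreal (norm (f x) powr q) \<partial>lborel)"
        if f: "schwartz f" for n and f :: "'a \<Rightarrow> complex"
      proof -
        \<comment> \<open>This c balances the two endpoint terms: it solves
          \<open>c powr (2 - q) = B n powr Q * c powr (Q - q)\<close>, and both sides are then
          \<open>B n powr (q * \<theta>)\<close>.\<close>
        define c where "c = B n powr (- Q / (Q - 2))"
        have c: "c > 0" using B[of n] by (simp add: c_def)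
        have bound: "(\<integral>\<^sup>+x. epow (square_function \<psi> (\<delta> n) f x) q \<partial>lborel) \<le>
           ennreal (4 powr q * (q * (3/2 * M\<^sup>2 * marc_const k 2 q * c powr (2 - q) + B n powr Q * (1 / q + 1 / (Q - q)) * c powr (Q - q)))) * (\<integral>\<^sup>+x. ennreal (norm (f x) powr q) \<partial>lborel)"
          by (rule marcinkiewicz[OF sigma_finite_lborel qs _ q2 qQ _ _ w2 wQ _ f c]) (use q2 k B[of n] in auto)
        have c1: "c powr (2 - q) = B n powr (q * \<theta>)"
        proof -
          have "- Q / (Q - 2) * (2 - q) = q * \<theta>" unfolding th using q2 qQ by (simp add: field_simps)
          then show ?thesis unfolding c_def powr_powr by simp
        qed
        have c2: "B n powr Q * (1 / q + 1 / (Q - q)) * c powr (Q - q) = (1 / q + 1 / (Q - q)) * B n powr (q * \<theta>)"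
        proof -
          have "Q + - Q / (Q - 2) * (Q - q) = q * \<theta>" unfolding th using q2 qQ by (simp add: field_simps)
          then have "B n powr Q * c powr (Q - q) = B n powr (q * \<theta>)" unfolding c_def powr_powr powr_add[symmetric] by simp
          then show ?thesis by (metis mult.assoc mult.commute)
        qed
        have "4 powr q * (q * (3/2 * M\<^sup>2 * marc_const k 2 q * c powr (2 - q) + B n powr Q * (1 / q + 1 / (Q - q)) * c powr (Q - q))) = K0 * B n powr (q * \<theta>)"
          unfolding c1 c2 K0_def by (simp only: distrib_right mult.assoc)
        with bound show ?thesis by (simp only:)
      qed
      moreover have "K0 > 0" using mc M q2 qQ by (auto simp: K0_def intro!: mult_pos_pos add_pos_pos)
      moreover have "0 \<le> \<theta>" "\<theta> \<le> 1" using q2 qQ unfolding th by (simp_all add: field_simps)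
      ultimately show ?thesis unfolding \<theta>_def by blast
    qed
  qed
  then obtain K0 \<theta> where K: "K0 > 0" "0 \<le> \<theta>" "\<theta> \<le> 1" "\<theta> = (1 - 2 * recip p) / (1 - 2 * recip P)"
    and bd: "\<And>n (f :: 'a \<Rightarrow> complex). schwartz f \<Longrightarrow>
     (\<integral>\<^sup>+x. epow (square_function \<psi> (\<delta> n) f x) q \<partial>lborel) \<le> ennreal (K0 * B n powr (q * \<theta>)) * (\<integral>\<^sup>+x. ennreal (norm (f x) powr q) \<partial>lborel)"
    by blast
  have q0: "q > 0" using q by simp
  have "eLp_norm p (square_function \<psi> (\<delta> n) f) \<le> ennreal (K0 powr (1 / q) * C1 powr \<theta> * 2 powr (real n * (\<theta> * alpha DIM('a) P + \<epsilon>))) * Lp_norm p f"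
    if "schwartz f" for n and f :: "'a \<Rightarrow> complex"
    unfolding q(1) by (rule interpolated_norm_bound[OF q0 C1(1) K(1-3) e bd[OF that, unfolded B_def]])
  moreover have "\<theta> * alpha DIM('a) P = crit DIM('a) P p" by (simp add: crit K(4))
  moreover have "K0 powr (1 / q) * C1 powr \<theta> > 0" using K C1 by simp
  ultimately show ?thesis unfolding \<delta>_def by (intro that[of "K0 powr (1 / q) * C1 powr \<theta>"]) auto
qed

section \<open>Decomposition of the Bochner--Riesz multiplier\<close>

context
  fixes \<beta> :: real assumes \<beta>: "\<beta> > 0"
begin

definition br_mult :: "real \<Rightarrow> 'a::euclidean_space \<Rightarrow> complex" where
  "br_mult t \<xi> = complex_of_real (max 0 (t - (norm \<xi>)\<^sup>2) powr \<beta>)"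

text \<open>The difference of two steps localises to [1/4, 1], away from the singularity of the
  power at 0, and it is arranged so that its dyadic rescalings telescope.\<close>

definition fine_cutoff :: "real \<Rightarrow> real" where
  "fine_cutoff x = x powr \<beta> * (smooth_step (4 * x - 1) - smooth_step (2 * x - 1))"

text \<open>The power with its singularity removed: the initial term of the telescoping sum in
  \<open>powr_decomposition\<close>.\<close>

definition coarse_cutoff :: "real \<Rightarrow> real" where
  "coarse_cutoff x = x powr \<beta> * smooth_step (8 * x - 1)"

lemma smooth_fine_cutoff: "smooth_real fine_cutoff"
proof -
  have "smooth_real (\<lambda>x. smooth_step (4 * x + (-1)) - smooth_step (2 * x + (-1)))"
    by (intro smooth_real_diff smooth_real_affine smooth_real_smooth_step)
  then have "smooth_real (\<lambda>x. x powr \<beta> * (smooth_step (4 * x + (-1)) - smooth_step (2 * x + (-1))))"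
    by (rule smooth_real_powr_mult[where c = "1/4"]) (auto simp: smooth_step_eq_0)
  then show ?thesis by (simp add: fine_cutoff_def[abs_def])
qed

lemma smooth_coarse_cutoff: "smooth_real coarse_cutoff"
proof -
  have "smooth_real (\<lambda>x. smooth_step (8 * x + (-1)))" by (intro smooth_real_affine smooth_real_smooth_step)
  then have "smooth_real (\<lambda>x. x powr \<beta> * smooth_step (8 * x + (-1)))"
    by (rule smooth_real_powr_mult[where c = "1/8"]) (auto simp: smooth_step_eq_0)
  then show ?thesis by (simp add: coarse_cutoff_def[abs_def])
qed

lemma fine_cutoff_support: "x \<notin> {-1..1} \<Longrightarrow> fine_cutoff x = 0"
  by (cases "x < 0") (auto simp: fine_cutoff_def smooth_step_eq_0 smooth_step_eq_1)

lemma coarse_cutoff_neg: "x < 0 \<Longrightarrow> coarse_cutoff x = 0"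
  by (simp add: coarse_cutoff_def smooth_step_eq_0)

text \<open>With F n = \<open>x powr \<beta> * smooth_step (8 * 2 ^ n * x - 1)\<close> the n-th term
  is F(n+1) - F(n). For each x > 0 the sequence F is eventually equal to
  \<open>x powr \<beta>\<close>, and F(0) is the coarse part.\<close>

lemma powr_decomposition:
  "(\<lambda>n. 2 powr (- (real (n + 2) * \<beta>)) * fine_cutoff (2 ^ (n + 2) * x)) sums (max 0 x powr \<beta> - coarse_cutoff x)"
proof (cases "x > 0")
  case False
  then have "fine_cutoff (2 ^ (n + 2) * x) = 0" for n
  proof -
    have "2 ^ (n + 2) * x \<le> 0" using False by (simp add: mult_nonneg_nonpos)
    then show ?thesis by (simp add: fine_cutoff_def smooth_step_eq_0 del: power_add power_Suc)
  qed
  moreover have "max 0 x powr \<beta> - coarse_cutoff x = 0" using False by (simp add: max_def coarse_cutoff_def smooth_step_eq_0)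
  ultimately show ?thesis by simp
next
  case True
  define F where "F = (\<lambda>n::nat. x powr \<beta> * smooth_step (8 * 2 ^ n * x - 1))"
  have "2 powr (- (real (n + 2) * \<beta>)) * fine_cutoff (2 ^ (n + 2) * x) = F (Suc n) - F n" for n
  proof -
    have "(2 ^ (n + 2) * x) powr \<beta> = 2 powr (real (n + 2) * \<beta>) * x powr \<beta>"
      using True by (simp add: powr_mult powr_realpow[symmetric] powr_powr del: power_add power_Suc)
    then have "2 powr (- (real (n + 2) * \<beta>)) * (2 ^ (n + 2) * x) powr \<beta> = x powr \<beta>"
      by (simp add: mult.assoc[symmetric] powr_add[symmetric] del: power_add)
    then have "2 powr (- (real (n + 2) * \<beta>)) * fine_cutoff (2 ^ (n + 2) * x) = x powr \<beta> * (smooth_step (4 * (2 ^ (n + 2) * x) - 1) - smooth_step (2 * (2 ^ (n + 2) * x) - 1))"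
      unfolding fine_cutoff_def by (simp only: mult.assoc[symmetric])
    then show ?thesis by (simp add: F_def right_diff_distrib algebra_simps)
  qed
  moreover have "F \<longlonglongrightarrow> x powr \<beta>"
  proof (rule tendsto_eventually)
    obtain N where N: "1 / x < 2 ^ N" using real_arch_pow[of 2 "1 / x"] by auto
    have "F n = x powr \<beta>" if "n \<ge> N" for n
    proof -
      have "(2::real) ^ N \<le> 2 ^ n" using that by simp
      with N have "1 / x < 2 ^ n" by linarith
      then have "1 < 2 ^ n * x" using True by (simp add: field_simps)
      then have "8 * 2 ^ n * x - 1 \<ge> 1" by linarith
      then show ?thesis by (simp add: F_def smooth_step_eq_1)
    qed
    then show "\<forall>\<^sub>F n in sequentially. F n = x powr \<beta>" by (auto simp: eventually_sequentially)
  qed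
  from telescope_sums[OF this] have "(\<lambda>n. F (Suc n) - F n) sums (x powr \<beta> - F 0)" .
  ultimately show ?thesis using True by (simp add: F_def coarse_cutoff_def max_def)
qed

lemma br_mult_measurable2 [measurable]:
  "(\<lambda>(t, \<xi>::'a::euclidean_space). br_mult t \<xi>) \<in> borel_measurable (borel \<Otimes>\<^sub>M borel)"
  unfolding br_mult_def by measurable

lemma norm_br_mult_le: "norm (br_mult t \<xi>) \<le> \<bar>t\<bar> powr \<beta>"
proof -
  have "t - (norm \<xi>)\<^sup>2 \<le> t" by simp
  then have "max 0 (t - (norm \<xi>)\<^sup>2) \<le> \<bar>t\<bar>" by linarith
  then have "max 0 (t - (norm \<xi>)\<^sup>2) powr \<beta> \<le> \<bar>t\<bar> powr \<beta>" using \<beta> by (intro powr_mono2) auto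
  then show ?thesis by (simp add: br_mult_def)
qed

lemma br_mult_measurable [measurable]: "br_mult t \<in> borel_measurable (borel :: 'a::euclidean_space measure)"
  unfolding br_mult_def[abs_def] by measurable

definition fine_scale :: "nat \<Rightarrow> real" where "fine_scale n = 2 powr (- real (n + 2))"

lemma fine_scale: "fine_scale n > 0" "fine_scale n \<le> 1/4" "x / fine_scale n = 2 ^ (n + 2) * x"
proof -
  show "fine_scale n > 0" by (simp add: fine_scale_def)
  have "fine_scale n \<le> 2 powr (- 2)" unfolding fine_scale_def by (intro powr_mono) auto
  then show "fine_scale n \<le> 1/4" by (simp add: powr_minus)
  have "2 powr real (n + 2) = (2::real) ^ (n + 2)" by (rule powr_realpow) simp
  then show "x / fine_scale n = 2 ^ (n + 2) * x" unfolding fine_scale_def powr_minus by (simp only: divide_inverse inverse_inverse_eq mult.commute)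
qed

text \<open>Termwise integration of the decomposition of the multiplier: the fine cutoff is bounded
  and \<beta> > 0 makes the weights geometric, so the series converges absolutely in L^1 against the
  transform of f.\<close>

lemma br_op_decomposition:
  fixes f :: "'a::euclidean_space \<Rightarrow> complex"
  assumes f: "schwartz f" and t: "t \<le> 5"
  shows "ennreal (norm (multiplier_op (br_mult t) f x)) \<le>
    ennreal (norm (multiplier_op (\<lambda>\<xi>. of_real (coarse_cutoff (t - (norm \<xi>)\<^sup>2))) f x))
    + (\<Sum>n. ennreal (2 powr (- (real n * \<beta>))) * ennreal (norm (multiplier_op (sphere_mult fine_cutoff (fine_scale n) t) f x)))"
proof -
  let ?c = "\<lambda>\<xi>::'a. complex_of_real (coarse_cutoff (t - (norm \<xi>)\<^sup>2))"
  let ?s = "\<lambda>n. sphere_mult fine_cutoff (fine_scale n) t"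
  define e where "e = (\<lambda>\<xi>::'a. cis (2 * pi * (x \<bullet> \<xi>)))"
  have em[measurable]: "e \<in> borel_measurable borel" unfolding e_def by measurable
  have [measurable]: "fine_cutoff \<in> borel_measurable borel" "coarse_cutoff \<in> borel_measurable borel"
    by (intro smooth_real_measurable smooth_fine_cutoff smooth_coarse_cutoff)+
  note fi = integrable_fourier_schwartz[OF f]
  have "?c = (\<lambda>t \<xi>. complex_of_real (coarse_cutoff (t - (norm (\<xi>::'a))\<^sup>2))) t" by simp
  have "schwartz ?c"
    by (rule radial_family_schwartz[OF _ t, where F = "\<lambda>t \<xi>. complex_of_real (coarse_cutoff (t - (norm \<xi>)\<^sup>2))"])
       (intro radial_base smooth_coarse_cutoff coarse_cutoff_neg)
  then obtain Bc where Bc: "\<And>\<xi>. norm (?c \<xi>) \<le> Bc" using schwartz_bounded by metis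
  have ci: "integrable lborel (\<lambda>\<xi>. (e \<xi> * ?c \<xi>) * fourier f \<xi>)"
    by (rule integrable_mult_bounded[OF fi, where B = Bc]) (use Bc in \<open>auto simp: e_def norm_mult\<close>)
  obtain M where M: "M > 0" "\<And>x. \<bar>fine_cutoff x\<bar> \<le> M" using smooth_compact_bounded[OF smooth_fine_cutoff fine_cutoff_support] by metis
  \<comment> \<open>The exact weights carry n + 2; in the conclusion they are enlarged to
    \<open>2 powr (- (n * \<beta>))\<close>.\<close>
  define w where "w = (\<lambda>n::nat. (2::real) powr (- (real (n + 2) * \<beta>)))"
  have wg: "w n = 2 powr (- (2 * \<beta>)) * (2 powr (- \<beta>)) ^ n" for n
    by (simp add: w_def powr_realpow[symmetric] powr_powr powr_add[symmetric] algebra_simps)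
  have q: "0 < (2::real) powr (- \<beta>)" "(2::real) powr (- \<beta>) < 1" using \<beta> by (auto simp: powr_less_one)
  have ws: "summable w" unfolding wg[abs_def] using q by (intro summable_mult summable_geometric) auto
  have w0: "w n > 0" for n by (simp add: w_def)
  define T where "T = (\<lambda>n \<xi>. of_real (w n) * ((e \<xi> * ?s n \<xi>) * fourier f \<xi>))"
  have si: "integrable lborel (\<lambda>\<xi>. (e \<xi> * ?s n \<xi>) * fourier f \<xi>)" for n
  proof (rule integrable_mult_bounded[OF fi, where B = M])
    show "(\<lambda>\<xi>. e \<xi> * ?s n \<xi>) \<in> borel_measurable lborel" unfolding sphere_mult_def by measurable
  qed (use M in \<open>auto simp: e_def norm_mult sphere_mult_def\<close>)
  have Ti: "integrable lborel (T n)" for n unfolding T_def by (intro integrable_mult_right si)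
  have Tn: "norm (T n \<xi>) \<le> w n * (M * norm (fourier f \<xi>))" for n \<xi>
    using M(2) w0[of n] by (auto simp: T_def norm_mult e_def sphere_mult_def intro!: mult_left_mono mult_right_mono)
  have S1: "summable (\<lambda>n. norm (T n \<xi>))" for \<xi>
    by (rule summable_comparison_test[OF _ summable_mult2[OF ws, of "M * norm (fourier f \<xi>)"]]) (use Tn in auto)
  have S2: "summable (\<lambda>n. LINT \<xi>|lborel. norm (T n \<xi>))"
  proof (rule summable_comparison_test[OF _ summable_mult2[OF ws, of "LINT \<xi>|lborel. M * norm (fourier f \<xi>)"]])
    have "(LINT \<xi>|lborel. norm (T n \<xi>)) \<le> w n * (LINT \<xi>|lborel. M * norm (fourier f \<xi>))" for n
    proof -
      have "(LINT \<xi>|lborel. norm (T n \<xi>)) \<le> (LINT \<xi>|lborel. w n * (M * norm (fourier f \<xi>)))"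
        by (intro integral_mono integrable_norm Ti integrable_mult_right fi Tn)
      then show ?thesis by simp
    qed
    then show "\<exists>N. \<forall>n\<ge>N. norm (LINT \<xi>|lborel. norm (T n \<xi>)) \<le> w n * (LINT \<xi>|lborel. M * norm (fourier f \<xi>))" by auto
  qed
  have Tsum: "(\<Sum>n. T n \<xi>) = e \<xi> * (br_mult t \<xi> - ?c \<xi>) * fourier f \<xi>" for \<xi>
  proof -
    have "(\<lambda>n. complex_of_real (w n * fine_cutoff (2 ^ (n + 2) * (t - (norm \<xi>)\<^sup>2)))) sums complex_of_real (max 0 (t - (norm \<xi>)\<^sup>2) powr \<beta> - coarse_cutoff (t - (norm \<xi>)\<^sup>2))"
      using powr_decomposition[of "t - (norm \<xi>)\<^sup>2"] unfolding w_def by (intro sums_of_real)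
    from sums_mult2[OF sums_mult[OF this, of "e \<xi>"], of "fourier f \<xi>"]
    have "(\<lambda>n. T n \<xi>) sums (e \<xi> * (br_mult t \<xi> - ?c \<xi>) * fourier f \<xi>)"
      by (simp add: T_def sphere_mult_def fine_scale(3) br_mult_def mult_ac del: power_add power_Suc)
    then show ?thesis by (rule sums_unique[symmetric])
  qed
  have dI: "(\<lambda>n. LINT \<xi>|lborel. T n \<xi>) sums (LINT \<xi>|lborel. (\<Sum>n. T n \<xi>))"
    by (rule sums_integral[OF Ti _ S2]) (use S1 in auto)
  have di: "integrable lborel (\<lambda>\<xi>. \<Sum>n. T n \<xi>)"
    by (rule integrable_suminf[OF Ti _ S2]) (use S1 in auto)
  have Tv: "(LINT \<xi>|lborel. T n \<xi>) = of_real (w n) * multiplier_op (?s n) f x" for n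
    unfolding T_def multiplier_op_def e_def by (rule integral_mult_right_zero)
  have "multiplier_op (br_mult t) f x = (LINT \<xi>|lborel. (e \<xi> * ?c \<xi>) * fourier f \<xi> + (\<Sum>n. T n \<xi>))"
    unfolding multiplier_op_def Tsum e_def[symmetric] by (intro Bochner_Integration.integral_cong) (auto simp: e_def algebra_simps)
  also have "\<dots> = multiplier_op ?c f x + (LINT \<xi>|lborel. (\<Sum>n. T n \<xi>))"
    by (subst Bochner_Integration.integral_add[OF ci di]) (simp add: multiplier_op_def e_def)
  finally have V: "multiplier_op (br_mult t) f x = multiplier_op ?c f x + (\<Sum>n. LINT \<xi>|lborel. T n \<xi>)"
    using sums_unique[OF dI] by simp
  have Ns: "summable (\<lambda>n. norm (LINT \<xi>|lborel. T n \<xi>))"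
    by (rule summable_comparison_test[OF _ S2]) auto
  have "ennreal (norm (\<Sum>n. LINT \<xi>|lborel. T n \<xi>)) \<le> ennreal (\<Sum>n. norm (LINT \<xi>|lborel. T n \<xi>))"
    by (intro ennreal_leI summable_norm Ns)
  also have "\<dots> = (\<Sum>n. ennreal (norm (LINT \<xi>|lborel. T n \<xi>)))"
    by (rule suminf_ennreal2[symmetric]) (auto simp: Ns)
  also have "\<dots> \<le> (\<Sum>n. ennreal (2 powr (- (real n * \<beta>))) * ennreal (norm (multiplier_op (?s n) f x)))"
  proof (intro suminf_le)
    fix n
    have "w n \<le> 2 powr (- (real n * \<beta>))" unfolding w_def using \<beta> by (intro powr_mono) (auto simp: algebra_simps)
    then have "norm (LINT \<xi>|lborel. T n \<xi>) \<le> 2 powr (- (real n * \<beta>)) * norm (multiplier_op (?s n) f x)"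
      unfolding Tv norm_mult using w0[of n] by (intro mult_right_mono) auto
    then show "ennreal (norm (LINT \<xi>|lborel. T n \<xi>)) \<le> ennreal (2 powr (- (real n * \<beta>))) * ennreal (norm (multiplier_op (?s n) f x))"
      by (simp add: ennreal_mult[symmetric] ennreal_leI)
  qed auto
  finally have S: "ennreal (norm (\<Sum>n. LINT \<xi>|lborel. T n \<xi>)) \<le> (\<Sum>n. ennreal (2 powr (- (real n * \<beta>))) * ennreal (norm (multiplier_op (?s n) f x)))" .
  have "ennreal (norm (multiplier_op (br_mult t) f x)) \<le> ennreal (norm (multiplier_op ?c f x)) + ennreal (norm (\<Sum>n. LINT \<xi>|lborel. T n \<xi>))"
    unfolding V by (simp add: ennreal_plus[symmetric] norm_triangle_ineq ennreal_leI del: ennreal_plus)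
  also have "\<dots> \<le> ennreal (norm (multiplier_op ?c f x)) + (\<Sum>n. ennreal (2 powr (- (real n * \<beta>))) * ennreal (norm (multiplier_op (?s n) f x)))"
    by (intro add_left_mono S)
  finally show ?thesis .
qed

text \<open>The coarse multiplier is smooth and compactly supported with bounds uniform in t \<le>
  5, so its kernel decays to order d + 1 uniformly in t.\<close>

lemma coarse_le_hl_max:
  obtains C where "C > 0" "\<And>t (f :: 'a::euclidean_space \<Rightarrow> complex) x. t \<le> 5 \<Longrightarrow> schwartz f \<Longrightarrow>
    ennreal (norm (multiplier_op (\<lambda>\<xi>. of_real (coarse_cutoff (t - (norm \<xi>)\<^sup>2))) f x)) \<le> ennreal C * hl_max f x"
proof -
  obtain C where C: "C > 0" "\<And>t \<xi>. t \<le> 5 \<Longrightarrow> norm (fourier (\<lambda>\<xi>::'a. complex_of_real (coarse_cutoff (t - (norm \<xi>)\<^sup>2))) \<xi>) \<le> C / (1 + norm \<xi>) ^ Suc DIM('a)"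
    using radial_fourier_decay[OF smooth_coarse_cutoff coarse_cutoff_neg, of "Suc DIM('a)"] by metis
  let ?C = "C * (2 ^ (DIM('a) + 2) * unit_ball_vol DIM('a))"
  have "ennreal (norm (multiplier_op (\<lambda>\<xi>. of_real (coarse_cutoff (t - (norm \<xi>)\<^sup>2))) f x)) \<le> ennreal ?C * hl_max f x"
    if t: "t \<le> 5" and f: "schwartz f" for t and f :: "'a \<Rightarrow> complex" and x
  proof -
    let ?c = "\<lambda>\<xi>::'a. complex_of_real (coarse_cutoff (t - (norm \<xi>)\<^sup>2))"
    have s: "schwartz ?c"
      by (rule radial_family_schwartz[OF _ t, where F = "\<lambda>t \<xi>. complex_of_real (coarse_cutoff (t - (norm \<xi>)\<^sup>2))"])
         (intro radial_base smooth_coarse_cutoff coarse_cutoff_neg)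
    show ?thesis
      unfolding multiplier_op_conv[OF schwartz_integrable[OF s] schwartz_integrable[OF f]]
    proof (rule kernel_le_hl_max[OF schwartz_measurable[OF f]])
      show "norm (fourier ?c (- u)) \<le> C / (1 + norm u) ^ Suc DIM('a)" for u
        using C(2)[OF t, of "- u"] by simp
    qed (use C in simp)
  qed
  moreover have "?C > 0" using C by simp
  ultimately show ?thesis using that by blast
qed

text \<open>On the support of the fine multipliers the Littlewood--Paley cutoff is \<open>1\<close>.\<close>

lemma fine_op_lp:
  fixes f :: "'a::euclidean_space \<Rightarrow> complex"
  assumes f: "schwartz f" and t: "t \<in> {1/2..2}"
  shows "multiplier_op (sphere_mult fine_cutoff (fine_scale n) t) f x = multiplier_op (sphere_mult fine_cutoff (fine_scale n) t) (multiplier_op lp_mult f) x"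
proof -
  have "sphere_mult fine_cutoff (fine_scale n) t \<xi> = sphere_mult fine_cutoff (fine_scale n) t \<xi> * lp_mult \<xi>" for \<xi> :: 'a
  proof (cases "fine_cutoff ((t - (norm \<xi>)\<^sup>2) / fine_scale n) = 0")
    case False
    then have "(t - (norm \<xi>)\<^sup>2) / fine_scale n \<in> {-1..1}" using fine_cutoff_support by blast
    then have "\<bar>t - (norm \<xi>)\<^sup>2\<bar> \<le> fine_scale n" using fine_scale(1)[of n] by (auto simp: divide_simps abs_le_iff)
    then have "\<bar>t - (norm \<xi>)\<^sup>2\<bar> \<le> 1/4" using fine_scale(2)[of n] by linarith
    then have "t - (norm \<xi>)\<^sup>2 \<le> 1/4" "(norm \<xi>)\<^sup>2 - t \<le> 1/4" by linarith+
    moreover have "1/2 \<le> t" "t \<le> 2" using t by auto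
    ultimately have "1/4 \<le> (norm \<xi>)\<^sup>2 \<and> (norm \<xi>)\<^sup>2 \<le> 3" by linarith
    then show ?thesis by (simp add: lp_mult_eq_1)
  qed (simp add: sphere_mult_def)
  then show ?thesis
    unfolding multiplier_op_def[of "sphere_mult fine_cutoff (fine_scale n) t"] fourier_multiplier_op[OF schwartz_lp_mult f]
    by (intro Bochner_Integration.integral_cong refl) (metis mult.assoc)
qed

text \<open>Dilating f and evaluating at x / \<open>dyad l\<close> realises the multiplier
  \<open>br_mult t (dyad l *\<^sub>R \<xi>)\<close> at x. In this way t always stays in [1/2, 2],
  the range covered by \<open>square_function\<close>.\<close>

definition loc_square :: "int \<Rightarrow> ('a::euclidean_space \<Rightarrow> complex) \<Rightarrow> 'a \<Rightarrow> ennreal" where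
  "loc_square l f x = (\<integral>\<^sup>+t\<in>{1/2..2}. ennreal ((norm (multiplier_op (br_mult t) (\<lambda>x. f (dyad l *\<^sub>R x)) ((1 / dyad l) *\<^sub>R x)))\<^sup>2) \<partial>lborel)"

definition fine_square :: "nat \<Rightarrow> ('a::euclidean_space \<Rightarrow> complex) \<Rightarrow> 'a \<Rightarrow> ennreal" where
  "fine_square n f = square_function fine_cutoff (fine_scale n) (multiplier_op lp_mult f)"

lemma fine_square_measurable [measurable]: "schwartz f \<Longrightarrow> fine_square n f \<in> borel_measurable borel"
  unfolding fine_square_def
  by (intro square_function_measurable schwartz_measurable schwartz_multiplier_op schwartz_lp_mult smooth_real_measurable smooth_fine_cutoff)

text \<open>The square of the sum over n becomes a weighted sum of squares by
  \<open>epow_suminf_le\<close> with exponent 2, which costs 2^(2 \<kappa> n); integrating the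
  squares in t then produces the square functions of the Littlewood--Paley piece.\<close>

lemma loc_square_bound:
  assumes k: "\<kappa> > 0"
  obtains C where "C > 0" "\<And>(f :: 'a::euclidean_space \<Rightarrow> complex) y. schwartz f \<Longrightarrow>
    (\<integral>\<^sup>+t\<in>{1/2..2}. ennreal ((norm (multiplier_op (br_mult t) f y))\<^sup>2) \<partial>lborel) \<le>
      ennreal C * (epow (hl_max f y) 2 + (\<Sum>n. ennreal (2 powr (real n * (2 * \<kappa> - 2 * \<beta>))) * epow (fine_square n f y) 2))"
proof -
  obtain C1 where C1: "C1 > 0" "\<And>t (f :: 'a::euclidean_space \<Rightarrow> complex) x. t \<le> 5 \<Longrightarrow> schwartz f \<Longrightarrow>
    ennreal (norm (multiplier_op (\<lambda>\<xi>. of_real (coarse_cutoff (t - (norm \<xi>)\<^sup>2))) f x)) \<le> ennreal C1 * hl_max f x"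
    using coarse_le_hl_max by metis
  obtain C2 where C2: "C2 > 0" "\<And>b :: nat \<Rightarrow> ennreal. epow (\<Sum>n. b n) 2 \<le> ennreal C2 * (\<Sum>n. ennreal (2 powr (real n * \<kappa> * 2)) * epow (b n) 2)"
    by (rule epow_suminf_le[of 2, OF zero_less_numeral k], rule that)
  \<comment> \<open>4 is \<open>2 powr 2\<close> from squaring a sum of two terms; 3/2 is the length
    of [1/2, 2], over which the coarse bound is constant.\<close>
  define C where "C = 4 * max (C1\<^sup>2 * (3/2)) C2"
  have C: "C > 0" "4 * (C1\<^sup>2 * (3/2)) \<le> C" "4 * C2 \<le> C" using C2 by (auto simp: C_def max_def)
  have [measurable]: "fine_cutoff \<in> borel_measurable borel" by (intro smooth_real_measurable smooth_fine_cutoff)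
  have "(\<integral>\<^sup>+t\<in>{1/2..2}. ennreal ((norm (multiplier_op (br_mult t) f y))\<^sup>2) \<partial>lborel) \<le>
      ennreal C * (epow (hl_max f y) 2 + (\<Sum>n. ennreal (2 powr (real n * (2 * \<kappa> - 2 * \<beta>))) * epow (fine_square n f y) 2))"
    if f: "schwartz f" for f :: "'a \<Rightarrow> complex" and y
  proof -
    let ?lp = "multiplier_op lp_mult f"
    let ?S = "\<lambda>n t. ennreal ((norm (multiplier_op (sphere_mult fine_cutoff (fine_scale n) t) ?lp y))\<^sup>2) * indicator {1/2..2} t"
    let ?w = "\<lambda>n. 2 powr (real n * (2 * \<kappa> - 2 * \<beta>))"
    have lps: "schwartz ?lp" by (rule schwartz_multiplier_op[OF schwartz_lp_mult f])
    note [measurable] = sphere_mult_op_measurable[OF schwartz_measurable[OF lps], of fine_cutoff]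
    have Sm[measurable]: "?S n \<in> borel_measurable borel" for n by measurable
    have "(\<integral>\<^sup>+t\<in>{1/2..2}. ennreal ((norm (multiplier_op (br_mult t) f y))\<^sup>2) \<partial>lborel) \<le>
      (\<integral>\<^sup>+t. ennreal (4 * C1\<^sup>2) * epow (hl_max f y) 2 * indicator {1/2..2} t + ennreal (4 * C2) * (\<Sum>n. ennreal (?w n) * ?S n t) \<partial>lborel)"
    proof (rule nn_integral_mono)
      fix t :: real
      show "ennreal ((norm (multiplier_op (br_mult t) f y))\<^sup>2) * indicator {1/2..2} t \<le>
         ennreal (4 * C1\<^sup>2) * epow (hl_max f y) 2 * indicator {1/2..2} t + ennreal (4 * C2) * (\<Sum>n. ennreal (?w n) * ?S n t)"
      proof (cases "t \<in> {1/2..2}")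
        case True
        let ?b = "\<lambda>n. ennreal (2 powr (- (real n * \<beta>))) * ennreal (norm (multiplier_op (sphere_mult fine_cutoff (fine_scale n) t) f y))"
        have "ennreal (norm (multiplier_op (br_mult t) f y)) \<le> ennreal C1 * hl_max f y + (\<Sum>n. ?b n)"
          by (rule order_trans[OF br_op_decomposition[OF f]]) (use True C1(2)[OF _ f] in \<open>auto intro!: add_right_mono\<close>)
        then have "epow (ennreal (norm (multiplier_op (br_mult t) f y))) 2 \<le> epow (ennreal C1 * hl_max f y + (\<Sum>n. ?b n)) 2"
          by (rule epow_mono) simp
        also have "\<dots> \<le> ennreal (2 powr 2) * (epow (ennreal C1 * hl_max f y) 2 + epow (\<Sum>n. ?b n) 2)" by (rule epow_add_le) simp
        also have "\<dots> \<le> ennreal 4 * (ennreal (C1\<^sup>2) * epow (hl_max f y) 2 + ennreal C2 * (\<Sum>n. ennreal (2 powr (real n * \<kappa> * 2)) * epow (?b n) 2))"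
          using C1(1) C2(2)[of ?b] by (auto simp: epow_mult epow_ennreal intro!: mult_left_mono add_left_mono)
        also have "(\<lambda>n. ennreal (2 powr (real n * \<kappa> * 2)) * epow (?b n) 2) = (\<lambda>n. ennreal (?w n) * ?S n t)"
        proof
          fix n
          have "ennreal (2 powr (real n * \<kappa> * 2)) * ennreal ((2 powr (- (real n * \<beta>)))\<^sup>2) = ennreal (?w n)"
            by (simp add: ennreal_mult[symmetric] power2_eq_square powr_add[symmetric] algebra_simps)
          then show "ennreal (2 powr (real n * \<kappa> * 2)) * epow (?b n) 2 = ennreal (?w n) * ?S n t"
            using True fine_op_lp[OF f True, of n y] by (simp add: epow_mult epow_ennreal mult.assoc[symmetric])
        qed
        finally have "epow (ennreal (norm (multiplier_op (br_mult t) f y))) 2 \<le> ennreal 4 * (ennreal (C1\<^sup>2) * epow (hl_max f y) 2 + ennreal C2 * (\<Sum>n. ennreal (?w n) * ?S n t))" .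
        then show ?thesis using True C1 C2 by (simp add: epow_ennreal distrib_left ennreal_mult mult.assoc)
      qed simp
    qed
    also have "\<dots> = (\<integral>\<^sup>+t. ennreal (4 * C1\<^sup>2) * epow (hl_max f y) 2 * indicator {1/2..2::real} t \<partial>lborel) + (\<integral>\<^sup>+t. ennreal (4 * C2) * (\<Sum>n. ennreal (?w n) * ?S n t) \<partial>lborel)"
      by (rule nn_integral_add) measurable
    also have "(\<integral>\<^sup>+t. ennreal (4 * C1\<^sup>2) * epow (hl_max f y) 2 * indicator {1/2..2::real} t \<partial>lborel) = ennreal (4 * (C1\<^sup>2 * (3/2))) * epow (hl_max f y) 2"
    proof -
      have "ennreal (4 * C1\<^sup>2) * ennreal (3/2) = ennreal (4 * (C1\<^sup>2 * (3/2)))" by (simp add: ennreal_mult[symmetric])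
      then show ?thesis by (subst nn_integral_cmult_indicator) (auto simp: mult_ac)
    qed
    also have "(\<integral>\<^sup>+t. ennreal (4 * C2) * (\<Sum>n. ennreal (?w n) * ?S n t) \<partial>lborel) = ennreal (4 * C2) * (\<Sum>n. ennreal (?w n) * (\<integral>\<^sup>+t. ?S n t \<partial>lborel))"
      by (subst nn_integral_cmult, measurable, subst nn_integral_suminf, measurable) (simp add: nn_integral_cmult)
    also have "(\<lambda>n. \<integral>\<^sup>+t. ?S n t \<partial>lborel) = (\<lambda>n. epow (fine_square n f y) 2)"
      by (simp add: fine_square_def square_function_eq epow_epow)
    also have "ennreal (4 * (C1\<^sup>2 * (3/2))) * epow (hl_max f y) 2 + ennreal (4 * C2) * (\<Sum>n. ennreal (?w n) * epow (fine_square n f y) 2)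
      \<le> ennreal C * epow (hl_max f y) 2 + ennreal C * (\<Sum>n. ennreal (?w n) * epow (fine_square n f y) 2)"
      by (intro add_mono mult_right_mono ennreal_leI C) auto
    finally show ?thesis by (simp add: distrib_left)
  qed
  with C(1) show ?thesis by (rule that)
qed

end

section \<open>The linear maximal square function\<close>

lemma nn_integral_count_int: "(\<integral>\<^sup>+l. F l \<partial>count_space (UNIV :: int set)) = (\<Sum>k. F (int_decode k))"
proof -
  have "(\<integral>\<^sup>+k. F (int_decode k) \<partial>count_space (UNIV :: nat set)) = (\<integral>\<^sup>+l. F l \<partial>count_space (UNIV :: int set))"
    by (rule nn_integral_bij_count_space[OF bij_int_decode])
  then show ?thesis by (simp add: nn_integral_count_space_nat)
qed

lemma le_suminf_ennreal: "F k \<le> (\<Sum>k. F k :: ennreal)"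
  using sum_le_suminf[of F "{k}"] by simp

text \<open>A squared quantity over countably many dilations; the maximal function itself is its
  square root.\<close>

definition sup_square :: "real \<Rightarrow> ('a::euclidean_space \<Rightarrow> complex) \<Rightarrow> 'a \<Rightarrow> ennreal" where
  "sup_square \<beta> f x = (SUP l. loc_square \<beta> l f x)"

lemma loc_square_measurable:
  fixes f :: "'a::euclidean_space \<Rightarrow> complex"
  assumes b: "\<beta> > 0" and "schwartz f" shows "loc_square \<beta> l f \<in> borel_measurable borel"
proof -
  have s: "schwartz (\<lambda>x. f (dyad l *\<^sub>R x))" by (rule schwartz_dilate[OF assms(2)]) (simp add: less_imp_neq[symmetric])
  note [measurable] = multiplier_op_measurable2[OF schwartz_measurable[OF s], of "br_mult \<beta>", OF br_mult_measurable2[OF b]]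
  have "(\<lambda>y. \<integral>\<^sup>+t\<in>{1/2..2}. ennreal ((norm (multiplier_op (br_mult \<beta> t) (\<lambda>x. f (dyad l *\<^sub>R x)) y))\<^sup>2) \<partial>lborel) \<in> borel_measurable borel"
    by measurable
  then have "(\<lambda>x. \<integral>\<^sup>+t\<in>{1/2..2}. ennreal ((norm (multiplier_op (br_mult \<beta> t) (\<lambda>x. f (dyad l *\<^sub>R x)) ((1 / dyad l) *\<^sub>R x)))\<^sup>2) \<partial>lborel) \<in> borel_measurable borel"
    by (rule measurable_compose[rotated]) measurable
  then show ?thesis by (simp add: loc_square_def[OF b, abs_def])
qed

lemma sup_square_measurable:
  assumes "\<beta> > 0" "schwartz f" shows "sup_square \<beta> f \<in> borel_measurable borel"
  unfolding sup_square_def[abs_def] using loc_square_measurable[OF assms] by (intro borel_measurable_SUP) auto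

lemma loc_square_le:
  assumes b: "\<beta> > 0" and k: "\<kappa> > 0"
  obtains C where "C > 0" "\<And>(f :: 'a::euclidean_space \<Rightarrow> complex) l x. schwartz f \<Longrightarrow>
    loc_square \<beta> l f x \<le> ennreal C * (epow (hl_max f x) 2 + (\<Sum>n. ennreal (2 powr (real n * (2 * \<kappa> - 2 * \<beta>))) *
      epow (fine_square \<beta> n (\<lambda>x. f (dyad l *\<^sub>R x)) ((1 / dyad l) *\<^sub>R x)) 2))"
proof -
  obtain C where C: "C > 0" "\<And>(f :: 'a \<Rightarrow> complex) y. schwartz f \<Longrightarrow>
    (\<integral>\<^sup>+t\<in>{1/2..2}. ennreal ((norm (multiplier_op (br_mult \<beta> t) f y))\<^sup>2) \<partial>lborel) \<le>
      ennreal C * (epow (hl_max f y) 2 + (\<Sum>n. ennreal (2 powr (real n * (2 * \<kappa> - 2 * \<beta>))) * epow (fine_square \<beta> n f y) 2))"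
    by (rule loc_square_bound[OF b k], rule that)
  have "loc_square \<beta> l f x \<le> ennreal C * (epow (hl_max f x) 2 + (\<Sum>n. ennreal (2 powr (real n * (2 * \<kappa> - 2 * \<beta>))) *
      epow (fine_square \<beta> n (\<lambda>x. f (dyad l *\<^sub>R x)) ((1 / dyad l) *\<^sub>R x)) 2))" if f: "schwartz f" for f :: "'a \<Rightarrow> complex" and l x
  proof -
    have s: "schwartz (\<lambda>x. f (dyad l *\<^sub>R x))" by (rule schwartz_dilate[OF f]) (simp add: less_imp_neq[symmetric])
    have "epow (hl_max (\<lambda>x. f (dyad l *\<^sub>R x)) ((1 / dyad l) *\<^sub>R x)) 2 \<le> epow (hl_max f x) 2"
      by (rule epow_mono[OF hl_max_dilate[OF schwartz_measurable[OF f] dyad_pos]]) simp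
    then show ?thesis
      unfolding loc_square_def[OF b] using C(2)[OF s, of "(1 / dyad l) *\<^sub>R x"]
      by (meson add_right_mono mult_left_mono order_trans zero_le)
  qed
  with C(1) show ?thesis by (rule that)
qed

lemma nn_integral_dilate:
  fixes F :: "'a::euclidean_space \<Rightarrow> ennreal"
  assumes "F \<in> borel_measurable borel" "\<sigma> > 0"
  shows "(\<integral>\<^sup>+x. F ((1 / \<sigma>) *\<^sub>R x) \<partial>lborel) = ennreal (\<sigma> ^ DIM('a)) * (\<integral>\<^sup>+x. F x \<partial>lborel)"
proof -
  have [measurable]: "F \<in> borel_measurable borel" by fact
  have "(\<integral>\<^sup>+x. F ((1 / \<sigma>) *\<^sub>R x) \<partial>lborel) = ennreal (\<bar>\<sigma>\<bar> ^ DIM('a)) * (\<integral>\<^sup>+x. F ((1 / \<sigma>) *\<^sub>R (0 + \<sigma> *\<^sub>R x)) \<partial>lborel)"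
    by (rule nn_integral_lborel_affine) (use assms in auto)
  then show ?thesis using assms(2) by simp
qed

lemma suminf_geometric_powr:
  assumes "\<kappa> > 0"
  shows "(\<Sum>n. ennreal (2 powr (- (real n * \<kappa>)))) = ennreal (1 / (1 - 2 powr (- \<kappa>)))"
proof -
  have e: "2 powr (- (real n * \<kappa>)) = (2 powr (- \<kappa>)) ^ n" for n
    by (simp add: powr_realpow[symmetric] powr_powr mult.commute)
  have q: "norm ((2::real) powr (- \<kappa>)) < 1" using assms by (simp add: powr_less_one)
  show ?thesis unfolding e using suminf_geometric[OF q] summable_geometric[OF q]
    by (subst suminf_ennreal2) auto
qed

context
  fixes N :: nat and P :: ennreal
  assumes d: "DIM('a::euclidean_space) \<ge> 2" and P: "P \<ge> ennreal (2 * real DIM('a) / (real DIM('a) - 1))"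
    and H: "square_function_hyp TYPE('a) N P"
begin

lemma fine_square_norm:
  assumes b: "\<beta> > 0" and p: "p \<ge> 2" and e: "\<epsilon> > 0"
  obtains C where "C > 0" "\<And>n (f :: 'a \<Rightarrow> complex). schwartz f \<Longrightarrow>
    eLp_norm p (fine_square \<beta> n f) \<le> ennreal (C * 2 powr (real n * (crit DIM('a) P p + \<epsilon>))) * Lp_norm p (multiplier_op lp_mult f)"
proof -
  obtain C where C: "C > 0" "\<And>n (f :: 'a \<Rightarrow> complex). schwartz f \<Longrightarrow>
    eLp_norm p (square_function (fine_cutoff \<beta>) (2 powr (- real (n + 2))) f) \<le> ennreal (C * 2 powr (real n * (crit DIM('a) P p + \<epsilon>))) * Lp_norm p f"
    by (rule square_function_scale[OF d P H smooth_fine_cutoff[OF b] fine_cutoff_support[OF b] p e], assumption, rule that)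
  have "eLp_norm p (fine_square \<beta> n f) \<le> ennreal (C * 2 powr (real n * (crit DIM('a) P p + \<epsilon>))) * Lp_norm p (multiplier_op lp_mult f)"
    if f: "schwartz f" for n and f :: "'a \<Rightarrow> complex"
    unfolding fine_square_def[OF b] fine_scale_def[OF b] using C(2)[OF schwartz_multiplier_op[OF schwartz_lp_mult f]] .
  with C(1) show ?thesis by (rule that)
qed

text \<open>Only the fine parts pay for the supremum over l, which is replaced by a sum of q-th
  powers; the coarse parts have a majorant independent of l. After rescaling, the sum over l is the
  sum in \<open>lp_piece_Lp\<close>, and the gap between \<beta> and the threshold makes the sum
  over n converge.\<close>

lemma linear_maximal_finite:
  assumes q: "q \<ge> 2" and b: "\<beta> > 0" "\<beta> > crit DIM('a) P (ennreal q)"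
  obtains C where "C > 0" "\<And>f :: 'a \<Rightarrow> complex. schwartz f \<Longrightarrow>
    (\<integral>\<^sup>+x. epow (sup_square \<beta> f x) (q / 2) \<partial>lborel) \<le> ennreal C * (\<integral>\<^sup>+x. ennreal (norm (f x) powr q) \<partial>lborel)"
proof -
  define A where "A = crit DIM('a) P (ennreal q)"
  \<comment> \<open>The gap 4 \<kappa> pays for \<kappa> in \<open>loc_square_le\<close>, \<kappa>/2
    in raising the sum over n to the power q/2, and \<kappa> in the square function bound; the
    remaining 3/2 \<kappa> is the geometric decay in n.\<close>
  define \<kappa> where "\<kappa> = (\<beta> - A) / 4"
  have k: "\<kappa> > 0" using b by (simp add: \<kappa>_def A_def)
  have q0: "q > 0" "q / 2 > 0" using q by auto
  have p2: "ennreal q \<ge> 2" using ennreal_leI[OF q] by simp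
  obtain C1 where C1: "C1 > 0" "\<And>(f :: 'a \<Rightarrow> complex) l x. schwartz f \<Longrightarrow>
    loc_square \<beta> l f x \<le> ennreal C1 * (epow (hl_max f x) 2 + (\<Sum>n. ennreal (2 powr (real n * (2 * \<kappa> - 2 * \<beta>))) *
      epow (fine_square \<beta> n (\<lambda>x. f (dyad l *\<^sub>R x)) ((1 / dyad l) *\<^sub>R x)) 2))"
    by (rule loc_square_le[OF b(1) k], rule that)
  obtain C2 where C2: "C2 > 0" "\<And>b :: nat \<Rightarrow> ennreal. epow (\<Sum>n. b n) (q / 2) \<le> ennreal C2 * (\<Sum>n. ennreal (2 powr (real n * \<kappa> * (q / 2))) * epow (b n) (q / 2))"
    by (rule epow_suminf_le[OF q0(2) k], rule that)
  obtain C3 where C3: "C3 > 0" "\<And>n (f :: 'a \<Rightarrow> complex). schwartz f \<Longrightarrow>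
    eLp_norm (ennreal q) (fine_square \<beta> n f) \<le> ennreal (C3 * 2 powr (real n * (A + \<kappa>))) * Lp_norm (ennreal q) (multiplier_op lp_mult f)"
    by (rule fine_square_norm[OF b(1) p2 k], rule that, assumption, unfold A_def, assumption)
  obtain C4 where C4: "C4 > 0" "\<And>f :: 'a \<Rightarrow> complex. schwartz f \<Longrightarrow>
    (\<integral>\<^sup>+l. (\<integral>\<^sup>+x. ennreal (norm (lp_piece l f x) powr q) \<partial>lborel) \<partial>count_space UNIV) \<le> ennreal C4 * (\<integral>\<^sup>+x. ennreal (norm (f x) powr q) \<partial>lborel)"
    by (rule lp_piece_Lp[OF q], rule that)
  have q1: "q > 1" using q by simp
  obtain C5 where C5: "C5 > 0" "\<And>f :: 'a \<Rightarrow> complex. schwartz f \<Longrightarrow>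
    (\<integral>\<^sup>+x. epow (hl_max f x) q \<partial>lborel) \<le> ennreal C5 * (\<integral>\<^sup>+x. ennreal (norm (f x) powr q) \<partial>lborel)"
    by (rule hl_max_Lp[OF q1], rule that)
  define G where "G = 1 / (1 - (2::real) powr (- (q * (3/2 * \<kappa>))))"
  have qk: "q * (3/2 * \<kappa>) > 0" using q0 k by simp
  have G: "G > 0" using qk unfolding G_def by (simp add: powr_less_one)
  define D where "D = C1 powr (q / 2) * 2 powr (q / 2) * (C5 + C2 * (C3 powr q * (C4 * G)))"
  have Dpos: "D > 0" using C1 C2 C3 C4 C5 G by (auto simp: D_def intro!: mult_pos_pos add_pos_pos)
  have "(\<integral>\<^sup>+x. epow (sup_square \<beta> f x) (q / 2) \<partial>lborel) \<le> ennreal D * (\<integral>\<^sup>+x. ennreal (norm (f x) powr q) \<partial>lborel)"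
    if f: "schwartz f" for f :: "'a \<Rightarrow> complex"
  proof -
    let ?J = "\<integral>\<^sup>+x. ennreal (norm (f x) powr q) \<partial>lborel"
    define E where "E = (\<lambda>n l x. epow (fine_square \<beta> n (\<lambda>x. f (dyad l *\<^sub>R x)) ((1 / dyad l) *\<^sub>R x)) q)"
    have s: "schwartz (\<lambda>x. f (dyad l *\<^sub>R x))" for l by (rule schwartz_dilate[OF f]) (simp add: less_imp_neq[symmetric])
    have Em[measurable]: "E n l \<in> borel_measurable borel" for n l
    proof -
      note [measurable] = fine_square_measurable[OF b(1) s[of l], of n]
      have "(\<lambda>x. fine_square \<beta> n (\<lambda>x. f (dyad l *\<^sub>R x)) ((1 / dyad l) *\<^sub>R x)) \<in> borel_measurable borel"
        by (rule measurable_compose[OF _ fine_square_measurable[OF b(1) s[of l], of n]]) measurable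
      then show ?thesis unfolding E_def by measurable
    qed
    \<comment> \<open>R does not depend on l, so the bound for each l passes to the
      supremum.\<close>
    define R where "R = (\<lambda>x. ennreal (C1 powr (q / 2) * 2 powr (q / 2)) *
       (epow (hl_max f x) q + ennreal C2 * (\<Sum>n. ennreal (2 powr (real n * (q * (3/2 * \<kappa> - \<beta>)))) * (\<Sum>k. E n (int_decode k) x))))"
    have pt: "epow (loc_square \<beta> l f x) (q / 2) \<le> R x" for l x
    proof -
      let ?F = "\<lambda>n. fine_square \<beta> n (\<lambda>x. f (dyad l *\<^sub>R x)) ((1 / dyad l) *\<^sub>R x)"
      let ?S = "\<Sum>n. ennreal (2 powr (real n * (2 * \<kappa> - 2 * \<beta>))) * epow (?F n) 2"
      have "epow (loc_square \<beta> l f x) (q / 2) \<le> epow (ennreal C1 * (epow (hl_max f x) 2 + ?S)) (q / 2)"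
        by (rule epow_mono[OF C1(2)[OF f] q0(2)])
      also have "\<dots> = ennreal (C1 powr (q / 2)) * epow (epow (hl_max f x) 2 + ?S) (q / 2)"
        using C1 q0 by (simp add: epow_mult epow_ennreal)
      also have "\<dots> \<le> ennreal (C1 powr (q / 2)) * (ennreal (2 powr (q / 2)) * (epow (epow (hl_max f x) 2) (q / 2) + epow ?S (q / 2)))"
        by (intro mult_left_mono epow_add_le q0) simp
      also have "epow (epow (hl_max f x) 2) (q / 2) = epow (hl_max f x) q" by (simp add: epow_epow)
      also have "epow ?S (q / 2) \<le> ennreal C2 * (\<Sum>n. ennreal (2 powr (real n * \<kappa> * (q / 2))) * epow (ennreal (2 powr (real n * (2 * \<kappa> - 2 * \<beta>))) * epow (?F n) 2) (q / 2))"
        by (rule C2(2))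
      also have "\<dots> \<le> ennreal C2 * (\<Sum>n. ennreal (2 powr (real n * (q * (3/2 * \<kappa> - \<beta>)))) * (\<Sum>k. E n (int_decode k) x))"
      proof (intro mult_left_mono suminf_le)
        fix n
        have "epow (ennreal (2 powr (real n * (2 * \<kappa> - 2 * \<beta>))) * epow (?F n) 2) (q / 2) = ennreal (2 powr (real n * (2 * \<kappa> - 2 * \<beta>) * (q / 2))) * E n l x"
          using q0 by (simp add: epow_mult epow_ennreal powr_powr epow_epow E_def)
        moreover have "ennreal (2 powr (real n * \<kappa> * (q / 2))) * ennreal (2 powr (real n * (2 * \<kappa> - 2 * \<beta>) * (q / 2))) = ennreal (2 powr (real n * (q * (3/2 * \<kappa> - \<beta>))))"
          by (simp add: ennreal_mult[symmetric] powr_add[symmetric]) (simp add: field_simps)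
        ultimately have "ennreal (2 powr (real n * \<kappa> * (q / 2))) * epow (ennreal (2 powr (real n * (2 * \<kappa> - 2 * \<beta>))) * epow (?F n) 2) (q / 2) = ennreal (2 powr (real n * (q * (3/2 * \<kappa> - \<beta>)))) * E n l x"
          by (simp add: mult.assoc[symmetric])
        \<comment> \<open>The single scale l is replaced by the sum over all scales;
          \<open>int_decode\<close> enumerates the integers.\<close>
        also have "E n l x \<le> (\<Sum>k. E n (int_decode k) x)"
          using le_suminf_ennreal[of "\<lambda>k. E n (int_decode k) x" "int_encode l"] by simp
        finally show "ennreal (2 powr (real n * \<kappa> * (q / 2))) * epow (ennreal (2 powr (real n * (2 * \<kappa> - 2 * \<beta>))) * epow (?F n) 2) (q / 2)
          \<le> ennreal (2 powr (real n * (q * (3/2 * \<kappa> - \<beta>)))) * (\<Sum>k. E n (int_decode k) x)" by (simp add: mult_left_mono)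
      qed auto
      finally show ?thesis
        unfolding R_def by (simp add: ennreal_mult mult.assoc mult_left_mono add_left_mono)
    qed
    have "epow (sup_square \<beta> f x) (q / 2) \<le> R x" for x
    proof -
      have "loc_square \<beta> l f x \<le> epow (R x) (1 / (q / 2))" for l
        using epow_mono[OF pt[of l x], of "1 / (q / 2)"] q0 by (simp add: epow_epow)
      then have "sup_square \<beta> f x \<le> epow (R x) (1 / (q / 2))" unfolding sup_square_def by (intro SUP_least)
      from epow_mono[OF this q0(2)] show ?thesis using q0 by (simp add: epow_epow)
    qed
    then have "(\<integral>\<^sup>+x. epow (sup_square \<beta> f x) (q / 2) \<partial>lborel) \<le> (\<integral>\<^sup>+x. R x \<partial>lborel)" by (intro nn_integral_mono)
    also have "\<dots> = ennreal (C1 powr (q / 2) * 2 powr (q / 2)) * ((\<integral>\<^sup>+x. epow (hl_max f x) q \<partial>lborel) +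
       ennreal C2 * (\<Sum>n. ennreal (2 powr (real n * (q * (3/2 * \<kappa> - \<beta>)))) * (\<Sum>k. \<integral>\<^sup>+x. E n (int_decode k) x \<partial>lborel)))"
      unfolding R_def by (simp add: nn_integral_cmult nn_integral_add nn_integral_suminf)
    also have "\<dots> \<le> ennreal (C1 powr (q / 2) * 2 powr (q / 2)) * (ennreal C5 * ?J + ennreal C2 * (ennreal (C3 powr q * (C4 * G)) * ?J))"
    proof (intro mult_left_mono add_mono C5(2) f)
      have Esum: "(\<Sum>k. \<integral>\<^sup>+x. E n (int_decode k) x \<partial>lborel) \<le> ennreal ((C3 * 2 powr (real n * (A + \<kappa>))) powr q) * (ennreal C4 * ?J)" for n
      proof -
        \<comment> \<open>The change of variables by \<open>dyad l\<close> produces the same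
          Jacobian on both sides, so the bound at unit scale holds with the same constant at every
          scale.\<close>
        have El: "(\<integral>\<^sup>+x. E n l x \<partial>lborel) \<le> ennreal ((C3 * 2 powr (real n * (A + \<kappa>))) powr q) * (\<integral>\<^sup>+x. ennreal (norm (lp_piece l f x) powr q) \<partial>lborel)" for l
        proof -
          let ?g = "\<lambda>x. f (dyad l *\<^sub>R x)"
          note [measurable] = fine_square_measurable[OF b(1) s[of l], of n]
            schwartz_measurable[OF schwartz_multiplier_op[OF schwartz_lp_mult s[of l]]]
          have "(\<integral>\<^sup>+x. E n l x \<partial>lborel) = ennreal (dyad l ^ DIM('a)) * (\<integral>\<^sup>+x. epow (fine_square \<beta> n ?g x) q \<partial>lborel)"
            unfolding E_def by (rule nn_integral_dilate[where F = "\<lambda>x. epow (fine_square \<beta> n ?g x) q"]) auto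
          also have "\<dots> \<le> ennreal (dyad l ^ DIM('a)) * (ennreal ((C3 * 2 powr (real n * (A + \<kappa>))) powr q) * (\<integral>\<^sup>+x. ennreal (norm (multiplier_op lp_mult ?g x) powr q) \<partial>lborel))"
            using C3(2)[OF s[of l], of n] C3(1) q0 by (intro mult_left_mono) (auto simp: eLp_norm_le_iff)
          also have "\<dots> = ennreal ((C3 * 2 powr (real n * (A + \<kappa>))) powr q) * (ennreal (dyad l ^ DIM('a)) * (\<integral>\<^sup>+x. ennreal (norm (multiplier_op lp_mult ?g x) powr q) \<partial>lborel))"
            by (rule mult.left_commute)
          also have "ennreal (dyad l ^ DIM('a)) * (\<integral>\<^sup>+x. ennreal (norm (multiplier_op lp_mult ?g x) powr q) \<partial>lborel) = (\<integral>\<^sup>+x. ennreal (norm (lp_piece l f x) powr q) \<partial>lborel)"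
            unfolding lp_piece_def by (rule nn_integral_dilate[where F = "\<lambda>x. ennreal (norm (multiplier_op lp_mult ?g x) powr q)", symmetric]) auto
          finally show ?thesis .
        qed
        have "(\<Sum>k. \<integral>\<^sup>+x. E n (int_decode k) x \<partial>lborel) \<le> (\<Sum>k. ennreal ((C3 * 2 powr (real n * (A + \<kappa>))) powr q) * (\<integral>\<^sup>+x. ennreal (norm (lp_piece (int_decode k) f x) powr q) \<partial>lborel))"
          by (intro suminf_le El) auto
        also have "\<dots> = ennreal ((C3 * 2 powr (real n * (A + \<kappa>))) powr q) * (\<integral>\<^sup>+l. (\<integral>\<^sup>+x. ennreal (norm (lp_piece l f x) powr q) \<partial>lborel) \<partial>count_space UNIV)"
          by (simp add: nn_integral_count_int)
        also have "\<dots> \<le> ennreal ((C3 * 2 powr (real n * (A + \<kappa>))) powr q) * (ennreal C4 * ?J)"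
          by (intro mult_left_mono C4(2) f) simp
        finally show ?thesis .
      qed
      have "(\<Sum>n. ennreal (2 powr (real n * (q * (3/2 * \<kappa> - \<beta>)))) * (\<Sum>k. \<integral>\<^sup>+x. E n (int_decode k) x \<partial>lborel))
        \<le> (\<Sum>n. ennreal (2 powr (- (real n * (q * (3/2 * \<kappa>))))) * (ennreal (C3 powr q * C4) * ?J))"
      proof (intro suminf_le)
        fix n
        have "2 powr (real n * (q * (3/2 * \<kappa> - \<beta>))) * (C3 * 2 powr (real n * (A + \<kappa>))) powr q = 2 powr (- (real n * (q * (3/2 * \<kappa>)))) * C3 powr q"
        proof -
          have be: "\<beta> = A + 4 * \<kappa>" by (simp add: \<kappa>_def field_simps)
          have "(C3 * 2 powr (real n * (A + \<kappa>))) powr q = C3 powr q * 2 powr (real n * (A + \<kappa>) * q)" using C3 by (simp add: powr_mult powr_powr)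
          moreover have "2 powr (real n * (q * (3/2 * \<kappa> - \<beta>))) * 2 powr (real n * (A + \<kappa>) * q) = (2::real) powr (- (real n * (q * (3/2 * \<kappa>))))"
            unfolding powr_add[symmetric] be by (rule arg_cong) (simp add: field_simps)
          moreover have "x * w = z * c" if "w = c * y" "x * y = z" for x y z w c :: real using that by (simp add: mult_ac)
          from this[OF calculation] show ?thesis .
        qed
        then have e: "ennreal (2 powr (real n * (q * (3/2 * \<kappa> - \<beta>)))) * ennreal ((C3 * 2 powr (real n * (A + \<kappa>))) powr q) = ennreal (2 powr (- (real n * (q * (3/2 * \<kappa>))))) * ennreal (C3 powr q)"
          by (simp only: ennreal_mult[symmetric] powr_ge_zero)
        have "ennreal (2 powr (real n * (q * (3/2 * \<kappa> - \<beta>)))) * (\<Sum>k. \<integral>\<^sup>+x. E n (int_decode k) x \<partial>lborel) \<le> ennreal (2 powr (real n * (q * (3/2 * \<kappa> - \<beta>)))) * (ennreal ((C3 * 2 powr (real n * (A + \<kappa>))) powr q) * (ennreal C4 * ?J))"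
          by (intro mult_left_mono Esum) simp
        also have "\<dots> = ennreal (2 powr (- (real n * (q * (3/2 * \<kappa>))))) * (ennreal (C3 powr q * C4) * ?J)"
        proof -
          have e2: "ennreal (C3 powr q * C4) = ennreal (C3 powr q) * ennreal C4" using C4 by (intro ennreal_mult) auto
          have "a * (b * (c * j)) = u * ((v * c) * j)" if "a * b = u * v" for a b c j u v :: ennreal using that by (simp add: mult.assoc[symmetric])
          from this[OF e] show ?thesis unfolding e2 .
        qed
        finally show "ennreal (2 powr (real n * (q * (3/2 * \<kappa> - \<beta>)))) * (\<Sum>k. \<integral>\<^sup>+x. E n (int_decode k) x \<partial>lborel) \<le> ennreal (2 powr (- (real n * (q * (3/2 * \<kappa>))))) * (ennreal (C3 powr q * C4) * ?J)" .
      qed auto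
      also have "\<dots> = ennreal G * (ennreal (C3 powr q * C4) * ?J)"
        unfolding ennreal_suminf_multc suminf_geometric_powr[OF qk] G_def ..
      also have "\<dots> = ennreal (C3 powr q * (C4 * G)) * ?J"
      proof -
        have "ennreal G * ennreal (C3 powr q * C4) = ennreal (G * (C3 powr q * C4))" using G C4(1) by (intro ennreal_mult[symmetric]) auto
        also have "G * (C3 powr q * C4) = C3 powr q * (C4 * G)" by (simp only: mult_ac)
        finally show ?thesis by (simp only: mult.assoc[symmetric])
      qed
      finally show "(\<Sum>n. ennreal (2 powr (real n * (q * (3/2 * \<kappa> - \<beta>)))) * (\<Sum>k. \<integral>\<^sup>+x. E n (int_decode k) x \<partial>lborel)) \<le> ennreal (C3 powr q * (C4 * G)) * ?J" .
    qed auto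
    also have "\<dots> = ennreal D * ?J"
    proof -
      have c: "0 \<le> C3 powr q * (C4 * G)" "0 \<le> C1 powr (q / 2) * 2 powr (q / 2)" "0 \<le> C2" "0 \<le> C5" using C2 C4 C5 G by auto
      have "ennreal C5 * ?J + ennreal C2 * (ennreal (C3 powr q * (C4 * G)) * ?J) = ennreal (C5 + C2 * (C3 powr q * (C4 * G))) * ?J"
      proof -
        have c2: "0 \<le> C2 * (C3 powr q * (C4 * G))" by (rule mult_nonneg_nonneg[OF c(3,1)])
        have "ennreal C5 * ?J + ennreal C2 * (ennreal (C3 powr q * (C4 * G)) * ?J) = (ennreal C5 + ennreal C2 * ennreal (C3 powr q * (C4 * G))) * ?J"
          by (simp only: distrib_right mult.assoc)
        also have "ennreal C5 + ennreal C2 * ennreal (C3 powr q * (C4 * G)) = ennreal (C5 + C2 * (C3 powr q * (C4 * G)))"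
          unfolding ennreal_mult[OF c(3,1), symmetric] ennreal_plus[OF c(4) c2] ..
        finally show ?thesis .
      qed
      then have "ennreal (C1 powr (q / 2) * 2 powr (q / 2)) * (ennreal C5 * ?J + ennreal C2 * (ennreal (C3 powr q * (C4 * G)) * ?J)) =
        (ennreal (C1 powr (q / 2) * 2 powr (q / 2)) * ennreal (C5 + C2 * (C3 powr q * (C4 * G)))) * ?J" by (simp only: mult.assoc)
      moreover have "0 \<le> C5 + C2 * (C3 powr q * (C4 * G))" by (rule add_nonneg_nonneg[OF c(4) mult_nonneg_nonneg[OF c(3,1)]])
      from ennreal_mult[OF c(2) this]
      have "ennreal D = ennreal (C1 powr (q / 2) * 2 powr (q / 2)) * ennreal (C5 + C2 * (C3 powr q * (C4 * G)))" unfolding D_def .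
      ultimately show ?thesis by simp
    qed
    finally show ?thesis .
  qed
  with Dpos show ?thesis by (rule that)
qed

end

text \<open>By continuity a value above the essential supremum would persist on a ball of positive
  measure. The resulting pointwise bound is the form in which \<open>hl_max_bounded\<close> and
  \<open>lp_bounded\<close> take their input.\<close>

lemma schwartz_le_Lp_infinity:
  fixes f :: "'a::euclidean_space \<Rightarrow> complex"
  assumes f: "schwartz f"
  shows "ennreal (norm (f x)) \<le> Lp_norm \<infinity> f"
proof (rule ccontr)
  assume "\<not> ennreal (norm (f x)) \<le> Lp_norm \<infinity> f"
  then have lt: "esssup lborel (\<lambda>x. ennreal (norm (f x))) < ennreal (norm (f x))" by (simp add: Lp_norm_def eLp_norm_def)
  define c where "c = enn2real (esssup lborel (\<lambda>x. ennreal (norm (f x))))"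
  have c: "esssup lborel (\<lambda>x. ennreal (norm (f x))) = ennreal c"
    unfolding c_def by (rule ennreal_enn2real[symmetric], rule order.strict_trans[OF lt ennreal_less_top])
  have c0: "c \<ge> 0" by (simp add: c_def)
  define S where "S = {y. c < norm (f y)}"
  have "continuous_on UNIV (\<lambda>y. norm (f y))" by (intro continuous_on_norm schwartz_continuous f)
  then have "open S" unfolding S_def by (intro open_Collect_less continuous_on_const)
  moreover have "x \<in> S" using lt c0 unfolding c by (simp add: S_def ennreal_less_iff)
  ultimately obtain r where r: "r > 0" "ball x r \<subseteq> S" using open_contains_ball by blast
  have "emeasure lborel (ball x r) \<le> emeasure lborel {y \<in> space lborel. ennreal (norm (f y)) > esssup lborel (\<lambda>x. ennreal (norm (f x)))}"
  proof (rule emeasure_mono)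
    show "ball x r \<subseteq> {y \<in> space lborel. ennreal (norm (f y)) > esssup lborel (\<lambda>x. ennreal (norm (f x)))}"
      using r c0 unfolding c S_def by (auto simp: ennreal_less_iff)
    show "{y \<in> space lborel. ennreal (norm (f y)) > esssup lborel (\<lambda>x. ennreal (norm (f x)))} \<in> sets lborel"
      using schwartz_measurable[OF f] by measurable
  qed
  also have "\<dots> = 0" by (rule esssup_zero_measure)
  finally have "emeasure lborel (ball x r) = 0" by simp
  then have "measure lborel (ball x r) = 0" by (simp add: Sigma_Algebra.measure_def)
  then show False using content_ball_pos[OF r(1), of x] by simp
qed

lemma Lp_infinity_real:
  fixes f :: "'a::euclidean_space \<Rightarrow> complex"
  assumes f: "schwartz f"
  obtains \<mu> where "\<mu> \<ge> 0" "Lp_norm \<infinity> f = ennreal \<mu>" "\<And>x. norm (f x) \<le> \<mu>"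
proof -
  obtain C where C: "\<And>x. norm (f x) \<le> C" using schwartz_bounded[OF f] by metis
  have "Lp_norm \<infinity> f \<le> ennreal C" by (rule Lp_norm_infinity_le[OF schwartz_measurable[OF f] C])
  then have lt: "Lp_norm \<infinity> f < top" by (rule order.strict_trans1) (rule ennreal_less_top)
  then obtain \<mu> where mu: "\<mu> \<ge> 0" "Lp_norm \<infinity> f = ennreal \<mu>" by (cases "Lp_norm \<infinity> f") auto
  have "norm (f x) \<le> \<mu>" for x
    using schwartz_le_Lp_infinity[OF f, of x] mu by (simp add: ennreal_le_iff)
  with mu show ?thesis by (rule that)
qed

lemma AE_dilate_le:
  fixes F :: "'a::euclidean_space \<Rightarrow> ennreal"
  assumes [measurable]: "F \<in> borel_measurable borel" and s: "\<sigma> > 0" and ae: "AE x in lborel. F x \<le> c"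
  shows "AE x in lborel. F ((1 / \<sigma>) *\<^sub>R x) \<le> c"
proof -
  let ?I = "\<lambda>x. indicator {x. \<not> F x \<le> c} x :: ennreal"
  have Im: "?I \<in> borel_measurable borel" by measurable
  have "(\<integral>\<^sup>+x. ?I x \<partial>lborel) = 0"
    using ae by (subst nn_integral_0_iff_AE) (auto elim!: eventually_mono)
  then have "(\<integral>\<^sup>+x. ?I ((1 / \<sigma>) *\<^sub>R x) \<partial>lborel) = 0" by (simp only: nn_integral_dilate[OF Im s] mult_zero_right)
  then show ?thesis by (subst (asm) nn_integral_0_iff_AE) (auto elim!: eventually_mono simp: indicator_def split: if_splits)
qed

context
  fixes N :: nat and P :: ennreal
  assumes d: "DIM('a::euclidean_space) \<ge> 2" and P: "P \<ge> ennreal (2 * real DIM('a) / (real DIM('a) - 1))"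
    and H: "square_function_hyp TYPE('a) N P"
begin

text \<open>At the infinite endpoint each fine term has an essential bound independent of l, so the
  supremum over l is free and only the sum over n must converge.\<close>

lemma linear_maximal_infinity:
  assumes b: "\<beta> > 0" "\<beta> > crit DIM('a) P \<infinity>"
  obtains C where "C > 0" "\<And>(f :: 'a \<Rightarrow> complex) \<mu>. schwartz f \<Longrightarrow> \<mu> \<ge> 0 \<Longrightarrow> (\<And>x. norm (f x) \<le> \<mu>) \<Longrightarrow>
    AE x in lborel. sup_square \<beta> f x \<le> ennreal (C * \<mu>\<^sup>2)"
proof -
  define A where "A = crit DIM('a) P \<infinity>"
  define \<kappa> where "\<kappa> = (\<beta> - A) / 4"
  have k: "\<kappa> > 0" using b by (simp add: \<kappa>_def A_def)
  obtain C1 where C1: "C1 > 0" "\<And>(f :: 'a \<Rightarrow> complex) l x. schwartz f \<Longrightarrow>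
    loc_square \<beta> l f x \<le> ennreal C1 * (epow (hl_max f x) 2 + (\<Sum>n. ennreal (2 powr (real n * (2 * \<kappa> - 2 * \<beta>))) *
      epow (fine_square \<beta> n (\<lambda>x. f (dyad l *\<^sub>R x)) ((1 / dyad l) *\<^sub>R x)) 2))"
    by (rule loc_square_le[OF b(1) k], rule that)
  obtain C3 where C3: "C3 > 0" "\<And>n (f :: 'a \<Rightarrow> complex). schwartz f \<Longrightarrow>
    eLp_norm \<infinity> (fine_square \<beta> n f) \<le> ennreal (C3 * 2 powr (real n * (A + \<kappa>))) * Lp_norm \<infinity> (multiplier_op lp_mult f)"
    by (rule fine_square_norm[OF d P H b(1) _ k, of \<infinity>], simp, rule that, assumption, unfold A_def, assumption)
  obtain C4 where C4: "C4 > 0" "\<And>(f :: 'a \<Rightarrow> complex) \<mu> x. schwartz f \<Longrightarrow> (\<And>x. norm (f x) \<le> \<mu>) \<Longrightarrow> norm (multiplier_op lp_mult f x) \<le> C4 * \<mu>"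
  proof (rule lp_bounded)
    fix C :: real
    assume "C > 0" "\<And>(f :: 'a \<Rightarrow> complex) \<mu> x. schwartz f \<Longrightarrow> (\<And>x. norm (f x) \<le> \<mu>) \<Longrightarrow> norm (multiplier_op lp_mult f x) \<le> C * \<mu>"
    then show thesis by (rule that)
  qed
  \<comment> \<open>With \<beta> = A + 4 \<kappa> the exponents of the squared terms add up to 2
    \<kappa> - 2 \<beta> + 2 (A + \<kappa>) = -4 \<kappa>.\<close>
  define G where "G = 1 / (1 - (2::real) powr (- (4 * \<kappa>)))"
  have k4: "4 * \<kappa> > 0" using k by simp
  have G: "G > 0" using k4 unfolding G_def by (simp add: powr_less_one)
  define D where "D = C1 * (1 + G * (C3 * C4)\<^sup>2)"
  have Dpos: "D > 0" using C1 C3 C4 G by (auto simp: D_def intro!: mult_pos_pos add_pos_pos)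
  have "AE x in lborel. sup_square \<beta> f x \<le> ennreal (D * \<mu>\<^sup>2)"
    if f: "schwartz f" and mu0: "\<mu> \<ge> 0" and mu: "\<And>x. norm (f x) \<le> \<mu>" for f :: "'a \<Rightarrow> complex" and \<mu>
  proof -
    let ?F = "\<lambda>n l x. fine_square \<beta> n (\<lambda>x. f (dyad l *\<^sub>R x)) ((1 / dyad l) *\<^sub>R x)"
    have s: "schwartz (\<lambda>x. f (dyad l *\<^sub>R x))" for l by (rule schwartz_dilate[OF f]) (simp add: less_imp_neq[symmetric])
    have ae1: "AE x in lborel. ?F n l x \<le> ennreal (C3 * 2 powr (real n * (A + \<kappa>)) * (C4 * \<mu>))" for n l
    proof (rule AE_dilate_le[OF fine_square_measurable[OF b(1) s] dyad_pos])
      have "Lp_norm \<infinity> (multiplier_op lp_mult (\<lambda>x. f (dyad l *\<^sub>R x))) \<le> ennreal (C4 * \<mu>)"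
        by (intro Lp_norm_infinity_le schwartz_measurable schwartz_multiplier_op schwartz_lp_mult s C4(2) mu)
      then have "eLp_norm \<infinity> (fine_square \<beta> n (\<lambda>x. f (dyad l *\<^sub>R x))) \<le> ennreal (C3 * 2 powr (real n * (A + \<kappa>))) * ennreal (C4 * \<mu>)"
        by (rule order_trans[OF C3(2)[OF s] mult_left_mono]) simp
      also have "\<dots> = ennreal (C3 * 2 powr (real n * (A + \<kappa>)) * (C4 * \<mu>))" using C3 C4 mu0 by (simp only: ennreal_mult mult_nonneg_nonneg powr_ge_zero order.strict_implies_order)
      finally have "esssup lborel (fine_square \<beta> n (\<lambda>x. f (dyad l *\<^sub>R x))) \<le> ennreal (C3 * 2 powr (real n * (A + \<kappa>)) * (C4 * \<mu>))"
        by (simp add: eLp_norm_def)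
      with esssup_AE[of "fine_square \<beta> n (\<lambda>x. f (dyad l *\<^sub>R x))" lborel]
      show "AE x in lborel. fine_square \<beta> n (\<lambda>x. f (dyad l *\<^sub>R x)) x \<le> ennreal (C3 * 2 powr (real n * (A + \<kappa>)) * (C4 * \<mu>))"
        by (auto elim!: eventually_mono)
    qed
    \<comment> \<open>There are only countably many pairs (n, l), so a single exceptional null set
      serves all of them.\<close>
    then have "AE x in lborel. \<forall>n l. ?F n l x \<le> ennreal (C3 * 2 powr (real n * (A + \<kappa>)) * (C4 * \<mu>))"
      by (simp add: AE_all_countable)
    then show ?thesis
    proof eventually_elim
      case (elim x)
      have "loc_square \<beta> l f x \<le> ennreal (D * \<mu>\<^sup>2)" for l
      proof -
        have hl: "epow (hl_max f x) 2 \<le> ennreal (\<mu>\<^sup>2)"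
          using epow_mono[OF hl_max_bounded[of f \<mu> x, OF mu], of 2] mu0 by (simp add: epow_ennreal)
        have "(\<Sum>n. ennreal (2 powr (real n * (2 * \<kappa> - 2 * \<beta>))) * epow (?F n l x) 2) \<le> (\<Sum>n. ennreal (2 powr (- (real n * (4 * \<kappa>)))) * ennreal ((C3 * C4)\<^sup>2 * \<mu>\<^sup>2))"
        proof (intro suminf_le)
          fix n
          have "epow (?F n l x) 2 \<le> epow (ennreal (C3 * 2 powr (real n * (A + \<kappa>)) * (C4 * \<mu>))) 2" using elim by (intro epow_mono) auto
          also have "\<dots> = ennreal ((C3 * 2 powr (real n * (A + \<kappa>)) * (C4 * \<mu>))\<^sup>2)" using C3 C4 mu0 by (simp add: epow_ennreal)
          finally have "ennreal (2 powr (real n * (2 * \<kappa> - 2 * \<beta>))) * epow (?F n l x) 2 \<le> ennreal (2 powr (real n * (2 * \<kappa> - 2 * \<beta>))) * ennreal ((C3 * 2 powr (real n * (A + \<kappa>)) * (C4 * \<mu>))\<^sup>2)"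
            by (rule mult_left_mono) simp
          also have "\<dots> = ennreal (2 powr (real n * (2 * \<kappa> - 2 * \<beta>)) * (C3 * 2 powr (real n * (A + \<kappa>)) * (C4 * \<mu>))\<^sup>2)"
            by (rule ennreal_mult[symmetric]) auto
          also have "2 powr (real n * (2 * \<kappa> - 2 * \<beta>)) * (C3 * 2 powr (real n * (A + \<kappa>)) * (C4 * \<mu>))\<^sup>2 = 2 powr (- (real n * (4 * \<kappa>))) * ((C3 * C4)\<^sup>2 * \<mu>\<^sup>2)"
          proof -
            have be: "\<beta> = A + 4 * \<kappa>" by (simp add: \<kappa>_def field_simps)
            have "2 powr (real n * (2 * \<kappa> - 2 * \<beta>)) * ((2::real) powr (real n * (A + \<kappa>)))\<^sup>2 = 2 powr (- (real n * (4 * \<kappa>)))"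
              unfolding power2_eq_square powr_add[symmetric] be by (rule arg_cong) (simp add: algebra_simps)
            moreover have "(C3 * Z * (C4 * \<mu>))\<^sup>2 = Z\<^sup>2 * ((C3 * C4)\<^sup>2 * \<mu>\<^sup>2)" for Z by (simp add: power_mult_distrib mult_ac)
            ultimately show ?thesis by (simp only: mult.assoc[symmetric])
          qed
          also have "ennreal (2 powr (- (real n * (4 * \<kappa>))) * ((C3 * C4)\<^sup>2 * \<mu>\<^sup>2)) = ennreal (2 powr (- (real n * (4 * \<kappa>)))) * ennreal ((C3 * C4)\<^sup>2 * \<mu>\<^sup>2)"
            by (rule ennreal_mult) auto
          finally show "ennreal (2 powr (real n * (2 * \<kappa> - 2 * \<beta>))) * epow (?F n l x) 2 \<le> ennreal (2 powr (- (real n * (4 * \<kappa>)))) * ennreal ((C3 * C4)\<^sup>2 * \<mu>\<^sup>2)" .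
        qed auto
        also have "\<dots> = ennreal G * ennreal ((C3 * C4)\<^sup>2 * \<mu>\<^sup>2)" unfolding ennreal_suminf_multc suminf_geometric_powr[OF k4] G_def ..
        also have "\<dots> = ennreal (G * ((C3 * C4)\<^sup>2 * \<mu>\<^sup>2))" using G by (intro ennreal_mult[symmetric]) auto
        finally have S: "(\<Sum>n. ennreal (2 powr (real n * (2 * \<kappa> - 2 * \<beta>))) * epow (?F n l x) 2) \<le> ennreal (G * ((C3 * C4)\<^sup>2 * \<mu>\<^sup>2))" .
        have "loc_square \<beta> l f x \<le> ennreal C1 * (ennreal (\<mu>\<^sup>2) + ennreal (G * ((C3 * C4)\<^sup>2 * \<mu>\<^sup>2)))"
          by (rule order_trans[OF C1(2)[OF f] mult_left_mono[OF add_mono[OF hl S]]]) simp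
        also have "\<dots> = ennreal (C1 * (\<mu>\<^sup>2 + G * ((C3 * C4)\<^sup>2 * \<mu>\<^sup>2)))"
        proof -
          have "0 \<le> G * ((C3 * C4)\<^sup>2 * \<mu>\<^sup>2)" using G by simp
          then show ?thesis using C1(1) by (simp only: ennreal_plus[symmetric] ennreal_mult[symmetric] zero_le_power2 add_nonneg_nonneg order.strict_implies_order)
        qed
        also have "C1 * (\<mu>\<^sup>2 + G * ((C3 * C4)\<^sup>2 * \<mu>\<^sup>2)) = D * \<mu>\<^sup>2" by (simp add: D_def algebra_simps)
        finally show ?thesis .
      qed
      then show ?case unfolding sup_square_def by (intro SUP_least)
    qed
  qed
  with Dpos show ?thesis by (rule that)
qed

theorem linear_maximal:
  assumes p: "p \<ge> 2" and b: "\<beta> > 0" "\<beta> > crit DIM('a) P p"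
  obtains C where "C > 0" "\<And>f :: 'a \<Rightarrow> complex. schwartz f \<Longrightarrow> eLp_norm p (\<lambda>x. epow (sup_square \<beta> f x) (1/2)) \<le> ennreal C * Lp_norm p f"
  using p
proof (cases rule: exponent_cases)
  case 1
  obtain C where C: "C > 0" "\<And>(f :: 'a \<Rightarrow> complex) \<mu>. schwartz f \<Longrightarrow> \<mu> \<ge> 0 \<Longrightarrow> (\<And>x. norm (f x) \<le> \<mu>) \<Longrightarrow>
    AE x in lborel. sup_square \<beta> f x \<le> ennreal (C * \<mu>\<^sup>2)"
  proof (rule linear_maximal_infinity[OF b(1) b(2)[unfolded 1]])
    fix C :: real
    assume "C > 0" "\<And>(f :: 'a \<Rightarrow> complex) \<mu>. schwartz f \<Longrightarrow> \<mu> \<ge> 0 \<Longrightarrow> (\<And>x. norm (f x) \<le> \<mu>) \<Longrightarrow>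
      AE x in lborel. sup_square \<beta> f x \<le> ennreal (C * \<mu>\<^sup>2)"
    then show thesis by (rule that)
  qed
  have "eLp_norm p (\<lambda>x. epow (sup_square \<beta> f x) (1/2)) \<le> ennreal (sqrt C) * Lp_norm p f" if f: "schwartz f" for f :: "'a \<Rightarrow> complex"
  proof -
    note [measurable] = sup_square_measurable[OF b(1) f]
    obtain \<mu> where mu: "\<mu> \<ge> 0" "Lp_norm \<infinity> f = ennreal \<mu>" "\<And>x. norm (f x) \<le> \<mu>" using Lp_infinity_real[OF f] by metis
    have "AE x in lborel. epow (sup_square \<beta> f x) (1/2) \<le> ennreal (sqrt C * \<mu>)"
      using C(2)[OF f mu(1,3)]
    proof eventually_elim
      case (elim x)
      then have "epow (sup_square \<beta> f x) (1/2) \<le> epow (ennreal (C * \<mu>\<^sup>2)) (1/2)" by (rule epow_mono) simp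
      also have "\<dots> = ennreal (sqrt C * \<mu>)" using C mu by (simp add: epow_ennreal powr_half_sqrt real_sqrt_mult)
      finally show ?case .
    qed
    then show ?thesis unfolding 1 eLp_norm_def mu(2) using C mu by (auto intro!: esssup_I simp: ennreal_mult[symmetric])
  qed
  moreover have "sqrt C > 0" using C by simp
  ultimately show ?thesis using that by blast
next
  case (2 q)
  obtain C where C: "C > 0" "\<And>f :: 'a \<Rightarrow> complex. schwartz f \<Longrightarrow>
    (\<integral>\<^sup>+x. epow (sup_square \<beta> f x) (q / 2) \<partial>lborel) \<le> ennreal C * (\<integral>\<^sup>+x. ennreal (norm (f x) powr q) \<partial>lborel)"
    by (rule linear_maximal_finite[OF d P H 2(2) b(1) b(2)[unfolded 2(1)]], rule that)
  have "eLp_norm p (\<lambda>x. epow (sup_square \<beta> f x) (1/2)) \<le> ennreal (C powr (1 / q)) * Lp_norm p f" if f: "schwartz f" for f :: "'a \<Rightarrow> complex"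
    unfolding 2(1) using C(2)[OF f] C(1) 2(2) by (subst eLp_norm_le_iff) (auto simp: epow_epow powr_powr)
  moreover have "C powr (1 / q) > 0" using C by simp
  ultimately show ?thesis using that by blast
qed

end

section \<open>The bilinear maximal function\<close>

text \<open>The substitution t = a + s u with s = 1 - a - b reduces the integral to the Beta
  integral; c is the Beta function at (\<beta> + 1, \<gamma> + 1), and the Jacobian s accounts for
  the 1 in the exponent \<beta> + \<gamma> + 1.\<close>

lemma positive_part_powr_convolution:
  assumes b: "\<beta> > 0" and g: "\<gamma> > 0"
  obtains c :: real where "c > 0" "\<And>a b. 0 \<le> a \<Longrightarrow> 0 \<le> b \<Longrightarrow>
    (LINT t|lborel. max 0 (t - a) powr \<beta> * max 0 (1 - t - b) powr \<gamma>) = c * max 0 (1 - a - b) powr (\<beta> + \<gamma> + 1)"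
proof -
  define h where "h = (\<lambda>u::real. max 0 u powr \<beta> * max 0 (1 - u) powr \<gamma>)"
  have hm[measurable]: "h \<in> borel_measurable borel" unfolding h_def by measurable
  have hb: "norm (h u) \<le> indicator {0..1} u" for u
  proof (cases "u \<in> {0..1}")
    case True
    then have "max 0 u powr \<beta> \<le> 1" "max 0 (1 - u) powr \<gamma> \<le> 1" using b g by (auto intro!: powr_le1 simp: max_def)
    then show ?thesis using True by (simp add: h_def abs_mult mult_le_one)
  next
    case False then show ?thesis by (auto simp: h_def max_def)
  qed
  have hi: "integrable lborel h"
    by (rule Bochner_Integration.integrable_bound[of _ "indicator {0..1} :: real \<Rightarrow> real"]) (use hb in auto)
  define c where "c = (LINT u|lborel. h u)"
  \<comment> \<open>On the middle half of [0, 1] both u and 1 - u are at least 1/4, so c is at least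
    k/2 > 0.\<close>
  define k where "k = (1/4) powr \<beta> * (1/4 :: real) powr \<gamma>"
  have "k * (1/2) = (LINT u|lborel. k * indicator {1/4..3/4::real} u)" by simp
  also have "\<dots> \<le> c" unfolding c_def
  proof (rule integral_mono[OF _ hi])
    show "integrable lborel (\<lambda>u. k * indicator {1/4..3/4::real} u :: real)" by (intro integrable_mult_right integrable_real_indicator emeasure_compact_finite compact_Icc) simp
    fix u :: real
    show "k * indicator {1/4..3/4} u \<le> h u"
    proof (cases "u \<in> {1/4..3/4}")
      case True
      then have "(1/4) powr \<beta> \<le> max 0 u powr \<beta>" "(1/4) powr \<gamma> \<le> max 0 (1 - u) powr \<gamma>" using b g by (auto intro!: powr_mono2)
      then show ?thesis using True by (auto simp: h_def k_def intro!: mult_mono)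
    qed (simp add: h_def)
  qed
  finally have c0: "c > 0" by (rule less_le_trans[rotated]) (simp add: k_def)
  have "(LINT t|lborel. max 0 (t - a) powr \<beta> * max 0 (1 - t - b) powr \<gamma>) = c * max 0 (1 - a - b) powr (\<beta> + \<gamma> + 1)" for a b :: real
  proof (cases "1 - a - b > 0")
    case True
    define s where "s = 1 - a - b"
    have s: "s > 0" using True by (simp add: s_def)
    have "(LINT t|lborel. max 0 (t - a) powr \<beta> * max 0 (1 - t - b) powr \<gamma>) =
      \<bar>s\<bar> *\<^sub>R (LINT u|lborel. max 0 ((a + s * u) - a) powr \<beta> * max 0 (1 - (a + s * u) - b) powr \<gamma>)"
      by (rule lborel_integral_real_affine) (use s in simp)
    also have "(\<lambda>u. max 0 ((a + s * u) - a) powr \<beta> * max 0 (1 - (a + s * u) - b) powr \<gamma>) = (\<lambda>u. s powr (\<beta> + \<gamma>) * h u)"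
    proof
      fix u
      have e1: "max 0 ((a + s * u) - a) = s * max 0 u" using s by (auto simp: max_def zero_le_mult_iff mult_le_0_iff)
      have "1 - (a + s * u) - b = s * (1 - u)" by (simp add: s_def algebra_simps)
      then have e2: "max 0 (1 - (a + s * u) - b) = s * max 0 (1 - u)" using s by (auto simp: max_def zero_le_mult_iff mult_le_0_iff)
      show "max 0 ((a + s * u) - a) powr \<beta> * max 0 (1 - (a + s * u) - b) powr \<gamma> = s powr (\<beta> + \<gamma>) * h u"
        unfolding e1 e2 h_def using s by (simp add: powr_mult powr_add)
    qed
    also have "\<bar>s\<bar> *\<^sub>R (LINT u|lborel. s powr (\<beta> + \<gamma>) * h u) = c * (s * s powr (\<beta> + \<gamma>))" using s by (simp add: c_def)
    also have "s * s powr (\<beta> + \<gamma>) = max 0 (1 - a - b) powr (\<beta> + \<gamma> + 1)" using s by (simp add: s_def powr_add)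
    finally show ?thesis .
  next
    case False
    have z: "max 0 (t - a) powr \<beta> * max 0 (1 - t - b) powr \<gamma> = 0" for t
      using False by (cases "t \<le> a") (auto simp: max_def)
    have m: "max 0 (1 - a - b) = 0" using False by simp
    show ?thesis unfolding z m by simp
  qed
  with c0 show ?thesis by (intro that)
qed

lemma
  fixes u :: "'a::euclidean_space \<Rightarrow> complex" and v :: "'b::euclidean_space \<Rightarrow> complex"
  assumes u: "integrable lborel u" and v: "integrable lborel v"
  shows integrable_tensor: "integrable (lborel \<Otimes>\<^sub>M lborel) (\<lambda>z. u (fst z) * v (snd z))"
    and integral_tensor: "(LINT z|(lborel \<Otimes>\<^sub>M lborel). u (fst z) * v (snd z)) = (LINT x|lborel. u x) * (LINT y|lborel. v y)"
proof -
  have [measurable]: "u \<in> borel_measurable borel" "v \<in> borel_measurable borel"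
    using u v borel_measurable_integrable by fastforce+
  show i: "integrable (lborel \<Otimes>\<^sub>M lborel) (\<lambda>z. u (fst z) * v (snd z))"
  proof (rule lborel_pair.Fubini_integrable)
    show "integrable lborel (\<lambda>x. LINT y|lborel. norm (u (fst (x, y)) * v (snd (x, y))))"
      using u by (simp add: norm_mult)
    show "AE x in lborel. integrable lborel (\<lambda>y. u (fst (x, y)) * v (snd (x, y)))" using v by simp
  qed measurable
  show "(LINT z|(lborel \<Otimes>\<^sub>M lborel). u (fst z) * v (snd z)) = (LINT x|lborel. u x) * (LINT y|lborel. v y)"
    using lborel_pair.integral_fst'[OF i] by simp
qed

lemma integrable_br_mult:
  fixes f :: "'a::euclidean_space \<Rightarrow> complex"
  assumes b: "\<beta> > 0" and f: "schwartz f"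
  shows "integrable lborel (\<lambda>\<xi>. cis (2 * pi * (x \<bullet> \<xi>)) * br_mult \<beta> t (l *\<^sub>R \<xi>) * fourier f \<xi>)"
proof -
  note [measurable] = br_mult_measurable[OF b, where 'a='a]
  have "integrable lborel (\<lambda>\<xi>. br_mult \<beta> t (l *\<^sub>R \<xi>) * fourier f \<xi>)"
    by (rule integrable_mult_bounded[OF integrable_fourier_schwartz[OF f] _ norm_br_mult_le[OF b]]) measurable
  then have "integrable lborel (\<lambda>\<xi>. cis (2 * pi * (x \<bullet> \<xi>)) * (br_mult \<beta> t (l *\<^sub>R \<xi>) * fourier f \<xi>))"
    by (rule integrable_cis_mult) measurable
  then show ?thesis by (simp only: mult.assoc)
qed

text \<open>Up to a constant, \<open>(1 - |\<xi>|\<^sup>2 - |\<eta>|\<^sup>2)\<^sub>+\<^sup>\<alpha>\<close> with \<open>\<alpha> = \<beta> + \<gamma> + 1\<close> is the convolution integral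
  of \<open>(t - |\<xi>|\<^sup>2)\<^sub>+\<^sup>\<beta>\<close> and \<open>(1 - t - |\<eta>|\<^sup>2)\<^sub>+\<^sup>\<gamma>\<close>, which separates the two functions.\<close>

lemma bochner_riesz_eq_integral:
  fixes f g :: "'a::euclidean_space \<Rightarrow> complex"
  assumes b: "\<beta> > 0" and c: "\<gamma> > 0" and f: "schwartz f" and g: "schwartz g"
    and conv: "\<And>a b. 0 \<le> a \<Longrightarrow> 0 \<le> b \<Longrightarrow>
      (LINT t|lborel. max 0 (t - a) powr \<beta> * max 0 (1 - t - b) powr \<gamma>) = C * max 0 (1 - a - b) powr (\<beta> + \<gamma> + 1)"
  shows "of_real C * bochner_riesz (\<beta> + \<gamma> + 1) l f g x =
    (LINT t|lborel. multiplier_op (\<lambda>\<xi>. br_mult \<beta> t (l *\<^sub>R \<xi>)) f x * multiplier_op (\<lambda>\<eta>. br_mult \<gamma> (1 - t) (l *\<^sub>R \<eta>)) g x)"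
proof -
  note [measurable] = fourier_measurable[OF schwartz_measurable[OF f]] fourier_measurable[OF schwartz_measurable[OF g]]
  define F where "F = (\<lambda>\<xi>. cis (2 * pi * (x \<bullet> \<xi>)) * fourier f \<xi>)"
  define G where "G = (\<lambda>\<eta>. cis (2 * pi * (x \<bullet> \<eta>)) * fourier g \<eta>)"
  have Fi: "integrable lborel F" unfolding F_def by (rule integrable_cis_mult[OF integrable_fourier_schwartz[OF f]]) measurable
  have Gi: "integrable lborel G" unfolding G_def by (rule integrable_cis_mult[OF integrable_fourier_schwartz[OF g]]) measurable
  define w where "w = (\<lambda>z. F (fst z) * G (snd z))"
  have wi: "integrable lborel w" unfolding w_def lborel_prod[symmetric] by (rule integrable_tensor[OF Fi Gi])
  have [measurable]: "w \<in> borel_measurable borel" using borel_measurable_integrable[OF wi] by simp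
  define k where "k = (\<lambda>t z. max 0 (t - (norm (l *\<^sub>R fst z :: 'a))\<^sup>2) powr \<beta> * max 0 (1 - t - (norm (l *\<^sub>R snd z :: 'a))\<^sup>2) powr \<gamma>)"
  \<comment> \<open>The weight is at most 1 and vanishes unless 0 \<le> t \<le> 1, so
    \<open>indicator {0..1}\<close> times |w| is an integrable majorant for the exchange of
    integrals.\<close>
  have kb: "norm (k t z) \<le> indicator {0..1} t" for t z
  proof (cases "t \<in> {0..1}")
    case True
    have "t - (norm (l *\<^sub>R fst z))\<^sup>2 \<le> 1" "1 - t - (norm (l *\<^sub>R snd z))\<^sup>2 \<le> 1"
      using True zero_le_power2[of "norm (l *\<^sub>R fst z)"] zero_le_power2[of "norm (l *\<^sub>R snd z)"]
      unfolding atLeastAtMost_iff by linarith+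
    then have "max 0 (t - (norm (l *\<^sub>R fst z))\<^sup>2) \<le> 1" "max 0 (1 - t - (norm (l *\<^sub>R snd z))\<^sup>2) \<le> 1" by simp_all
    then have "max 0 (t - (norm (l *\<^sub>R fst z))\<^sup>2) powr \<beta> \<le> 1" "max 0 (1 - t - (norm (l *\<^sub>R snd z))\<^sup>2) powr \<gamma> \<le> 1"
      using b c by (auto intro!: powr_le1)
    then show ?thesis using True by (simp add: k_def abs_mult mult_le_one)
  next
    case False
    have "t - (norm (l *\<^sub>R fst z))\<^sup>2 \<le> 0 \<or> 1 - t - (norm (l *\<^sub>R snd z))\<^sup>2 \<le> 0"
      using False zero_le_power2[of "norm (l *\<^sub>R fst z)"] zero_le_power2[of "norm (l *\<^sub>R snd z)"]
      unfolding atLeastAtMost_iff by linarith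
    then have "k t z = 0" unfolding k_def by (auto simp: max_absorb1)
    then show ?thesis by simp
  qed
  have km: "(\<lambda>(t, z). complex_of_real (k t z)) \<in> borel_measurable (borel \<Otimes>\<^sub>M borel)"
  proof -
    have "(\<lambda>(t, z). complex_of_real (k t z)) \<in> borel_measurable (borel \<Otimes>\<^sub>M (borel \<Otimes>\<^sub>M borel))"
      unfolding k_def by measurable
    then show ?thesis by (simp add: borel_prod)
  qed
  have J: "integrable (lborel \<Otimes>\<^sub>M lborel) (\<lambda>(t, z). of_real (k t z) * w z)"
  proof (rule Bochner_Integration.integrable_bound[OF integrable_tensor[OF _ wi]])
    show "integrable lborel (\<lambda>t. complex_of_real (indicator {0..1::real} t))" by (intro integrable_of_real) simp
    have "(\<lambda>(t::real, z::'a \<times> 'a). complex_of_real (k t z) * w z) \<in> borel_measurable (borel \<Otimes>\<^sub>M borel)"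
      using km by measurable
    then show "(\<lambda>(t::real, z::'a \<times> 'a). complex_of_real (k t z) * w z) \<in> borel_measurable (lborel \<Otimes>\<^sub>M lborel)"
      by (simp cong: measurable_cong_sets sets_pair_measure_cong)
    show "AE tz in lborel \<Otimes>\<^sub>M lborel. norm (case tz of (t, z) \<Rightarrow> complex_of_real (k t z) * w z) \<le> norm (complex_of_real (indicator {0..1} (fst tz)) * w (snd tz))"
    proof (rule AE_I2)
      fix tz :: "real \<times> 'a \<times> 'a"
      show "norm (case tz of (t, z) \<Rightarrow> complex_of_real (k t z) * w z) \<le> norm (complex_of_real (indicator {0..1} (fst tz)) * w (snd tz))"
        unfolding case_prod_beta norm_mult by (rule mult_right_mono) (use kb[of "fst tz" "snd tz"] in auto)
    qed
  qed
  have "of_real C * bochner_riesz (\<beta> + \<gamma> + 1) l f g x = (LINT z|lborel. LINT t|lborel. of_real (k t z) * w z)"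
  proof -
    have "of_real C * bochner_riesz (\<beta> + \<gamma> + 1) l f g x = (LINT z|lborel. of_real C * (case z of (\<xi>, \<eta>) \<Rightarrow> cis (2 * pi * (x \<bullet> (\<xi> + \<eta>))) *
        complex_of_real (max 0 (1 - (norm (l *\<^sub>R \<xi>))\<^sup>2 - (norm (l *\<^sub>R \<eta>))\<^sup>2) powr (\<beta> + \<gamma> + 1)) * fourier f \<xi> * fourier g \<eta>))"
      unfolding bochner_riesz_def lborel_prod by simp
    also have "\<dots> = (LINT z|lborel. LINT t|lborel. of_real (k t z) * w z)"
    proof (intro Bochner_Integration.integral_cong refl)
      fix z :: "'a \<times> 'a"
      obtain \<xi> \<eta> where z: "z = (\<xi>, \<eta>)" by (cases z)
      have "(LINT t|lborel. complex_of_real (k t z) * w z) = of_real (LINT t|lborel. k t z) * w z" by simp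
      also have "(LINT t|lborel. k t z) = C * max 0 (1 - (norm (l *\<^sub>R \<xi>))\<^sup>2 - (norm (l *\<^sub>R \<eta>))\<^sup>2) powr (\<beta> + \<gamma> + 1)"
        unfolding k_def z fst_conv snd_conv by (rule conv) auto
      finally have E: "(LINT t|lborel. complex_of_real (k t z) * w z) = of_real (C * max 0 (1 - (norm (l *\<^sub>R \<xi>))\<^sup>2 - (norm (l *\<^sub>R \<eta>))\<^sup>2) powr (\<beta> + \<gamma> + 1)) * w z" .
      have wz: "w z = cis (2 * pi * (x \<bullet> (\<xi> + \<eta>))) * fourier f \<xi> * fourier g \<eta>"
        by (simp add: w_def F_def G_def z inner_add_right distrib_left cis_mult[symmetric])
      show "of_real C * (case z of (\<xi>, \<eta>) \<Rightarrow> cis (2 * pi * (x \<bullet> (\<xi> + \<eta>))) *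
        complex_of_real (max 0 (1 - (norm (l *\<^sub>R \<xi>))\<^sup>2 - (norm (l *\<^sub>R \<eta>))\<^sup>2) powr (\<beta> + \<gamma> + 1)) * fourier f \<xi> * fourier g \<eta>) =
        (LINT t|lborel. complex_of_real (k t z) * w z)" unfolding E unfolding wz by (simp only: z prod.case of_real_mult mult_ac)
    qed
    finally show ?thesis .
  qed
  also have "\<dots> = (LINT t|lborel. LINT z|lborel. of_real (k t z) * w z)"
    by (rule lborel_pair.Fubini_integral[OF J])
  also have "(\<lambda>t. LINT z|lborel. of_real (k t z) * w z) =
    (\<lambda>t. multiplier_op (\<lambda>\<xi>. br_mult \<beta> t (l *\<^sub>R \<xi>)) f x * multiplier_op (\<lambda>\<eta>. br_mult \<gamma> (1 - t) (l *\<^sub>R \<eta>)) g x)"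
  proof
    fix t
    have "multiplier_op (\<lambda>\<xi>. br_mult \<beta> t (l *\<^sub>R \<xi>)) f x * multiplier_op (\<lambda>\<eta>. br_mult \<gamma> (1 - t) (l *\<^sub>R \<eta>)) g x =
      (LINT z|(lborel \<Otimes>\<^sub>M lborel). (cis (2 * pi * (x \<bullet> fst z)) * br_mult \<beta> t (l *\<^sub>R fst z) * fourier f (fst z)) *
         (cis (2 * pi * (x \<bullet> snd z)) * br_mult \<gamma> (1 - t) (l *\<^sub>R snd z) * fourier g (snd z)))"
      unfolding multiplier_op_def by (rule integral_tensor[OF integrable_br_mult[OF b f] integrable_br_mult[OF c g], symmetric])
    also have "\<dots> = (LINT z|lborel. of_real (k t z) * w z)"
      unfolding lborel_prod by (intro Bochner_Integration.integral_cong refl) (simp add: br_mult_def b c k_def w_def F_def G_def mult_ac)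
    finally show "(LINT z|lborel. of_real (k t z) * w z) = multiplier_op (\<lambda>\<xi>. br_mult \<beta> t (l *\<^sub>R \<xi>)) f x * multiplier_op (\<lambda>\<eta>. br_mult \<gamma> (1 - t) (l *\<^sub>R \<eta>)) g x" ..
  qed
  finally show ?thesis .
qed

text \<open>The interval (0, 1] is the range of t for which both t and 1 - t can give a nonzero
  multiplier, up to an endpoint.\<close>

definition unit_square :: "real \<Rightarrow> real \<Rightarrow> ('a::euclidean_space \<Rightarrow> complex) \<Rightarrow> 'a \<Rightarrow> ennreal" where
  "unit_square \<beta> l f x = (\<integral>\<^sup>+t\<in>{0<..1}. ennreal ((norm (multiplier_op (\<lambda>\<xi>. br_mult \<beta> t (l *\<^sub>R \<xi>)) f x))\<^sup>2) \<partial>lborel)"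

lemma br_op_measurable:
  fixes f :: "'a::euclidean_space \<Rightarrow> complex"
  assumes b: "\<beta> > 0" and f: "schwartz f"
  shows "(\<lambda>t. multiplier_op (\<lambda>\<xi>. br_mult \<beta> t (l *\<^sub>R \<xi>)) f x) \<in> borel_measurable borel"
proof -
  have "(\<lambda>(t, \<xi>). br_mult \<beta> t (l *\<^sub>R (\<xi>::'a))) \<in> borel_measurable (borel \<Otimes>\<^sub>M borel)"
    unfolding br_mult_def[OF b] by measurable
  from multiplier_op_measurable2[OF schwartz_measurable[OF f] this]
  have "(\<lambda>(x, t). multiplier_op (\<lambda>\<xi>. br_mult \<beta> t (l *\<^sub>R \<xi>)) f x) \<in> borel_measurable (borel \<Otimes>\<^sub>M borel)" .
  from measurable_compose[OF _ this, of "\<lambda>t. (x, t)"] show ?thesis by simp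
qed

lemma epow_two: "epow x 2 = x\<^sup>2"
  by (cases x) (auto simp: epow_ennreal ennreal_power)

text \<open>Cauchy--Schwarz in t; the reflection of t to 1 - t preserves the integral and brings
  both factors to the same form.\<close>

lemma bochner_riesz_le_unit_square:
  fixes f g :: "'a::euclidean_space \<Rightarrow> complex"
  assumes b: "\<beta> > 0" and c: "\<gamma> > 0" and f: "schwartz f" and g: "schwartz g" and C: "C > 0"
    and conv: "\<And>a b. 0 \<le> a \<Longrightarrow> 0 \<le> b \<Longrightarrow>
      (LINT t|lborel. max 0 (t - a) powr \<beta> * max 0 (1 - t - b) powr \<gamma>) = C * max 0 (1 - a - b) powr (\<beta> + \<gamma> + 1)"
  shows "ennreal C * ennreal (norm (bochner_riesz (\<beta> + \<gamma> + 1) l f g x)) \<le> epow (unit_square \<beta> l f x) (1/2) * epow (unit_square \<gamma> l g x) (1/2)"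
proof -
  define A where "A = (\<lambda>t. multiplier_op (\<lambda>\<xi>. br_mult \<beta> t (l *\<^sub>R \<xi>)) f x)"
  define B where "B = (\<lambda>t. multiplier_op (\<lambda>\<xi>. br_mult \<gamma> t (l *\<^sub>R \<xi>)) g x)"
  have [measurable]: "A \<in> borel_measurable borel" "B \<in> borel_measurable borel"
    unfolding A_def B_def by (intro br_op_measurable b c f g)+
  \<comment> \<open>For t \<le> 0 the multiplier vanishes, so restricting both factors to (0, 1]
    leaves the integrand unchanged.\<close>
  have z: "A t = 0" "B t = 0" if "t \<le> 0" for t
  proof -
    have "br_mult \<beta> t \<xi> = 0" "br_mult \<gamma> t \<xi> = 0" for \<xi> :: 'a
      using that order_trans[OF that zero_le_power2[of "norm \<xi>"]] b c by (simp_all add: br_mult_def max_absorb1)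
    then show "A t = 0" "B t = 0" by (simp_all add: A_def B_def multiplier_op_def)
  qed
  define F where "F = (\<lambda>t. ennreal (norm (A t)) * indicator {0<..1} t)"
  define G where "G = (\<lambda>t. ennreal (norm (B t)) * indicator {0<..1} t)"
  have [measurable]: "F \<in> borel_measurable borel" "G \<in> borel_measurable borel" unfolding F_def G_def by measurable
  have "(LINT t|lborel. A t * B (1 - t)) = of_real C * bochner_riesz (\<beta> + \<gamma> + 1) l f g x"
    unfolding A_def B_def by (rule bochner_riesz_eq_integral[OF b c f g conv, symmetric])
  then have "ennreal C * ennreal (norm (bochner_riesz (\<beta> + \<gamma> + 1) l f g x)) = ennreal (norm (LINT t|lborel. A t * B (1 - t)))"
    using C by (simp add: norm_mult ennreal_mult)
  also have "\<dots> \<le> (\<integral>\<^sup>+t. ennreal (norm (A t * B (1 - t))) \<partial>lborel)" by (rule norm_LINT_le)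
  also have "\<dots> = (\<integral>\<^sup>+t. F t * G (1 - t) \<partial>lborel)"
  proof (intro nn_integral_cong)
    fix t :: real
    consider "t \<le> 0" | "1 - t \<le> 0" | "0 < t" "t < 1" by linarith
    then show "ennreal (norm (A t * B (1 - t))) = F t * G (1 - t)"
      by cases (auto simp: F_def G_def z norm_mult ennreal_mult)
  qed
  finally have "(ennreal C * ennreal (norm (bochner_riesz (\<beta> + \<gamma> + 1) l f g x)))\<^sup>2 \<le> (\<integral>\<^sup>+t. F t * G (1 - t) \<partial>lborel)\<^sup>2"
    by (rule power_mono) simp
  also have "\<dots> \<le> (\<integral>\<^sup>+t. (F t)\<^sup>2 \<partial>lborel) * (\<integral>\<^sup>+t. (G (1 - t))\<^sup>2 \<partial>lborel)" by (rule Cauchy_Schwarz_nn_integral) measurable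
  also have "(\<integral>\<^sup>+t. (G (1 - t))\<^sup>2 \<partial>lborel) = (\<integral>\<^sup>+t. (G t)\<^sup>2 \<partial>lborel)"
    using nn_integral_real_affine[of "\<lambda>t. (G t)\<^sup>2" "-1" 1] by simp
  also have "(\<lambda>t. (F t)\<^sup>2) = (\<lambda>t. ennreal ((norm (A t))\<^sup>2) * indicator {0<..1} t)"
    by (auto simp: F_def fun_eq_iff ennreal_power power_mult_distrib split: split_indicator)
  also have "(\<lambda>t. (G t)\<^sup>2) = (\<lambda>t. ennreal ((norm (B t))\<^sup>2) * indicator {0<..1} t)"
    by (auto simp: G_def fun_eq_iff ennreal_power power_mult_distrib split: split_indicator)
  finally have "(ennreal C * ennreal (norm (bochner_riesz (\<beta> + \<gamma> + 1) l f g x)))\<^sup>2 \<le> unit_square \<beta> l f x * unit_square \<gamma> l g x"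
    by (simp add: unit_square_def A_def B_def)
  from epow_mono[OF this, of "1/2"] show ?thesis by (simp add: epow_mult epow_two[symmetric] epow_epow)
qed

lemma dyadic_multiple_cover:
  fixes c t :: real
  assumes "c \<ge> 1/2" "0 < t" "t \<le> 1"
  obtains i :: nat where "c * (1/2) ^ i < t" "t \<le> 2 * (c * (1/2) ^ i)"
proof -
  have "(\<lambda>i. c * (1/2) ^ i) \<longlonglongrightarrow> c * 0" by (intro tendsto_intros LIMSEQ_power_zero) simp
  then have "\<forall>\<^sub>F i in sequentially. c * (1/2) ^ i < t" using assms by (intro order_tendstoD(2)) auto
  then have ex: "\<exists>i. c * (1/2) ^ i < t" by (rule eventually_happens'[OF sequentially_bot])
  define i where "i = (LEAST i. c * (1/2) ^ i < t)"
  have i: "c * (1/2) ^ i < t" unfolding i_def by (rule LeastI_ex[OF ex])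
  have "t \<le> 2 * (c * (1/2) ^ i)"
  proof (cases i)
    case 0 then show ?thesis using assms by simp
  next
    case (Suc j)
    then have "\<not> c * (1/2) ^ j < t" using not_less_Least[of j "\<lambda>i. c * (1/2) ^ i < t"] by (simp add: i_def)
    then show ?thesis using Suc by simp
  qed
  with i show ?thesis by (rule that)
qed

text \<open>The intervals (C i, 2 C i] with C i = c 2^(-i) cover (0, 1], and c is such that C i
  (\<open>dyad (L0 - i)\<close>)^2 = l^2. Rescaling t by C i then turns the dilation by l into a
  dyadic one, up to the factor (C i)^\<beta> \<le> 1. The lengths of the intervals are at most
  2^(-i), and their sum is the constant 2.\<close>

lemma unit_square_le_sup_square:
  fixes f :: "'a::euclidean_space \<Rightarrow> complex"
  assumes b: "\<beta> > 0" and f: "schwartz f" and l: "l > 0"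
  shows "unit_square \<beta> l f x \<le> 2 * sup_square \<beta> f x"
proof -
  \<comment> \<open>L0 places c in [1/2, 1): the upper bound gives C i \<le> 2^(-i), and the lower
    bound lets the intervals reach up to 1.\<close>
  define L0 where "L0 = \<lceil>- 2 * log 2 l\<rceil> - 1"
  define c where "c = l\<^sup>2 * 2 powr (real_of_int L0)"
  have l2: "l\<^sup>2 = 2 powr (2 * log 2 l)" using l by (simp add: powr_powr[symmetric] mult.commute[of 2] powr_realpow)
  have ce: "c = 2 powr (2 * log 2 l + real_of_int L0)" unfolding c_def l2 powr_add ..
  have r: "2 * log 2 l + real_of_int L0 < 0" "2 * log 2 l + real_of_int L0 \<ge> -1" unfolding L0_def by linarith+
  have c1: "c < 1" using powr_less_mono[OF r(1), of 2] unfolding ce by simp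
  have c2: "c \<ge> 1/2" using powr_mono[OF r(2), of 2] unfolding ce by (simp add: powr_minus)
  have c0: "c > 0" using c2 by linarith
  define C where "C = (\<lambda>i::nat. c * (1/2) ^ i)"
  have C0: "C i > 0" for i using c0 by (simp add: C_def)
  have Cle: "C i \<le> (1/2) ^ i" for i using c1 by (simp add: C_def)
  have C1: "C i \<le> 1" for i using Cle[of i] power_le_one[of "1/2 :: real" i] by simp
  define A where "A = (\<lambda>t. multiplier_op (\<lambda>\<xi>. br_mult \<beta> t (l *\<^sub>R \<xi>)) f x)"
  have [measurable]: "A \<in> borel_measurable borel" unfolding A_def by (rule br_op_measurable[OF b f])
  \<comment> \<open>Homogeneity of the positive part: C i comes out of t - |\<xi>|^2 because |l
    \<xi>|^2 = C i |\<open>dyad (L0 - i)\<close> \<xi>|^2.\<close>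
  have scale: "A (C i * t) = of_real (C i powr \<beta>) * multiplier_op (br_mult \<beta> t) (\<lambda>x. f (dyad (L0 - int i) *\<^sub>R x)) ((1 / dyad (L0 - int i)) *\<^sub>R x)" for i t
  proof -
    let ?d = "dyad (L0 - int i)"
    have "C i * ?d\<^sup>2 = l\<^sup>2"
    proof -
      have "C i = l\<^sup>2 * 2 powr (real_of_int (L0 - int i))"
        unfolding C_def c_def by (simp add: powr_diff powr_realpow power_divide)
      moreover have "2 powr (real_of_int (L0 - int i)) * ?d\<^sup>2 = 1" unfolding dyad_power2 powr_add[symmetric] by simp
      ultimately show ?thesis by (simp add: mult.assoc)
    qed
    then have n: "C i * (norm (?d *\<^sub>R \<xi>))\<^sup>2 = (norm (l *\<^sub>R \<xi>))\<^sup>2" for \<xi> :: 'a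
      by (simp add: power_mult_distrib mult.assoc[symmetric])
    have e: "br_mult \<beta> (C i * t) (l *\<^sub>R \<xi>) = of_real (C i powr \<beta>) * br_mult \<beta> t (?d *\<^sub>R \<xi>)" for \<xi> :: 'a
    proof -
      have "max 0 (C i * t - (norm (l *\<^sub>R \<xi>))\<^sup>2) = C i * max 0 (t - (norm (?d *\<^sub>R \<xi>))\<^sup>2)"
        unfolding n[symmetric] right_diff_distrib[symmetric] using C0[of i] by (auto simp: max_def zero_le_mult_iff mult_le_0_iff)
      then show ?thesis unfolding br_mult_def[OF b] using C0[of i] by (simp add: powr_mult)
    qed
    have "A (C i * t) = of_real (C i powr \<beta>) * multiplier_op (\<lambda>\<xi>. br_mult \<beta> t (?d *\<^sub>R \<xi>)) f x"
    proof -
      have "A (C i * t) = (LINT \<xi>|lborel. of_real (C i powr \<beta>) * (cis (2 * pi * (x \<bullet> \<xi>)) * br_mult \<beta> t (?d *\<^sub>R \<xi>) * fourier f \<xi>))"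
        unfolding A_def multiplier_op_def e by (intro Bochner_Integration.integral_cong refl) (simp only: mult_ac)
      then show ?thesis unfolding multiplier_op_def by simp
    qed
    also have "multiplier_op (\<lambda>\<xi>. br_mult \<beta> t (?d *\<^sub>R \<xi>)) f x = multiplier_op (br_mult \<beta> t) (\<lambda>x. f (?d *\<^sub>R x)) ((1 / ?d) *\<^sub>R x)"
      by (rule multiplier_op_dilate[OF schwartz_measurable[OF f] br_mult_measurable[OF b] dyad_pos])
    finally show ?thesis .
  qed
  have piece: "(\<integral>\<^sup>+t. ennreal ((norm (A t))\<^sup>2) * indicator {C i<..2 * C i} t \<partial>lborel) \<le> ennreal ((1/2) ^ i) * sup_square \<beta> f x" for i
  proof -
    let ?M = "\<lambda>t. multiplier_op (br_mult \<beta> t) (\<lambda>x. f (dyad (L0 - int i) *\<^sub>R x)) ((1 / dyad (L0 - int i)) *\<^sub>R x)"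
    have "(\<integral>\<^sup>+t. ennreal ((norm (A t))\<^sup>2) * indicator {C i<..2 * C i} t \<partial>lborel) =
      ennreal (C i) * (\<integral>\<^sup>+t. ennreal ((norm (A (C i * t)))\<^sup>2) * indicator {C i<..2 * C i} (C i * t) \<partial>lborel)"
      using nn_integral_real_affine[of "\<lambda>t. ennreal ((norm (A t))\<^sup>2) * indicator {C i<..2 * C i} t" "C i" 0] C0[of i] by simp
    also have "\<dots> \<le> ennreal ((1/2) ^ i) * loc_square \<beta> (L0 - int i) f x"
      unfolding loc_square_def[OF b]
    proof (rule mult_mono[OF ennreal_leI[OF Cle] nn_integral_mono])
      fix t :: real
      have "(norm (A (C i * t)))\<^sup>2 \<le> (norm (?M t))\<^sup>2"
      proof (rule power_mono)
        have "C i powr \<beta> \<le> 1" using C0[of i] C1[of i] b by (intro powr_le1) auto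
        then show "norm (A (C i * t)) \<le> norm (?M t)" unfolding scale norm_mult by (simp add: mult_left_le_one_le)
      qed simp
      moreover have "1 < t \<and> t \<le> 2" if "C i * t \<in> {C i<..2 * C i}"
        using that C0[of i] by simp
      ultimately show "ennreal ((norm (A (C i * t)))\<^sup>2) * indicator {C i<..2 * C i} (C i * t) \<le> ennreal ((norm (?M t))\<^sup>2) * indicator {1/2..2} t"
        by (intro mult_mono ennreal_leI) (auto simp: indicator_def)
    qed auto
    also have "\<dots> \<le> ennreal ((1/2) ^ i) * sup_square \<beta> f x"
      unfolding sup_square_def by (intro mult_left_mono SUP_upper) auto
    finally show ?thesis .
  qed
  have "unit_square \<beta> l f x = (\<integral>\<^sup>+t. ennreal ((norm (A t))\<^sup>2) * indicator {0<..1} t \<partial>lborel)"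
    by (simp add: unit_square_def A_def)
  also have "\<dots> \<le> (\<integral>\<^sup>+t. (\<Sum>i. ennreal ((norm (A t))\<^sup>2) * indicator {C i<..2 * C i} t) \<partial>lborel)"
  proof (intro nn_integral_mono)
    fix t :: real
    show "ennreal ((norm (A t))\<^sup>2) * indicator {0<..1} t \<le> (\<Sum>i. ennreal ((norm (A t))\<^sup>2) * indicator {C i<..2 * C i} t)"
    proof (cases "t \<in> {0<..1}")
      case True
      then obtain i where "C i < t" "t \<le> 2 * C i" using dyadic_multiple_cover[OF c2, of t] unfolding C_def by auto
      then have "ennreal ((norm (A t))\<^sup>2) * indicator {0<..1} t = ennreal ((norm (A t))\<^sup>2) * indicator {C i<..2 * C i} t" using True by simp
      also have "\<dots> \<le> (\<Sum>i. ennreal ((norm (A t))\<^sup>2) * indicator {C i<..2 * C i} t)"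
        by (rule le_suminf_ennreal[of "\<lambda>i. ennreal ((norm (A t))\<^sup>2) * indicator {C i<..2 * C i} t"])
      finally show ?thesis .
    qed (auto simp: indicator_def)
  qed
  also have "\<dots> = (\<Sum>i. \<integral>\<^sup>+t. ennreal ((norm (A t))\<^sup>2) * indicator {C i<..2 * C i} t \<partial>lborel)"
    by (rule nn_integral_suminf) measurable
  also have "\<dots> \<le> (\<Sum>i. ennreal ((1/2) ^ i) * sup_square \<beta> f x)" by (intro suminf_le piece) auto
  also have "\<dots> = (\<Sum>i. ennreal ((1/2) ^ i)) * sup_square \<beta> f x" by (rule ennreal_suminf_multc)
  also have "(\<Sum>i. ennreal ((1/2) ^ i)) = ennreal 2"
    by (rule suminf_ennreal_eq) (use geometric_sums[of "1/2 :: real"] in auto)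
  finally show ?thesis by simp
qed

lemma bochner_riesz_max_le:
  assumes b: "\<beta> > 0" and c: "\<gamma> > 0"
  obtains C where "C > 0" "\<And>(f :: 'a::euclidean_space \<Rightarrow> complex) g x. schwartz f \<Longrightarrow> schwartz g \<Longrightarrow>
    bochner_riesz_max (\<beta> + \<gamma> + 1) f g x \<le> ennreal C * (epow (sup_square \<beta> f x) (1/2) * epow (sup_square \<gamma> g x) (1/2))"
proof -
  obtain C :: real where C: "C > 0" "\<And>a b. 0 \<le> a \<Longrightarrow> 0 \<le> b \<Longrightarrow>
    (LINT t|lborel. max 0 (t - a) powr \<beta> * max 0 (1 - t - b) powr \<gamma>) = C * max 0 (1 - a - b) powr (\<beta> + \<gamma> + 1)"
    by (rule positive_part_powr_convolution[OF b c], rule that)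
  have "bochner_riesz_max (\<beta> + \<gamma> + 1) f g x \<le> ennreal (2 / C) * (epow (sup_square \<beta> f x) (1/2) * epow (sup_square \<gamma> g x) (1/2))"
    if f: "schwartz f" and g: "schwartz g" for f g :: "'a \<Rightarrow> complex" and x
    unfolding bochner_riesz_max_def
  proof (rule SUP_least)
    fix l :: real assume "l \<in> {0<..}"
    then have l: "l > 0" by simp
    let ?B = "ennreal (norm (bochner_riesz (\<beta> + \<gamma> + 1) l f g x))"
    let ?S = "epow (sup_square \<beta> f x) (1/2)" and ?T = "epow (sup_square \<gamma> g x) (1/2)"
    have "ennreal C * ?B \<le> epow (unit_square \<beta> l f x) (1/2) * epow (unit_square \<gamma> l g x) (1/2)"
      by (rule bochner_riesz_le_unit_square[OF b c f g C])
    also have "\<dots> \<le> epow (2 * sup_square \<beta> f x) (1/2) * epow (2 * sup_square \<gamma> g x) (1/2)"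
      by (intro mult_mono epow_mono unit_square_le_sup_square b c f g l) auto
    also have "\<dots> = (ennreal (sqrt 2) * ?S) * (ennreal (sqrt 2) * ?T)" by (simp add: epow_mult powr_half_sqrt)
    also have "\<dots> = (ennreal (sqrt 2) * ennreal (sqrt 2)) * (?S * ?T)" by (simp only: mult_ac)
    also have "ennreal (sqrt 2) * ennreal (sqrt 2) = ennreal 2" by (simp add: ennreal_mult[symmetric] del: ennreal_numeral)
    finally have "ennreal (1 / C) * (ennreal C * ?B) \<le> ennreal (1 / C) * (ennreal 2 * (?S * ?T))" by (rule mult_left_mono) simp
    moreover have "ennreal (1 / C) * (ennreal C * ?B) = ?B" using C(1) by (simp add: mult.assoc[symmetric] ennreal_mult[symmetric])
    moreover have "ennreal (1 / C) * (ennreal 2 * (?S * ?T)) = ennreal (2 / C) * (?S * ?T)"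
      using C(1) by (simp add: mult.assoc[symmetric] ennreal_mult[symmetric] del: ennreal_numeral)
    ultimately show "?B \<le> ennreal (2 / C) * (?S * ?T)" by simp
  qed
  moreover have "2 / C > 0" using C(1) by simp
  ultimately show ?thesis by (intro that)
qed

lemma continuous_bochner_riesz:
  fixes f g :: "'a::euclidean_space \<Rightarrow> complex"
  assumes a: "\<alpha> > 0" and f: "schwartz f" and g: "schwartz g"
  shows "continuous_on UNIV (bochner_riesz \<alpha> l f g)"
proof -
  define m where "m = (\<lambda>z. complex_of_real (max 0 (1 - (norm (l *\<^sub>R fst z :: 'a))\<^sup>2 - (norm (l *\<^sub>R snd z :: 'a))\<^sup>2) powr \<alpha>))"
  define h where "h = (\<lambda>z. m z * (fourier f (fst z) * fourier g (snd z)))"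
  have mb: "norm (m z) \<le> 1" for z
  proof -
    have "max 0 (1 - (norm (l *\<^sub>R fst z))\<^sup>2 - (norm (l *\<^sub>R snd z))\<^sup>2) \<le> 1"
      using zero_le_power2[of "norm (l *\<^sub>R fst z)"] zero_le_power2[of "norm (l *\<^sub>R snd z)"] by linarith
    then show ?thesis using a unfolding m_def by (auto intro!: powr_le1)
  qed
  have [measurable]: "m \<in> borel_measurable (lborel \<Otimes>\<^sub>M lborel)" unfolding m_def by measurable
  have "integrable (lborel \<Otimes>\<^sub>M lborel) h" unfolding h_def
    by (rule integrable_mult_bounded[OF integrable_tensor[OF integrable_fourier_schwartz[OF f] integrable_fourier_schwartz[OF g]] _ mb]) measurable
  then have "continuous_on UNIV (\<lambda>x. LINT z|(lborel \<Otimes>\<^sub>M lborel). cis (2 * pi * (x \<bullet> (fst z + snd z))) * h z)"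
    by (rule continuous_on_LINT_cis) measurable
  also have "(\<lambda>x. LINT z|(lborel \<Otimes>\<^sub>M lborel). cis (2 * pi * (x \<bullet> (fst z + snd z))) * h z) = bochner_riesz \<alpha> l f g"
    unfolding bochner_riesz_def h_def m_def case_prod_beta by (simp only: mult.assoc)
  finally show ?thesis .
qed

text \<open>The supremum is over an uncountable set, but every member is continuous in x, so
  superlevel sets are open.\<close>

lemma bochner_riesz_max_measurable:
  fixes f g :: "'a::euclidean_space \<Rightarrow> complex"
  assumes "\<alpha> > 0" "schwartz f" "schwartz g"
  shows "bochner_riesz_max \<alpha> f g \<in> borel_measurable borel"
proof (rule borel_measurableI_greater)
  fix y
  have "open {x. y < ennreal (norm (bochner_riesz \<alpha> l f g x))}" for l
    by (intro open_Collect_less continuous_on_const continuous_on_ennreal continuous_on_norm continuous_bochner_riesz assms)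
  then have "open (\<Union>l\<in>{0<..}. {x. y < ennreal (norm (bochner_riesz \<alpha> l f g x))})" by blast
  also have "(\<Union>l\<in>{0<..}. {x. y < ennreal (norm (bochner_riesz \<alpha> l f g x))}) = {x \<in> space borel. y < bochner_riesz_max \<alpha> f g x}"
    by (auto simp: bochner_riesz_max_def less_SUP_iff)
  finally show "{x \<in> space borel. y < bochner_riesz_max \<alpha> f g x} \<in> sets borel" by simp
qed

text \<open>After normalising both integrals to 1, the inequality is the integrated weighted
  arithmetic-geometric mean inequality. Zero and infinite integrals are separated first; when one
  integral vanishes the integrand is null, in keeping with the convention that 0 times \<infinity>
  is 0.\<close>

lemma nn_integral_Holder:
  assumes [measurable]: "u \<in> borel_measurable M" "v \<in> borel_measurable M" and t: "0 < \<theta>" "\<theta> < 1"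
  shows "(\<integral>\<^sup>+x. epow (u x) \<theta> * epow (v x) (1 - \<theta>) \<partial>M) \<le> epow (\<integral>\<^sup>+x. u x \<partial>M) \<theta> * epow (\<integral>\<^sup>+x. v x \<partial>M) (1 - \<theta>)"
proof -
  let ?U = "\<integral>\<^sup>+x. u x \<partial>M" and ?V = "\<integral>\<^sup>+x. v x \<partial>M" and ?I = "\<integral>\<^sup>+x. epow (u x) \<theta> * epow (v x) (1 - \<theta>) \<partial>M"
  have pos: "epow X a \<noteq> 0" if "X \<noteq> 0" for X a
    using that by (cases X) (auto simp: epow_ennreal)
  consider "?U = 0" | "?V = 0" | "?U = \<infinity>" "?V \<noteq> 0" | "?V = \<infinity>" "?U \<noteq> 0" | "?U \<noteq> 0" "?V \<noteq> 0" "?U \<noteq> \<infinity>" "?V \<noteq> \<infinity>" by blast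
  then show ?thesis
  proof cases
    case 1
    then have "AE x in M. u x = 0" by (subst (asm) nn_integral_0_iff_AE) auto
    then have "?I = 0" by (subst nn_integral_0_iff_AE) (auto elim!: eventually_mono)
    then show ?thesis by simp
  next
    case 2
    then have "AE x in M. v x = 0" by (subst (asm) nn_integral_0_iff_AE) auto
    then have "?I = 0" by (subst nn_integral_0_iff_AE) (auto elim!: eventually_mono)
    then show ?thesis by simp
  next
    case 3
    then show ?thesis using pos[of ?V "1 - \<theta>"] by (simp add: ennreal_top_mult)
  next
    case 4
    then show ?thesis using pos[of ?U \<theta>] by (simp add: ennreal_mult_top)
  next
    case 5
    then obtain U V where U: "?U = ennreal U" "U > 0" and V: "?V = ennreal V" "V > 0"
      by (cases ?U; cases ?V) (auto simp: less_le)
    \<comment> \<open>K is the right-hand side; multiplying by it undoes the normalisation by U and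
      V.\<close>
    define K where "K = U powr \<theta> * V powr (1 - \<theta>)"
    have K: "K > 0" using U V by (simp add: K_def)
    have pt: "epow (u x) \<theta> * epow (v x) (1 - \<theta>) \<le> ennreal (K * \<theta> / U) * u x + ennreal (K * (1 - \<theta>) / V) * v x" for x
    proof (cases "u x = \<infinity> \<or> v x = \<infinity>")
      case True
      have "ennreal (K * \<theta> / U) \<noteq> 0" "ennreal (K * (1 - \<theta>) / V) \<noteq> 0" using K U V t by auto
      then have T: "ennreal (K * \<theta> / U) * u x + ennreal (K * (1 - \<theta>) / V) * v x = top"
        using True by (auto simp: ennreal_mult_eq_top_iff)
      show ?thesis unfolding T by (rule top_greatest)
    next
      case False
      then obtain a b where a: "u x = ennreal a" "a \<ge> 0" and b: "v x = ennreal b" "b \<ge> 0"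
        by (cases "u x"; cases "v x") auto
      have "a powr \<theta> * b powr (1 - \<theta>) \<le> K * \<theta> / U * a + K * (1 - \<theta>) / V * b"
      proof (cases "a = 0 \<or> b = 0")
        case True
        then have "a powr \<theta> * b powr (1 - \<theta>) = 0" by auto
        moreover have "0 \<le> K * \<theta> / U * a + K * (1 - \<theta>) / V * b" using K U V t a b by simp
        ultimately show ?thesis by linarith
      next
        case False
        then have ab: "a > 0" "b > 0" using a b by auto
        have "(a / U) powr \<theta> * (b / V) powr (1 - \<theta>) \<le> \<theta> * (a / U) + (1 - \<theta>) * (b / V)"
          by (rule Youngs_inequality_0) (use t ab U V in auto)
        then have "K * ((a / U) powr \<theta> * (b / V) powr (1 - \<theta>)) \<le> K * (\<theta> * (a / U) + (1 - \<theta>) * (b / V))"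
          using K by (intro mult_left_mono) auto
        moreover have "K * ((a / U) powr \<theta> * (b / V) powr (1 - \<theta>)) = a powr \<theta> * b powr (1 - \<theta>)"
          using ab U V by (simp add: K_def powr_divide)
        ultimately show ?thesis by (simp add: distrib_left)
      qed
      then have "ennreal (a powr \<theta> * b powr (1 - \<theta>)) \<le> ennreal (K * \<theta> / U * a + K * (1 - \<theta>) / V * b)" by (rule ennreal_leI)
      moreover have "0 \<le> K * \<theta> / U" "0 \<le> K * (1 - \<theta>) / V" using K U V t by auto
      then have "ennreal (K * \<theta> / U * a + K * (1 - \<theta>) / V * b) = ennreal (K * \<theta> / U) * ennreal a + ennreal (K * (1 - \<theta>) / V) * ennreal b"
        using a(2) b(2) by (simp only: ennreal_plus ennreal_mult mult_nonneg_nonneg)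
      ultimately show ?thesis unfolding a(1) b(1) epow_ennreal[OF a(2)] epow_ennreal[OF b(2)] by (simp only: ennreal_mult powr_ge_zero)
    qed
    have "?I \<le> (\<integral>\<^sup>+x. ennreal (K * \<theta> / U) * u x + ennreal (K * (1 - \<theta>) / V) * v x \<partial>M)" by (intro nn_integral_mono pt)
    also have "\<dots> = ennreal (K * \<theta> / U) * ennreal U + ennreal (K * (1 - \<theta>) / V) * ennreal V"
      by (simp add: nn_integral_add nn_integral_cmult U(1) V(1))
    also have "\<dots> = ennreal (K * \<theta> / U * U + K * (1 - \<theta>) / V * V)"
    proof -
      have "0 \<le> K * \<theta> / U" "0 \<le> K * (1 - \<theta>) / V" using K U V t by auto
      then show ?thesis using U V by (simp only: ennreal_mult ennreal_plus mult_nonneg_nonneg order.strict_implies_order)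
    qed
    also have "K * \<theta> / U * U + K * (1 - \<theta>) / V * V = K * \<theta> + K * (1 - \<theta>)" using U(2) V(2) by simp
    also have "\<dots> = K" by (simp add: algebra_simps)
    also have "ennreal K = epow ?U \<theta> * epow ?V (1 - \<theta>)" using U V by (simp add: K_def epow_ennreal ennreal_mult)
    finally show ?thesis .
  qed
qed

lemma ennreal_reciprocal_eq:
  assumes "1 / r = ennreal a" "a > 0" shows "r = ennreal (1 / a)"
proof (cases r)
  case top
  then show ?thesis using assms by simp
next
  case (real s)
  then have "s \<noteq> 0" using assms by (auto simp: ennreal_divide_zero)
  then have s: "s > 0" using real by simp
  then have "1 / r = ennreal (1 / s)" unfolding real using divide_ennreal[of 1 s] by simp
  then have "1 / s = a" using assms s by simp
  then show ?thesis using real s by auto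
qed

lemma ennreal_one_divide: "a > 0 \<Longrightarrow> 1 / ennreal a = ennreal (1 / a)"
  using divide_ennreal[of 1 a] by simp

lemma eLp_norm_mult_infinity:
  fixes F G :: "'a::euclidean_space \<Rightarrow> ennreal"
  assumes [measurable]: "F \<in> borel_measurable borel" "G \<in> borel_measurable borel" and b: "b > 0"
  shows "eLp_norm (ennreal b) (\<lambda>x. F x * G x) \<le> eLp_norm \<infinity> F * eLp_norm (ennreal b) G"
proof -
  let ?M = "eLp_norm \<infinity> F"
  have "(\<integral>\<^sup>+x. epow (F x * G x) b \<partial>lborel) \<le> (\<integral>\<^sup>+x. epow ?M b * epow (G x) b \<partial>lborel)"
  proof (rule nn_integral_mono_AE)
    have "AE x in lborel. F x \<le> ?M" unfolding eLp_norm_def using esssup_AE[of F lborel] by simp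
    then show "AE x in lborel. epow (F x * G x) b \<le> epow ?M b * epow (G x) b"
      by (auto elim!: eventually_mono simp: epow_mult b intro!: mult_right_mono epow_mono)
  qed
  also have "\<dots> = epow ?M b * (\<integral>\<^sup>+x. epow (G x) b \<partial>lborel)" by (rule nn_integral_cmult) measurable
  finally have "epow (\<integral>\<^sup>+x. epow (F x * G x) b \<partial>lborel) (1 / b) \<le> epow (epow ?M b * (\<integral>\<^sup>+x. epow (G x) b \<partial>lborel)) (1 / b)"
    by (rule epow_mono) (use b in simp)
  then show ?thesis using b by (simp add: eLp_norm_ennreal epow_mult epow_inverse)
qed

lemma eLp_norm_Holder:
  fixes F G :: "'a::euclidean_space \<Rightarrow> ennreal"
  assumes [measurable]: "F \<in> borel_measurable borel" "G \<in> borel_measurable borel"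
    and p: "p \<ge> 2" and q: "q \<ge> 2" and r: "1 / r = 1 / p + 1 / q"
  shows "eLp_norm r (\<lambda>x. F x * G x) \<le> eLp_norm p F * eLp_norm q G"
  using p
proof (cases rule: exponent_cases)
  case 1
  show ?thesis using q
  proof (cases rule: exponent_cases)
    case 1
    have "1 / r = 0" using r \<open>p = \<infinity>\<close> 1 by simp
    then have ri: "r = \<infinity>" by (simp add: ennreal_divide_eq_0_iff)
    have "esssup lborel (\<lambda>x. F x * G x) \<le> esssup lborel F * esssup lborel G"
    proof (rule esssup_I)
      show "AE x in lborel. F x * G x \<le> esssup lborel F * esssup lborel G"
        using esssup_AE[of F lborel] esssup_AE[of G lborel] by eventually_elim (rule mult_mono, auto)
    qed measurable
    then show ?thesis by (simp add: ri \<open>p = \<infinity>\<close> 1 eLp_norm_def)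
  next
    case (2 b)
    have "1 / r = ennreal (1 / b)" using r \<open>p = \<infinity>\<close> 2 by (simp add: ennreal_one_divide)
    from ennreal_reciprocal_eq[OF this] have "r = ennreal b" using 2 by simp
    then show ?thesis using eLp_norm_mult_infinity[of F G b] 2 \<open>p = \<infinity>\<close> by simp
  qed
next
  case (2 a)
  show ?thesis using q
  proof (cases rule: exponent_cases)
    case 1
    have "1 / r = ennreal (1 / a)" using r 1 2 by (simp add: ennreal_one_divide)
    from ennreal_reciprocal_eq[OF this] have "r = ennreal a" using 2 by simp
    then show ?thesis using eLp_norm_mult_infinity[of G F a] 1 2 by (simp add: mult.commute)
  next
    case (2 b)
    note a = \<open>p = ennreal a\<close> \<open>2 \<le> a\<close> and b = 2
    \<comment> \<open>c is the real value of r. The weights are \<theta> = c/a and 1 - \<theta> =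
      c/b, applied to the a-th and b-th powers of the factors.\<close>
    define c where "c = 1 / (1 / a + 1 / b)"
    have c: "c > 0" "1 / c = 1 / a + 1 / b" using a b by (auto simp: c_def add_pos_pos)
    have ab: "a > 0" "b > 0" using a b by auto
    have "1 / r = ennreal (1 / c)" using r a b unfolding c(2) by (simp add: ennreal_one_divide)
    then have "r = ennreal (1 / (1 / c))" by (rule ennreal_reciprocal_eq) (use c(1) in simp)
    then have rc: "r = ennreal c" by simp
    have th: "0 < c / a" "c / a < 1" "1 - c / a = c / b"
    proof -
      have "c / a + c / b = c * (1 / c)" unfolding c(2) by (simp add: distrib_left)
      also have "c * (1 / c) = 1" using c(1) by simp
      finally have s: "c / a + c / b = 1" .
      have "c / a > 0" "c / b > 0" using c ab by auto
      with s show "0 < c / a" "c / a < 1" "1 - c / a = c / b" by linarith+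
    qed
    have "(\<integral>\<^sup>+x. epow (F x * G x) c \<partial>lborel) = (\<integral>\<^sup>+x. epow (epow (F x) a) (c / a) * epow (epow (G x) b) (1 - c / a) \<partial>lborel)"
      unfolding th(3) using ab by (simp add: epow_epow epow_mult c(1))
    also have "\<dots> \<le> epow (\<integral>\<^sup>+x. epow (F x) a \<partial>lborel) (c / a) * epow (\<integral>\<^sup>+x. epow (G x) b \<partial>lborel) (1 - c / a)"
      by (rule nn_integral_Holder[OF _ _ th(1,2)]) measurable
    finally have "epow (\<integral>\<^sup>+x. epow (F x * G x) c \<partial>lborel) (1 / c) \<le>
      epow (epow (\<integral>\<^sup>+x. epow (F x) a \<partial>lborel) (c / a) * epow (\<integral>\<^sup>+x. epow (G x) b \<partial>lborel) (1 - c / a)) (1 / c)"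
      by (rule epow_mono) (use c(1) in simp)
    also have "\<dots> = epow (\<integral>\<^sup>+x. epow (F x) a \<partial>lborel) (1 / a) * epow (\<integral>\<^sup>+x. epow (G x) b \<partial>lborel) (1 / b)"
      unfolding th(3) using c(1) by (simp add: epow_mult epow_epow)
    finally show ?thesis unfolding rc a(1) b(1) using c(1) ab by (simp add: eLp_norm_ennreal)
  qed
qed

lemma eLp_norm_mono:
  assumes "r > 0" "F \<in> borel_measurable borel" "\<And>x. F x \<le> G x"
  shows "eLp_norm r F \<le> eLp_norm r G"
proof (cases r)
  case (real s)
  then have "s > 0" using assms(1) by auto
  moreover have "r = ennreal s" using real by simp
  ultimately show ?thesis by (auto simp: eLp_norm_ennreal intro!: epow_mono nn_integral_mono assms(3))
next
  case top
  then show ?thesis using assms by (simp add: eLp_norm_def esssup_mono)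
qed

section \<open>The exponent \<open>alpha_star\<close> as a sum of one-function thresholds\<close>

lemma le_iff_recip_le:
  assumes "p \<ge> 2" "q \<ge> (2 :: ennreal)" shows "p \<le> q \<longleftrightarrow> recip q \<le> recip p"
  using assms(1)
proof (cases rule: exponent_cases)
  case 1
  note p = 1
  show ?thesis using assms(2) by (cases rule: exponent_cases) (auto simp: p recip_ennreal top_unique)
next
  case (2 a)
  note p = 2
  show ?thesis using assms(2)
    by (cases rule: exponent_cases) (use p in \<open>auto simp: recip_ennreal divide_simps\<close>)
qed

text \<open>On \<open>D1\<close> both thresholds are values of \<open>alpha\<close>; on
  \<open>D2\<close> the two chords add up. In the mixed region the function with the smaller
  reciprocal realises the maximum, since \<open>alpha\<close> decreases in the reciprocal on
  [0, 1/2], and the other one realises the minimum.\<close>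

lemma alpha_star_eq_crit:
  assumes d: "d \<ge> 2" and P: "P \<ge> ennreal (2 * real d / (real d - 1))" and p: "p \<ge> 2" and q: "q \<ge> 2"
  shows "alpha_star d P p q = 1 + crit d P p + crit d P q"
proof -
  define \<nu> u v where "\<nu> = recip P" and "u = recip p" and "v = recip q"
  have h: "2 * real d / (real d - 1) \<ge> 2" using d by (simp add: field_simps)
  have P2: "P \<ge> 2" using order_trans[OF ennreal_leI[OF h] P] by simp
  have n: "\<nu> < 1/2"
  proof -
    have "\<nu> \<le> 1 / (2 * real d / (real d - 1))" unfolding \<nu>_def by (rule recip_antimono[OF P]) (use h in linarith)
    also have "\<dots> < 1/2" using d by (simp add: field_simps)
    finally show ?thesis .
  qed
  have rng: "recip s \<in> {0..1/2}" if "s \<ge> 2" for s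
    using recip_antimono[of 2 s] that by simp
  have c: "crit d P s = (if recip s \<le> \<nu> then alpha d s else (1 - 2 * recip s) / (1 - 2 * \<nu>) * alpha d P)" if "s \<ge> 2" for s
    unfolding crit_def \<nu>_def le_iff_recip_le[OF P2 that] ..
  have al: "alpha d s = (real d - 1) / 2 - real d * recip s" if "recip s \<le> \<nu>" "s \<ge> 2" for s
  proof -
    have "P \<le> s" using that le_iff_recip_le[OF P2 that(2)] by (simp add: \<nu>_def)
    from order_trans[OF P this] show ?thesis by (rule alpha_eq(1)[OF d])
  qed
  have alP: "alpha d P = (real d - 1) / 2 - real d * \<nu>" unfolding \<nu>_def by (rule alpha_eq(1)[OF d P])
  have mono: "alpha d t \<le> alpha d s" if "recip s \<le> recip t" "s \<ge> 2" "t \<ge> 2" for s t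
  proof -
    have "\<bar>1/2 - recip t\<bar> \<le> \<bar>1/2 - recip s\<bar>" using that rng[of s] rng[of t] by auto
    then have "real d * \<bar>1/2 - recip t\<bar> \<le> real d * \<bar>1/2 - recip s\<bar>" by (rule mult_left_mono) simp
    then show ?thesis unfolding alpha_def by linarith
  qed
  have aP: "alpha d P \<ge> 0" by (simp add: alpha_def)
  \<comment> \<open>On the boundary recip s = \<nu> the two formulas of \<open>crit\<close> agree,
    so \<open>D2\<close> may be treated with the second one up to its edge.\<close>
  have edge: "crit d P s = (1 - 2 * recip s) / (1 - 2 * \<nu>) * alpha d P" if "recip s \<ge> \<nu>" "s \<ge> 2" for s
  proof (cases "recip s = \<nu>")
    case True
    then have "crit d P s = alpha d P" unfolding c[OF that(2)] using al[OF _ that(2)] alP by simp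
    then show ?thesis using True n by simp
  next
    case False then show ?thesis using that unfolding c[OF that(2)] by simp
  qed
  have e: "alpha_star d P p q = (if u \<le> \<nu> \<and> v \<le> \<nu> then alpha d p + alpha d q + 1
      else if u \<ge> \<nu> \<and> v \<ge> \<nu> then 1 + 2 * (1 - u - v) / (1 - 2 * \<nu>) * alpha d P
      else 1 + max (alpha d p) (alpha d q) + alpha d P * min ((1 - 2 * u) / (1 - 2 * \<nu>)) ((1 - 2 * v) / (1 - 2 * \<nu>)))"
    using rng[OF p] rng[OF q] by (simp add: alpha_star_def Let_def D1_def D2_def \<nu>_def u_def v_def)
  \<comment> \<open>Stated for an ordered pair, so that it covers both halves of the mixed region by
    exchanging p and q.\<close>
  have mix: "max (alpha d s) (alpha d t) + alpha d P * min ((1 - 2 * recip s) / (1 - 2 * \<nu>)) ((1 - 2 * recip t) / (1 - 2 * \<nu>)) = crit d P s + crit d P t"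
    if "recip s \<le> \<nu>" "\<nu> < recip t" "s \<ge> 2" "t \<ge> 2" for s t
  proof -
    have "max (alpha d s) (alpha d t) = alpha d s" using mono[of s t] that by (simp add: max_absorb1)
    moreover have "(1 - 2 * recip t) / (1 - 2 * \<nu>) \<le> (1 - 2 * recip s) / (1 - 2 * \<nu>)" using that n by (intro divide_right_mono) auto
    ultimately show ?thesis using that unfolding c[OF that(3)] c[OF that(4)] by (simp add: min_absorb2 mult.commute)
  qed
  consider "u \<le> \<nu>" "v \<le> \<nu>" | "\<not> (u \<le> \<nu> \<and> v \<le> \<nu>)" "u \<ge> \<nu>" "v \<ge> \<nu>" | "u < \<nu>" "\<nu> < v" | "v < \<nu>" "\<nu> < u" by linarith
  then show ?thesis
  proof cases
    case 1
    then show ?thesis unfolding e c[OF p] c[OF q] by (simp add: u_def v_def)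
  next
    case 2
    have "2 * (1 - u - v) / (1 - 2 * \<nu>) * alpha d P = ((1 - 2 * u) + (1 - 2 * v)) / (1 - 2 * \<nu>) * alpha d P" by (simp add: algebra_simps)
    also have "\<dots> = crit d P p + crit d P q"
      using edge[OF _ p] edge[OF _ q] 2 unfolding u_def v_def by (simp only: add_divide_distrib distrib_right)
    finally show ?thesis unfolding e if_not_P[OF 2(1)] using 2(2,3) by simp
  next
    case 3
    then show ?thesis unfolding e using mix[of p q] p q by (simp add: u_def v_def)
  next
    case 4
    then show ?thesis unfolding e using mix[of q p] p q by (simp add: u_def v_def max.commute min.commute)
  qed
qed

lemma crit_nonneg:
  assumes d: "d \<ge> 2" and P: "P \<ge> ennreal (2 * real d / (real d - 1))" and p: "p \<ge> 2"
  shows "crit d P p \<ge> 0"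
proof -
  have h: "2 * real d / (real d - 1) \<ge> 2" using d by (simp add: field_simps)
  have "recip P \<le> 1 / 2" "recip p \<le> 1 / 2"
    using recip_antimono[of 2 P] recip_antimono[of 2 p] order_trans[OF ennreal_leI[OF h] P] p by simp_all
  then show ?thesis by (simp add: crit_def alpha_def)
qed

theorem theorem1p2:
  fixes P p q r :: ennreal
  assumes "CARD('d::finite) \<ge> 2"
    and "P \<ge> ennreal (2 * real CARD('d) / (real CARD('d) - 1))"
    and "p \<ge> 2" and "q \<ge> 2"
    and "1 / r = 1 / p + 1 / q"
    and "\<exists>N::nat. \<forall>s\<ge>P. \<forall>\<epsilon>>0. \<exists>C\<ge>0. \<forall>\<delta> \<phi>. \<forall>f :: real ^ 'd \<Rightarrow> complex.
           0 < \<delta> \<and> \<delta> \<le> 1/4 \<and> \<phi> \<in> C_class N \<and> schwartz f \<longrightarrow>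
           eLp_norm s (square_function \<phi> \<delta> f)
             \<le> ennreal (C * \<delta> powr (- (real CARD('d) - 2) / 2 + real CARD('d) * recip s - \<epsilon>))
                * Lp_norm s f"
  shows "\<forall>\<alpha> > alpha_star CARD('d) P p q. \<exists>C'\<ge>0. \<forall>f g :: real ^ 'd \<Rightarrow> complex.
           schwartz f \<and> schwartz g \<longrightarrow>
           eLp_norm r (bochner_riesz_max \<alpha> f g) \<le> ennreal C' * Lp_norm p f * Lp_norm q g"
proof (intro allI impI)
  fix \<alpha> assume \<alpha>: "\<alpha> > alpha_star CARD('d) P p q"
  have dim: "DIM(real ^ 'd) = CARD('d)" by simp
  obtain N where H: "square_function_hyp TYPE(real ^ 'd) N P"
    using assms(6) unfolding square_function_hyp_def dim by blast
  note d = assms(1)[folded dim] and P = assms(2)[folded dim]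
  \<comment> \<open>The excess of \<alpha> is split evenly: both \<beta> and \<gamma> lie strictly
    above their thresholds and \<beta> + \<gamma> + 1 is exactly \<alpha>.\<close>
  define \<kappa> where "\<kappa> = (\<alpha> - alpha_star CARD('d) P p q) / 2"
  define \<beta> where "\<beta> = crit CARD('d) P p + \<kappa>"
  define \<gamma> where "\<gamma> = crit CARD('d) P q + \<kappa>"
  have k: "\<kappa> > 0" using \<alpha> by (simp add: \<kappa>_def)
  have b: "\<beta> > 0" "\<beta> > crit DIM(real ^ 'd) P p"
    using k crit_nonneg[OF assms(1,2,3)] by (simp_all add: \<beta>_def)
  have c: "\<gamma> > 0" "\<gamma> > crit DIM(real ^ 'd) P q"
    using k crit_nonneg[OF assms(1,2,4)] by (simp_all add: \<gamma>_def)
  have ae: "\<alpha> = \<beta> + \<gamma> + 1"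
    unfolding \<beta>_def \<gamma>_def \<kappa>_def alpha_star_eq_crit[OF assms(1,2,3,4)] by (simp add: field_simps)
  have "r \<noteq> 0"
  proof
    assume "r = 0"
    then have "1 / p + 1 / q = top" using assms(5) by simp
    then have "1 / p = top \<or> 1 / q = top" by simp
    then show False using assms(3,4) by (auto simp: ennreal_divide_eq_top_iff)
  qed
  then have r0: "r > 0" by (simp add: zero_less_iff_neq_zero)
  obtain C1 where C1: "C1 > 0" "\<And>f :: real ^ 'd \<Rightarrow> complex. schwartz f \<Longrightarrow> eLp_norm p (\<lambda>x. epow (sup_square \<beta> f x) (1/2)) \<le> ennreal C1 * Lp_norm p f"
    by (rule linear_maximal[OF d P H assms(3) b], rule that)
  obtain C2 where C2: "C2 > 0" "\<And>f :: real ^ 'd \<Rightarrow> complex. schwartz f \<Longrightarrow> eLp_norm q (\<lambda>x. epow (sup_square \<gamma> f x) (1/2)) \<le> ennreal C2 * Lp_norm q f"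
    by (rule linear_maximal[OF d P H assms(4) c], rule that)
  obtain C3 where C3: "C3 > 0" "\<And>(f :: real ^ 'd \<Rightarrow> complex) g x. schwartz f \<Longrightarrow> schwartz g \<Longrightarrow>
    bochner_riesz_max (\<beta> + \<gamma> + 1) f g x \<le> ennreal C3 * (epow (sup_square \<beta> f x) (1/2) * epow (sup_square \<gamma> g x) (1/2))"
    by (rule bochner_riesz_max_le[OF b(1) c(1)], rule that)
  have "eLp_norm r (bochner_riesz_max \<alpha> f g) \<le> ennreal (C3 * C1 * C2) * Lp_norm p f * Lp_norm q g"
    if f: "schwartz f" and g: "schwartz g" for f g :: "real ^ 'd \<Rightarrow> complex"
  proof -
    let ?F = "\<lambda>x. epow (sup_square \<beta> f x) (1/2)" and ?G = "\<lambda>x. epow (sup_square \<gamma> g x) (1/2)"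
    note [measurable] = sup_square_measurable[OF b(1) f] sup_square_measurable[OF c(1) g]
    have cF: "eLp_norm p (\<lambda>x. ennreal C3 * ?F x) \<le> ennreal C3 * eLp_norm p ?F"
      by (rule eLp_norm_cmult_le[OF _ _ assms(3)]) (use C3(1) in auto)
    have "eLp_norm r (bochner_riesz_max \<alpha> f g) \<le> eLp_norm r (\<lambda>x. (ennreal C3 * ?F x) * ?G x)"
    proof (rule eLp_norm_mono[OF r0])
      show "bochner_riesz_max \<alpha> f g \<in> borel_measurable borel" unfolding ae
        by (rule bochner_riesz_max_measurable[OF _ f g]) (use b c in linarith)
      show "bochner_riesz_max \<alpha> f g x \<le> (ennreal C3 * ?F x) * ?G x" for x
        unfolding ae mult.assoc by (rule C3(2)[OF f g])
    qed
    also have "\<dots> \<le> eLp_norm p (\<lambda>x. ennreal C3 * ?F x) * eLp_norm q ?G"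
      by (rule eLp_norm_Holder[OF _ _ assms(3,4,5)]) measurable
    also have "\<dots> \<le> (ennreal C3 * (ennreal C1 * Lp_norm p f)) * (ennreal C2 * Lp_norm q g)"
      by (intro mult_mono order_trans[OF cF mult_left_mono] C1(2) C2(2) f g) auto
    also have "\<dots> = (ennreal C3 * ennreal C1 * ennreal C2) * Lp_norm p f * Lp_norm q g" by (simp only: mult_ac)
    also have "ennreal C3 * ennreal C1 * ennreal C2 = ennreal (C3 * C1 * C2)"
      using C1(1) C2(1) C3(1) by (simp add: ennreal_mult)
    finally show ?thesis .
  qed
  moreover have "C3 * C1 * C2 \<ge> 0" using C1(1) C2(1) C3(1) by simp
  ultimately show "\<exists>C'\<ge>0. \<forall>f g :: real ^ 'd \<Rightarrow> complex. schwartz f \<and> schwartz g \<longrightarrow>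
           eLp_norm r (bochner_riesz_max \<alpha> f g) \<le> ennreal C' * Lp_norm p f * Lp_norm q g" by blast
qed

end
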